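(* Let $m\ge2$, $n\ge1$ be integers and let $E\subset\mathbb{R}^m$ be a centrally symmetric convex body with $C^2$ boundary. For $\delta>0$ let $w_\delta:\mathbb{R}^m\times\delta^2\mathbb{Z}_-\to\mathbb{R}$ be the rescaled value function. As $\delta\to0^+$, the functions $w_\delta$ converge to a limit $w:\mathbb{R}^m\times(-\infty,0]\to\mathbb{R}$ in the sense that for every $R>0$ $$\lim_{\delta\to0^+}\max\{|w_\delta(x,t)-w(x,t)|:\ |x|\le R,\ |t|\le R,\ t\in\delta^2\mathbb{Z}_-\}=0,$$ where $w$ is the unique viscosity solution of the terminal value problem $$\partial_tw+\tfrac12H_n(D^2w,\nabla w)=0\ \text{ in }\mathbb{R}^m\times(-\infty,0),\qquad w(x,0)=\|x\|_E\ \text{ in }\mathbb{R}^m.$$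
   Context: $\mathbb{Z}_-=\{0,-1,-2,\dots\}$; a centrally symmetric convex body is a compact convex set $E=-E$ with nonempty interior; $\|\cdot\|_E$ is the norm with closed unit ball $E$; $|\cdot|$ is the Euclidean norm. Let $\mathcal{A}$ be the set of real $m\times n$ matrices whose columns have Euclidean norm at most $1$. Value function $v:\mathbb{R}^m\times\mathbb{Z}_-\to\mathbb{R}$: $v(y,0)=\|y\|_E$ and $v(y,s-1)=\max_{A\in\mathcal{A}}\min_{\bar\varepsilon\in\{-1,1\}^n}v(y+A\bar\varepsilon,s)$ for $s\le0$. Rescaled: $w_\delta(x,t)=\delta\,v(x/\delta,t/\delta^2)$. Operator: for symmetric $M\in\mathbb{R}^{m\times m}$ and $p\in\mathbb{R}^m$, $H_n(M,p)=\max_{A\in\mathcal{A}(p)}\min_{\bar\varepsilon\in\{-1,1\}^n}(MA\bar\varepsilon,A\bar\varepsilon)$ with $\mathcal{A}(p)=\{A\in\mathcal{A}:A^\top p=0\}$. Its envelopes are $(H_n)^*(M,p)=\limsup_{M'\to M,p'\to p}H_n(M',p')$ and $(H_n)_*(M,p)=\liminf_{M'\to M,p'\to p}H_n(M',p')$. Viscosity solution: an upper semicontinuous $u$ on $\mathbb{R}^m\times(-\infty,0]$ is a subsolution if, whenever $\phi$ is a test function (with $\partial_t\phi,\nabla\phi,D^2\phi$ continuous) and $u-\phi$ has a local maximum at $(x_0,t_0)$, $t_0<0$, one has $\partial_t\phi+\frac12(H_n)^*(D^2\phi,\nabla\phi)\ge0$ at $(x_0,t_0)$. A lower semicontinuous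 $u$ is a supersolution if, whenever $u-\phi$ has a local minimum at $(x_0,t_0)$, $t_0<0$, one has $\partial_t\phi+\frac12(H_n)_*(D^2\phi,\nabla\phi)\le0$ at $(x_0,t_0)$. A solution is both. Uniqueness is understood in the class of functions of at most linear growth in $x$, uniformly for $t$ in bounded intervals. *)

theory Defs
  imports "HOL-Analysis.Analysis"
begin

text \<open>The space \<open>\<real>\<^sup>m\<close> is \<open>real^'m\<close>, and real \<open>m \<times> n\<close> matrices are \<open>real^'n^'m\<close>. Notions that
  depend on \<open>n\<close> without having an argument of dimension \<open>n\<close> take \<open>TYPE('n)\<close>. Functions on space-time
  take pairs \<open>(x, t)\<close>.\<close>

section \<open>Convex bodies\<close>

definition centrally_symmetric_body :: "(real^'m) set \<Rightarrow> bool" where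
  "centrally_symmetric_body E \<longleftrightarrow>
     compact E \<and> convex E \<and> uminus ` E = E \<and> interior E \<noteq> {}"

text \<open>The Minkowski functional: for a centrally symmetric body \<open>E\<close> this is the norm with closed
  unit ball \<open>E\<close>.\<close>

definition body_norm :: "(real^'m) set \<Rightarrow> real^'m \<Rightarrow> real" where
  "body_norm E x = Inf {r. 0 < r \<and> x \<in> (*\<^sub>R) r ` E}"

text \<open>\<open>g\<close> and \<open>h\<close> are the gradient and the Hessian matrix of \<open>f\<close> on the open set \<open>U\<close>.\<close>

definition C2_on_with :: "(real^'m) set \<Rightarrow> (real^'m \<Rightarrow> real) \<Rightarrow> (real^'m \<Rightarrow> real^'m) \<Rightarrow>
    (real^'m \<Rightarrow> real^'m^'m) \<Rightarrow> bool" where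
  "C2_on_with U f g h \<longleftrightarrow>
     (\<forall>x\<in>U. (f has_derivative (\<lambda>v. g x \<bullet> v)) (at x)) \<and>
     (\<forall>x\<in>U. (g has_derivative (\<lambda>v. h x *v v)) (at x)) \<and>
     continuous_on U h"

text \<open>The boundary is a \<open>C\<^sup>2\<close> hypersurface: locally it is a regular level set of a \<open>C\<^sup>2\<close> function.\<close>

definition C2_boundary :: "(real^'m) set \<Rightarrow> bool" where
  "C2_boundary E \<longleftrightarrow>
     (\<forall>z\<in>frontier E. \<exists>U f g h. open U \<and> z \<in> U \<and> C2_on_with U f g h \<and>
        (\<forall>x\<in>U. g x \<noteq> 0) \<and> frontier E \<inter> U = {x\<in>U. f x = 0})"

section \<open>The game\<close>

definition admissible :: "(real^'n^'m) set" where
  "admissible = {A. \<forall>j. norm (column j A) \<le> 1}"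

definition sign_vectors :: "(real^'n) set" where
  "sign_vectors = {\<epsilon>. \<forall>j. \<epsilon> $ j \<in> {-1, 1}}"

text \<open>\<open>game_value_steps TYPE('n) E k y\<close> is \<open>v(y, -k)\<close>. The suprema here and in \<open>H\<^sub>n\<close> below are maxima
  of continuous functions over nonempty compact sets.\<close>

primrec game_value_steps :: "'n::finite itself \<Rightarrow> (real^'m) set \<Rightarrow> nat \<Rightarrow> real^'m \<Rightarrow> real" where
  "game_value_steps N E 0 y = body_norm E y"
| "game_value_steps N E (Suc k) y =
     (SUP A\<in>(admissible :: (real^'n^'m) set).
        MIN \<epsilon>\<in>sign_vectors. game_value_steps N E k (y + A *v \<epsilon>))"

text \<open>The second argument of \<open>v\<close> is an integer \<open>s \<le> 0\<close>.\<close>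

definition game_value :: "'n::finite itself \<Rightarrow> (real^'m) set \<Rightarrow> real^'m \<Rightarrow> int \<Rightarrow> real" where
  "game_value N E y s = game_value_steps N E (nat (- s)) y"

definition time_lattice :: "real \<Rightarrow> real set" where
  "time_lattice \<delta> = {\<delta>\<^sup>2 * of_int s | s :: int. s \<le> 0}"

text \<open>For \<open>t \<in> time_lattice \<delta>\<close> the quotient \<open>t / \<delta>\<^sup>2\<close> is an integer; the floor only converts its type.\<close>

definition rescaled_value ::
    "'n::finite itself \<Rightarrow> (real^'m) set \<Rightarrow> real \<Rightarrow> (real^'m) \<times> real \<Rightarrow> real" where
  "rescaled_value N E \<delta> = (\<lambda>(x, t). \<delta> * game_value N E (x /\<^sub>R \<delta>) \<lfloor>t / \<delta>\<^sup>2\<rfloor>)"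

section \<open>The operator and its envelopes\<close>

definition H_op :: "'n::finite itself \<Rightarrow> real^'m^'m \<Rightarrow> real^'m \<Rightarrow> real" where
  "H_op N M p =
     (SUP A\<in>{A \<in> (admissible :: (real^'n^'m) set). transpose A *v p = 0}.
        MIN \<epsilon>\<in>sign_vectors. (M *v (A *v \<epsilon>)) \<bullet> (A *v \<epsilon>))"

definition symmetric_matrices :: "(real^'m^'m) set" where
  "symmetric_matrices = {M. transpose M = M}"

text \<open>Approach to \<open>(M, p)\<close> with \<open>M'\<close> symmetric; as usual for semicontinuous envelopes, the point
  \<open>(M, p)\<close> itself is included.\<close>

definition envelope_filter :: "real^'m^'m \<Rightarrow> real^'m \<Rightarrow> ((real^'m^'m) \<times> (real^'m)) filter" where
  "envelope_filter M p = inf (nhds (M, p)) (principal (symmetric_matrices \<times> UNIV))"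

definition upper_env :: "(real^'m^'m \<Rightarrow> real^'m \<Rightarrow> real) \<Rightarrow> real^'m^'m \<Rightarrow> real^'m \<Rightarrow> ereal" where
  "upper_env F M p = Limsup (envelope_filter M p) (\<lambda>(M', p'). ereal (F M' p'))"

definition lower_env :: "(real^'m^'m \<Rightarrow> real^'m \<Rightarrow> real) \<Rightarrow> real^'m^'m \<Rightarrow> real^'m \<Rightarrow> ereal" where
  "lower_env F M p = Liminf (envelope_filter M p) (\<lambda>(M', p'). ereal (F M' p'))"

section \<open>Viscosity solutions\<close>

definition usc_on :: "'a::topological_space set \<Rightarrow> ('a \<Rightarrow> real) \<Rightarrow> bool" where
  "usc_on S u \<longleftrightarrow> (\<forall>c. openin (top_of_set S) {z\<in>S. u z < c})"

definition lsc_on :: "'a::topological_space set \<Rightarrow> ('a \<Rightarrow> real) \<Rightarrow> bool" where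
  "lsc_on S u \<longleftrightarrow> (\<forall>c. openin (top_of_set S) {z\<in>S. c < u z})"

text \<open>\<open>d\<close>, \<open>g\<close>, \<open>h\<close> are \<open>\<partial>\<^sub>t\<phi>\<close>, \<open>\<nabla>\<phi>\<close>, \<open>D\<^sup>2\<phi>\<close> (the latter two in the space variable) on
  \<open>\<real>\<^sup>m \<times> (-\<infinity>, 0)\<close>.\<close>

definition test_function_with :: "((real^'m) \<times> real \<Rightarrow> real) \<Rightarrow> ((real^'m) \<times> real \<Rightarrow> real) \<Rightarrow>
    ((real^'m) \<times> real \<Rightarrow> real^'m) \<Rightarrow> ((real^'m) \<times> real \<Rightarrow> real^'m^'m) \<Rightarrow> bool" where
  "test_function_with \<phi> d g h \<longleftrightarrow>
     (\<forall>x. \<forall>t<0.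
        ((\<lambda>s. \<phi> (x, s)) has_real_derivative d (x, t)) (at t) \<and>
        ((\<lambda>y. \<phi> (y, t)) has_derivative (\<lambda>v. g (x, t) \<bullet> v)) (at x) \<and>
        ((\<lambda>y. g (y, t)) has_derivative (\<lambda>v. h (x, t) *v v)) (at x)) \<and>
     continuous_on (UNIV \<times> {..<0}) d \<and>
     continuous_on (UNIV \<times> {..<0}) g \<and>
     continuous_on (UNIV \<times> {..<0}) h"

definition local_max_at :: "('a::topological_space \<Rightarrow> real) \<Rightarrow> 'a \<Rightarrow> bool" where
  "local_max_at f z \<longleftrightarrow> (\<forall>\<^sub>F y in nhds z. f y \<le> f z)"

definition local_min_at :: "('a::topological_space \<Rightarrow> real) \<Rightarrow> 'a \<Rightarrow> bool" where
  "local_min_at f z \<longleftrightarrow> (\<forall>\<^sub>F y in nhds z. f z \<le> f y)"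

text \<open>Sub- and supersolutions of the backward equation \<open>\<partial>\<^sub>tu + 1/2 F(D\<^sup>2u, \<nabla>u) = 0\<close> in
  \<open>\<real>\<^sup>m \<times> (-\<infinity>, 0)\<close>.\<close>

definition viscosity_subsolution ::
    "(real^'m^'m \<Rightarrow> real^'m \<Rightarrow> real) \<Rightarrow> ((real^'m) \<times> real \<Rightarrow> real) \<Rightarrow> bool" where
  "viscosity_subsolution F u \<longleftrightarrow>
     usc_on (UNIV \<times> {..0}) u \<and>
     (\<forall>\<phi> d g h x t. test_function_with \<phi> d g h \<and> t < 0 \<and> local_max_at (\<lambda>z. u z - \<phi> z) (x, t) \<longrightarrow>
        ereal (d (x, t)) + ereal (1/2) * upper_env F (h (x, t)) (g (x, t)) \<ge> 0)"

definition viscosity_supersolution ::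
    "(real^'m^'m \<Rightarrow> real^'m \<Rightarrow> real) \<Rightarrow> ((real^'m) \<times> real \<Rightarrow> real) \<Rightarrow> bool" where
  "viscosity_supersolution F u \<longleftrightarrow>
     lsc_on (UNIV \<times> {..0}) u \<and>
     (\<forall>\<phi> d g h x t. test_function_with \<phi> d g h \<and> t < 0 \<and> local_min_at (\<lambda>z. u z - \<phi> z) (x, t) \<longrightarrow>
        ereal (d (x, t)) + ereal (1/2) * lower_env F (h (x, t)) (g (x, t)) \<le> 0)"

definition viscosity_solution ::
    "(real^'m^'m \<Rightarrow> real^'m \<Rightarrow> real) \<Rightarrow> ((real^'m) \<times> real \<Rightarrow> real) \<Rightarrow> bool" where
  "viscosity_solution F u \<longleftrightarrow> viscosity_subsolution F u \<and> viscosity_supersolution F u"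

definition terminal_value_solution :: "(real^'m^'m \<Rightarrow> real^'m \<Rightarrow> real) \<Rightarrow> (real^'m \<Rightarrow> real) \<Rightarrow>
    ((real^'m) \<times> real \<Rightarrow> real) \<Rightarrow> bool" where
  "terminal_value_solution F f u \<longleftrightarrow> viscosity_solution F u \<and> (\<forall>x. u (x, 0) = f x)"

text \<open>At most linear growth in \<open>x\<close>, uniformly for \<open>t\<close> in bounded intervals.\<close>

definition linear_growth :: "((real^'m) \<times> real \<Rightarrow> real) \<Rightarrow> bool" where
  "linear_growth u \<longleftrightarrow> (\<forall>T>0. \<exists>C. \<forall>x. \<forall>t\<in>{-T..0}. \<bar>u (x, t)\<bar> \<le> C * (1 + norm x))"

end

theory Submission
  imports Defs "HOL-Complex_Analysis.Great_Picard"
begin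

text \<open>The minimizing player can keep the squared distance to any fixed point from growing by more than
  \<open>n\<^sup>2\<close> per step. The rescaled values are therefore Lipschitz in space and, up to the step size,
  Hoelder continuous of exponent \<open>1/2\<close> in time, so their upper and lower half-relaxed limits are
  continuous; by dynamic programming these are a sub- and a supersolution with the same terminal values.

  Convergence and uniqueness thus reduce to comparison. Variables are doubled with the penalty
  \<open>\<bar>\<xi>\<bar>\<^sup>4 / 4\<eta>\<close> in space. If its gradients stay away from zero in the limit, \<open>H\<^sub>n\<close> is continuous there and
  monotone in the matrix. Otherwise \<open>\<xi> \<rightarrow> 0\<close>, the Hessians, being at least \<open>-3\<bar>\<xi>\<bar>\<^sup>2 / \<eta>\<close> with a sum
  that is at most \<open>o(1)\<close>, tend to zero, and so does \<open>H\<^sub>n\<close>. Second-order information at the maximum comes from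
  the sup-convolutions: their gradients are Lipschitz on the contact set, and the energies of the
  difference quotients of a Lipschitz map at dyadic scales increase and stay bounded, so that second
  differences become negligible at some scale.\<close>

section \<open>Blow-ups of Lipschitz maps and semiconvex functions\<close>

text \<open>The maximum in the comparison argument runs over three points: \<open>y\<close> for
  \<open>u\<close>, \<open>z\<close> for \<open>v = - w\<close>, and a free third point
  \<open>x\<close> to which both are tied. For fixed \<open>x\<close> the suprema over
  \<open>y\<close> and \<open>z\<close> separate, so what is maximized in \<open>x\<close> is a sum
  of two sup-convolutions minus a penalty, and all summands are semiconvex. A contradiction needs a
  strict gap. It comes from the time slope of the penalty \<open>\<sigma> t^2\<close>, so all times
  must stay away from 0. This is secured by one-sided barriers,
  \<open>u \<le> f + C sqrt (- t)\<close> and \<open>w \<ge> f\<close>, which also replace linear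
  growth as the source of compactness. The order of the parameters is decisive: the kernel parameter
  \<open>\<eta>\<close> is fixed first, with bounds independent of \<open>\<kappa>\<close>; only
  then do the spatial penalty and the tolerance of the maximum principle, both governed by
  \<open>\<kappa>\<close>, tend to zero. Displacements and Hessians therefore have limits at fixed
  \<open>\<eta>\<close>, and the gradients vanish in the limit exactly when the displacements
  do.\<close>

lemma lborel_integral_shift:
  fixes g :: "'a::euclidean_space \<Rightarrow> 'b::{banach,second_countable_topology}"
  assumes "g \<in> borel_measurable borel"
  shows "(\<integral>x. g (x + v) \<partial>lborel) = (\<integral>x. g x \<partial>lborel)"
proof -
  have "(\<integral>x. g x \<partial>lborel) = (\<integral>x. g x \<partial>distr lborel borel ((+) v))"
    by (simp add: lborel_distr_plus)
  also have "\<dots> = (\<integral>x. g (v + x) \<partial>lborel)"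
    by (rule integral_distr) (use assms in auto)
  finally show ?thesis by (simp add: add.commute)
qed

lemma integrable_lborel_compact_support:
  fixes g :: "'a::euclidean_space \<Rightarrow> real"
  assumes "continuous_on UNIV g" and "\<And>x. x \<notin> cball 0 B \<Longrightarrow> g x = 0"
  shows "integrable lborel g"
proof -
  have "integrable lborel (\<lambda>x. indicator (cball 0 B) x *\<^sub>R g x)"
    by (rule borel_integrable_compact) (use continuous_on_subset[OF assms(1)] in auto)
  moreover have "(\<lambda>x. indicator (cball 0 B) x *\<^sub>R g x) = g"
    using assms(2) by (auto simp: indicator_def fun_eq_iff)
  ultimately show ?thesis by simp
qed

text \<open>The difference quotients at step \<open>2s\<close> average two translates of those at step \<open>s\<close>; by the
  parallelogram law their \<open>L\<^sup>2\<close> norms increase as the step is halved, and the increment is the norm of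
  the second difference.\<close>

lemma second_difference_energy:
  fixes G :: "'a::euclidean_space \<Rightarrow> 'b::euclidean_space"
  assumes L: "L-lipschitz_on UNIV G" and supp: "\<And>x. x \<notin> cball 0 B \<Longrightarrow> G x = 0"
  defines "s \<equiv> \<lambda>j. (1/2::real)^j"
  shows "(\<lambda>j. \<integral>x. (norm (G (x + (2 * s j) *\<^sub>R v) - 2 *\<^sub>R G (x + s j *\<^sub>R v) + G x) / s j)\<^sup>2 \<partial>lborel) \<longlonglongrightarrow> 0"
proof -
  define D where "D j x = (1 / s j) *\<^sub>R (G (x + s j *\<^sub>R v) - G x)" for j x
  define E where "E j = (\<integral>x. (norm (D j x))\<^sup>2 \<partial>lborel)" for j
  have s: "0 < s j" "s j \<le> 1" for j by (simp_all add: s_def power_le_one)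
  have contG: "continuous_on UNIV G" using L by (rule lipschitz_on_continuous_on)
  have contD: "continuous_on UNIV (\<lambda>x. D j (x + w))" for j w
    unfolding D_def by (intro continuous_intros continuous_on_compose2[OF contG]) auto
  have suppD: "D j x = 0" if "x \<notin> cball 0 (B + norm v)" for j and x :: 'a
  proof -
    have nx: "norm x > B + norm v" using that by simp
    have "norm (s j *\<^sub>R v) \<le> norm v" using s[of j] by (simp add: mult_left_le_one_le)
    moreover have "norm x \<le> norm (x + s j *\<^sub>R v) + norm (s j *\<^sub>R v)"
      using norm_triangle_ineq4[of "x + s j *\<^sub>R v" "s j *\<^sub>R v"] by simp
    ultimately have "norm (x + s j *\<^sub>R v) > B" using nx by linarith
    moreover have "norm x > B" using nx norm_ge_zero[of v] by linarith
    ultimately show ?thesis by (simp add: D_def supp)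
  qed
  have int: "integrable lborel (\<lambda>x. (norm (D j (x + w)))\<^sup>2)" for j w
  proof (rule integrable_lborel_compact_support[where B = "B + norm v + norm w"])
    show "continuous_on UNIV (\<lambda>x. (norm (D j (x + w)))\<^sup>2)"
      by (intro continuous_intros contD)
    fix x :: 'a assume "x \<notin> cball 0 (B + norm v + norm w)"
    then have "norm x > B + norm v + norm w" by simp
    moreover have "norm x \<le> norm (x + w) + norm w"
      using norm_triangle_ineq4[of "x + w" w] by simp
    ultimately have "x + w \<notin> cball 0 (B + norm v)" by simp
    then show "(norm (D j (x + w)))\<^sup>2 = 0" using suppD by simp
  qed
  have Dle: "norm (D j x) \<le> L * norm v" for j and x :: 'a
  proof -
    have "norm (G (x + s j *\<^sub>R v) - G x) \<le> L * norm (s j *\<^sub>R v)"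
      using lipschitz_on_normD[OF L, of "x + s j *\<^sub>R v" x] by simp
    then have "norm (G (x + s j *\<^sub>R v) - G x) / s j \<le> L * norm v"
      using s[of j] by (simp add: pos_divide_le_eq mult.assoc mult.commute mult.left_commute)
    then show ?thesis using s[of j] unfolding D_def norm_scaleR by simp
  qed
  \<comment> \<open>The Lipschitz bound holds pointwise, and since the steps are at most 1
    everything vanishes outside a ball independent of \<open>j\<close>; so the energies are bounded
    uniformly.\<close>
  have Ele: "E j \<le> (\<integral>x. indicator (cball 0 (B + norm v)) x * (L * norm v)\<^sup>2 \<partial>(lborel::'a measure))" for j
    unfolding E_def
  proof (rule integral_mono)
    show "integrable lborel (\<lambda>x. (norm (D j x))\<^sup>2)" using int[of j 0] by simp
    show "integrable lborel (\<lambda>x::'a. indicat_real (cball 0 (B + norm v)) x * (L * norm v)\<^sup>2)"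
      by (intro integrable_mult_left integrable_real_indicator)
        (simp_all add: emeasure_compact_finite[simplified])
    fix x show "(norm (D j x))\<^sup>2 \<le> indicator (cball 0 (B + norm v)) x * (L * norm v)\<^sup>2"
      using Dle[of j x] suppD[of x j] power_mono[of "norm (D j x)" "L * norm v" 2]
      by (auto simp: indicator_def)
  qed
  have half: "s j = 2 * s (Suc j)" for j by (simp add: s_def)
  have avg: "2 *\<^sub>R D j (x::'a) = D (Suc j) (x + s (Suc j) *\<^sub>R v) + D (Suc j) x" for j x
  proof -
    have e: "x + s (Suc j) *\<^sub>R v + s (Suc j) *\<^sub>R v = x + s j *\<^sub>R v"
      unfolding half[of j] by (simp only: mult_2 scaleR_left_distrib add.assoc)
    have "D (Suc j) (x + s (Suc j) *\<^sub>R v) + D (Suc j) x = (1 / s (Suc j)) *\<^sub>R (G (x + s j *\<^sub>R v) - G x)"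
      unfolding D_def e by (simp add: scaleR_diff_right)
    also have "\<dots> = 2 *\<^sub>R D j x" unfolding D_def half[of j] by simp
    finally show ?thesis by simp
  qed
  have dd: "D j ((x::'a) + s j *\<^sub>R v) - D j x = (1 / s j) *\<^sub>R (G (x + (2 * s j) *\<^sub>R v) - 2 *\<^sub>R G (x + s j *\<^sub>R v) + G x)" for j x
  proof -
    have e: "x + s j *\<^sub>R v + s j *\<^sub>R v = x + (2 * s j) *\<^sub>R v"
      by (simp only: mult_2 scaleR_left_distrib add.assoc)
    show ?thesis unfolding D_def e scaleR_diff_right[symmetric] by (rule arg_cong[of _ _ "scaleR (1 / s j)"]) (simp add: scaleR_2)
  qed
  have par: "(norm (a - b))\<^sup>2 = 2 * (norm a)\<^sup>2 + 2 * (norm b)\<^sup>2 - (norm (a + b))\<^sup>2" for a b :: 'b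
    unfolding power2_norm_eq_inner by (simp add: algebra_simps inner_commute)
  have key: "(\<integral>x. (norm (G (x + (2 * s (Suc j)) *\<^sub>R v) - 2 *\<^sub>R G (x + s (Suc j) *\<^sub>R v) + G x) / s (Suc j))\<^sup>2 \<partial>lborel)
      = 4 * E (Suc j) - 4 * E j" for j
  proof -
    have "(norm (G (x + (2 * s (Suc j)) *\<^sub>R v) - 2 *\<^sub>R G (x + s (Suc j) *\<^sub>R v) + G x) / s (Suc j))\<^sup>2
      = 2 * (norm (D (Suc j) (x + s (Suc j) *\<^sub>R v)))\<^sup>2 + 2 * (norm (D (Suc j) (x + 0)))\<^sup>2 - 4 * (norm (D j (x + 0)))\<^sup>2" for x
    proof -
      have "norm (G (x + (2 * s (Suc j)) *\<^sub>R v) - 2 *\<^sub>R G (x + s (Suc j) *\<^sub>R v) + G x) / s (Suc j)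
        = norm (D (Suc j) (x + s (Suc j) *\<^sub>R v) - D (Suc j) x)"
        unfolding dd using s[of "Suc j"] by simp
      moreover have "(norm (D (Suc j) (x + s (Suc j) *\<^sub>R v) + D (Suc j) x))\<^sup>2 = 4 * (norm (D j x))\<^sup>2"
        unfolding avg[symmetric] by (simp add: power_mult_distrib)
      ultimately show ?thesis using par[of "D (Suc j) (x + s (Suc j) *\<^sub>R v)" "D (Suc j) x"] by simp
    qed
    then have "(\<integral>x. (norm (G (x + (2 * s (Suc j)) *\<^sub>R v) - 2 *\<^sub>R G (x + s (Suc j) *\<^sub>R v) + G x) / s (Suc j))\<^sup>2 \<partial>lborel)
      = (\<integral>x. 2 * (norm (D (Suc j) (x + s (Suc j) *\<^sub>R v)))\<^sup>2 + 2 * (norm (D (Suc j) (x + 0)))\<^sup>2 - 4 * (norm (D j (x + 0)))\<^sup>2 \<partial>lborel)"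
      by (simp cong: Bochner_Integration.integral_cong)
    also have "\<dots> = 2 * (\<integral>x. (norm (D (Suc j) (x + s (Suc j) *\<^sub>R v)))\<^sup>2 \<partial>lborel) + 2 * E (Suc j) - 4 * E j"
      unfolding E_def using int[of "Suc j" "s (Suc j) *\<^sub>R v"] int[of "Suc j" 0] int[of j 0] by simp
    also have "(\<integral>x. (norm (D (Suc j) (x + s (Suc j) *\<^sub>R v)))\<^sup>2 \<partial>lborel) = E (Suc j)"
      unfolding E_def
      by (rule lborel_integral_shift[where g = "\<lambda>x. (norm (D (Suc j) x))\<^sup>2"])
        (use contD[of "Suc j" 0] in \<open>auto intro!: borel_measurable_continuous_onI continuous_intros\<close>)
    finally show ?thesis by simp
  qed
  have "E j \<le> E (Suc j)" for j
  proof -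
    have "0 \<le> (\<integral>x. (norm (G (x + (2 * s (Suc j)) *\<^sub>R v) - 2 *\<^sub>R G (x + s (Suc j) *\<^sub>R v) + G x) / s (Suc j))\<^sup>2 \<partial>(lborel::'a measure))"
      by (rule Bochner_Integration.integral_nonneg) simp
    then show ?thesis unfolding key by simp
  qed
  then have "incseq E" by (rule incseq_SucI)
  then obtain l where l: "E \<longlonglongrightarrow> l"
    by (rule incseq_convergent[OF _ allI[OF Ele]])
  have "(\<lambda>j. 4 * E (Suc j) - 4 * E j) \<longlonglongrightarrow> 4 * l - 4 * l"
    by (intro tendsto_intros l LIMSEQ_Suc)
  then have "(\<lambda>j. 4 * E (Suc j) - 4 * E j) \<longlonglongrightarrow> 0" by simp
  \<comment> \<open>\<open>key\<close> compares a scale with the next coarser one, so it covers only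
    indices from 1 on.\<close>
  from this[folded key] show ?thesis by (rule LIMSEQ_imp_Suc)
qed

text \<open>At boundary points of \<open>K\<close> the translates may lie outside \<open>K\<close>
  for every \<open>j\<close>, so the integrand need not tend to 0 pointwise. Translation invariance
  (\<open>eq\<close>) exchanges the points that leave \<open>K\<close> for those that enter it, and
  a point outside the closed set \<open>K\<close> is eventually not carried into it; dominated
  convergence concludes.\<close>

lemma translate_difference_tendsto_0:
  fixes K :: "'a::euclidean_space set"
  assumes "compact K" and s: "s \<longlonglongrightarrow> 0" and "\<And>j. \<bar>s j\<bar> \<le> 1"
  shows "(\<lambda>j. \<integral>x. indicat_real K x * (1 - indicat_real K (x + s j *\<^sub>R y)) \<partial>lborel) \<longlonglongrightarrow> 0"
proof -
  obtain r where r: "K \<subseteq> cball 0 r" using compact_imp_bounded[OF assms(1)] by (auto simp: bounded_iff subset_iff)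
  have [measurable]: "K \<in> sets borel" using assms(1) by (simp add: borel_compact)
  have fin: "emeasure lborel K < \<infinity>" using assms(1) by (rule emeasure_compact_finite)
  have iK: "integrable lborel (indicat_real K)" using fin by (intro integrable_real_indicator) auto
  have iKs: "integrable lborel (\<lambda>x. indicat_real K (x + w))" for w
  proof -
    have "integrable (distr lborel borel ((+) w)) (indicat_real K)" using iK by (simp add: lborel_distr_plus)
    then have "integrable lborel (\<lambda>x. indicat_real K (w + x))" by (subst (asm) integrable_distr_eq) auto
    then show ?thesis by (simp add: add.commute)
  qed
  have iKK: "integrable lborel (\<lambda>x. indicat_real K x * indicat_real K (x + w))" for w
    by (rule Bochner_Integration.integrable_bound[OF iK]) (auto simp: indicator_def)
  have eq: "(\<integral>x. indicat_real K x * (1 - indicat_real K (x + w)) \<partial>lborel)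
     = (\<integral>x. indicat_real K (x + w) * (1 - indicat_real K x) \<partial>lborel)" for w
  proof -
    have "(\<integral>x. indicat_real K x * (1 - indicat_real K (x + w)) \<partial>lborel)
       = (\<integral>x. indicat_real K x \<partial>lborel) - (\<integral>x. indicat_real K x * indicat_real K (x + w) \<partial>lborel)"
      using iK iKK[of w] by (simp add: right_diff_distrib)
    also have "(\<integral>x. indicat_real K x \<partial>lborel) = (\<integral>x. indicat_real K (x + w) \<partial>lborel)"
      by (rule lborel_integral_shift[symmetric]) simp
    also have "\<dots> - (\<integral>x. indicat_real K x * indicat_real K (x + w) \<partial>lborel)
       = (\<integral>x. indicat_real K (x + w) * (1 - indicat_real K x) \<partial>lborel)"
      using iKs[of w] iKK[of w] by (simp add: right_diff_distrib mult.commute[of "indicat_real K (_ + w)"] left_diff_distrib)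
    finally show ?thesis .
  qed
  have "(\<lambda>j. \<integral>x. indicat_real K (x + s j *\<^sub>R y) * (1 - indicat_real K x) \<partial>lborel) \<longlonglongrightarrow> (\<integral>x. 0 \<partial>(lborel::'a measure))"
  proof (rule integral_dominated_convergence[where w = "indicat_real (cball 0 (r + norm y))"])
    show "integrable lborel (indicat_real (cball (0::'a) (r + norm y)))"
      by (intro integrable_real_indicator) (simp_all add: emeasure_compact_finite[simplified])
    show "AE x in lborel. (\<lambda>j. indicat_real K (x + s j *\<^sub>R y) * (1 - indicat_real K x)) \<longlonglongrightarrow> 0"
    proof (rule AE_I2)
      fix x :: 'a
      show "(\<lambda>j. indicat_real K (x + s j *\<^sub>R y) * (1 - indicat_real K x)) \<longlonglongrightarrow> 0"
      proof (cases "x \<in> K")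
        case False
        have "(\<lambda>j. x + s j *\<^sub>R y) \<longlonglongrightarrow> x + 0 *\<^sub>R y" by (intro tendsto_intros s)
        moreover have "open (- K)" using assms(1) by (simp add: compact_imp_closed open_Compl)
        ultimately have "\<forall>\<^sub>F j in sequentially. x + s j *\<^sub>R y \<in> - K"
          using False by (intro topological_tendstoD[of _ x]) auto
        then show ?thesis by (intro tendsto_eventually) (auto elim: eventually_mono)
      qed simp
    qed
    fix j show "AE x in lborel. norm (indicat_real K (x + s j *\<^sub>R y) * (1 - indicat_real K x)) \<le> indicat_real (cball 0 (r + norm y)) x"
    proof (rule AE_I2)
      fix x :: 'a
      show "norm (indicat_real K (x + s j *\<^sub>R y) * (1 - indicat_real K x)) \<le> indicat_real (cball 0 (r + norm y)) x"
      proof (cases "x + s j *\<^sub>R y \<in> K")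
        case True
        have "norm (s j *\<^sub>R y) \<le> norm y" using assms(3)[of j] by (simp add: mult_left_le_one_le)
        moreover have "norm x \<le> norm (x + s j *\<^sub>R y) + norm (s j *\<^sub>R y)"
          using norm_triangle_ineq4[of "x + s j *\<^sub>R y" "s j *\<^sub>R y"] by simp
        moreover have "norm (x + s j *\<^sub>R y) \<le> r" using True r by auto
        ultimately show ?thesis by (auto simp: indicator_def)
      qed simp
    qed
  qed measurable
  then show ?thesis unfolding eq by simp
qed

text \<open>A Chebyshev argument. \<open>T\<close> adds the indicators of leaving \<open>K\<close>
  and the squared second differences divided by \<open>\<kappa>^2\<close>; it is at least 1 at every
  point of \<open>K\<close> where the claim fails, while its integral tends to 0. If all of
  \<open>K\<close> failed at every scale beyond \<open>J\<close>, then \<open>K\<close> would be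
  null.\<close>

lemma exists_good_scale:
  fixes G :: "'a::euclidean_space \<Rightarrow> 'b::euclidean_space"
  assumes L: "L-lipschitz_on UNIV G" and supp: "\<And>x. x \<notin> cball 0 B \<Longrightarrow> G x = 0"
    and K: "compact K" "\<not> negligible K" and fin: "finite Y" "finite V" and "\<kappa> > 0"
  shows "\<exists>j\<ge>J. \<exists>x\<in>K. \<forall>y\<in>Y. x + (1/2)^j *\<^sub>R y \<in> K \<and>
     (\<forall>v\<in>V. norm (G (x + (1/2)^j *\<^sub>R y + (2 * (1/2)^j) *\<^sub>R v) - 2 *\<^sub>R G (x + (1/2)^j *\<^sub>R y + (1/2)^j *\<^sub>R v)
         + G (x + (1/2)^j *\<^sub>R y)) \<le> \<kappa> * (1/2)^j)"
proof (rule ccontr)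
  assume neg: "\<not> ?thesis"
  define s where "s j = (1/2::real)^j" for j
  have s: "0 < s j" "s j \<le> 1" for j by (simp_all add: s_def power_le_one)
  define \<Delta> where "\<Delta> j v x = (norm (G (x + (2 * s j) *\<^sub>R v) - 2 *\<^sub>R G (x + s j *\<^sub>R v) + G x) / s j)\<^sup>2" for j v x
  define I where "I j y x = indicat_real K x * (1 - indicat_real K (x + s j *\<^sub>R y))" for j y x
  define T where "T j x = (\<Sum>y\<in>Y. I j y x) + (\<Sum>y\<in>Y. \<Sum>v\<in>V. \<Delta> j v (x + s j *\<^sub>R y) / \<kappa>\<^sup>2)" for j x
  have [measurable]: "K \<in> sets borel" using K(1) by (simp add: borel_compact)
  have finK: "emeasure lborel K < \<infinity>" using K(1) by (rule emeasure_compact_finite)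
  have contG: "continuous_on UNIV G" using L by (rule lipschitz_on_continuous_on)
  have cont\<Delta>: "continuous_on UNIV (\<Delta> j v)" for j v
    unfolding \<Delta>_def using s[of j]
    by (intro continuous_intros continuous_on_compose2[OF contG]) auto
  have supp\<Delta>: "\<Delta> j v x = 0" if "x \<notin> cball 0 (B + 2 * norm v)" for j v x
  proof -
    have nx: "norm x > B + 2 * norm v" using that by simp
    have 1: "norm (s j *\<^sub>R v) \<le> norm v" using s[of j] by (simp add: mult_left_le_one_le)
    then have 2: "norm ((2 * s j) *\<^sub>R v) \<le> 2 * norm v" by simp
    have 3: "norm x \<le> norm (x + s j *\<^sub>R v) + norm (s j *\<^sub>R v)"
      using norm_triangle_ineq4[of "x + s j *\<^sub>R v" "s j *\<^sub>R v"] by simp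
    have 4: "norm x \<le> norm (x + (2 * s j) *\<^sub>R v) + norm ((2 * s j) *\<^sub>R v)"
      using norm_triangle_ineq4[of "x + (2 * s j) *\<^sub>R v" "(2 * s j) *\<^sub>R v"] by simp
    have "norm (x + s j *\<^sub>R v) > B" "norm (x + (2 * s j) *\<^sub>R v) > B" "norm x > B"
      using nx 1 2 3 4 norm_ge_zero[of v] by linarith+
    then show ?thesis by (simp add: \<Delta>_def supp)
  qed
  have int\<Delta>0: "integrable lborel (\<Delta> j v)" for j v
    using integrable_lborel_compact_support[OF cont\<Delta> supp\<Delta>] .
  have int\<Delta>: "integrable lborel (\<lambda>x. \<Delta> j v (x + w))" for j v w
  proof -
    have [measurable]: "\<Delta> j v \<in> borel_measurable borel" using cont\<Delta> by (rule borel_measurable_continuous_onI)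
    have "integrable (distr lborel borel ((+) w)) (\<Delta> j v)" using int\<Delta>0 by (simp add: lborel_distr_plus)
    then have "integrable lborel (\<lambda>x. \<Delta> j v (w + x))" by (subst (asm) integrable_distr_eq) auto
    then show ?thesis by (simp add: add.commute)
  qed
  have iK: "integrable lborel (indicat_real K)" using finK by (intro integrable_real_indicator) auto
  have intI: "integrable lborel (I j y)" for j y unfolding I_def
    by (rule Bochner_Integration.integrable_bound[OF iK]) (auto simp: indicator_def)
  have shift: "(\<integral>x. \<Delta> j v (x + w) \<partial>lborel) = (\<integral>x. \<Delta> j v x \<partial>lborel)" for j v w
    by (rule lborel_integral_shift) (use cont\<Delta> borel_measurable_continuous_onI in blast)
  have intT: "(\<integral>x. T j x \<partial>lborel) = (\<Sum>y\<in>Y. \<integral>x. I j y x \<partial>lborel) + (\<Sum>y\<in>Y. \<Sum>v\<in>V. (\<integral>x. \<Delta> j v x \<partial>lborel) / \<kappa>\<^sup>2)" for j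
    unfolding T_def using intI int\<Delta> by (simp add: shift)
  have s0: "s \<longlonglongrightarrow> 0" unfolding s_def by (intro LIMSEQ_realpow_zero) auto
  have "(\<lambda>j. \<integral>x. T j x \<partial>lborel) \<longlonglongrightarrow> (\<Sum>y\<in>Y. 0) + (\<Sum>y\<in>Y. \<Sum>v\<in>V. 0 / \<kappa>\<^sup>2)"
    unfolding intT
  proof (intro tendsto_intros)
    show "(\<lambda>j. \<integral>x. I j y x \<partial>lborel) \<longlonglongrightarrow> 0" for y
      unfolding I_def by (rule translate_difference_tendsto_0[OF K(1) s0]) (use s in \<open>auto simp: abs_of_pos\<close>)
    show "(\<lambda>j. \<integral>x. \<Delta> j v x \<partial>lborel) \<longlonglongrightarrow> 0" for v
      unfolding \<Delta>_def s_def by (rule second_difference_energy[OF L supp])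
  qed (use \<open>\<kappa> > 0\<close> in auto)
  then have lim: "(\<lambda>j. \<integral>x. T j x \<partial>lborel) \<longlonglongrightarrow> 0" by simp
  have ge: "indicat_real K x \<le> T j x" if jJ: "j \<ge> J" for j x
  proof -
    have I0: "I j y x \<ge> 0" for y by (auto simp: I_def indicator_def)
    have \<Delta>0: "\<Delta> j v z / \<kappa>\<^sup>2 \<ge> 0" for v z by (simp add: \<Delta>_def)
    have T0: "(\<Sum>y\<in>Y. I j y x) \<ge> 0" "(\<Sum>y\<in>Y. \<Sum>v\<in>V. \<Delta> j v (x + s j *\<^sub>R y) / \<kappa>\<^sup>2) \<ge> 0"
      by (intro sum_nonneg I0 \<Delta>0)+
    show ?thesis
    proof (cases "x \<in> K")
      case True
      then obtain y where y: "y \<in> Y" "x + s j *\<^sub>R y \<notin> K \<or> (\<exists>v\<in>V. norm (G (x + s j *\<^sub>R y + (2 * s j) *\<^sub>R v) - 2 *\<^sub>R G (x + s j *\<^sub>R y + s j *\<^sub>R v)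
         + G (x + s j *\<^sub>R y)) > \<kappa> * s j)"
        using neg jJ unfolding s_def not_le[symmetric] by blast
      from y(2) show ?thesis
      proof
        assume "x + s j *\<^sub>R y \<notin> K"
        then have "I j y x = 1" using True by (simp add: I_def)
        moreover have "I j y x \<le> (\<Sum>y\<in>Y. I j y x)" using y(1) fin I0 by (intro member_le_sum) auto
        ultimately show ?thesis using T0 True by (simp add: T_def)
      next
        assume "\<exists>v\<in>V. norm (G (x + s j *\<^sub>R y + (2 * s j) *\<^sub>R v) - 2 *\<^sub>R G (x + s j *\<^sub>R y + s j *\<^sub>R v)
         + G (x + s j *\<^sub>R y)) > \<kappa> * s j"
        then obtain v where v: "v \<in> V" "norm (G (x + s j *\<^sub>R y + (2 * s j) *\<^sub>R v) - 2 *\<^sub>R G (x + s j *\<^sub>R y + s j *\<^sub>R v)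
         + G (x + s j *\<^sub>R y)) > \<kappa> * s j" by blast
        have "\<Delta> j v (x + s j *\<^sub>R y) \<ge> \<kappa>\<^sup>2"
          unfolding \<Delta>_def using v(2) s[of j] \<open>\<kappa> > 0\<close> by (intro power_mono) (auto simp: field_simps)
        then have "1 \<le> \<Delta> j v (x + s j *\<^sub>R y) / \<kappa>\<^sup>2" using \<open>\<kappa> > 0\<close> by simp
        also have "\<dots> \<le> (\<Sum>v\<in>V. \<Delta> j v (x + s j *\<^sub>R y) / \<kappa>\<^sup>2)"
          using v(1) fin \<Delta>0 by (intro member_le_sum) auto
        also have "\<dots> \<le> (\<Sum>y\<in>Y. \<Sum>v\<in>V. \<Delta> j v (x + s j *\<^sub>R y) / \<kappa>\<^sup>2)"
          using y(1) fin \<Delta>0 by (intro member_le_sum[where f = "\<lambda>y. \<Sum>v\<in>V. \<Delta> j v (x + s j *\<^sub>R y) / \<kappa>\<^sup>2"] sum_nonneg) auto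
        finally show ?thesis using T0 True by (simp add: T_def)
      qed
    next
      case False
      then show ?thesis using T0 by (simp add: T_def)
    qed
  qed
  have iT: "integrable lborel (T j)" for j
    unfolding T_def using intI int\<Delta> by simp
  have "measure lborel K \<le> (\<integral>x. T j x \<partial>lborel)" if "j \<ge> J" for j
  proof -
    have "measure lborel K = (\<integral>x. indicat_real K x \<partial>lborel)" by simp
    also have "\<dots> \<le> (\<integral>x. T j x \<partial>lborel)"
      by (rule integral_mono[OF iK iT ge[OF that]])
    finally show ?thesis .
  qed
  then have "measure lborel K \<le> 0"
    using LIMSEQ_le_const[OF lim] by blast
  then have "measure lborel K = 0" using measure_nonneg[of lborel K] by linarith
  then have "emeasure lborel K = 0" using finK by (simp add: emeasure_eq_ennreal_measure)
  then have "K \<in> null_sets lborel" by auto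
  then have "negligible K" by (simp add: negligible_iff_null_sets null_sets_completionI)
  with K(2) show False ..
qed

section \<open>Lipschitz extensions with compact support\<close>

lemma abs_max_diff_le: "\<bar>max a b - max c d\<bar> \<le> max \<bar>a - c\<bar> \<bar>b - (d::real)\<bar>"
  by linarith

lemma abs_min_diff_le: "\<bar>min a b - min c d\<bar> \<le> max \<bar>a - c\<bar> \<bar>b - (d::real)\<bar>"
  by linarith

text \<open>McShane's extension \<open>e\<close>, truncated to the interval from \<open>- c\<close>
  to \<open>c\<close>. The cone \<open>c\<close> is at least \<open>A\<close> on the ball of radius
  \<open>r\<close>, so nothing changes on \<open>K\<close>, and it vanishes outside radius
  \<open>A + r\<close>; its slope 1 accounts for \<open>max L 1\<close>.\<close>

lemma scalar_lipschitz_extension: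
  fixes p :: "'a::real_normed_vector \<Rightarrow> real"
  assumes L: "L-lipschitz_on K p" and K: "\<And>x. x \<in> K \<Longrightarrow> norm x \<le> r" and A: "\<And>x. x \<in> K \<Longrightarrow> \<bar>p x\<bar> \<le> A"
  shows "\<exists>G. (max L 1)-lipschitz_on UNIV G \<and> (\<forall>x\<in>K. G x = p x) \<and> (\<forall>x. norm x > A + r \<longrightarrow> G x = 0)"
proof (cases "K = {}")
  case True
  then show ?thesis
    by (intro exI[of _ "\<lambda>_. 0"]) (auto intro: lipschitz_on_mono[OF lipschitz_on_constant])
next
  case False
  then obtain z0 where z0: "z0 \<in> K" by blast
  have L0: "L \<ge> 0" using L by (rule lipschitz_on_nonneg)
  define e where "e x = (INF z\<in>K. p z + L * norm (x - z))" for x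
  have bdd: "bdd_below ((\<lambda>z. p z + L * norm (x - z)) ` K)" for x
    using A L0 by (intro bdd_belowI[of _ "- A"]) (force intro: add_increasing2)
  have e_le: "e x \<le> p z + L * norm (x - z)" if "z \<in> K" for x z
    unfolding e_def using that by (intro cINF_lower bdd)
  have eK: "e x = p x" if "x \<in> K" for x
  proof (rule antisym)
    show "e x \<le> p x" using e_le[OF that, of x] by simp
    show "p x \<le> e x" unfolding e_def
    proof (rule cINF_greatest[OF False])
      fix z assume "z \<in> K"
      then show "p x \<le> p z + L * norm (x - z)"
        using lipschitz_on_normD[OF L that \<open>z \<in> K\<close>] by (simp add: abs_le_iff)
    qed
  qed
  have e1: "e x \<le> e y + L * norm (x - y)" for x y
  proof -
    have "e x - L * norm (x - y) \<le> e y"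
      unfolding e_def[of y]
    proof (rule cINF_greatest[OF False])
      fix z assume "z \<in> K"
      have "norm (x - z) \<le> norm (x - y) + norm (y - z)"
        using norm_triangle_ineq[of "x - y" "y - z"] by simp
      then have "L * norm (x - z) \<le> L * norm (x - y) + L * norm (y - z)"
        using mult_left_mono[OF _ L0] by (simp add: distrib_left[symmetric])
      then show "e x - L * norm (x - y) \<le> p z + L * norm (y - z)"
        using e_le[OF \<open>z \<in> K\<close>, of x] by linarith
    qed
    then show ?thesis by linarith
  qed
  have elip: "\<bar>e x - e y\<bar> \<le> L * norm (x - y)" for x y
    using e1[of x y] e1[of y x] by (simp add: norm_minus_commute abs_le_iff)
  define c where "c x = max 0 (A + r - norm x)" for x :: 'a
  have clip: "\<bar>c x - c y\<bar> \<le> norm (x - y)" for x y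
    using abs_max_diff_le[of 0 "A + r - norm x" 0 "A + r - norm y"] norm_triangle_ineq3[of x y]
    unfolding c_def by linarith
  define G where "G x = max (- c x) (min (c x) (e x))" for x
  have "(max L 1)-lipschitz_on UNIV G"
  proof (rule lipschitz_onI)
    fix x y
    have "\<bar>G x - G y\<bar> \<le> max \<bar>c x - c y\<bar> \<bar>e x - e y\<bar>"
      unfolding G_def
      by (rule order_trans[OF abs_max_diff_le max.boundedI[OF _ abs_min_diff_le]])
        (simp add: abs_minus_commute)
    also have "\<dots> \<le> max L 1 * norm (x - y)"
    proof (rule max.boundedI)
      show "\<bar>c x - c y\<bar> \<le> max L 1 * norm (x - y)"
        by (rule order_trans[OF clip]) (metis max.cobounded2 mult_1 mult_right_mono norm_ge_zero)
      show "\<bar>e x - e y\<bar> \<le> max L 1 * norm (x - y)"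
        by (rule order_trans[OF elip]) (simp add: mult_right_mono)
    qed
    finally show "dist (G x) (G y) \<le> max L 1 * dist x y" by (simp add: dist_norm)
  qed simp
  moreover have "G x = p x" if "x \<in> K" for x
    using A[OF that] K[OF that] eK[OF that] by (simp add: G_def c_def)
  moreover have "G x = 0" if "norm x > A + r" for x
    using that by (simp add: G_def c_def)
  ultimately show ?thesis by blast
qed

text \<open>Compact support is what makes the energies in \<open>second_difference_energy\<close>
  finite and uniformly bounded. Extending coordinate by coordinate enlarges the Lipschitz constant
  by the dimension, which is harmless.\<close>

lemma lipschitz_extension_compact_support:
  fixes P :: "'a::euclidean_space \<Rightarrow> 'b::euclidean_space"
  assumes L: "L-lipschitz_on K P" and K: "bounded K"
  shows "\<exists>G L' B. L'-lipschitz_on UNIV G \<and> (\<forall>x\<in>K. G x = P x) \<and> (\<forall>x. x \<notin> cball 0 B \<longrightarrow> G x = 0)"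
proof -
  obtain r where r: "\<And>x. x \<in> K \<Longrightarrow> norm x \<le> r" using K by (auto simp: bounded_iff)
  have "bounded (P ` K)"
    using L K by (intro bounded_uniformly_continuous_image lipschitz_on_uniformly_continuous)
  then obtain A where A: "\<And>x. x \<in> K \<Longrightarrow> norm (P x) \<le> A" by (auto simp: bounded_iff)
  have "\<exists>g. (max L 1)-lipschitz_on UNIV g \<and> (\<forall>x\<in>K. g x = P x \<bullet> b) \<and> (\<forall>x. norm x > A + r \<longrightarrow> g x = 0)"
    if b: "b \<in> Basis" for b
  proof (rule scalar_lipschitz_extension)
    show "L-lipschitz_on K (\<lambda>x. P x \<bullet> b)"
    proof (rule lipschitz_onI)
      fix x y assume xy: "x \<in> K" "y \<in> K"
      have "\<bar>(P x - P y) \<bullet> b\<bar> \<le> norm (P x - P y)" using b by (rule Basis_le_norm)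
      then show "dist (P x \<bullet> b) (P y \<bullet> b) \<le> L * dist x y"
        using lipschitz_on_normD[OF L xy] by (simp add: dist_norm inner_diff_left)
    qed (use lipschitz_on_nonneg[OF L] in simp)
    show "\<bar>P x \<bullet> b\<bar> \<le> A" if "x \<in> K" for x
      using Basis_le_norm[OF b, of "P x"] A[OF that] by linarith
  qed (use r in auto)
  then obtain g where g: "\<And>b. b \<in> Basis \<Longrightarrow> (max L 1)-lipschitz_on UNIV (g b)"
     "\<And>b x. b \<in> Basis \<Longrightarrow> x \<in> K \<Longrightarrow> g b x = P x \<bullet> b"
     "\<And>b x. b \<in> Basis \<Longrightarrow> norm x > A + r \<Longrightarrow> g b x = 0" by metis
  define G where "G x = (\<Sum>b\<in>Basis. g b x *\<^sub>R b)" for x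
  have "(real DIM('b) * max L 1)-lipschitz_on UNIV G"
  proof (rule lipschitz_onI)
    fix x y
    have "norm (G x - G y) = norm (\<Sum>b\<in>Basis. (g b x - g b y) *\<^sub>R (b::'b))"
      by (simp add: G_def sum_subtractf scaleR_left_diff_distrib)
    also have "\<dots> \<le> (\<Sum>b\<in>(Basis::'b set). \<bar>g b x - g b y\<bar>)"
      by (rule order_trans[OF norm_sum]) (simp add: sum_mono)
    also have "\<dots> \<le> (\<Sum>b\<in>(Basis::'b set). max L 1 * dist x y)"
      using lipschitz_onD[OF g(1)] by (intro sum_mono) (auto simp: dist_real_def)
    finally show "dist (G x) (G y) \<le> real DIM('b) * max L 1 * dist x y"
      by (simp add: dist_norm)
  qed simp
  moreover have "G x = P x" if "x \<in> K" for x
    unfolding G_def using g(2) that by (simp add: euclidean_representation)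
  moreover have "G x = 0" if "x \<notin> cball 0 (A + r)" for x
    unfolding G_def using g(3) that by simp
  ultimately show ?thesis by blast
qed

section \<open>Linear maps from additive data on rational vectors\<close>

text \<open>Countable, for the diagonal extraction; dense, for passing to all directions; closed
  under sums and rational multiples, so that additivity of a limit can be expressed inside the
  set.\<close>

definition rational_vectors :: "'a::euclidean_space set" where
  "rational_vectors = {y. \<forall>b\<in>Basis. y \<bullet> b \<in> \<rat>}"

lemma countable_rational_vectors: "countable (rational_vectors :: 'a::euclidean_space set)"
proof -
  have "rational_vectors \<subseteq> (\<lambda>f. \<Sum>b\<in>(Basis::'a set). f b *\<^sub>R b) ` (Basis \<rightarrow>\<^sub>E \<rat>)"
  proof
    fix y :: 'a assume y: "y \<in> rational_vectors"
    have "y = (\<Sum>b\<in>Basis. restrict (\<lambda>b. y \<bullet> b) Basis b *\<^sub>R b)"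
      by (simp add: euclidean_representation)
    moreover have "restrict (\<lambda>b. y \<bullet> b) Basis \<in> Basis \<rightarrow>\<^sub>E \<rat>"
      using y by (auto simp: rational_vectors_def)
    ultimately show "y \<in> (\<lambda>f. \<Sum>b\<in>(Basis::'a set). f b *\<^sub>R b) ` (Basis \<rightarrow>\<^sub>E \<rat>)" by (rule image_eqI)
  qed
  moreover have "countable (Basis \<rightarrow>\<^sub>E (\<rat>::real set))"
    by (intro countable_PiE) (auto simp: countable_rat)
  ultimately show ?thesis using countable_image countable_subset by blast
qed

lemma rational_vectors_dense:
  fixes x :: "'a::euclidean_space"
  assumes "e > 0"
  obtains y where "y \<in> rational_vectors" "dist x y < e"
proof -
  have "x \<in> closure (\<Union>f\<in>Basis \<rightarrow> \<rat>. {\<Sum>i\<in>Basis. f i *\<^sub>R i})"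
    by (simp add: closure_rational_coordinates)
  then obtain y where y: "y \<in> (\<Union>f\<in>Basis \<rightarrow> \<rat>. {\<Sum>i\<in>Basis. f i *\<^sub>R (i::'a)})" "dist y x < e"
    using assms unfolding closure_approachable by blast
  then have "y \<in> rational_vectors"
    by (auto simp: rational_vectors_def inner_sum_left_Basis Pi_iff)
  with y(2) show ?thesis using that by (simp add: dist_commute)
qed

lemma rational_vectors_add: "x \<in> rational_vectors \<Longrightarrow> y \<in> rational_vectors \<Longrightarrow> x + y \<in> rational_vectors"
  and rational_vectors_diff: "x \<in> rational_vectors \<Longrightarrow> y \<in> rational_vectors \<Longrightarrow> x - y \<in> rational_vectors"
  and rational_vectors_scale: "q \<in> \<rat> \<Longrightarrow> x \<in> rational_vectors \<Longrightarrow> q *\<^sub>R x \<in> rational_vectors"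
  and rational_vectors_0: "0 \<in> rational_vectors"
  by (auto simp: rational_vectors_def inner_add_left inner_diff_left)

text \<open>Additivity already yields homogeneity over the rationals, and a rational-linear map is
  determined by its values on \<open>Basis\<close>; \<open>M\<close> is the real-linear map with the
  same basis values.\<close>

lemma additive_on_rational_vectors:
  fixes m :: "'a::euclidean_space \<Rightarrow> 'b::real_normed_vector"
  assumes add: "\<And>x y. x \<in> rational_vectors \<Longrightarrow> y \<in> rational_vectors \<Longrightarrow> m (x + y) = m x + m y"
  obtains M where "linear M" "\<And>x. x \<in> rational_vectors \<Longrightarrow> M x = m x"
proof -
  have m0: "m 0 = 0" using add[of 0 0] by (simp add: rational_vectors_0)
  have nat: "m (real n *\<^sub>R x) = real n *\<^sub>R m x" if "x \<in> rational_vectors" for n x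
  proof (induction n)
    case (Suc n)
    have "real n *\<^sub>R x \<in> rational_vectors" using that by (intro rational_vectors_scale) auto
    then show ?case using add[of "real n *\<^sub>R x" x] that Suc by (simp add: scaleR_left_distrib add.commute)
  qed (simp add: m0)
  have neg: "m (- x) = - m x" if "x \<in> rational_vectors" for x
    using add[of x "- x"] rational_vectors_scale[of "-1" x] that m0 by (simp add: eq_neg_iff_add_eq_0 add.commute)
  have int: "m (of_int k *\<^sub>R x) = of_int k *\<^sub>R m x" if x: "x \<in> rational_vectors" for k x
  proof (cases "k \<ge> 0")
    case True
    then show ?thesis using nat[OF x, of "nat k"] by simp
  next
    case False
    have "real (nat (-k)) *\<^sub>R x \<in> rational_vectors" using x by (intro rational_vectors_scale) auto
    then show ?thesis using nat[OF x, of "nat (-k)"] neg[of "real (nat (-k)) *\<^sub>R x"] False by simp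
  qed
  have rat: "m (q *\<^sub>R x) = q *\<^sub>R m x" if q: "q \<in> \<rat>" and x: "x \<in> rational_vectors" for q x
  proof -
    obtain a b where ab: "b > 0" "q = of_int a / of_int b"
      using q by (metis Rats_cases')
    have y: "(1 / of_int b) *\<^sub>R x \<in> rational_vectors" using x by (intro rational_vectors_scale) auto
    have "of_int b *\<^sub>R m ((1 / of_int b) *\<^sub>R x) = m x" using int[OF y, of b] ab by simp
    then have "m ((1 / of_int b) *\<^sub>R x) = (1 / of_int b) *\<^sub>R m x" using ab by (metis divide_inverse mult_1 of_int_eq_0_iff order_less_irrefl scaleR_scaleR left_inverse scaleR_one)
    then show ?thesis using int[OF y, of a] ab by simp
  qed
  define M where "M y = (\<Sum>b\<in>Basis. (y \<bullet> b) *\<^sub>R m b)" for y :: 'a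
  have "linear M" unfolding M_def
    by (intro linear_sum linear_scaleR_left linear_compose_sum linearI)
      (auto simp: inner_add_left scaleR_left_distrib sum.distrib scaleR_sum_right)
  moreover have "M y = m y" if y: "y \<in> rational_vectors" for y
  proof -
    have "m (\<Sum>b\<in>S. (y \<bullet> b) *\<^sub>R b) = (\<Sum>b\<in>S. (y \<bullet> b) *\<^sub>R m b) \<and> (\<Sum>b\<in>S. (y \<bullet> b) *\<^sub>R b) \<in> rational_vectors"
      if "finite S" "S \<subseteq> Basis" for S
      using that
    proof (induction S)
      case empty then show ?case by (simp add: m0 rational_vectors_0)
    next
      case (insert b S)
      have b: "y \<bullet> b \<in> \<rat>" "b \<in> rational_vectors" using y insert by (auto simp: rational_vectors_def inner_Basis)
      then have "(y \<bullet> b) *\<^sub>R b \<in> rational_vectors" by (rule rational_vectors_scale)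
      then show ?case using insert b by (simp add: add rat rational_vectors_add)
    qed
    from this[of Basis] show ?thesis by (simp add: M_def euclidean_representation)
  qed
  ultimately show ?thesis using that by blast
qed

text \<open>A substitute for Rademacher's theorem, along a single sequence of base points and scales: by
  \<open>exists_good_scale\<close> the second differences of the blow-ups vanish in the limit.\<close>

lemma lipschitz_blowup:
  fixes P :: "'a::euclidean_space \<Rightarrow> 'b::euclidean_space"
  assumes L: "L-lipschitz_on K P" and K: "compact K" "\<not> negligible K"
  shows "\<exists>x s M. (\<forall>j::nat. x j \<in> K) \<and> (\<forall>j. (0::real) < s j) \<and> s \<longlonglongrightarrow> 0 \<and> linear M \<and>
    (\<forall>y\<in>rational_vectors. \<forall>\<^sub>F j in sequentially. x j + s j *\<^sub>R y \<in> K) \<and>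
    (\<forall>y\<in>rational_vectors. (\<lambda>j. (1 / s j) *\<^sub>R (P (x j + s j *\<^sub>R y) - P (x j))) \<longlonglongrightarrow> M y)"
proof -
  obtain G L' B where G: "L'-lipschitz_on UNIV G" "\<And>x. x \<in> K \<Longrightarrow> G x = P x" "\<And>x. x \<notin> cball 0 B \<Longrightarrow> G x = 0"
    using lipschitz_extension_compact_support[OF L compact_imp_bounded[OF K(1)]] by auto
  define e where "e = from_nat_into (rational_vectors :: 'a set)"
  have ne: "(rational_vectors :: 'a set) \<noteq> {}" using rational_vectors_0 by blast
  \<comment> \<open>Finite sets exhausting the rational vectors: \<open>exists_good_scale\<close>
    handles finitely many directions, so stage \<open>n\<close> treats those in \<open>D n\<close>,
    with tolerance \<open>1 / (n + 1)\<close>.\<close>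
  define D where "D n = e ` {..(n::nat)}" for n
  have D: "\<exists>n. \<forall>k\<ge>n. y \<in> D k" if yD: "y \<in> rational_vectors" for y
  proof -
    obtain i where "e i = y" using from_nat_into_surj[OF countable_rational_vectors yD] unfolding e_def by blast
    then show ?thesis unfolding D_def by (intro exI[of _ i]) auto
  qed
  have "\<forall>n. \<exists>j x. j \<ge> n \<and> x \<in> K \<and> (\<forall>y\<in>D n. x + (1/2)^j *\<^sub>R y \<in> K \<and>
     (\<forall>v\<in>D n. norm (G (x + (1/2)^j *\<^sub>R y + (2 * (1/2)^j) *\<^sub>R v) - 2 *\<^sub>R G (x + (1/2)^j *\<^sub>R y + (1/2)^j *\<^sub>R v)
         + G (x + (1/2)^j *\<^sub>R y)) \<le> (1 / real (Suc n)) * (1/2)^j))"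
  proof
    fix n
    have f: "finite (D n)" by (simp add: D_def)
    have "1 / real (Suc n) > 0" by simp
    from exists_good_scale[OF G(1) G(3) K f f this, where J = n]
    show "\<exists>j x. j \<ge> n \<and> x \<in> K \<and> (\<forall>y\<in>D n. x + (1/2)^j *\<^sub>R y \<in> K \<and>
     (\<forall>v\<in>D n. norm (G (x + (1/2)^j *\<^sub>R y + (2 * (1/2)^j) *\<^sub>R v) - 2 *\<^sub>R G (x + (1/2)^j *\<^sub>R y + (1/2)^j *\<^sub>R v)
         + G (x + (1/2)^j *\<^sub>R y)) \<le> (1 / real (Suc n)) * (1/2)^j))" by blast
  qed
  then obtain J X where JX: "\<And>n. J n \<ge> n" "\<And>n. X n \<in> K" "\<And>n y. y \<in> D n \<Longrightarrow> X n + (1/2)^J n *\<^sub>R y \<in> K"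
    "\<And>n y v. y \<in> D n \<Longrightarrow> v \<in> D n \<Longrightarrow> norm (G (X n + (1/2)^J n *\<^sub>R y + (2 * (1/2)^J n) *\<^sub>R v) - 2 *\<^sub>R G (X n + (1/2)^J n *\<^sub>R y + (1/2)^J n *\<^sub>R v)
         + G (X n + (1/2)^J n *\<^sub>R y)) \<le> (1 / real (Suc n)) * (1/2)^J n" by metis
  define S where "S n = (1/2::real)^J n" for n
  have S: "S n > 0" for n by (simp add: S_def)
  have "S \<longlonglongrightarrow> 0"
  proof (rule tendsto_sandwich[OF _ _ tendsto_const])
    show "(\<lambda>n. (1/2::real)^n) \<longlonglongrightarrow> 0" by (intro LIMSEQ_realpow_zero) auto
    show "\<forall>\<^sub>F n in sequentially. S n \<le> (1/2)^n"
      using JX(1) by (auto simp: S_def intro!: always_eventually power_decreasing)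
    show "\<forall>\<^sub>F n in sequentially. 0 \<le> S n" using S by (simp add: less_imp_le)
  qed
  define Q where "Q n y = (1 / S n) *\<^sub>R (G (X n + S n *\<^sub>R y) - G (X n))" for n y
  have Qbd: "norm (Q n y) \<le> L' * norm y" for n y
  proof -
    have "norm (G (X n + S n *\<^sub>R y) - G (X n)) \<le> L' * norm (S n *\<^sub>R y)"
      using lipschitz_on_normD[OF G(1), of "X n + S n *\<^sub>R y" "X n"] by simp
    then have "norm (G (X n + S n *\<^sub>R y) - G (X n)) / S n \<le> L' * norm y"
      using S[of n] by (simp add: pos_divide_le_eq mult.assoc mult.commute mult.left_commute)
    then show ?thesis using S[of n] unfolding Q_def norm_scaleR by simp
  qed
  have L'0: "L' \<ge> 0" using G(1) by (rule lipschitz_on_nonneg)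
  \<comment> \<open>Dividing by \<open>1 + norm y\<close> makes the bound uniform in
    \<open>y\<close>, as the diagonal extraction requires.\<close>
  have Qbd': "norm ((1 / (1 + norm y)) *\<^sub>R Q n y) \<le> L'" for n y
  proof -
    have "norm (Q n y) \<le> L' * (1 + norm y)" using Qbd[of n y] L'0 by (simp add: distrib_left)
    moreover have "1 + norm y > 0" by (simp add: add_pos_nonneg)
    ultimately show ?thesis by (simp add: pos_divide_le_eq)
  qed
  obtain k where k: "strict_mono (k::nat\<Rightarrow>nat)"
    "\<And>y. y \<in> rational_vectors \<Longrightarrow> \<exists>l. (\<lambda>n. (1 / (1 + norm y)) *\<^sub>R Q (k n) y) \<longlonglongrightarrow> l"
    using function_convergent_subsequence[OF countable_rational_vectors, of "\<lambda>n y. (1 / (1 + norm y)) *\<^sub>R Q n y" L'] Qbd'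
    by blast
  have "\<exists>l. (\<lambda>n. Q (k n) y) \<longlonglongrightarrow> l" if yr: "y \<in> rational_vectors" for y
  proof -
    obtain l where "(\<lambda>n. (1 / (1 + norm y)) *\<^sub>R Q (k n) y) \<longlonglongrightarrow> l" using k(2)[OF yr] by blast
    then have "(\<lambda>n. (1 + norm y) *\<^sub>R (1 / (1 + norm y)) *\<^sub>R Q (k n) y) \<longlonglongrightarrow> (1 + norm y) *\<^sub>R l"
      by (intro tendsto_intros)
    moreover have "1 + norm y \<noteq> 0" using norm_ge_zero[of y] by linarith
    ultimately show ?thesis by (auto simp del: scaleR_left_distrib)
  qed
  then obtain m where m: "\<And>y. y \<in> rational_vectors \<Longrightarrow> (\<lambda>n. Q (k n) y) \<longlonglongrightarrow> m y" by metis
  have evD: "\<forall>\<^sub>F n in sequentially. y \<in> D (k n)" if yr: "y \<in> rational_vectors" for y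
  proof -
    obtain n0 where "\<forall>i\<ge>n0. y \<in> D i" using D[OF yr] by blast
    then show ?thesis using seq_suble[OF k(1)] unfolding eventually_sequentially by (metis order_trans)
  qed
  have lin: "c *\<^sub>R (a - g) - 2 *\<^sub>R (c *\<^sub>R (b - g)) + c *\<^sub>R (d - g) = c *\<^sub>R (a - 2 *\<^sub>R b + d)"
    for c :: real and a b d g :: 'b
    by (simp only: scaleR_2 scaleR_right_distrib scaleR_right_diff_distrib) simp
  \<comment> \<open>The second differences of the blow-ups are at most the tolerance of their stage,
    so those of the limit vanish.\<close>
  have mid: "m (y + 2 *\<^sub>R v) - 2 *\<^sub>R m (y + v) + m y = 0"
    if y: "y \<in> rational_vectors" and v: "v \<in> rational_vectors" for y v
  proof -
    have r: "y + v \<in> rational_vectors" "y + 2 *\<^sub>R v \<in> rational_vectors"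
      using y v by (auto intro!: rational_vectors_add rational_vectors_scale)
    have "(\<lambda>n. Q (k n) (y + 2 *\<^sub>R v) - 2 *\<^sub>R Q (k n) (y + v) + Q (k n) y) \<longlonglongrightarrow> m (y + 2 *\<^sub>R v) - 2 *\<^sub>R m (y + v) + m y"
      by (intro tendsto_intros m r y)
    moreover have "(\<lambda>n. Q (k n) (y + 2 *\<^sub>R v) - 2 *\<^sub>R Q (k n) (y + v) + Q (k n) y) \<longlonglongrightarrow> 0"
    proof (rule Lim_null_comparison)
      show "(\<lambda>n. 1 / real (Suc (k n))) \<longlonglongrightarrow> 0"
        using LIMSEQ_subseq_LIMSEQ[OF LIMSEQ_inverse_real_of_nat k(1)] by (simp add: o_def inverse_eq_divide)
      show "\<forall>\<^sub>F n in sequentially. norm (Q (k n) (y + 2 *\<^sub>R v) - 2 *\<^sub>R Q (k n) (y + v) + Q (k n) y) \<le> 1 / real (Suc (k n))"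
        using evD[OF y] evD[OF v]
      proof eventually_elim
        case (elim n)
        let ?x = "X (k n)" and ?s = "S (k n)"
        have e: "?x + ?s *\<^sub>R (y + 2 *\<^sub>R v) = ?x + ?s *\<^sub>R y + (2 * ?s) *\<^sub>R v" "?x + ?s *\<^sub>R (y + v) = ?x + ?s *\<^sub>R y + ?s *\<^sub>R v"
          by (simp_all add: scaleR_right_distrib mult.commute)
        have "Q (k n) (y + 2 *\<^sub>R v) - 2 *\<^sub>R Q (k n) (y + v) + Q (k n) y
          = (1 / ?s) *\<^sub>R (G (?x + ?s *\<^sub>R y + (2 * ?s) *\<^sub>R v) - 2 *\<^sub>R G (?x + ?s *\<^sub>R y + ?s *\<^sub>R v) + G (?x + ?s *\<^sub>R y))"
          unfolding Q_def e by (rule lin)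
        moreover have "norm (G (?x + ?s *\<^sub>R y + (2 * ?s) *\<^sub>R v) - 2 *\<^sub>R G (?x + ?s *\<^sub>R y + ?s *\<^sub>R v) + G (?x + ?s *\<^sub>R y)) / ?s
            \<le> 1 / real (Suc (k n))"
          using JX(4)[OF elim] S[of "k n"] by (simp add: S_def pos_divide_le_eq)
        ultimately show ?case using S[of "k n"] by simp
      qed
    qed
    ultimately show ?thesis by (rule LIMSEQ_unique)
  qed
  have m0: "m 0 = 0"
  proof -
    have "(\<lambda>n. Q (k n) 0) \<longlonglongrightarrow> m 0" by (intro m rational_vectors_0)
    then show ?thesis by (simp add: Q_def LIMSEQ_const_iff)
  qed
  have dbl: "m (2 *\<^sub>R v) = 2 *\<^sub>R m v" if "v \<in> rational_vectors" for v
    using mid[OF rational_vectors_0 that] m0 by simp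
  have "m (a + b) = m a + m b" if a: "a \<in> rational_vectors" and b: "b \<in> rational_vectors" for a b
  proof -
    have "2 *\<^sub>R a \<in> rational_vectors" using a by (intro rational_vectors_scale) auto
    \<comment> \<open>With base \<open>2 a\<close> and increment \<open>b - a\<close> the three
      points are \<open>2 a\<close>, \<open>a + b\<close> and \<open>2 b\<close>; \<open>dbl\<close>
      then turns the midpoint identity into additivity.\<close>
    from mid[OF this rational_vectors_diff[OF b a]]
    have "m (2 *\<^sub>R b) - 2 *\<^sub>R m (a + b) + m (2 *\<^sub>R a) = 0"
      by (simp add: scaleR_2 algebra_simps)
    then have "2 *\<^sub>R (m a + m b) = 2 *\<^sub>R m (a + b)" unfolding dbl[OF a] dbl[OF b] by (simp add: algebra_simps)
    then show ?thesis by simp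
  qed
  then obtain M where M: "linear M" "\<And>x. x \<in> rational_vectors \<Longrightarrow> M x = m x"
    using additive_on_rational_vectors[of m] by blast
  show ?thesis
  proof (intro exI[of _ "\<lambda>n. X (k n)"] exI[of _ "\<lambda>n. S (k n)"] exI[of _ M] conjI ballI)
    show "(\<lambda>n. S (k n)) \<longlonglongrightarrow> 0" using LIMSEQ_subseq_LIMSEQ[OF \<open>S \<longlonglongrightarrow> 0\<close> k(1)] by (simp add: o_def)
    fix y :: 'a assume y: "y \<in> rational_vectors"
    show ev: "\<forall>\<^sub>F n in sequentially. X (k n) + S (k n) *\<^sub>R y \<in> K"
      using evD[OF y] by eventually_elim (use JX(3) in \<open>auto simp: S_def\<close>)
    have "\<forall>\<^sub>F n in sequentially. Q (k n) y = (1 / S (k n)) *\<^sub>R (P (X (k n) + S (k n) *\<^sub>R y) - P (X (k n)))"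
      using ev by eventually_elim (simp add: Q_def G(2) JX(2))
    with m[OF y] show "(\<lambda>n. (1 / S (k n)) *\<^sub>R (P (X (k n) + S (k n) *\<^sub>R y) - P (X (k n)))) \<longlonglongrightarrow> M y"
      unfolding M(2)[OF y] by (rule Lim_transform_eventually)
  qed (use JX S M in auto)
qed

section \<open>Second-order expansions along a blow-up\<close>

text \<open>Cut the segment from \<open>x j\<close> in direction \<open>s j\<close> times
  \<open>y\<close> into \<open>n\<close> pieces with nodes in \<open>K\<close>. The first-order
  expansions leave a total error \<open>C (s j)^2 |y|^2 / n\<close>, and the gradient terms form a
  Riemann sum for the integral of \<open>\<tau> (M y \<bullet> y)\<close> over the unit interval,
  which is half of \<open>M y \<bullet> y\<close>. First \<open>j\<close>, then \<open>n\<close>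
  tends to infinity.\<close>

lemma second_order_blowup_limit:
  fixes f :: "'a::euclidean_space \<Rightarrow> real"
  assumes C11: "\<And>z z'. z \<in> K \<Longrightarrow> z' \<in> B \<Longrightarrow> \<bar>f z' - f z - P z \<bullet> (z' - z)\<bar> \<le> C * (norm (z' - z))\<^sup>2"
    and KB: "K \<subseteq> B" and xK: "\<And>j::nat. x j \<in> K" and s: "\<And>j. (0::real) < s j" and M: "linear M"
    and inK: "\<And>y. y \<in> rational_vectors \<Longrightarrow> \<forall>\<^sub>F j in sequentially. x j + s j *\<^sub>R y \<in> K"
    and lim: "\<And>y. y \<in> rational_vectors \<Longrightarrow> (\<lambda>j. (1 / s j) *\<^sub>R (P (x j + s j *\<^sub>R y) - P (x j))) \<longlonglongrightarrow> M y"
    and y: "y \<in> rational_vectors"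
  shows "(\<lambda>j. (f (x j + s j *\<^sub>R y) - f (x j) - s j * (P (x j) \<bullet> y)) / (s j)\<^sup>2) \<longlonglongrightarrow> (M y \<bullet> y) / 2"
proof -
  define T where "T j = (f (x j + s j *\<^sub>R y) - f (x j) - s j * (P (x j) \<bullet> y)) / (s j)\<^sup>2" for j
  define Rq where "Rq j w = (1 / s j) *\<^sub>R (P (x j + s j *\<^sub>R w) - P (x j))" for j w
  have TT: "(s j)\<^sup>2 * T j = f (x j + s j *\<^sub>R y) - f (x j) - s j * (P (x j) \<bullet> y)" for j
    using s[of j] by (simp add: T_def)
  have main: "\<forall>\<^sub>F j in sequentially. \<bar>T j - (\<Sum>i<n. Rq j ((real i / real n) *\<^sub>R y) \<bullet> y) / n\<bar> \<le> C * (norm y)\<^sup>2 / n"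
    if n: "n > 0" for n :: nat
  proof -
    have "\<forall>\<^sub>F j in sequentially. \<forall>i\<in>{..n}. x j + s j *\<^sub>R ((real i / real n) *\<^sub>R y) \<in> K"
      by (intro eventually_ball_finite ballI inK rational_vectors_scale y) auto
    then show ?thesis
    proof eventually_elim
      case (elim j)
      define z where "z i = x j + s j *\<^sub>R ((real i / real n) *\<^sub>R y)" for i
      have zK: "z i \<in> K" if "i \<le> n" for i using elim that by (auto simp: z_def)
      have dz: "z (Suc i) - z i = (s j / n) *\<^sub>R y" for i
      proof -
        have "z (Suc i) - z i = (s j * (real (Suc i) / n) - s j * (real i / n)) *\<^sub>R y"
          by (simp add: z_def scaleR_left_diff_distrib)
        also have "s j * (real (Suc i) / n) - s j * (real i / n) = s j / n"
          by (simp add: add_divide_distrib distrib_left)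
        finally show ?thesis .
      qed
      have z0: "z 0 = x j" "z n = x j + s j *\<^sub>R y" using n by (simp_all add: z_def)
      have Pz: "P (z i) = P (x j) + s j *\<^sub>R Rq j ((real i / real n) *\<^sub>R y)" for i
        using s[of j] by (simp add: Rq_def z_def)
      have step: "\<bar>f (z (Suc i)) - f (z i) - P (z i) \<bullet> ((s j / n) *\<^sub>R y)\<bar> \<le> C * (s j)\<^sup>2 * (norm y)\<^sup>2 / (real n)\<^sup>2"
        if "i < n" for i
        using C11[OF zK[of i], of "z (Suc i)"] zK[of "Suc i"] KB that
        by (auto simp: dz power_mult_distrib power_divide mult.assoc)
      have "\<bar>(\<Sum>i<n. f (z (Suc i)) - f (z i) - P (z i) \<bullet> ((s j / n) *\<^sub>R y))\<bar>
          \<le> (\<Sum>i<n. C * (s j)\<^sup>2 * (norm y)\<^sup>2 / (real n)\<^sup>2)"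
        by (rule order_trans[OF sum_abs sum_mono]) (use step in auto)
      also have "\<dots> = (s j)\<^sup>2 * (C * (norm y)\<^sup>2 / n)" using n by (simp add: power2_eq_square)
      finally have 1: "\<bar>(\<Sum>i<n. f (z (Suc i)) - f (z i) - P (z i) \<bullet> ((s j / n) *\<^sub>R y))\<bar> \<le> (s j)\<^sup>2 * (C * (norm y)\<^sup>2 / n)" .
      have "(\<Sum>i<n. f (z (Suc i)) - f (z i) - P (z i) \<bullet> ((s j / n) *\<^sub>R y))
         = (f (z n) - f (z 0)) - (\<Sum>i<n. P (z i) \<bullet> ((s j / n) *\<^sub>R y))"
        using sum_lessThan_telescope[of "\<lambda>i. f (z i)" n] by (simp add: sum_subtractf)
      also have "(\<Sum>i<n. P (z i) \<bullet> ((s j / n) *\<^sub>R y))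
         = (\<Sum>i<n. s j / n * (P (x j) \<bullet> y) + (s j)\<^sup>2 * (Rq j ((real i / real n) *\<^sub>R y) \<bullet> y / n))"
        unfolding Pz by (intro sum.cong refl) (simp add: inner_add_left power2_eq_square field_simps)
      also have "\<dots> = s j * (P (x j) \<bullet> y) + (s j)\<^sup>2 * ((\<Sum>i<n. Rq j ((real i / real n) *\<^sub>R y) \<bullet> y) / n)"
        using n by (simp add: sum.distrib sum_distrib_left[symmetric] sum_divide_distrib[symmetric])
      finally have 2: "(\<Sum>i<n. f (z (Suc i)) - f (z i) - P (z i) \<bullet> ((s j / n) *\<^sub>R y))
         = (s j)\<^sup>2 * (T j - (\<Sum>i<n. Rq j ((real i / real n) *\<^sub>R y) \<bullet> y) / n)"
        using TT[of j] by (simp add: z0 right_diff_distrib)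
      have "(s j)\<^sup>2 * \<bar>T j - (\<Sum>i<n. Rq j ((real i / real n) *\<^sub>R y) \<bullet> y) / n\<bar> \<le> (s j)\<^sup>2 * (C * (norm y)\<^sup>2 / n)"
        using 1 unfolding 2 by (simp add: abs_mult)
      then show ?case by (rule mult_left_le_imp_le) (use s[of j] in simp)
    qed
  qed
  have avg: "(\<lambda>j. (\<Sum>i<n. Rq j ((real i / real n) *\<^sub>R y) \<bullet> y) / n) \<longlonglongrightarrow> (real n - 1) / (2 * real n) * (M y \<bullet> y)"
    if n: "n > 0" for n :: nat
  proof -
    have "(\<lambda>j. (\<Sum>i<n. Rq j ((real i / real n) *\<^sub>R y) \<bullet> y) / n) \<longlonglongrightarrow> (\<Sum>i<n. M ((real i / real n) *\<^sub>R y) \<bullet> y) / n"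
      unfolding Rq_def using n by (intro tendsto_intros lim rational_vectors_scale y) auto
    also have "(\<Sum>i<n. M ((real i / real n) *\<^sub>R y) \<bullet> y) = (\<Sum>i<n. real i) * ((M y \<bullet> y) / n)"
      unfolding sum_distrib_right by (intro sum.cong refl) (simp add: linear_scale[OF M])
    also have "(\<Sum>i<n. real i) = real n * (real n - 1) / 2"
      by (induction n) (auto simp: field_simps)
    also have "real n * (real n - 1) / 2 * (M y \<bullet> y / real n) / real n = (real n - 1) / (2 * real n) * (M y \<bullet> y)"
      using n by simp
    finally show ?thesis .
  qed
  have "T \<longlonglongrightarrow> (M y \<bullet> y) / 2"
  proof (rule LIMSEQ_I)
    fix e :: real assume e: "e > 0"
    obtain n0 :: nat where "real n0 > 2 * (C * (norm y)\<^sup>2 + \<bar>M y \<bullet> y\<bar>) / e"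
      using reals_Archimedean2 by blast
    then obtain n :: nat where n: "real n > 2 * (C * (norm y)\<^sup>2 + \<bar>M y \<bullet> y\<bar>) / e" "n > 0"
      by (intro that[of "Suc n0"]) auto
    \<comment> \<open>One term is the expansion error; the other covers the deviation of the Riemann
      sum from its limit, which is \<open>\<bar>M y \<bullet> y\<bar> / (2 n)\<close>.\<close>
    have n': "C * (norm y)\<^sup>2 / n + \<bar>M y \<bullet> y\<bar> / n < e / 2"
      using n e by (simp add: field_simps)
    have "\<forall>\<^sub>F j in sequentially. \<bar>(\<Sum>i<n. Rq j ((real i / real n) *\<^sub>R y) \<bullet> y) / n - (real n - 1) / (2 * real n) * (M y \<bullet> y)\<bar> < e / 2"
      using avg[OF n(2)] e unfolding tendsto_iff dist_real_def by (metis half_gt_zero)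
    with main[OF n(2)] have "\<forall>\<^sub>F j in sequentially. norm (T j - (M y \<bullet> y) / 2) < e"
    proof eventually_elim
      case (elim j)
      have "(real n - 1) / (2 * real n) * (M y \<bullet> y) = (M y \<bullet> y) / 2 - (M y \<bullet> y) / n / 2"
        using n(2) by (simp add: field_simps)
      moreover have "\<bar>(M y \<bullet> y) / n / 2\<bar> \<le> \<bar>M y \<bullet> y\<bar> / n"
        using n(2) by (auto simp: abs_divide intro!: divide_left_mono)
      moreover have "\<bar>t - m\<bar> < e" if "c = m - d" "\<bar>d\<bar> \<le> b" "\<bar>t - S\<bar> \<le> a" "\<bar>S - c\<bar> < e / 2" "a + b < e / 2"
        for t m c d b S a :: real using that by linarith
      ultimately show ?case using elim n' unfolding real_norm_def by blast
    qed
    then show "\<exists>no. \<forall>j\<ge>no. norm (T j - (M y \<bullet> y) / 2) < e" by (simp add: eventually_sequentially)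
  qed
  then show ?thesis by (simp add: T_def[abs_def])
qed

text \<open>Uniformity over the unit ball comes from a finite net of rational vectors. At net points
  the pointwise limit holds, and since the points they stand for lie in \<open>K\<close>, the
  first-order expansion there reaches every nearby \<open>w\<close>, even where the point belonging
  to \<open>w\<close> leaves \<open>K\<close>.\<close>

lemma second_order_blowup_upper:
  fixes f :: "'a::euclidean_space \<Rightarrow> real"
  assumes C11: "\<And>z z'. z \<in> K \<Longrightarrow> z' \<in> B \<Longrightarrow> \<bar>f z' - f z - P z \<bullet> (z' - z)\<bar> \<le> C * (norm (z' - z))\<^sup>2"
    and KB: "K \<subseteq> B" and xK: "\<And>j::nat. x j \<in> K" and s: "\<And>j. (0::real) < s j" and M: "linear M"
    and inK: "\<And>y. y \<in> rational_vectors \<Longrightarrow> \<forall>\<^sub>F j in sequentially. x j + s j *\<^sub>R y \<in> K"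
    and lim: "\<And>y. y \<in> rational_vectors \<Longrightarrow> (\<lambda>j. (1 / s j) *\<^sub>R (P (x j + s j *\<^sub>R y) - P (x j))) \<longlonglongrightarrow> M y"
    and inB: "\<forall>\<^sub>F j in sequentially. cball (x j) (s j) \<subseteq> B" and "\<kappa> > 0" and C: "C \<ge> 0"
  shows "\<forall>\<^sub>F j in sequentially. \<forall>w. norm w \<le> 1 \<longrightarrow>
     f (x j + s j *\<^sub>R w) \<le> f (x j) + s j * (P (x j) \<bullet> w) + (s j)\<^sup>2 * ((M w \<bullet> w) / 2 + \<kappa>)"
proof -
  define T where "T j y = (f (x j + s j *\<^sub>R y) - f (x j) - s j * (P (x j) \<bullet> y)) / (s j)\<^sup>2" for j y
  define Rq where "Rq j w = (1 / s j) *\<^sub>R (P (x j + s j *\<^sub>R w) - P (x j))" for j w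
  obtain m where m: "m > 0" "\<And>v. norm (M v) \<le> m * norm v" using linear_bounded_pos[OF M] by blast
  \<comment> \<open>With \<open>norm w \<le> 1\<close> and \<open>norm z \<le> 2\<close>, passing
    from \<open>w\<close> to its net point \<open>z\<close> costs at most
    \<open>7/2 * m * \<rho> + C * \<rho>\<close>, kept below \<open>\<kappa> / 2\<close>; the other
    half is split between the convergence of \<open>T\<close> and of \<open>Rq\<close> on the
    net.\<close>
  define \<rho> where "\<rho> = min 1 (\<kappa> / (2 * (4 * m + C + 1)))"
  have pos: "4 * m + C + 1 > 0" using m C by linarith
  have \<rho>: "\<rho> > 0" "\<rho> \<le> 1" using pos \<open>\<kappa> > 0\<close> by (auto simp: \<rho>_def)
  have \<rho>\<kappa>: "(4 * m + C) * \<rho> \<le> \<kappa> / 2"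
  proof -
    have "(4 * m + C) * \<rho> \<le> (4 * m + C + 1) * \<rho>" using \<rho> by simp
    also have "\<dots> \<le> (4 * m + C + 1) * (\<kappa> / (2 * (4 * m + C + 1)))"
      using pos by (intro mult_left_mono) (auto simp: \<rho>_def)
    also have "\<dots> = \<kappa> / 2" using pos by (simp add: divide_simps)
    finally show ?thesis .
  qed
  have "cball 0 1 \<subseteq> (\<Union>z\<in>rational_vectors. ball (z::'a) \<rho>)"
  proof
    fix w :: 'a
    obtain z where "z \<in> rational_vectors" "dist w z < \<rho>" using rational_vectors_dense[OF \<rho>(1)] .
    then show "w \<in> (\<Union>z\<in>rational_vectors. ball z \<rho>)" by (auto simp: dist_commute)
  qed
  then obtain Z where Z: "Z \<subseteq> rational_vectors" "finite Z" "cball 0 1 \<subseteq> (\<Union>z\<in>Z. ball (z::'a) \<rho>)"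
    using compactE_image[OF compact_cball, where f = "\<lambda>z. ball z \<rho>"] by (metis open_ball)
  have ev1: "\<forall>\<^sub>F j in sequentially. \<forall>z\<in>Z. x j + s j *\<^sub>R z \<in> K"
    using Z by (intro eventually_ball_finite ballI inK) auto
  have ev2: "\<forall>\<^sub>F j in sequentially. \<forall>z\<in>Z. T j z < (M z \<bullet> z) / 2 + \<kappa> / 4"
  proof (intro eventually_ball_finite ballI Z(2))
    fix z assume "z \<in> Z"
    then have "z \<in> rational_vectors" using Z by blast
    from second_order_blowup_limit[OF C11 KB xK s M inK lim this]
    have "(\<lambda>j. T j z) \<longlonglongrightarrow> (M z \<bullet> z) / 2" by (simp add: T_def)
    then show "\<forall>\<^sub>F j in sequentially. T j z < (M z \<bullet> z) / 2 + \<kappa> / 4"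
      using \<open>\<kappa> > 0\<close> by (intro order_tendstoD(2)) auto
  qed
  have ev3: "\<forall>\<^sub>F j in sequentially. \<forall>z\<in>Z. dist (Rq j z) (M z) < \<kappa> / 4"
    using Z lim \<open>\<kappa> > 0\<close> by (intro eventually_ball_finite ballI tendstoD) (auto simp: Rq_def)
  from ev1 ev2 ev3 inB show ?thesis
  proof eventually_elim
    case (elim j)
    show ?case
    proof (intro allI impI)
      fix w :: 'a assume w: "norm w \<le> 1"
      then obtain z where z: "z \<in> Z" "norm (w - z) < \<rho>"
        using Z(3) by (force simp: dist_norm norm_minus_commute)
      let ?x = "x j" and ?s = "s j"
      have sp: "?s > 0" by (rule s)
      have "norm z \<le> norm w + norm (w - z)" using norm_triangle_ineq4[of w "w - z"] by simp
      then have nz: "norm z \<le> 2" using w z(2) \<rho>(2) by linarith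
      have wB: "?x + ?s *\<^sub>R w \<in> B"
        using elim(4) w sp by (auto simp: dist_norm subset_iff mult_left_le)
      have e: "?x + ?s *\<^sub>R w - (?x + ?s *\<^sub>R z) = ?s *\<^sub>R (w - z)" by (simp add: scaleR_right_diff_distrib)
      have 1: "f (?x + ?s *\<^sub>R w) \<le> f (?x + ?s *\<^sub>R z) + P (?x + ?s *\<^sub>R z) \<bullet> (?s *\<^sub>R (w - z)) + C * (norm (?s *\<^sub>R (w - z)))\<^sup>2"
        using C11[of "?x + ?s *\<^sub>R z", OF _ wB] elim(1) z(1) unfolding e by (auto simp: abs_le_iff)
      have 2: "f (?x + ?s *\<^sub>R z) = f ?x + ?s * (P ?x \<bullet> z) + ?s\<^sup>2 * T j z"
        using sp by (simp add: T_def)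
      have 3: "P (?x + ?s *\<^sub>R z) = P ?x + ?s *\<^sub>R Rq j z" using sp by (simp add: Rq_def)
      have nn: "(norm (?s *\<^sub>R (w - z)))\<^sup>2 = ?s\<^sup>2 * (norm (w - z))\<^sup>2" by (simp add: power_mult_distrib)
      have "(norm (w - z))\<^sup>2 \<le> \<rho>\<^sup>2" using z(2) by (intro power_mono) auto
      also have "\<rho>\<^sup>2 \<le> \<rho>" using \<rho> by (simp add: power2_eq_square mult_left_le)
      finally have q: "(norm (w - z))\<^sup>2 \<le> \<rho>" .
      have "f (?x + ?s *\<^sub>R w) \<le> f ?x + ?s * (P ?x \<bullet> w) + ?s\<^sup>2 * (T j z + Rq j z \<bullet> (w - z) + C * (norm (w - z))\<^sup>2)"
        using 1 unfolding 2 3 nn by (simp add: inner_add_left inner_diff_right algebra_simps power2_eq_square)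
      also have "\<dots> \<le> f ?x + ?s * (P ?x \<bullet> w) + ?s\<^sup>2 * ((M w \<bullet> w) / 2 + \<kappa>)"
      proof (intro add_left_mono mult_left_mono)
        have "Rq j z \<bullet> (w - z) - M z \<bullet> (w - z) \<le> norm (Rq j z - M z) * norm (w - z)"
          unfolding inner_diff_left[symmetric] by (rule norm_cauchy_schwarz)
        also have "\<dots> \<le> \<kappa> / 4 * 1"
          using elim(3) z \<rho> \<open>\<kappa> > 0\<close> by (intro mult_mono) (auto simp: dist_norm less_imp_le)
        finally have a: "Rq j z \<bullet> (w - z) \<le> M z \<bullet> (w - z) + \<kappa> / 4" by simp
        have b: "T j z \<le> (M z \<bullet> z) / 2 + \<kappa> / 4" using elim(2) z(1) by (auto simp: less_imp_le)
        have c: "C * (norm (w - z))\<^sup>2 \<le> C * \<rho>" using q C by (rule mult_left_mono)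
        have Mz: "norm (M z) \<le> m * 2"
          by (rule order_trans[OF m(2)]) (use nz m(1) in simp)
        have Mzw: "norm (M (z - w)) \<le> m * \<rho>"
          by (rule order_trans[OF m(2)]) (use z(2) m(1) in \<open>simp add: norm_minus_commute less_imp_le\<close>)
        have "M z \<bullet> (w - z) \<le> norm (M z) * norm (w - z)" by (rule norm_cauchy_schwarz)
        also have "\<dots> \<le> (m * 2) * \<rho>"
          using Mz z(2) m(1) by (intro mult_mono) auto
        finally have d: "M z \<bullet> (w - z) \<le> 2 * m * \<rho>" by simp
        have "M z \<bullet> z - M w \<bullet> w = M (z - w) \<bullet> w + M z \<bullet> (z - w)"
          by (simp add: linear_diff[OF M] inner_diff_left inner_diff_right)
        also have "\<dots> \<le> norm (M (z - w)) * norm w + norm (M z) * norm (z - w)"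
          by (intro add_mono norm_cauchy_schwarz)
        also have "\<dots> \<le> (m * \<rho>) * 1 + (m * 2) * \<rho>"
          using Mz Mzw w z(2) m(1) \<rho> by (intro add_mono mult_mono) (auto simp: norm_minus_commute)
        finally have e: "M z \<bullet> z - M w \<bullet> w \<le> 3 * m * \<rho>" by (simp add: mult.commute mult.left_commute)
        have "m * \<rho> \<ge> 0" using m \<rho> by simp
        then show "T j z + Rq j z \<bullet> (w - z) + C * (norm (w - z))\<^sup>2 \<le> (M w \<bullet> w) / 2 + \<kappa>"
          using a b c d e \<rho>\<kappa> by (simp add: algebra_simps)
      qed auto
      finally show "f (?x + ?s *\<^sub>R w) \<le> f ?x + ?s * (P ?x \<bullet> w) + ?s\<^sup>2 * ((M w \<bullet> w) / 2 + \<kappa>)" .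
    qed
  qed
qed

text \<open>A bound with the extra \<open>\<kappa>\<close> is not yet touching. Subtracting
  \<open>2 * \<kappa>\<close> times the squared distance pushes the values on the sphere of radius
  \<open>s\<close> below the value at the centre, so the maximum is attained inside, and there a
  paraboloid touches from above. The subtracted term returns in \<open>X\<close> as
  \<open>4 * \<kappa>\<close>.\<close>

lemma touching_from_one_scale:
  fixes f :: "'a::euclidean_space \<Rightarrow> real"
  assumes cont: "continuous_on (cball x s) f" and s: "s > 0" and M: "linear M" and k: "\<kappa> > 0"
    and m: "\<And>v. norm (M v) \<le> m * norm v"
    and le: "\<forall>w. norm w \<le> 1 \<longrightarrow> f (x + s *\<^sub>R w) \<le> f x + s * (P \<bullet> w) + s\<^sup>2 * ((M w \<bullet> w) / 2 + \<kappa>)"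
  shows "\<exists>x' p X. x' \<in> ball x s \<and> norm (p - P) \<le> (m + 4 * \<kappa>) * s \<and> linear X \<and> (\<forall>v w. X v \<bullet> w = v \<bullet> X w) \<and>
    (\<forall>v. X v \<bullet> v = M v \<bullet> v + 4 * \<kappa> * (norm v)\<^sup>2) \<and>
    (\<forall>z\<in>cball x s. f z \<le> f x' + p \<bullet> (z - x') + (X (z - x') \<bullet> (z - x')) / 2)"
proof -
  define h where "h z = f z - P \<bullet> (z - x) - (M (z - x) \<bullet> (z - x)) / 2 - 2 * \<kappa> * (norm (z - x))\<^sup>2" for z
  have "continuous_on (cball x s) h"
    unfolding h_def
    by (intro continuous_intros cont linear_continuous_on_compose[OF _ M]) auto
  then obtain x' where x': "x' \<in> cball x s" "\<And>z. z \<in> cball x s \<Longrightarrow> h z \<le> h x'"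
    using continuous_attains_sup[OF compact_cball, of x s h] s by fastforce
  have hle: "h z \<le> f x + \<kappa> * s\<^sup>2 - 2 * \<kappa> * (norm (z - x))\<^sup>2" if "z \<in> cball x s" for z
  proof -
    define w where "w = (1 / s) *\<^sub>R (z - x)"
    have zw: "z - x = s *\<^sub>R w" using s by (simp add: w_def)
    have "norm (z - x) \<le> s" using that by (simp add: dist_norm norm_minus_commute)
    then have "norm w \<le> 1" using s by (simp add: w_def)
    from le[rule_format, OF this] have "f z \<le> f x + s * (P \<bullet> w) + s\<^sup>2 * ((M w \<bullet> w) / 2 + \<kappa>)"
      unfolding zw[symmetric] by simp
    then show ?thesis unfolding h_def zw by (simp add: linear_scale[OF M] power2_eq_square algebra_simps)
  qed
  have xh: "h x = f x" using linear_0[OF M] by (simp add: h_def)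
  have "x' \<in> ball x s"
  proof (rule ccontr)
    assume "x' \<notin> ball x s"
    then have "norm (x' - x) = s" using x'(1) by (simp add: dist_norm norm_minus_commute)
    then have "h x' \<le> f x - \<kappa> * s\<^sup>2" using hle[OF x'(1)] by simp
    moreover have "h x \<le> h x'" using x'(2)[of x] s by simp
    moreover have "\<kappa> * s\<^sup>2 > 0" using k s by simp
    ultimately show False using xh by linarith
  qed
  \<comment> \<open>The blow-up derivative \<open>M\<close> is not known to be symmetric; the form
    \<open>M v \<bullet> v\<close> depends only on its symmetric part, which is what the paraboloid
    uses.\<close>
  define Ma where "Ma = adjoint M"
  have Ma: "linear Ma" "\<And>v w. M v \<bullet> w = v \<bullet> Ma w" "\<And>v w. Ma v \<bullet> w = v \<bullet> M w"
    using adjoint_linear[OF M] adjoint_works[OF M] by (auto simp: Ma_def inner_commute)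
  define w0 where "w0 = x' - x"
  define X where "X v = (1/2) *\<^sub>R (M v + Ma v) + (4 * \<kappa>) *\<^sub>R v" for v
  define p where "p = P + (1/2) *\<^sub>R (M w0 + Ma w0) + (4 * \<kappa>) *\<^sub>R w0"
  have nMa: "norm (Ma v) \<le> m * norm v" for v
  proof -
    have "norm (Ma v) * norm (Ma v) = Ma v \<bullet> Ma v" by (simp add: dot_square_norm power2_eq_square)
    also have "\<dots> = M (Ma v) \<bullet> v" using Ma(2)[of "Ma v" v] by simp
    also have "\<dots> \<le> norm (M (Ma v)) * norm v" by (rule norm_cauchy_schwarz)
    also have "\<dots> \<le> m * norm (Ma v) * norm v" by (intro mult_right_mono m) auto
    finally have *: "norm (Ma v) * norm (Ma v) \<le> (m * norm v) * norm (Ma v)" by (simp add: mult.commute mult.left_commute)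
    show ?thesis
    proof (cases "norm (Ma v) = 0")
      case True
      have "0 \<le> m * norm v" using m[of v] norm_ge_zero order_trans by blast
      then show ?thesis using True by simp
    next
      case False
      then show ?thesis using * by (simp add: mult_le_cancel_right)
    qed
  qed
  have w0: "norm w0 \<le> s" using x'(1) by (simp add: w0_def dist_norm norm_minus_commute)
  have m0: "m \<ge> 0"
  proof -
    obtain b :: 'a where "b \<in> Basis" using nonempty_Basis by blast
    then show ?thesis using m[of b] order_trans[OF norm_ge_zero] by fastforce
  qed
  have nX: "norm (p - P) \<le> (m + 4 * \<kappa>) * s"
  proof -
    have "norm (p - P) \<le> norm ((1/2) *\<^sub>R (M w0 + Ma w0)) + norm ((4 * \<kappa>) *\<^sub>R w0)"
      unfolding p_def using norm_triangle_ineq[of "(1/2) *\<^sub>R (M w0 + Ma w0)" "(4 * \<kappa>) *\<^sub>R w0"] by (simp add: add.assoc)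
    also have "\<dots> \<le> (norm (M w0) + norm (Ma w0)) / 2 + 4 * \<kappa> * norm w0"
      using norm_triangle_ineq[of "M w0" "Ma w0"] k by simp
    also have "\<dots> \<le> (m + 4 * \<kappa>) * norm w0" using m[of w0] nMa[of w0] by (simp add: algebra_simps)
    also have "\<dots> \<le> (m + 4 * \<kappa>) * s" using w0 m0 k by (intro mult_left_mono) auto
    finally show ?thesis .
  qed
  have "linear X" unfolding X_def
    by (intro linear_compose_add linear_compose_scale_right M Ma linear_scale_self)
  have sym: "X v \<bullet> w = v \<bullet> X w" for v w
    unfolding X_def using Ma(2)[of v w] Ma(3)[of v w]
    by (simp add: inner_add_left inner_add_right)
  have diag: "X v \<bullet> v = M v \<bullet> v + 4 * \<kappa> * (norm v)\<^sup>2" for v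
    unfolding X_def using Ma(3)[of v v] by (simp add: inner_add_left inner_add_right power2_norm_eq_inner inner_commute)
  have touch: "f z \<le> f x' + p \<bullet> (z - x') + (X (z - x') \<bullet> (z - x')) / 2" if z: "z \<in> cball x s" for z
  proof -
    define v where "v = z - x'"
    have zv: "z - x = w0 + v" by (simp add: v_def w0_def)
    have "h z \<le> h x'" using x'(2)[OF z] .
    then have "f z \<le> f x' + P \<bullet> (w0 + v) - P \<bullet> w0 + (M (w0 + v) \<bullet> (w0 + v) - M w0 \<bullet> w0) / 2
       + 2 * \<kappa> * ((norm (w0 + v))\<^sup>2 - (norm w0)\<^sup>2)"
      unfolding h_def zv w0_def[symmetric] by (simp add: algebra_simps diff_divide_distrib)
    also have "\<dots> = f x' + p \<bullet> v + (X v \<bullet> v) / 2"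
      unfolding diag p_def linear_add[OF M] power2_norm_eq_inner using Ma(3)[of w0 v]
      by (simp add: inner_add_left inner_add_right inner_commute field_simps)
    finally show ?thesis unfolding v_def .
  qed
  show ?thesis using \<open>x' \<in> ball x s\<close> nX \<open>linear X\<close> sym diag touch by blast
qed

section \<open>Maxima of sums of semiconvex functions\<close>

text \<open>Phrased by supporting paraboloids rather than by convexity of \<open>f\<close> plus a
  quadratic: the slopes \<open>p\<close> are the objects of interest, since they become gradients at
  points of contact.\<close>

definition semiconvex_with :: "real \<Rightarrow> 'a::real_inner set \<Rightarrow> ('a \<Rightarrow> real) \<Rightarrow> bool" where
  "semiconvex_with C B f \<longleftrightarrow> (\<forall>x\<in>B. \<exists>p. \<forall>y\<in>B. f x + p \<bullet> (y - x) - C * (norm (y - x))\<^sup>2 \<le> f y)"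

text \<open>A second-order superjet, but with an exact inequality near \<open>x\<close> instead of
  an error of order \<open>o(|z - x|^2)\<close>, so that the paraboloid itself can serve as a test
  function.\<close>

definition touches_above :: "('a::real_inner \<Rightarrow> real) \<Rightarrow> 'a \<Rightarrow> 'a \<Rightarrow> ('a \<Rightarrow> 'a) \<Rightarrow> bool" where
  "touches_above f x p X \<longleftrightarrow> linear X \<and> (\<forall>v w. X v \<bullet> w = v \<bullet> X w) \<and>
     (\<exists>r>0. \<forall>z\<in>ball x r. f z \<le> f x + p \<bullet> (z - x) + (X (z - x) \<bullet> (z - x)) / 2)"

lemma eq_0_if_inner_le_square:
  fixes u x :: "'a::real_inner"
  assumes "r > 0" and le: "\<And>y. y \<in> cball x r \<Longrightarrow> u \<bullet> (y - x) \<le> c * (norm (y - x))\<^sup>2"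
  shows "u = 0"
proof (rule ccontr)
  assume u: "u \<noteq> 0"
  \<comment> \<open>The first bound keeps the test point in the ball; the second makes
    \<open>c * t \<le> 1 / 2\<close>, against \<open>1 \<le> c * t\<close>.\<close>
  define t where "t = min (r / norm u) (1 / (2 * (\<bar>c\<bar> + 1)))"
  have t: "t > 0" using u assms(1) by (auto simp: t_def)
  have "t * norm u \<le> r" using u by (simp add: t_def min_def field_simps)
  then have "x + t *\<^sub>R u \<in> cball x r" using t by (simp add: dist_norm)
  from le[OF this] have "t * (norm u)\<^sup>2 \<le> t * (norm u)\<^sup>2 * (c * t)"
    using t by (simp add: power_mult_distrib dot_square_norm power2_eq_square mult_ac)
  then have "1 \<le> c * t" using t u by (simp add: mult_le_cancel_left1)
  moreover have "c * t \<le> (\<bar>c\<bar> + 1) * t" using t by (intro mult_right_mono) auto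
  moreover have "(\<bar>c\<bar> + 1) * t \<le> (\<bar>c\<bar> + 1) * (1 / (2 * (\<bar>c\<bar> + 1)))"
    by (intro mult_left_mono) (auto simp: t_def)
  moreover have "(\<bar>c\<bar> + 1) * (1 / (2 * (\<bar>c\<bar> + 1))) = 1 / 2" by (simp add: field_simps)
  ultimately show False by linarith
qed

text \<open>The gradient difference is tested at the point \<open>y\<close> at distance
  \<open>d = norm (x - z)\<close> from \<open>z\<close> in its own direction. The upper expansion at
  \<open>z\<close> and the lower and upper ones at \<open>x\<close> leave errors of
  \<open>1 + 4 + 1\<close> times \<open>C d^2\<close>, as \<open>y\<close> is within
  \<open>2 d\<close> of \<open>x\<close>. Having \<open>K\<close> in the quarter ball keeps
  \<open>y\<close> in the ball.\<close>

lemma gradient_lipschitz_on_contact_set: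
  fixes f :: "'a::real_inner \<Rightarrow> real"
  assumes C11: "\<And>z z'. z \<in> K \<Longrightarrow> z' \<in> cball x0 R \<Longrightarrow> \<bar>f z' - f z - P z \<bullet> (z' - z)\<bar> \<le> C * (norm (z' - z))\<^sup>2"
    and K: "K \<subseteq> cball x0 (R / 4)" and C: "C \<ge> 0" and xz: "x \<in> K" "z \<in> K"
  shows "norm (P x - P z) \<le> 6 * C * norm (x - z)"
proof (cases "P x = P z \<or> x = z")
  case True
  then show ?thesis using C by auto
next
  case False
  define d where "d = norm (x - z)"
  define e where "e = (1 / norm (P x - P z)) *\<^sub>R (P x - P z)"
  define y where "y = z + d *\<^sub>R e"
  have d: "d > 0" using False by (simp add: d_def)
  have ne: "norm e = 1" using False by (simp add: e_def)
  have dx: "dist x0 x \<le> R / 4" "dist x0 z \<le> R / 4" using xz K by auto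
  have R: "R \<ge> 0" using dx zero_le_dist[of x0 x] by linarith
  have "d \<le> R / 2" using dx dist_triangle2[of x z x0] by (simp add: d_def dist_norm norm_minus_commute)
  moreover have "dist x0 y \<le> dist x0 z + d"
    using dist_triangle[of x0 y z] d ne by (simp add: y_def dist_norm)
  ultimately have yB: "y \<in> cball x0 R" using dx R by simp
  have xB: "x \<in> cball x0 R" and zB: "z \<in> cball x0 R" using dx R by auto
  have "norm (y - x) \<le> norm (y - z) + norm (z - x)" using norm_triangle_ineq[of "y - z" "z - x"] by simp
  then have "norm (y - x) \<le> 2 * d" using d ne by (simp add: y_def d_def norm_minus_commute)
  then have "(norm (y - x))\<^sup>2 \<le> (2 * d)\<^sup>2" by (intro power_mono) auto
  then have yx: "C * (norm (y - x))\<^sup>2 \<le> 4 * C * d\<^sup>2"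
    using mult_left_mono[OF _ C] by (fastforce simp: power_mult_distrib mult_ac)
  have 1: "f y \<le> f z + P z \<bullet> (y - z) + C * d\<^sup>2"
    using C11[OF xz(2) yB] d ne by (simp add: y_def abs_le_iff)
  have 2: "f x + P x \<bullet> (y - x) - C * (norm (y - x))\<^sup>2 \<le> f y"
    using C11[OF xz(1) yB] by (simp add: abs_le_iff)
  have 3: "f z \<le> f x + P x \<bullet> (z - x) + C * d\<^sup>2"
    using C11[OF xz(1) zB] by (simp add: d_def norm_minus_commute abs_le_iff)
  have "(P x - P z) \<bullet> (y - z) \<le> 6 * C * d\<^sup>2"
    using 1 2 3 yx by (simp add: inner_diff_left inner_diff_right)
  moreover have "(P x - P z) \<bullet> (y - z) = d * norm (P x - P z)"
    using False by (simp add: y_def e_def dot_square_norm power2_eq_square)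
  ultimately have "d * norm (P x - P z) \<le> d * (6 * C * d)" by (simp add: power2_eq_square mult_ac)
  then show ?thesis using d by (simp add: d_def[symmetric])
qed

lemma dense_inner_le_0:
  fixes A :: "'a::euclidean_space \<Rightarrow> 'a"
  assumes A: "linear A" and le: "\<And>y. y \<in> rational_vectors \<Longrightarrow> A y \<bullet> y \<le> 0"
  shows "A v \<bullet> v \<le> 0"
proof (rule ccontr)
  assume n: "\<not> A v \<bullet> v \<le> 0"
  have "isCont (\<lambda>y. A y \<bullet> y) v"
    using linear_continuous_at[of A v] A by (intro continuous_intros) (auto simp: linear_conv_bounded_linear)
  then obtain d where d: "d > 0" "\<And>y. dist y v < d \<Longrightarrow> dist (A y \<bullet> y) (A v \<bullet> v) < A v \<bullet> v"
    using n unfolding continuous_at_eps_delta by (metis not_le)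
  obtain y where "y \<in> rational_vectors" "dist v y < d" using rational_vectors_dense[OF d(1)] .
  then show False using d(2)[of y] le[of y] by (simp add: dist_commute dist_real_def abs_less_iff)
qed

text \<open>By strictness a tilt \<open>q\<close> moves the maximum point by at most
  \<open>norm q / \<kappa>1\<close>, so small tilts have their contact points near
  \<open>x0\<close>. The set \<open>K\<close> of these points carries the blow-up, and the
  second-order limit of the sum, nonpositive at maxima, gives the matrix inequality.\<close>

lemma jensen_ishii_strict:
  fixes f1 f2 :: "'a::euclidean_space \<Rightarrow> real"
  assumes R: "R > 0" and cont: "continuous_on (cball x0 R) f1" "continuous_on (cball x0 R) f2"
    and sc: "semiconvex_with C (cball x0 R) f1" "semiconvex_with C (cball x0 R) f2" and C: "C \<ge> 0"
    and k1: "\<kappa>1 > 0" and mx: "\<And>x. x \<in> cball x0 R \<Longrightarrow> f1 x + f2 x \<le> f1 x0 + f2 x0 - \<kappa>1 * (norm (x - x0))\<^sup>2"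
    and k: "\<kappa> > 0"
  shows "\<exists>x1 x2 p1 p2 X1 X2. dist x1 x0 < \<kappa> \<and> dist x2 x0 < \<kappa> \<and> norm (p1 + p2) < \<kappa> \<and>
    touches_above f1 x1 p1 X1 \<and> touches_above f2 x2 p2 X2 \<and>
    (\<forall>v. X1 v \<bullet> v + X2 v \<bullet> v \<le> \<kappa> * (norm v)\<^sup>2)"
proof -
  let ?B = "cball x0 R"
  define F where "F x = f1 x + f2 x" for x
  have contF: "continuous_on ?B F" unfolding F_def by (intro continuous_intros cont)
  define r0 where "r0 = min (R / 4) (\<kappa> / 2)"
  have r0: "r0 > 0" "r0 \<le> R / 4" "r0 \<le> \<kappa> / 2" using R k by (auto simp: r0_def)
  \<comment> \<open>The first bound puts the contact points within \<open>r0 \<le> R / 4\<close> of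
    \<open>x0\<close>, as \<open>gradient_lipschitz_on_contact_set\<close> requires; the second
    reserves half of \<open>\<kappa>\<close> for the tilt in \<open>norm (p1 + p2)\<close>.\<close>
  define \<delta> where "\<delta> = min (\<kappa>1 * r0) (\<kappa> / 2)"
  have \<delta>: "\<delta> > 0" "\<delta> \<le> \<kappa>1 * r0" "\<delta> \<le> \<kappa> / 2" using k1 r0 k by (auto simp: \<delta>_def)
  \<comment> \<open>Points are paired with their tilts: the condition is closed in the pair, and
    \<open>K\<close> is compact as a projection.\<close>
  define KK where "KK = {z \<in> ?B \<times> cball 0 \<delta>. \<forall>y\<in>?B. F y - snd z \<bullet> y \<le> F (fst z) - snd z \<bullet> fst z}"
  define K where "K = fst ` KK"
  have "KK = (\<Inter>y\<in>?B. {z \<in> ?B \<times> cball 0 \<delta>. F y - snd z \<bullet> y \<le> F (fst z) - snd z \<bullet> fst z})"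
  proof (rule set_eqI)
    have "x0 \<in> ?B" using R by simp
    then show "z \<in> KK \<longleftrightarrow> z \<in> (\<Inter>y\<in>?B. {z \<in> ?B \<times> cball 0 \<delta>. F y - snd z \<bullet> y \<le> F (fst z) - snd z \<bullet> fst z})" for z
      unfolding KK_def INT_iff mem_Collect_eq by blast
  qed
  moreover have "closed {z \<in> ?B \<times> cball 0 \<delta>. F y - snd z \<bullet> y \<le> F (fst z) - snd z \<bullet> fst z}" for y
  proof (rule continuous_on_closed_Collect_le)
    show "continuous_on (?B \<times> cball 0 \<delta>) (\<lambda>z. F y - snd z \<bullet> y)" by (intro continuous_intros)
    have "continuous_on (?B \<times> cball 0 \<delta>) (\<lambda>z. F (fst z))"
      by (rule continuous_on_compose2[OF contF continuous_on_fst[OF continuous_on_id]]) auto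
    then show "continuous_on (?B \<times> cball 0 \<delta>) (\<lambda>z. F (fst z) - snd z \<bullet> fst z)" by (intro continuous_intros)
  qed (simp add: closed_Times)
  ultimately have "closed KK" by auto
  then have "compact KK"
    using compact_Int_closed[of "?B \<times> cball 0 \<delta>" KK] by (simp add: compact_Times KK_def Int_absorb1 subset_iff)
  then have compK: "compact K" unfolding K_def by (intro compact_continuous_image continuous_intros)
  have K0: "K \<subseteq> cball x0 r0"
  proof
    fix x assume "x \<in> K"
    then obtain q where q: "x \<in> ?B" "norm q \<le> \<delta>" "\<And>y. y \<in> ?B \<Longrightarrow> F y - q \<bullet> y \<le> F x - q \<bullet> x"
      by (auto simp: K_def KK_def)
    have "\<kappa>1 * (norm (x - x0))\<^sup>2 \<le> q \<bullet> (x0 - x)"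
      using q(3)[of x0] mx[OF q(1)] R by (simp add: F_def inner_diff_right)
    also have "\<dots> \<le> norm q * norm (x0 - x)" by (rule norm_cauchy_schwarz)
    also have "\<dots> \<le> (\<kappa>1 * r0) * norm (x - x0)"
      using q(2) \<delta>(2) k1 r0(1) by (intro mult_mono) (auto simp: norm_minus_commute)
    finally have "norm (x - x0) * norm (x - x0) \<le> r0 * norm (x - x0)"
      using k1 by (simp add: power2_eq_square mult.assoc)
    then have "norm (x - x0) \<le> r0"
      using r0(1) by (cases "x = x0") (auto simp: mult_le_cancel_right)
    then show "x \<in> cball x0 r0" by (simp add: dist_norm norm_minus_commute)
  qed
  have KB: "K \<subseteq> cball x0 (R / 4)" using K0 r0(2) by auto
  have KB': "K \<subseteq> ?B" using KB R by auto
  obtain P1 where P1: "\<And>x y. x \<in> ?B \<Longrightarrow> y \<in> ?B \<Longrightarrow> f1 x + P1 x \<bullet> (y - x) - C * (norm (y - x))\<^sup>2 \<le> f1 y"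
    using sc(1) unfolding semiconvex_with_def by metis
  obtain P2 where P2: "\<And>x y. x \<in> ?B \<Longrightarrow> y \<in> ?B \<Longrightarrow> f2 x + P2 x \<bullet> (y - x) - C * (norm (y - x))\<^sup>2 \<le> f2 y"
    using sc(2) unfolding semiconvex_with_def by metis
  have sumP: "P1 x + P2 x = q" if "(x, q) \<in> KK" for x q
  proof -
    have "x \<in> K" using that by (force simp: K_def)
    moreover have "x \<in> ?B" using that by (simp add: KK_def)
    ultimately have x: "x \<in> ?B" "x \<in> K" by auto
    \<comment> \<open>The supporting paraboloids bound the tilted sum from below near
      \<open>x\<close>, the contact bounds it from above by its value at \<open>x\<close>; only a
      vanishing slope is compatible with both.\<close>
    have "P1 x + P2 x - q = 0"
    proof (rule eq_0_if_inner_le_square[where r = "R / 2" and x = x and c = "2 * C"])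
      fix y assume "y \<in> cball x (R / 2)"
      then have y: "y \<in> ?B" using x(2) KB R dist_triangle[of x0 y x] by (auto simp: subset_iff)
      show "(P1 x + P2 x - q) \<bullet> (y - x) \<le> 2 * C * (norm (y - x))\<^sup>2"
      proof -
        have "F y - q \<bullet> y \<le> F x - q \<bullet> x" using that y by (simp add: KK_def)
        then show ?thesis using P1[OF x(1) y] P2[OF x(1) y]
          by (simp add: F_def inner_add_left inner_diff_left inner_diff_right)
      qed
    qed (use R in auto)
    then show ?thesis by simp
  qed
  have Kq: "(x, P1 x + P2 x) \<in> KK" if "x \<in> K" for x
    using that sumP by (force simp: K_def)
  have maxK: "F y \<le> F x + (P1 x + P2 x) \<bullet> (y - x)" if "x \<in> K" "y \<in> ?B" for x y
  proof -
    have "F y - (P1 x + P2 x) \<bullet> y \<le> F x - (P1 x + P2 x) \<bullet> x"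
      using Kq[OF that(1)] that(2) by (simp add: KK_def)
    then show ?thesis unfolding inner_diff_right by linarith
  qed
  \<comment> \<open>The upper bound for \<open>f1\<close> is the upper bound for the sum at a
    contact point minus the lower bound for \<open>f2\<close>; so both functions have two-sided
    expansions there.\<close>
  have C1: "\<bar>f1 y - f1 x - P1 x \<bullet> (y - x)\<bar> \<le> C * (norm (y - x))\<^sup>2" if "x \<in> K" "y \<in> ?B" for x y
    using maxK[OF that] P1[of x y] P2[of x y] that KB' by (auto simp: F_def inner_add_left abs_le_iff)
  have C2: "\<bar>f2 y - f2 x - P2 x \<bullet> (y - x)\<bar> \<le> C * (norm (y - x))\<^sup>2" if "x \<in> K" "y \<in> ?B" for x y
    using maxK[OF that] P1[of x y] P2[of x y] that KB' by (auto simp: F_def inner_add_left abs_le_iff)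
  \<comment> \<open>Blowing up the pair provides common base points and scales for both
    functions.\<close>
  define P where "P x = (P1 x, P2 x)" for x
  have lip: "(12 * C)-lipschitz_on K P"
  proof (rule lipschitz_onI)
    fix x z assume xz: "x \<in> K" "z \<in> K"
    have "norm (P x - P z) \<le> norm (P1 x - P1 z) + norm (P2 x - P2 z)"
      unfolding P_def by (simp add: norm_Pair_le)
    then show "dist (P x) (P z) \<le> 12 * C * dist x z"
      using gradient_lipschitz_on_contact_set[OF C1 KB C xz] gradient_lipschitz_on_contact_set[OF C2 KB C xz]
      by (simp add: dist_norm)
  qed (use C in simp)
  \<comment> \<open>A null set has a null image under the Lipschitz map \<open>P1 + P2\<close>; but
    every tilt of norm at most \<open>\<delta>\<close> occurs at some contact point, so the image of
    \<open>K\<close> contains a ball.\<close>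
  have nneg: "\<not> negligible K"
  proof
    assume neg: "negligible K"
    have "negligible ((\<lambda>x. P1 x + P2 x) ` K)"
    proof (rule negligible_locally_Lipschitz_image[OF _ neg])
      fix x assume x: "x \<in> K"
      have "norm (P1 y + P2 y - (P1 x + P2 x)) \<le> (12 * C) * norm (y - x)" if "y \<in> K" for y
        using gradient_lipschitz_on_contact_set[OF C1 KB C that x] gradient_lipschitz_on_contact_set[OF C2 KB C that x]
          norm_triangle_ineq[of "P1 y - P1 x" "P2 y - P2 x"] by (simp add: algebra_simps)
      then show "\<exists>T B. open T \<and> x \<in> T \<and> (\<forall>y\<in>K \<inter> T. norm (P1 y + P2 y - (P1 x + P2 x)) \<le> B * norm (y - x))"
        by (intro exI[of _ UNIV] exI[of _ "12 * C"]) auto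
    qed simp
    moreover have "cball 0 \<delta> \<subseteq> (\<lambda>x. P1 x + P2 x) ` K"
    proof
      fix q :: 'a assume q: "q \<in> cball 0 \<delta>"
      have "continuous_on ?B (\<lambda>y. F y - q \<bullet> y)" by (intro continuous_intros contF)
      then obtain x where x: "x \<in> ?B" "\<And>y. y \<in> ?B \<Longrightarrow> F y - q \<bullet> y \<le> F x - q \<bullet> x"
        using continuous_attains_sup[OF compact_cball, of x0 R "\<lambda>y. F y - q \<bullet> y"] R by fastforce
      then have "(x, q) \<in> KK" using q by (auto simp: KK_def)
      then show "q \<in> (\<lambda>x. P1 x + P2 x) ` K"
        using sumP by (force simp: K_def)
    qed
    ultimately have "negligible (cball (0::'a) \<delta>)" by (rule negligible_subset)
    then show False using \<delta>(1) by (simp add: negligible_iff_measure0 content_cball_pos order_less_irrefl lmeasurable_cball)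
  qed
  obtain x s M where "(\<forall>j::nat. x j \<in> K) \<and> (\<forall>j. (0::real) < s j) \<and> s \<longlonglongrightarrow> 0 \<and> linear M \<and>
    (\<forall>y\<in>rational_vectors. \<forall>\<^sub>F j in sequentially. x j + s j *\<^sub>R y \<in> K) \<and>
    (\<forall>y\<in>rational_vectors. (\<lambda>j. (1 / s j) *\<^sub>R (P (x j + s j *\<^sub>R y) - P (x j))) \<longlonglongrightarrow> M y)"
    using lipschitz_blowup[OF lip compK nneg] by (elim exE)
  then have b: "\<And>j. x j \<in> K" "\<And>j. 0 < s j" "s \<longlonglongrightarrow> 0" "linear M"
    "\<And>y. y \<in> rational_vectors \<Longrightarrow> \<forall>\<^sub>F j in sequentially. x j + s j *\<^sub>R y \<in> K"
    "\<And>y. y \<in> rational_vectors \<Longrightarrow> (\<lambda>j. (1 / s j) *\<^sub>R (P (x j + s j *\<^sub>R y) - P (x j))) \<longlonglongrightarrow> M y"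
    by auto
  define M1 where "M1 v = fst (M v)" for v
  define M2 where "M2 v = snd (M v)" for v
  have M1: "linear M1" and M2: "linear M2"
    using linear_compose[OF b(4) linear_fst] linear_compose[OF b(4) linear_snd] by (simp_all add: M1_def[abs_def] M2_def[abs_def] o_def)
  have l1: "(\<lambda>j. (1 / s j) *\<^sub>R (P1 (x j + s j *\<^sub>R y) - P1 (x j))) \<longlonglongrightarrow> M1 y" if "y \<in> rational_vectors" for y
    using tendsto_fst[OF b(6)[OF that]] by (simp add: P_def M1_def)
  have l2: "(\<lambda>j. (1 / s j) *\<^sub>R (P2 (x j + s j *\<^sub>R y) - P2 (x j))) \<longlonglongrightarrow> M2 y" if "y \<in> rational_vectors" for y
    using tendsto_snd[OF b(6)[OF that]] by (simp add: P_def M2_def)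
  have neg: "M1 v \<bullet> v + M2 v \<bullet> v \<le> 0" for v
  proof -
    have "(M1 y + M2 y) \<bullet> y \<le> 0" if y: "y \<in> rational_vectors" for y
    proof -
      have "(\<lambda>j. (f1 (x j + s j *\<^sub>R y) - f1 (x j) - s j * (P1 (x j) \<bullet> y)) / (s j)\<^sup>2
          + (f2 (x j + s j *\<^sub>R y) - f2 (x j) - s j * (P2 (x j) \<bullet> y)) / (s j)\<^sup>2) \<longlonglongrightarrow> (M1 y \<bullet> y) / 2 + (M2 y \<bullet> y) / 2"
        by (intro tendsto_add second_order_blowup_limit[OF C1 KB' b(1,2) M1 b(5) l1 y]
            second_order_blowup_limit[OF C2 KB' b(1,2) M2 b(5) l2 y])
      moreover have "\<forall>\<^sub>F j in sequentially. (f1 (x j + s j *\<^sub>R y) - f1 (x j) - s j * (P1 (x j) \<bullet> y)) / (s j)\<^sup>2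
          + (f2 (x j + s j *\<^sub>R y) - f2 (x j) - s j * (P2 (x j) \<bullet> y)) / (s j)\<^sup>2 \<le> 0"
        using b(5)[OF y]
      proof eventually_elim
        case (elim j)
        have "x j + s j *\<^sub>R y \<in> ?B" using elim KB' by blast
        from maxK[OF b(1)[of j] this] have "(f1 (x j + s j *\<^sub>R y) - f1 (x j) - s j * (P1 (x j) \<bullet> y))
           + (f2 (x j + s j *\<^sub>R y) - f2 (x j) - s j * (P2 (x j) \<bullet> y)) \<le> 0"
          by (simp add: F_def inner_add_left distrib_left)
        then show ?case unfolding add_divide_distrib[symmetric] by (intro divide_nonpos_nonneg) auto
      qed
      ultimately have "(M1 y \<bullet> y) / 2 + (M2 y \<bullet> y) / 2 \<le> 0"
        by (intro tendsto_upperbound) auto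
      then show ?thesis by (simp add: inner_add_left)
    qed
    from dense_inner_le_0[OF linear_compose_add[OF M1 M2] this] show ?thesis by (simp add: inner_add_left)
  qed
  obtain m1 where m1: "m1 > 0" "\<And>v. norm (M1 v) \<le> m1 * norm v" using linear_bounded_pos[OF M1] by blast
  obtain m2 where m2: "m2 > 0" "\<And>v. norm (M2 v) \<le> m2 * norm v" using linear_bounded_pos[OF M2] by blast
  \<comment> \<open>The form of each touching matrix exceeds that of its \<open>M\<close> by
    \<open>4 * k' = \<kappa> / 2\<close>.\<close>
  define k' where "k' = \<kappa> / 8"
  have k': "k' > 0" using k by (simp add: k'_def)
  have smallB: "\<forall>\<^sub>F j in sequentially. s j < min (R / 4) (\<kappa> / 2)"
    using b(3) R k by (intro order_tendstoD(2)) auto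
  have inB: "\<forall>\<^sub>F j in sequentially. cball (x j) (s j) \<subseteq> ?B"
    using smallB
  proof eventually_elim
    case (elim j)
    have "dist x0 (x j) \<le> R / 4" using b(1)[of j] KB by auto
    then show ?case using elim R dist_triangle[of x0 _ "x j"] by (fastforce intro: order_trans)
  qed
  have smallp: "\<forall>\<^sub>F j in sequentially. (m1 + 4 * k') * s j + (m2 + 4 * k') * s j < \<kappa> / 2"
  proof -
    have "(\<lambda>j. (m1 + 4 * k') * s j + (m2 + 4 * k') * s j) \<longlonglongrightarrow> (m1 + 4 * k') * 0 + (m2 + 4 * k') * 0"
      by (intro tendsto_intros b(3))
    then show ?thesis using k by (intro order_tendstoD(2)) auto
  qed
  have ev1: "\<forall>\<^sub>F j in sequentially. \<forall>w. norm w \<le> 1 \<longrightarrow>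
     f1 (x j + s j *\<^sub>R w) \<le> f1 (x j) + s j * (P1 (x j) \<bullet> w) + (s j)\<^sup>2 * ((M1 w \<bullet> w) / 2 + k')"
    by (rule second_order_blowup_upper[OF C1 KB' b(1,2) M1 b(5) l1 inB k' C])
  have ev2: "\<forall>\<^sub>F j in sequentially. \<forall>w. norm w \<le> 1 \<longrightarrow>
     f2 (x j + s j *\<^sub>R w) \<le> f2 (x j) + s j * (P2 (x j) \<bullet> w) + (s j)\<^sup>2 * ((M2 w \<bullet> w) / 2 + k')"
    by (rule second_order_blowup_upper[OF C2 KB' b(1,2) M2 b(5) l2 inB k' C])
  have "\<forall>\<^sub>F j in sequentially. ?thesis"
    using smallB inB smallp ev1 ev2
  proof eventually_elim
    case (elim j)
    obtain x1 p1 X1 where 1: "x1 \<in> ball (x j) (s j) \<and> norm (p1 - P1 (x j)) \<le> (m1 + 4 * k') * s j \<and> linear X1 \<and> (\<forall>v w. X1 v \<bullet> w = v \<bullet> X1 w) \<and>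
      (\<forall>v. X1 v \<bullet> v = M1 v \<bullet> v + 4 * k' * (norm v)\<^sup>2) \<and>
      (\<forall>z\<in>cball (x j) (s j). f1 z \<le> f1 x1 + p1 \<bullet> (z - x1) + (X1 (z - x1) \<bullet> (z - x1)) / 2)"
      using touching_from_one_scale[OF continuous_on_subset[OF cont(1) elim(2)] b(2) M1 k' m1(2) elim(4)] by (elim exE)
    note 1 = 1[THEN conjunct1] 1[THEN conjunct2, THEN conjunct1] 1[THEN conjunct2, THEN conjunct2, THEN conjunct1]
      1[THEN conjunct2, THEN conjunct2, THEN conjunct2, THEN conjunct1, rule_format]
      1[THEN conjunct2, THEN conjunct2, THEN conjunct2, THEN conjunct2, THEN conjunct1, rule_format]
      1[THEN conjunct2, THEN conjunct2, THEN conjunct2, THEN conjunct2, THEN conjunct2, rule_format]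
    obtain x2 p2 X2 where 2: "x2 \<in> ball (x j) (s j) \<and> norm (p2 - P2 (x j)) \<le> (m2 + 4 * k') * s j \<and> linear X2 \<and> (\<forall>v w. X2 v \<bullet> w = v \<bullet> X2 w) \<and>
      (\<forall>v. X2 v \<bullet> v = M2 v \<bullet> v + 4 * k' * (norm v)\<^sup>2) \<and>
      (\<forall>z\<in>cball (x j) (s j). f2 z \<le> f2 x2 + p2 \<bullet> (z - x2) + (X2 (z - x2) \<bullet> (z - x2)) / 2)"
      using touching_from_one_scale[OF continuous_on_subset[OF cont(2) elim(2)] b(2) M2 k' m2(2) elim(5)] by (elim exE)
    note 2 = 2[THEN conjunct1] 2[THEN conjunct2, THEN conjunct1] 2[THEN conjunct2, THEN conjunct2, THEN conjunct1]
      2[THEN conjunct2, THEN conjunct2, THEN conjunct2, THEN conjunct1, rule_format]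
      2[THEN conjunct2, THEN conjunct2, THEN conjunct2, THEN conjunct2, THEN conjunct1, rule_format]
      2[THEN conjunct2, THEN conjunct2, THEN conjunct2, THEN conjunct2, THEN conjunct2, rule_format]
    have dx: "dist y x0 < \<kappa>" if "y \<in> ball (x j) (s j)" for y
    proof -
      have "dist (x j) x0 \<le> \<kappa> / 2" using b(1)[of j] K0 r0(3) by (auto simp: dist_commute)
      moreover have "dist y (x j) < \<kappa> / 2" using that elim(1) by (simp add: dist_commute)
      ultimately show ?thesis using dist_triangle[of y x0 "x j"] by linarith
    qed
    have t1: "touches_above f1 x1 p1 X1"
    proof -
      obtain r where r: "r > 0" "ball x1 r \<subseteq> ball (x j) (s j)" using 1(1) open_ball openE by blast
      then have "\<forall>z\<in>ball x1 r. f1 z \<le> f1 x1 + p1 \<bullet> (z - x1) + (X1 (z - x1) \<bullet> (z - x1)) / 2"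
        using 1(6) ball_subset_cball by blast
      then show ?thesis unfolding touches_above_def using 1(3,4) r(1) by auto
    qed
    have t2: "touches_above f2 x2 p2 X2"
    proof -
      obtain r where r: "r > 0" "ball x2 r \<subseteq> ball (x j) (s j)" using 2(1) open_ball openE by blast
      then have "\<forall>z\<in>ball x2 r. f2 z \<le> f2 x2 + p2 \<bullet> (z - x2) + (X2 (z - x2) \<bullet> (z - x2)) / 2"
        using 2(6) ball_subset_cball by blast
      then show ?thesis unfolding touches_above_def using 2(3,4) r(1) by auto
    qed
    have "norm (P1 (x j) + P2 (x j)) \<le> \<delta>" using Kq[OF b(1)] by (auto simp: KK_def)
    moreover have "norm (p1 + p2) \<le> norm (p1 - P1 (x j)) + norm (p2 - P2 (x j)) + norm (P1 (x j) + P2 (x j))"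
    proof -
      have e: "p1 + p2 = ((p1 - P1 (x j)) + (p2 - P2 (x j))) + (P1 (x j) + P2 (x j))" by simp
      show ?thesis unfolding e using norm_triangle_ineq[of "(p1 - P1 (x j)) + (p2 - P2 (x j))" "P1 (x j) + P2 (x j)"]
          norm_triangle_ineq[of "p1 - P1 (x j)" "p2 - P2 (x j)"] by linarith
    qed
    ultimately have np: "norm (p1 + p2) < \<kappa>" using 1(2) 2(2) elim(3) \<delta>(3) by linarith
    have "X1 v \<bullet> v + X2 v \<bullet> v \<le> \<kappa> * (norm v)\<^sup>2" for v
      using neg[of v] 1(5)[of v] 2(5)[of v] by (simp add: k'_def)
    then show ?case using dx[OF 1(1)] dx[OF 2(1)] np t1 t2 by blast
  qed
  then show ?thesis by simp
qed

text \<open>Where the sum, tilted by a small linear function, attains its maximum, both summands have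
  gradients depending on the contact point in a Lipschitz way, and these gradients sum to the tilt. Hence
  the contact set is not negligible, so the gradients can be blown up at one of its points. This
  replaces Alexandrov's theorem.\<close>

lemma jensen_ishii:
  fixes f1 f2 :: "'a::euclidean_space \<Rightarrow> real"
  assumes R: "R > 0" and cont: "continuous_on (cball x0 R) f1" "continuous_on (cball x0 R) f2"
    and sc: "semiconvex_with C (cball x0 R) f1" "semiconvex_with C (cball x0 R) f2" and C: "C \<ge> 0"
    and mx: "\<And>x. x \<in> cball x0 R \<Longrightarrow> f1 x + f2 x \<le> f1 x0 + f2 x0" and k: "\<kappa> > 0"
  shows "\<exists>x1 x2 p1 p2 X1 X2. dist x1 x0 < \<kappa> \<and> dist x2 x0 < \<kappa> \<and> norm (p1 + p2) < \<kappa> \<and>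
    touches_above f1 x1 p1 X1 \<and> touches_above f2 x2 p2 X2 \<and>
    (\<forall>v. X1 v \<bullet> v + X2 v \<bullet> v \<le> \<kappa> * (norm v)\<^sup>2)"
proof -
  \<comment> \<open>Subtracting \<open>k'\<close> times the squared distance to \<open>x0\<close>
    from \<open>f2\<close> makes the maximum strict. Undoing this adds
    \<open>2 * k' \<le> \<kappa> / 4\<close> to the matrix and at most \<open>\<kappa> / 2\<close>
    to the slope, hence the tolerance \<open>\<kappa> / 4\<close> in the strict version.\<close>
  define k' where "k' = min (\<kappa> / 8) 1"
  have k': "k' > 0" "k' \<le> \<kappa> / 8" "k' \<le> 1" using k by (auto simp: k'_def)
  define f2' where "f2' x = f2 x - k' * (norm (x - x0))\<^sup>2" for x
  have expand: "(norm (y - x0))\<^sup>2 = (norm (x - x0))\<^sup>2 + 2 * ((x - x0) \<bullet> (y - x)) + (norm (y - x))\<^sup>2" for x y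
    unfolding power2_norm_eq_inner by (simp add: inner_diff_left inner_diff_right inner_commute)
  have "\<exists>x1 x2 p1 p2 X1 X2. dist x1 x0 < \<kappa> / 4 \<and> dist x2 x0 < \<kappa> / 4 \<and> norm (p1 + p2) < \<kappa> / 4 \<and>
    touches_above f1 x1 p1 X1 \<and> touches_above f2' x2 p2 X2 \<and>
    (\<forall>v. X1 v \<bullet> v + X2 v \<bullet> v \<le> \<kappa> / 4 * (norm v)\<^sup>2)"
  proof (rule jensen_ishii_strict[OF R cont(1) _ _ _ _ k'(1), where C = "C + k'"])
    show "continuous_on (cball x0 R) f2'" unfolding f2'_def by (intro continuous_intros cont)
    show "semiconvex_with (C + k') (cball x0 R) f1"
      unfolding semiconvex_with_def
    proof
      fix x assume "x \<in> cball x0 R"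
      then obtain p where p: "\<And>y. y \<in> cball x0 R \<Longrightarrow> f1 x + p \<bullet> (y - x) - C * (norm (y - x))\<^sup>2 \<le> f1 y"
        using sc(1) unfolding semiconvex_with_def by blast
      have "k' * (norm (y - x))\<^sup>2 \<ge> 0" for y using k' by simp
      then show "\<exists>p. \<forall>y\<in>cball x0 R. f1 x + p \<bullet> (y - x) - (C + k') * (norm (y - x))\<^sup>2 \<le> f1 y"
        using p by (intro exI[of _ p]) (smt (verit) distrib_right)
    qed
    show "semiconvex_with (C + k') (cball x0 R) f2'"
      unfolding semiconvex_with_def
    proof
      fix x assume "x \<in> cball x0 R"
      then obtain p where p: "\<And>y. y \<in> cball x0 R \<Longrightarrow> f2 x + p \<bullet> (y - x) - C * (norm (y - x))\<^sup>2 \<le> f2 y"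
        using sc(2) unfolding semiconvex_with_def by blast
      have "f2' x + (p - (2 * k') *\<^sub>R (x - x0)) \<bullet> (y - x) - (C + k') * (norm (y - x))\<^sup>2 \<le> f2' y"
        if "y \<in> cball x0 R" for y
        using p[OF that] unfolding f2'_def expand[of y x] by (simp add: algebra_simps)
      then show "\<exists>p. \<forall>y\<in>cball x0 R. f2' x + p \<bullet> (y - x) - (C + k') * (norm (y - x))\<^sup>2 \<le> f2' y" by blast
    qed
    show "f1 x + f2' x \<le> f1 x0 + f2' x0 - k' * (norm (x - x0))\<^sup>2" if "x \<in> cball x0 R" for x
      using mx[OF that] by (simp add: f2'_def)
  qed (use k k' C in auto)
  then obtain x1 x2 p1 p2 X1 X2 where t: "dist x1 x0 < \<kappa> / 4" "dist x2 x0 < \<kappa> / 4" "norm (p1 + p2) < \<kappa> / 4"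
    "touches_above f1 x1 p1 X1" "touches_above f2' x2 p2 X2"
    "\<And>v. X1 v \<bullet> v + X2 v \<bullet> v \<le> \<kappa> / 4 * (norm v)\<^sup>2" by blast
  define X2' where "X2' v = X2 v + (2 * k') *\<^sub>R v" for v
  define p2' where "p2' = p2 + (2 * k') *\<^sub>R (x2 - x0)"
  have t2: "touches_above f2 x2 p2' X2'"
  proof -
    obtain r where r: "r > 0" "\<And>z. z \<in> ball x2 r \<Longrightarrow> f2' z \<le> f2' x2 + p2 \<bullet> (z - x2) + (X2 (z - x2) \<bullet> (z - x2)) / 2"
      using t(5) unfolding touches_above_def by blast
    have "f2 z \<le> f2 x2 + p2' \<bullet> (z - x2) + (X2' (z - x2) \<bullet> (z - x2)) / 2" if "z \<in> ball x2 r" for z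
    proof -
      have "(X2' (z - x2) \<bullet> (z - x2)) / 2 = (X2 (z - x2) \<bullet> (z - x2)) / 2 + k' * (norm (z - x2))\<^sup>2"
        by (simp add: X2'_def inner_add_left power2_norm_eq_inner add_divide_distrib)
      moreover have "p2' \<bullet> (z - x2) = p2 \<bullet> (z - x2) + 2 * k' * ((x2 - x0) \<bullet> (z - x2))"
        by (simp add: p2'_def inner_add_left)
      ultimately show ?thesis
        using r(2)[OF that] unfolding f2'_def expand[of z x2] by (simp add: distrib_left add_divide_distrib)
    qed
    moreover have "linear X2'" "\<forall>v w. X2' v \<bullet> w = v \<bullet> X2' w"
      using t(5) unfolding touches_above_def X2'_def
      by (auto intro: linear_compose_add linear_scale_self simp: inner_add_left inner_add_right)
    ultimately show ?thesis unfolding touches_above_def using r(1) by blast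
  qed
  have "norm (p1 + p2') < \<kappa>"
  proof -
    have "norm (p1 + p2') \<le> norm (p1 + p2) + norm ((2 * k') *\<^sub>R (x2 - x0))"
      unfolding p2'_def using norm_triangle_ineq[of "p1 + p2" "(2 * k') *\<^sub>R (x2 - x0)"] by (simp add: add.assoc)
    also have "norm ((2 * k') *\<^sub>R (x2 - x0)) \<le> 2 * (\<kappa> / 4)"
    proof -
      have "k' * norm (x2 - x0) \<le> 1 * (\<kappa> / 4)"
        using k' t(2) by (intro mult_mono) (auto simp: dist_norm)
      then show ?thesis using k' by simp
    qed
    finally show ?thesis using t(3) k by linarith
  qed
  moreover have "X1 v \<bullet> v + X2' v \<bullet> v \<le> \<kappa> * (norm v)\<^sup>2" for v
  proof -
    have "2 * k' * (norm v)\<^sup>2 \<le> \<kappa> / 4 * (norm v)\<^sup>2" using k' by (intro mult_right_mono) auto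
    moreover have "\<kappa> * (norm v)\<^sup>2 \<ge> 0" using k by simp
    ultimately show ?thesis using t(6)[of v] by (simp add: X2'_def inner_add_left power2_norm_eq_inner)
  qed
  moreover have "dist x1 x0 < \<kappa>" "dist x2 x0 < \<kappa>" using t(1,2) k by linarith+
  ultimately show ?thesis using t(4) t2 by blast
qed

section \<open>The operator\<close>

lemma finite_sign_vectors: "finite (sign_vectors :: (real^'n) set)"
proof -
  have "sign_vectors \<subseteq> (\<lambda>f. (\<chi> j. f j) :: real^'n) ` (UNIV \<rightarrow>\<^sub>E {-1, 1::real})"
  proof
    fix e :: "real^'n" assume "e \<in> sign_vectors"
    then have "(\<lambda>j. e $ j) \<in> UNIV \<rightarrow>\<^sub>E {-1, 1}" "e = (\<chi> j. e $ j)"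
      by (auto simp: sign_vectors_def)
    then show "e \<in> (\<lambda>f. (\<chi> j. f j) :: real^'n) ` (UNIV \<rightarrow>\<^sub>E {-1, 1::real})" by blast
  qed
  moreover have "finite (UNIV \<rightarrow>\<^sub>E {-1, 1::real} :: ('n \<Rightarrow> real) set)" by (intro finite_PiE) auto
  ultimately show ?thesis using finite_surj by blast
qed

lemma sign_vectors_nonempty: "sign_vectors \<noteq> {}"
  by (auto simp: sign_vectors_def intro!: exI[of _ "\<chi> j. 1"])

lemma uminus_sign_vectors: "\<epsilon> \<in> sign_vectors \<Longrightarrow> - \<epsilon> \<in> sign_vectors"
  by (force simp: sign_vectors_def)

lemma norm_admissible_mult:
  fixes A :: "real^'n^'m"
  assumes "A \<in> admissible" "\<epsilon> \<in> sign_vectors"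
  shows "norm (A *v \<epsilon>) \<le> CARD('n)"
proof -
  have "norm (A *v \<epsilon>) \<le> (\<Sum>j\<in>UNIV. norm (\<epsilon> $ j *s column j A))"
    unfolding matrix_mult_sum by (rule norm_sum)
  also have "\<dots> \<le> (\<Sum>j\<in>(UNIV::'n set). 1)"
  proof (rule sum_mono)
    fix j
    have "\<bar>\<epsilon> $ j\<bar> = 1" using assms(2) by (auto simp: sign_vectors_def) (metis abs_1 abs_minus_cancel)
    then show "norm (\<epsilon> $ j *s column j A) \<le> 1"
      using assms(1) by (simp add: admissible_def scalar_mult_eq_scaleR)
  qed
  finally show ?thesis by simp
qed

lemma zero_admissible: "0 \<in> admissible"
  by (simp add: admissible_def column_def zero_vec_def[symmetric])

text \<open>The norm on matrices is the Euclidean norm of all entries, so this is Cauchy-Schwarz in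
  each row.\<close>

lemma norm_matrix_vector_mult: "norm (M *v (x :: real^'n)) \<le> norm M * norm x" for M :: "real^'n^'m"
proof -
  have "norm (M *v x) = L2_set (\<lambda>i. \<bar>M $ i \<bullet> x\<bar>) UNIV"
    by (simp add: norm_vec_def matrix_vector_mul_component)
  also have "\<dots> \<le> L2_set (\<lambda>i. norm x * norm (M $ i)) UNIV"
    by (rule L2_set_mono) (simp_all add: Cauchy_Schwarz_ineq2 mult.commute[of "norm x"])
  also have "\<dots> = norm x * L2_set (\<lambda>i. norm (M $ i)) UNIV"
    by (simp add: L2_set_right_distrib)
  also have "\<dots> = norm M * norm x" by (simp add: norm_vec_def[of M] mult.commute)
  finally show ?thesis .
qed

lemma abs_quadratic_form_le: "\<bar>(M *v x) \<bullet> x\<bar> \<le> norm M * (norm x)\<^sup>2" for M :: "real^'m^'m"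
proof -
  have "\<bar>(M *v x) \<bullet> x\<bar> \<le> norm (M *v x) * norm x" by (rule Cauchy_Schwarz_ineq2)
  also have "\<dots> \<le> (norm M * norm x) * norm x" by (intro mult_right_mono norm_matrix_vector_mult) simp
  finally show ?thesis by (simp add: power2_eq_square mult.assoc)
qed

lemma quadratic_form_diff_le:
  fixes M :: "real^'m^'m"
  assumes "norm x \<le> r" "norm y \<le> r"
  shows "(M *v x) \<bullet> x - (M *v y) \<bullet> y \<le> 2 * r * norm M * norm (x - y)"
proof -
  have r: "0 \<le> r" using assms(1) norm_ge_zero order_trans by blast
  have "(M *v x) \<bullet> x - (M *v y) \<bullet> y = (M *v (x - y)) \<bullet> x + (M *v y) \<bullet> (x - y)"
    by (simp add: matrix_vector_mult_diff_distrib inner_diff_left inner_diff_right)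
  also have "\<dots> \<le> norm (M *v (x - y)) * norm x + norm (M *v y) * norm (x - y)"
    by (intro add_mono norm_cauchy_schwarz)
  also have "\<dots> \<le> (norm M * norm (x - y)) * r + (norm M * r) * norm (x - y)"
    using assms r
    by (intro add_mono mult_mono norm_matrix_vector_mult order_trans[OF norm_matrix_vector_mult mult_left_mono]) auto
  finally show ?thesis by (simp add: algebra_simps)
qed

section \<open>The max-min functional and elementary bounds for the operator\<close>

text \<open>Common shape of one step of the game and of \<open>H_op\<close>: only the set
  \<open>S\<close> of moves and the payoff \<open>G\<close> of a displacement differ.\<close>

definition maxmin :: "(real^'n^'m) set \<Rightarrow> (real^'m \<Rightarrow> real) \<Rightarrow> real" where
  "maxmin S G = (SUP A\<in>S. MIN \<epsilon>\<in>sign_vectors. G (A *v \<epsilon>))"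

lemma Min_sign_le: "\<epsilon> \<in> sign_vectors \<Longrightarrow> (MIN \<epsilon>\<in>sign_vectors. g \<epsilon>) \<le> (g \<epsilon> :: real)"
  by (intro Min_le finite_imageI finite_sign_vectors) auto

lemma Min_sign_ge_iff: "c \<le> (MIN \<epsilon>\<in>sign_vectors. g \<epsilon>) \<longleftrightarrow> (\<forall>\<epsilon>\<in>sign_vectors. c \<le> (g \<epsilon> :: real))"
  using Min_ge_iff[OF finite_imageI[OF finite_sign_vectors], of g c] sign_vectors_nonempty by auto

lemma maxmin_le:
  assumes "S \<noteq> {}" and "\<And>A. A \<in> S \<Longrightarrow> \<exists>\<epsilon>\<in>sign_vectors. G (A *v \<epsilon>) \<le> c"
  shows "maxmin S G \<le> c"
  unfolding maxmin_def
proof (rule cSUP_least[OF assms(1)])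
  fix A assume "A \<in> S"
  then obtain \<epsilon> where \<epsilon>: "\<epsilon> \<in> sign_vectors" "G (A *v \<epsilon>) \<le> c" using assms(2) by blast
  then show "(MIN \<epsilon>\<in>sign_vectors. G (A *v \<epsilon>)) \<le> c" using Min_sign_le[OF \<epsilon>(1), of "\<lambda>\<epsilon>. G (A *v \<epsilon>)"] by simp
qed

text \<open>The bound \<open>b\<close> makes the set of minima bounded above. A real supremum is
  guaranteed to dominate its members only then, so lower bounds for \<open>maxmin\<close> come with
  such a \<open>b\<close>.\<close>

lemma le_maxmin:
  fixes S :: "(real^'n^'m) set"
  assumes "A \<in> S" and "\<And>\<epsilon>. \<epsilon> \<in> sign_vectors \<Longrightarrow> c \<le> G (A *v \<epsilon>)"
    and "S \<subseteq> admissible" and "\<And>z. norm z \<le> CARD('n) \<Longrightarrow> G z \<le> b"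
  shows "c \<le> maxmin S G"
  unfolding maxmin_def
proof (rule cSUP_upper2[OF _ assms(1)])
  obtain \<epsilon>0 :: "real^'n" where \<epsilon>0: "\<epsilon>0 \<in> sign_vectors" using sign_vectors_nonempty by blast
  have "(MIN \<epsilon>\<in>sign_vectors. G (A *v \<epsilon>)) \<le> b" if "A \<in> S" for A
    using Min_sign_le[OF \<epsilon>0, of "\<lambda>\<epsilon>. G (A *v \<epsilon>)"] assms(4)[OF norm_admissible_mult[OF _ \<epsilon>0]] that assms(3)
    by (meson order_trans subsetD)
  then show "bdd_above ((\<lambda>A. MIN \<epsilon>\<in>sign_vectors. G (A *v \<epsilon>)) ` S)" by (intro bdd_aboveI2)
  show "c \<le> (MIN \<epsilon>\<in>sign_vectors. G (A *v \<epsilon>))" using assms(2) by (simp add: Min_sign_ge_iff)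
qed

text \<open>Supplies a near-optimal matrix wherever one would otherwise pick a maximizer, so
  attainment of the supremum is never at issue.\<close>

lemma less_maxminD:
  assumes "c < maxmin S G" and "S \<noteq> {}"
  shows "\<exists>A\<in>S. \<forall>\<epsilon>\<in>sign_vectors. c < G (A *v \<epsilon>)"
proof -
  have "\<exists>A\<in>S. c < (MIN \<epsilon>\<in>sign_vectors. G (A *v \<epsilon>))"
  proof (rule ccontr)
    assume "\<not> ?thesis"
    then have "maxmin S G \<le> c" unfolding maxmin_def
      by (intro cSUP_least assms(2)) (auto simp: not_less)
    then show False using assms(1) by simp
  qed
  then obtain A where A: "A \<in> S" "c < (MIN \<epsilon>\<in>sign_vectors. G (A *v \<epsilon>))" by blast
  have "c < G (A *v \<epsilon>)" if "\<epsilon> \<in> sign_vectors" for \<epsilon>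
    using A(2) Min_sign_le[OF that, of "\<lambda>\<epsilon>. G (A *v \<epsilon>)"] by simp
  then show ?thesis using A(1) by blast
qed

definition orthogonal_admissible :: "real^'m \<Rightarrow> (real^'n^'m) set" where
  "orthogonal_admissible p = {A \<in> admissible. transpose A *v p = 0}"

lemma H_op_maxmin: "H_op (N :: 'n::finite itself) M p = maxmin (orthogonal_admissible p :: (real^'n^_) set) (\<lambda>z. (M *v z) \<bullet> z)"
  by (simp add: H_op_def maxmin_def orthogonal_admissible_def)

lemma orthogonal_admissible_subset: "orthogonal_admissible p \<subseteq> admissible"
  by (auto simp: orthogonal_admissible_def)

lemma zero_orthogonal_admissible: "0 \<in> orthogonal_admissible p"
  by (simp add: orthogonal_admissible_def zero_admissible transpose_def vec_eq_iff matrix_vector_mult_def)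

lemma orthogonal_admissible_nonempty: "orthogonal_admissible p \<noteq> {}"
  using zero_orthogonal_admissible by blast

lemma orthogonal_admissible_0: "orthogonal_admissible 0 = admissible"
  by (simp add: orthogonal_admissible_def)

lemma orthogonal_admissible_inner: "A \<in> orthogonal_admissible p \<Longrightarrow> (A *v \<epsilon>) \<bullet> p = 0"
  using dot_lmul_matrix[of p A \<epsilon>] by (simp add: orthogonal_admissible_def inner_commute transpose_matrix_vector)

lemma quadratic_form_bound: "norm z \<le> real n \<Longrightarrow> (M *v z) \<bullet> z \<le> norm M * (real n)\<^sup>2" for M :: "real^'m^'m"
  using abs_quadratic_form_le[of M z] mult_left_mono[OF power_mono[of "norm z" "real n" 2], of "norm M"]
  by (auto simp: abs_le_iff)

lemma H_op_ge:
  fixes A :: "real^'n^'m"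
  assumes "A \<in> orthogonal_admissible p" and "\<And>\<epsilon>. \<epsilon> \<in> sign_vectors \<Longrightarrow> c \<le> (M *v (A *v \<epsilon>)) \<bullet> (A *v \<epsilon>)"
  shows "c \<le> H_op TYPE('n) M p"
  unfolding H_op_maxmin
  by (rule le_maxmin[where G = "\<lambda>z. (M *v z) \<bullet> z", OF assms orthogonal_admissible_subset quadratic_form_bound])

lemma H_op_le:
  assumes "\<And>A. A \<in> (orthogonal_admissible p :: (real^'n^'m) set) \<Longrightarrow>
     \<exists>\<epsilon>\<in>sign_vectors. (M *v (A *v \<epsilon>)) \<bullet> (A *v \<epsilon>) \<le> c"
  shows "H_op TYPE('n) M p \<le> c"
  unfolding H_op_maxmin by (rule maxmin_le[OF orthogonal_admissible_nonempty assms])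

lemma less_H_opD:
  assumes "c < H_op TYPE('n::finite) M (p :: real^'m)"
  shows "\<exists>A\<in>(orthogonal_admissible p :: (real^'n^'m) set). \<forall>\<epsilon>\<in>sign_vectors. c < (M *v (A *v \<epsilon>)) \<bullet> (A *v \<epsilon>)"
  using less_maxminD[OF assms[unfolded H_op_maxmin] orthogonal_admissible_nonempty] .

text \<open>The zero matrix competes for every gradient. This sign bounds supersolutions below by
  their terminal values, and it leaves only one Hessian to control when the gradients
  vanish.\<close>

lemma H_op_nonneg: "0 \<le> H_op TYPE('n::finite) M p"
  by (rule H_op_ge[OF zero_orthogonal_admissible]) simp

lemma H_op_le_norm: "H_op TYPE('n::finite) M (p :: real^'m) \<le> norm M * (real CARD('n))\<^sup>2"
proof (rule H_op_le)
  fix A :: "real^'n^'m" assume A: "A \<in> orthogonal_admissible p"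
  obtain \<epsilon> :: "real^'n" where \<epsilon>: "\<epsilon> \<in> sign_vectors" using sign_vectors_nonempty by blast
  then show "\<exists>\<epsilon>\<in>sign_vectors. (M *v (A *v \<epsilon>)) \<bullet> (A *v \<epsilon>) \<le> norm M * (real CARD('n))\<^sup>2"
    using quadratic_form_bound norm_admissible_mult A orthogonal_admissible_subset by (meson subsetD)
qed

lemma H_op_le_add:
  assumes "\<And>v. norm v \<le> real CARD('n) \<Longrightarrow> (M *v v) \<bullet> v \<le> (M' *v v) \<bullet> v + c"
  shows "H_op TYPE('n::finite) M p \<le> H_op TYPE('n) M' p + c"
proof (rule field_le_epsilon)
  fix e :: real assume "e > 0"
  then have "H_op TYPE('n) M p - e < H_op TYPE('n) M p" by simp
  from less_H_opD[OF this] obtain A :: "real^'n^_" where A: "A \<in> orthogonal_admissible p"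
    "\<And>\<epsilon>. \<epsilon> \<in> sign_vectors \<Longrightarrow> H_op TYPE('n) M p - e < (M *v (A *v \<epsilon>)) \<bullet> (A *v \<epsilon>)"
    by blast
  have "H_op TYPE('n) M p - e - c \<le> H_op TYPE('n) M' p"
  proof (rule H_op_ge[OF A(1)])
    fix \<epsilon> :: "real^'n" assume \<epsilon>: "\<epsilon> \<in> sign_vectors"
    have "norm (A *v \<epsilon>) \<le> CARD('n)"
      using norm_admissible_mult A(1) orthogonal_admissible_subset \<epsilon> by blast
    then show "H_op TYPE('n) M p - e - c \<le> (M' *v (A *v \<epsilon>)) \<bullet> (A *v \<epsilon>)"
      using A(2)[OF \<epsilon>] assms[of "A *v \<epsilon>"] by linarith
  qed
  then show "H_op TYPE('n) M p \<le> H_op TYPE('n) M' p + c + e" by simp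
qed

lemma H_op_mono: "(\<And>v. (M *v v) \<bullet> v \<le> (M' *v v) \<bullet> v) \<Longrightarrow> H_op TYPE('n::finite) M p \<le> H_op TYPE('n) M' p"
  using H_op_le_add[where c = 0 and 'n = 'n, of M M' p] by simp

section \<open>Dependence of the operator on gradient and matrix\<close>

text \<open>The product \<open>(I - p p^T / |p|^2) A\<close>, an orthogonal projection of each
  column; it makes an admissible matrix a competitor in \<open>H_op\<close> at gradient
  \<open>p\<close>.\<close>

definition proj_columns :: "real^'m \<Rightarrow> real^'n^'m \<Rightarrow> real^'n^'m" where
  "proj_columns p A = (\<chi> i j. A $ i $ j - (column j A \<bullet> p) / (p \<bullet> p) * p $ i)"

lemma column_proj_columns: "column j (proj_columns p A) = column j A - ((column j A \<bullet> p) / (p \<bullet> p)) *\<^sub>R p"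
  by (simp add: proj_columns_def column_def vec_eq_iff)

lemma proj_columns_mult: "proj_columns p A *v x = A *v x - (((A *v x) \<bullet> p) / (p \<bullet> p)) *\<^sub>R p"
proof -
  have "proj_columns p A *v x = (\<Sum>j\<in>UNIV. x $ j *\<^sub>R column j A - ((x $ j *\<^sub>R column j A \<bullet> p) / (p \<bullet> p)) *\<^sub>R p)"
    unfolding matrix_mult_sum column_proj_columns
    by (simp add: scalar_mult_eq_scaleR scaleR_right_diff_distrib)
  also have "\<dots> = (\<Sum>j\<in>UNIV. x $ j *\<^sub>R column j A) - (((\<Sum>j\<in>UNIV. x $ j *\<^sub>R column j A) \<bullet> p) / (p \<bullet> p)) *\<^sub>R p"
    by (simp add: sum_subtractf scaleR_left.sum[symmetric] sum_divide_distrib[symmetric] inner_sum_left)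
  finally show ?thesis unfolding matrix_mult_sum scalar_mult_eq_scaleR .
qed

lemma proj_columns_orthogonal_admissible:
  assumes A: "A \<in> admissible" and p: "p \<noteq> 0"
  shows "proj_columns p A \<in> orthogonal_admissible p"
proof -
  have "norm (column j (proj_columns p A)) \<le> 1" for j
  proof -
    let ?a = "column j A"
    have "(norm (?a - ((?a \<bullet> p) / (p \<bullet> p)) *\<^sub>R p))\<^sup>2 = (norm ?a)\<^sup>2 - (?a \<bullet> p)\<^sup>2 / (p \<bullet> p)"
      using p unfolding power2_norm_eq_inner
      by (simp add: inner_diff_left inner_diff_right inner_commute field_simps power2_eq_square)
    also have "\<dots> \<le> (norm ?a)\<^sup>2" by simp
    also have "\<dots> \<le> 1" using A by (simp add: admissible_def power_le_one)
    finally show ?thesis unfolding column_proj_columns by (simp add: power_le_one_iff)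
  qed
  moreover have "(transpose (proj_columns p A) *v p) $ j = 0" for j
  proof -
    have "(transpose (proj_columns p A) *v p) $ j = column j (proj_columns p A) \<bullet> p"
      by (simp add: matrix_vector_mul_component column_def transpose_def)
    also have "\<dots> = 0" using p by (simp add: column_proj_columns inner_diff_left)
    finally show ?thesis .
  qed
  ultimately show ?thesis by (simp add: orthogonal_admissible_def admissible_def vec_eq_iff)
qed

lemma norm_proj_columns_mult_diff:
  "p \<noteq> 0 \<Longrightarrow> norm (A *v x - proj_columns p A *v x) = \<bar>(A *v x) \<bullet> p\<bar> / norm p"
  by (simp add: proj_columns_mult dot_square_norm power2_eq_square)

text \<open>A near-optimal matrix for \<open>p\<close> is projected to become a competitor for
  \<open>p'\<close>. As \<open>A *v \<epsilon>\<close> is orthogonal to \<open>p\<close>, its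
  product with \<open>p'\<close> equals that with \<open>p' - p\<close>, so the projection moves it
  by at most \<open>n * norm (p - p') / norm p'\<close>.\<close>

lemma H_op_gradient_change:
  fixes p p' :: "real^'m"
  assumes "p' \<noteq> 0"
  shows "H_op TYPE('n::finite) M p \<le> H_op TYPE('n) M p' + 2 * (real CARD('n))\<^sup>2 * norm M * norm (p - p') / norm p'"
proof (rule field_le_epsilon)
  fix e :: real assume "e > 0"
  then have "H_op TYPE('n) M p - e < H_op TYPE('n) M p" by simp
  from less_H_opD[OF this] obtain A :: "real^'n^'m" where A: "A \<in> orthogonal_admissible p"
    "\<And>\<epsilon>. \<epsilon> \<in> sign_vectors \<Longrightarrow> H_op TYPE('n) M p - e < (M *v (A *v \<epsilon>)) \<bullet> (A *v \<epsilon>)"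
    by blast
  have A1: "A \<in> admissible" using A(1) orthogonal_admissible_subset by blast
  let ?B = "proj_columns p' A" and ?n = "real CARD('n)"
  have B: "?B \<in> orthogonal_admissible p'" using A1 assms by (rule proj_columns_orthogonal_admissible)
  then have B1: "?B \<in> admissible" using orthogonal_admissible_subset by blast
  have "H_op TYPE('n) M p - e - 2 * ?n\<^sup>2 * norm M * norm (p - p') / norm p' \<le> H_op TYPE('n) M p'"
  proof (rule H_op_ge[OF B])
    fix \<epsilon> :: "real^'n" assume \<epsilon>: "\<epsilon> \<in> sign_vectors"
    have nA: "norm (A *v \<epsilon>) \<le> ?n" "norm (?B *v \<epsilon>) \<le> ?n"
      using norm_admissible_mult[OF A1 \<epsilon>] norm_admissible_mult[OF B1 \<epsilon>] by auto
    have "(A *v \<epsilon>) \<bullet> p' = (A *v \<epsilon>) \<bullet> (p' - p)"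
      using orthogonal_admissible_inner[OF A(1)] by (simp add: inner_diff_right)
    also have "\<bar>\<dots>\<bar> \<le> norm (A *v \<epsilon>) * norm (p' - p)" by (rule Cauchy_Schwarz_ineq2)
    also have "\<dots> \<le> ?n * norm (p - p')" using nA by (simp add: mult_right_mono norm_minus_commute)
    finally have "norm (A *v \<epsilon> - ?B *v \<epsilon>) \<le> ?n * norm (p - p') / norm p'"
      unfolding norm_proj_columns_mult_diff[OF assms] by (simp add: divide_right_mono)
    then have "2 * ?n * norm M * norm (A *v \<epsilon> - ?B *v \<epsilon>) \<le> 2 * ?n * norm M * (?n * norm (p - p') / norm p')"
      by (intro mult_left_mono) auto
    then show "H_op TYPE('n) M p - e - 2 * ?n\<^sup>2 * norm M * norm (p - p') / norm p' \<le> (M *v (?B *v \<epsilon>)) \<bullet> (?B *v \<epsilon>)"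
      using A(2)[OF \<epsilon>] quadratic_form_diff_le[OF nA, of M] by (simp add: power2_eq_square mult_ac)
  qed
  then show "H_op TYPE('n) M p \<le> H_op TYPE('n) M p' + 2 * ?n\<^sup>2 * norm M * norm (p - p') / norm p' + e" by simp
qed

lemma H_op_matrix_change: "H_op TYPE('n::finite) M (p :: real^'b) \<le> H_op TYPE('n) M' p + norm (M - M') * (real CARD('n))\<^sup>2"
proof (rule H_op_le_add)
  fix v :: "real^'b" assume "norm v \<le> real CARD('n)"
  then show "(M *v v) \<bullet> v \<le> (M' *v v) \<bullet> v + norm (M - M') * (real CARD('n))\<^sup>2"
    using quadratic_form_bound[of v "CARD('n)" "M - M'"] by (simp add: matrix_vector_mult_diff_rdistrib inner_diff_left)
qed

text \<open>The one-sided estimate is used in both directions, once with \<open>p0\<close> and once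
  with \<open>p k\<close> in the denominator. At a vanishing gradient the set of competitors grows
  abruptly, and the operator can jump.\<close>

lemma tendsto_H_op:
  assumes M: "(M \<longlonglongrightarrow> M0)" and p: "(p \<longlonglongrightarrow> p0)" and "p0 \<noteq> 0"
  shows "(\<lambda>k. H_op TYPE('n::finite) (M k) (p k)) \<longlonglongrightarrow> H_op TYPE('n) M0 p0"
proof -
  let ?n = "real CARD('n)"
  have M': "(\<lambda>k. norm (M k - M0)) \<longlonglongrightarrow> 0" using M by (simp add: tendsto_norm_zero LIM_zero)
  have p': "(\<lambda>k. norm (p k - p0)) \<longlonglongrightarrow> 0" using p by (simp add: tendsto_norm_zero LIM_zero)
  have np: "\<forall>\<^sub>F k in sequentially. p k \<noteq> 0" using p assms(3) by (rule tendsto_imp_eventually_ne)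
  let ?e1 = "\<lambda>k. norm (M k - M0) * ?n\<^sup>2 + 2 * ?n\<^sup>2 * norm M0 * norm (p k - p0) / norm p0"
  let ?e2 = "\<lambda>k. norm (M k - M0) * ?n\<^sup>2 + 2 * ?n\<^sup>2 * norm M0 * norm (p k - p0) / norm (p k)"
  have e1: "?e1 \<longlonglongrightarrow> 0 * ?n\<^sup>2 + 2 * ?n\<^sup>2 * norm M0 * 0 / norm p0"
    using assms(3) by (intro tendsto_intros M' p') auto
  have e2: "?e2 \<longlonglongrightarrow> 0 * ?n\<^sup>2 + 2 * ?n\<^sup>2 * norm M0 * 0 / norm p0"
    using assms(3) by (intro tendsto_intros M' p' p) auto
  have "\<bar>H_op TYPE('n) (M k) (p k) - H_op TYPE('n) M0 p0\<bar> \<le> ?e1 k + ?e2 k" if "p k \<noteq> 0" for k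
  proof -
    have "H_op TYPE('n) (M k) (p k) \<le> H_op TYPE('n) M0 p0 + ?e1 k"
      using H_op_matrix_change[where 'n = 'n, of "M k" "p k" M0] H_op_gradient_change[where 'n = 'n, OF assms(3), of M0 "p k"]
      by simp
    moreover have "H_op TYPE('n) M0 p0 \<le> H_op TYPE('n) (M k) (p k) + ?e2 k"
      using H_op_matrix_change[where 'n = 'n, of M0 "p k" "M k"] H_op_gradient_change[where 'n = 'n, OF that, of M0 p0]
      by (simp add: norm_minus_commute)
    moreover have "?e1 k \<ge> 0" "?e2 k \<ge> 0" by auto
    ultimately show ?thesis unfolding abs_le_iff by linarith
  qed
  then have "\<forall>\<^sub>F k in sequentially. norm (H_op TYPE('n) (M k) (p k) - H_op TYPE('n) M0 p0) \<le> ?e1 k + ?e2 k"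
    using np by (auto elim: eventually_mono)
  moreover have "(\<lambda>k. ?e1 k + ?e2 k) \<longlonglongrightarrow> 0" using tendsto_add[OF e1 e2] by simp
  ultimately have "(\<lambda>k. H_op TYPE('n) (M k) (p k) - H_op TYPE('n) M0 p0) \<longlonglongrightarrow> 0"
    by (rule Lim_null_comparison)
  then show ?thesis by (rule LIM_zero_cancel)
qed

text \<open>The subsolution property without semicontinuous envelopes; supersolutions \<open>w\<close> of \<open>F\<close> are
  covered by applying it to \<open>-w\<close> and the reflected operator.\<close>

definition eps_subsolution :: "(real^'m^'m \<Rightarrow> real^'m \<Rightarrow> real) \<Rightarrow> ((real^'m) \<times> real \<Rightarrow> real) \<Rightarrow> bool" where
  "eps_subsolution F u \<longleftrightarrow>
     (\<forall>\<phi> d g h x t \<kappa>. test_function_with \<phi> d g h \<and> t < 0 \<and> local_max_at (\<lambda>z. u z - \<phi> z) (x, t) \<and> \<kappa> > 0 \<longrightarrow>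
        (\<exists>M' p'. M' \<in> symmetric_matrices \<and> dist (M', p') (h (x, t), g (x, t)) < \<kappa> \<and> - \<kappa> \<le> d (x, t) + F M' p' / 2))"

definition reflect_op :: "(real^'m^'m \<Rightarrow> real^'m \<Rightarrow> real) \<Rightarrow> real^'m^'m \<Rightarrow> real^'m \<Rightarrow> real" where
  "reflect_op F M p = - F (- M) (- p)"

section \<open>Viscosity inequalities as approximate inequalities\<close>

lemma le_Limsup_iff_frequently:
  fixes X :: "'a \<Rightarrow> ereal"
  shows "C \<le> Limsup F X \<longleftrightarrow> (\<forall>y<C. \<exists>\<^sub>F x in F. y < X x)"
proof (intro iffI allI impI)
  fix y assume "C \<le> Limsup F X" "y < C"
  show "\<exists>\<^sub>F x in F. y < X x"
  proof (rule ccontr)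
    assume "\<not> ?thesis"
    then have "\<forall>\<^sub>F x in F. X x \<le> y" by (simp add: frequently_def not_less)
    then have "Limsup F X \<le> y" by (rule Limsup_bounded)
    then show False using \<open>C \<le> Limsup F X\<close> \<open>y < C\<close> by simp
  qed
next
  assume *: "\<forall>y<C. \<exists>\<^sub>F x in F. y < X x"
  show "C \<le> Limsup F X"
  proof (rule ccontr)
    assume "\<not> ?thesis"
    then obtain y where y: "Limsup F X < y" "y < C" using ereal_dense2[of "Limsup F X" C] by (metis dense not_le)
    have "\<forall>\<^sub>F x in F. X x < y" using y(1) by (rule Limsup_lessD)
    then have "\<forall>\<^sub>F x in F. \<not> y < X x" by (auto elim: eventually_mono)
    then show False using *[rule_format, OF y(2)] by (simp add: frequently_def)
  qed
qed

text \<open>One tolerance \<open>\<kappa>\<close> serves both as distance to \<open>(M, p)\<close>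
  and as defect in the inequality; this keeps extended reals out of the comparison argument.\<close>

lemma upper_env_test_iff:
  "0 \<le> ereal a + ereal (1/2) * upper_env F M p \<longleftrightarrow>
     (\<forall>\<kappa>>0. \<exists>M' p'. M' \<in> symmetric_matrices \<and> dist (M', p') (M, p) < \<kappa> \<and> - \<kappa> \<le> a + F M' p' / 2)"
proof -
  have "0 \<le> ereal a + ereal (1/2) * upper_env F M p \<longleftrightarrow> ereal (- 2 * a) \<le> upper_env F M p"
    by (cases "upper_env F M p") (auto simp: field_simps)
  also have "\<dots> \<longleftrightarrow> (\<forall>y<ereal (- 2 * a). \<exists>\<^sub>F z in envelope_filter M p. y < ereal (F (fst z) (snd z)))"
    unfolding upper_env_def by (simp add: le_Limsup_iff_frequently case_prod_beta)
  also have "\<dots> \<longleftrightarrow> (\<forall>y<(- 2 * a). \<exists>\<^sub>F z in envelope_filter M p. y < F (fst z) (snd z))"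
  proof (intro iffI allI impI)
    fix y :: real assume *: "\<forall>y<ereal (- 2 * a). \<exists>\<^sub>F z in envelope_filter M p. y < ereal (F (fst z) (snd z))" "y < - 2 * a"
    have "ereal y < ereal (- 2 * a)" using *(2) by simp
    from *(1)[rule_format, OF this] have "\<exists>\<^sub>F z in envelope_filter M p. ereal y < ereal (F (fst z) (snd z))" .
    then show "\<exists>\<^sub>F z in envelope_filter M p. y < F (fst z) (snd z)" by simp
  next
    fix y :: ereal assume *: "\<forall>y<(- 2 * a). \<exists>\<^sub>F z in envelope_filter M p. y < F (fst z) (snd z)" "y < ereal (- 2 * a)"
    obtain r where r: "y < ereal r" "ereal r < ereal (- 2 * a)" using ereal_dense2[OF *(2)] by blast
    have "\<exists>\<^sub>F z in envelope_filter M p. r < F (fst z) (snd z)" using *(1) r(2) by simp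
    then show "\<exists>\<^sub>F z in envelope_filter M p. y < ereal (F (fst z) (snd z))"
      by (rule frequently_elim1) (use r(1) in \<open>auto intro: less_trans\<close>)
  qed
  also have "\<dots> \<longleftrightarrow> (\<forall>y<(- 2 * a). \<forall>e>0. \<exists>M' p'. M' \<in> symmetric_matrices \<and> dist (M', p') (M, p) < e \<and> y < F M' p')"
    unfolding frequently_def envelope_filter_def eventually_inf_principal eventually_nhds_metric
    by (auto simp: mem_Times_iff) blast+
  also have "\<dots> \<longleftrightarrow> (\<forall>\<kappa>>0. \<exists>M' p'. M' \<in> symmetric_matrices \<and> dist (M', p') (M, p) < \<kappa> \<and> - \<kappa> \<le> a + F M' p' / 2)"
  proof (intro iffI allI impI)
    fix \<kappa> :: real assume *: "\<forall>y<(- 2 * a). \<forall>e>0. \<exists>M' p'. M' \<in> symmetric_matrices \<and> dist (M', p') (M, p) < e \<and> y < F M' p'" "\<kappa> > 0"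
    have "- 2 * a - 2 * \<kappa> < - 2 * a" using *(2) by simp
    from *(1)[rule_format, OF this *(2)]
    obtain M' p' where "M' \<in> symmetric_matrices" "dist (M', p') (M, p) < \<kappa>" "- 2 * a - 2 * \<kappa> < F M' p'"
      by blast
    then show "\<exists>M' p'. M' \<in> symmetric_matrices \<and> dist (M', p') (M, p) < \<kappa> \<and> - \<kappa> \<le> a + F M' p' / 2"
      by (intro exI[of _ M'] exI[of _ p']) auto
  next
    fix y e :: real assume *: "\<forall>\<kappa>>0. \<exists>M' p'. M' \<in> symmetric_matrices \<and> dist (M', p') (M, p) < \<kappa> \<and> - \<kappa> \<le> a + F M' p' / 2"
      "y < - 2 * a" "e > 0"
    \<comment> \<open>The inequality with defect gives
      \<open>F M' p' \<ge> - 2 * a - 2 * \<kappa>\<close>; this choice spends only half of the gap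
      between \<open>y\<close> and \<open>- 2 * a\<close>.\<close>
    define \<kappa> where "\<kappa> = min e ((- 2 * a - y) / 4)"
    have "\<kappa> > 0" using * by (simp add: \<kappa>_def)
    then obtain M' p' where "M' \<in> symmetric_matrices" "dist (M', p') (M, p) < \<kappa>" "- \<kappa> \<le> a + F M' p' / 2"
      using *(1) by blast
    then show "\<exists>M' p'. M' \<in> symmetric_matrices \<and> dist (M', p') (M, p) < e \<and> y < F M' p'"
    proof (intro exI[of _ M'] exI[of _ p'] conjI)
      have "\<kappa> \<le> e" "\<kappa> \<le> (- 2 * a - y) / 4" unfolding \<kappa>_def by (rule min.cobounded1, rule min.cobounded2)
      then show "dist (M', p') (M, p) < e" "y < F M' p'"
        using *(2) \<open>dist (M', p') (M, p) < \<kappa>\<close> \<open>- \<kappa> \<le> a + F M' p' / 2\<close> by (simp_all add: field_simps)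
    qed
  qed
  finally show ?thesis .
qed

lemma viscosity_subsolution_iff:
  "viscosity_subsolution F u \<longleftrightarrow> usc_on (UNIV \<times> {..0}) u \<and> eps_subsolution F u"
  unfolding viscosity_subsolution_def eps_subsolution_def upper_env_test_iff by blast

lemma symmetric_matrices_uminus: "- M \<in> symmetric_matrices \<longleftrightarrow> M \<in> symmetric_matrices"
  by (auto simp: symmetric_matrices_def transpose_def vec_eq_iff)

text \<open>Negation is an isometry preserving symmetric matrices, so it carries one envelope filter
  to the other and turns the lower limit into an upper one. Supersolutions thereby become
  subsolutions of \<open>reflect_op F\<close>.\<close>

lemma lower_env_reflect: "lower_env F M p = - upper_env (reflect_op F) (- M) (- p)"
proof -
  have f: "filtermap uminus (envelope_filter (- M) (- p)) = envelope_filter M p"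
  proof (subst filter_eq_iff, rule allI)
    fix P :: "(real^'a^'a) \<times> (real^'a) \<Rightarrow> bool"
    have sub: "(\<forall>z. dist z (- M, - p) < d \<longrightarrow> z \<in> symmetric_matrices \<times> UNIV \<longrightarrow> P (- z)) \<longleftrightarrow>
       (\<forall>z. dist z (M, p) < d \<longrightarrow> z \<in> symmetric_matrices \<times> UNIV \<longrightarrow> P z)" for d
    proof -
      have "dist (- z) (- M, - p) = dist z (M, p)" for z :: "(real^'a^'a) \<times> (real^'a)"
        using dist_minus[of z "(M, p)"] by simp
      moreover have "- z \<in> symmetric_matrices \<times> UNIV \<longleftrightarrow> z \<in> symmetric_matrices \<times> UNIV" for z :: "(real^'a^'a) \<times> (real^'a)"
        by (cases z) (simp add: symmetric_matrices_uminus)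
      ultimately show ?thesis by (metis minus_minus)
    qed
    show "eventually P (filtermap uminus (envelope_filter (- M) (- p))) \<longleftrightarrow> eventually P (envelope_filter M p)"
      unfolding eventually_filtermap envelope_filter_def eventually_inf_principal eventually_nhds_metric sub ..
  qed
  have "lower_env F M p = Liminf (filtermap uminus (envelope_filter (- M) (- p))) (\<lambda>(M', p'). ereal (F M' p'))"
    unfolding f lower_env_def ..
  also have "\<dots> = Liminf (envelope_filter (- M) (- p)) (\<lambda>z. - ereal (reflect_op F (fst z) (snd z)))"
    unfolding case_prod_beta by (subst Liminf_filtermap_eq) (simp_all add: reflect_op_def inj_def)
  also have "\<dots> = - upper_env (reflect_op F) (- M) (- p)"
    unfolding upper_env_def case_prod_beta by (rule ereal_Liminf_uminus)
  finally show ?thesis .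
qed

lemma uminus_matrix_vector_mult: "(- M) *v x = - (M *v x)" for M :: "real^'n^'m"
  by (simp add: vec_eq_iff matrix_vector_mul_component)

lemma test_function_uminus:
  assumes "test_function_with \<phi> d g h"
  shows "test_function_with (\<lambda>z. - \<phi> z) (\<lambda>z. - d z) (\<lambda>z. - g z) (\<lambda>z. - h z)"
  unfolding test_function_with_def
proof (intro conjI allI impI)
  fix x t assume t: "t < (0::real)"
  have a: "((\<lambda>s. \<phi> (x, s)) has_real_derivative d (x, t)) (at t)"
    "((\<lambda>y. \<phi> (y, t)) has_derivative (\<lambda>v. g (x, t) \<bullet> v)) (at x)"
    "((\<lambda>y. g (y, t)) has_derivative (\<lambda>v. h (x, t) *v v)) (at x)"
    using assms t unfolding test_function_with_def by auto
  show "((\<lambda>s. - \<phi> (x, s)) has_real_derivative - d (x, t)) (at t)" by (rule DERIV_minus[OF a(1)])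
  show "((\<lambda>y. - \<phi> (y, t)) has_derivative (\<lambda>v. - g (x, t) \<bullet> v)) (at x)"
    unfolding inner_minus_left by (rule has_derivative_minus[OF a(2)])
  show "((\<lambda>y. - g (y, t)) has_derivative (\<lambda>v. - h (x, t) *v v)) (at x)"
    unfolding uminus_matrix_vector_mult by (rule has_derivative_minus[OF a(3)])
qed (use assms in \<open>auto simp: test_function_with_def intro: continuous_on_minus\<close>)

section \<open>The rescaled game\<close>

text \<open>If \<open>E\<close> contains a ball around \<open>x\<close>, then by symmetry it
  contains both \<open>x + v\<close> and \<open>v - x\<close> for small \<open>v\<close>, and their
  midpoint is \<open>v\<close>.\<close>

lemma centrally_symmetric_body_ball:
  fixes E :: "(real^'m) set"
  assumes "centrally_symmetric_body E"
  shows "\<exists>r>0. cball 0 r \<subseteq> E"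
proof -
  have E: "convex E" "uminus ` E = E" "interior E \<noteq> {}"
    using assms by (auto simp: centrally_symmetric_body_def)
  obtain x e where xe: "e > 0" "ball x e \<subseteq> E"
    using E(3) by (auto simp: mem_interior)
  have "v \<in> E" if v: "v \<in> cball 0 (e/2)" for v
  proof -
    have "x + v \<in> E" "x - v \<in> E" using xe v by (auto simp: dist_norm subset_iff)
    moreover have "v - x \<in> uminus ` E" using \<open>x - v \<in> E\<close> by (intro image_eqI[of _ _ "x - v"]) auto
    ultimately have "x + v \<in> E" "v - x \<in> E" using E(2) by auto
    then have "(1/2) *\<^sub>R (x + v) + (1/2) *\<^sub>R (v - x) \<in> E" using convexD[OF E(1)] by auto
    also have "(1/2) *\<^sub>R (x + v) + (1/2) *\<^sub>R (v - x) = v"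
      by (simp add: scaleR_right_distrib[symmetric] scaleR_2[symmetric])
    finally show ?thesis .
  qed
  then show ?thesis using xe(1) by (intro exI[of _ "e/2"]) auto
qed

lemma body_norm_le: "0 < r \<Longrightarrow> y \<in> E \<Longrightarrow> body_norm E (r *\<^sub>R y) \<le> r"
  unfolding body_norm_def by (rule cInf_lower) (auto intro!: bdd_belowI[of _ 0])

lemma body_norm_lessD:
  assumes "centrally_symmetric_body E" and "body_norm E x < s"
  shows "\<exists>r y. 0 < r \<and> r < s \<and> y \<in> E \<and> x = r *\<^sub>R y"
proof -
  obtain \<rho> where \<rho>: "\<rho> > 0" "cball 0 \<rho> \<subseteq> E" using centrally_symmetric_body_ball[OF assms(1)] by blast
  define a where "a = (norm x + 1) / \<rho>"
  have a: "a > 0" using \<rho>(1) by (simp add: a_def add_nonneg_pos)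
  have "norm ((1 / a) *\<^sub>R x) = norm x / a" using a by simp
  also have "\<dots> = \<rho> * (norm x / (norm x + 1))" by (simp add: a_def)
  also have "\<dots> \<le> \<rho>" using \<rho>(1) by (intro mult_left_le) (simp_all add: add_nonneg_pos)
  finally have "(1 / a) *\<^sub>R x \<in> E" using \<rho>(2) by auto
  then have "x \<in> (*\<^sub>R) a ` E" using a by (intro image_eqI[of _ _ "(1 / a) *\<^sub>R x"]) auto
  then have "{r. 0 < r \<and> x \<in> (*\<^sub>R) r ` E} \<noteq> {}" using a by blast
  from cInf_lessD[OF this assms(2)[unfolded body_norm_def]] show ?thesis by blast
qed

lemma body_norm_add_le:
  assumes E: "centrally_symmetric_body E"
  shows "body_norm E (x + y) \<le> body_norm E x + body_norm E y"
proof (rule field_le_epsilon)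
  fix e :: real assume "e > 0"
  then have "body_norm E x < body_norm E x + e/2" "body_norm E y < body_norm E y + e/2" by auto
  from this[THEN body_norm_lessD[OF E]] obtain r a s b where *: "0 < r" "r < body_norm E x + e/2" "a \<in> E" "x = r *\<^sub>R a"
    "0 < s" "s < body_norm E y + e/2" "b \<in> E" "y = s *\<^sub>R b" by blast
  have "(r / (r + s)) *\<^sub>R a + (s / (r + s)) *\<^sub>R b \<in> E"
    using E * by (intro convexD) (auto simp: centrally_symmetric_body_def add_divide_distrib[symmetric])
  then have "body_norm E ((r + s) *\<^sub>R ((r / (r + s)) *\<^sub>R a + (s / (r + s)) *\<^sub>R b)) \<le> r + s"
    using * by (intro body_norm_le) auto
  moreover have "(r + s) *\<^sub>R ((r / (r + s)) *\<^sub>R a + (s / (r + s)) *\<^sub>R b) = x + y"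
    using * by (simp add: scaleR_right_distrib)
  ultimately show "body_norm E (x + y) \<le> body_norm E x + body_norm E y + e" using * by simp
qed

lemma body_norm_scale_le:
  assumes E: "centrally_symmetric_body E" and c: "c > 0"
  shows "body_norm E (c *\<^sub>R x) \<le> c * body_norm E x"
proof (rule field_le_epsilon)
  fix e :: real assume "e > 0"
  then have "body_norm E x < body_norm E x + e / c" using c by simp
  from body_norm_lessD[OF E this] obtain r a where r: "0 < r" "r < body_norm E x + e / c" "a \<in> E" "x = r *\<^sub>R a" by blast
  have "body_norm E ((c * r) *\<^sub>R a) \<le> c * r" using r c by (intro body_norm_le) auto
  also have "\<dots> \<le> c * (body_norm E x + e / c)" using r c by simp
  also have "\<dots> = c * body_norm E x + e" using c by (simp add: distrib_left)
  finally show "body_norm E (c *\<^sub>R x) \<le> c * body_norm E x + e" by (simp add: r(4))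
qed

lemma body_norm_scale:
  assumes E: "centrally_symmetric_body E" and c: "c > 0"
  shows "body_norm E (c *\<^sub>R x) = c * body_norm E x"
proof (rule antisym[OF body_norm_scale_le[OF assms]])
  have "body_norm E ((1 / c) *\<^sub>R (c *\<^sub>R x)) \<le> (1 / c) * body_norm E (c *\<^sub>R x)"
    using c by (intro body_norm_scale_le[OF E]) auto
  then show "c * body_norm E x \<le> body_norm E (c *\<^sub>R x)" using c by (simp add: field_simps)
qed

lemma body_norm_lipschitz:
  fixes E :: "(real^'m) set"
  assumes E: "centrally_symmetric_body E"
  shows "\<exists>L>0. \<forall>x y. body_norm E x \<le> body_norm E y + L * norm (x - y)"
proof -
  obtain \<rho> where \<rho>: "\<rho> > 0" "cball 0 \<rho> \<subseteq> E" using centrally_symmetric_body_ball[OF E] by blast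
  have le: "body_norm E v \<le> (1 / \<rho>) * norm v" for v
  proof (cases "v = 0")
    case True
    \<comment> \<open>Homogeneity with factor 2 forces the value 0 at the origin.\<close>
    have "body_norm E ((2::real) *\<^sub>R (0 :: real^'m)) = 2 * body_norm E 0" by (rule body_norm_scale[OF E]) simp
    then show ?thesis using True by simp
  next
    case False
    have "(\<rho> / norm v) *\<^sub>R v \<in> E" using \<rho> False by (auto simp: subset_iff)
    then have "body_norm E ((norm v / \<rho>) *\<^sub>R ((\<rho> / norm v) *\<^sub>R v)) \<le> norm v / \<rho>"
      using \<rho>(1) False by (intro body_norm_le) auto
    then show ?thesis using \<rho>(1) False by simp
  qed
  have "body_norm E x \<le> body_norm E y + (1 / \<rho>) * norm (x - y)" for x y
    using body_norm_add_le[OF E, of y "x - y"] le[of "x - y"] by simp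
  then show ?thesis using \<rho>(1) by (intro exI[of _ "1 / \<rho>"]) auto
qed

section \<open>Regularity of the game values in space and time\<close>

lemma maxmin_le_add:
  fixes S :: "(real^'n^'m) set"
  assumes S: "S \<noteq> {}" "S \<subseteq> admissible" and le: "\<And>z. norm z \<le> CARD('n) \<Longrightarrow> G z \<le> G' z + c"
    and bd: "\<And>z. norm z \<le> CARD('n) \<Longrightarrow> G' z \<le> b"
  shows "maxmin S G \<le> maxmin S G' + c"
proof (rule field_le_epsilon)
  fix e :: real assume "e > 0"
  then have "maxmin S G - e < maxmin S G" by simp
  from less_maxminD[OF this S(1)] obtain A where A: "A \<in> S" "\<forall>\<epsilon>\<in>sign_vectors. maxmin S G - e < G (A *v \<epsilon>)" by blast
  have "maxmin S G - e - c \<le> maxmin S G'"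
  proof (rule le_maxmin[OF A(1) _ S(2) bd])
    fix \<epsilon> :: "real^'n" assume \<epsilon>: "\<epsilon> \<in> sign_vectors"
    show "maxmin S G - e - c \<le> G' (A *v \<epsilon>)"
      using A(2)[rule_format, OF \<epsilon>] le[OF norm_admissible_mult[OF subsetD[OF S(2) A(1)] \<epsilon>]] by linarith
  qed
  then show "maxmin S G \<le> maxmin S G' + c + e" by simp
qed

context
  fixes E :: "(real^'m) set" and L :: real
  assumes L: "L > 0" and lip0: "\<And>x y. body_norm E x \<le> body_norm E y + L * norm (x - y)"
begin

lemma game_value_Suc:
  "game_value_steps TYPE('n::finite) E (Suc k) y = maxmin (admissible :: (real^'n^'m) set) (\<lambda>z. game_value_steps TYPE('n) E k (y + z))"
  by (simp add: maxmin_def)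

lemma game_value_lipschitz:
  "game_value_steps TYPE('n::finite) E k x \<le> game_value_steps TYPE('n) E k y + L * norm (x - y)"
proof (induction k arbitrary: x y)
  case 0
  then show ?case using lip0 by simp
next
  case (Suc k)
  show ?case unfolding game_value_Suc
  proof (rule maxmin_le_add[where b = "game_value_steps TYPE('n) E k y + L * CARD('n)"])
    show "(admissible :: (real^'n^'m) set) \<noteq> {}" using zero_admissible by blast
    fix z :: "real^'m" assume z: "norm z \<le> CARD('n)"
    show "game_value_steps TYPE('n) E k (x + z) \<le> game_value_steps TYPE('n) E k (y + z) + L * norm (x - y)"
      using Suc[of "x + z" "y + z"] by simp
    have "L * norm z \<le> L * CARD('n)" using z L by simp
    then show "game_value_steps TYPE('n) E k (y + z) \<le> game_value_steps TYPE('n) E k y + L * CARD('n)"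
      using Suc[of "y + z" y] by simp
  qed auto
qed

lemma game_value_bound:
  assumes "norm z \<le> CARD('n)"
  shows "game_value_steps TYPE('n::finite) E k (y + z) \<le> game_value_steps TYPE('n) E k y + L * CARD('n)"
proof -
  have "L * norm z \<le> L * CARD('n)" using assms L by simp
  then show ?thesis using game_value_lipschitz[where 'n = 'n, of k "y + z" y] by simp
qed

text \<open>The maximizing player may pass by playing the zero matrix.\<close>

lemma game_value_mono:
  "game_value_steps TYPE('n::finite) E k y \<le> game_value_steps TYPE('n) E (k + j) y"
proof (induction j)
  case (Suc j)
  have "game_value_steps TYPE('n) E (k + j) y \<le> game_value_steps TYPE('n) E (Suc (k + j)) y"
    unfolding game_value_Suc
    by (rule le_maxmin[OF zero_admissible _ subset_refl game_value_bound]) simp_all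
  then show ?case using Suc by simp
qed simp

text \<open>The minimizing player can always choose the sign so that the squared distance to \<open>x\<close> grows by
  at most \<open>n\<^sup>2\<close> per step.\<close>

lemma game_value_quadratic_growth:
  assumes r: "r > 0"
  shows "game_value_steps TYPE('n::finite) E (i + k) y \<le>
    game_value_steps TYPE('n) E i x + L * (r / 2 + ((norm (y - x))\<^sup>2 + k * (CARD('n))\<^sup>2) / (2 * r))"
proof (induction k arbitrary: y)
  case 0
  \<comment> \<open>Young's inequality trades the distance for its square, whose growth per step is
    controlled; \<open>r\<close> stays free for later optimization.\<close>
  have "0 \<le> (norm (y - x) - r)\<^sup>2" by simp
  then have "norm (y - x) \<le> r / 2 + (norm (y - x))\<^sup>2 / (2 * r)"
    using r by (simp add: power2_diff field_simps power2_eq_square)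
  then have "L * norm (y - x) \<le> L * (r / 2 + (norm (y - x))\<^sup>2 / (2 * r))" using L by simp
  then show ?case using game_value_lipschitz[where 'n = 'n, of i y x] by simp
next
  case (Suc k)
  show ?case unfolding add_Suc_right game_value_Suc
  proof (rule maxmin_le)
    show "(admissible :: (real^'n^'m) set) \<noteq> {}" using zero_admissible by blast
    fix A :: "real^'n^'m" assume A: "A \<in> admissible"
    obtain \<epsilon>0 :: "real^'n" where \<epsilon>0: "\<epsilon>0 \<in> sign_vectors" using sign_vectors_nonempty by blast
    obtain \<epsilon> where \<epsilon>: "\<epsilon> \<in> sign_vectors" "(y - x) \<bullet> (A *v \<epsilon>) \<le> 0"
    proof (cases "(y - x) \<bullet> (A *v \<epsilon>0) \<le> 0")
      case True
      then show ?thesis using that \<epsilon>0 by blast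
    next
      case False
      have "A *v (- \<epsilon>0) = - (A *v \<epsilon>0)"
        using matrix_vector_mult_diff_distrib[of A 0 \<epsilon>0] by simp
      then show ?thesis using False that[of "- \<epsilon>0"] uminus_sign_vectors[OF \<epsilon>0] by simp
    qed
    have "(norm (y + A *v \<epsilon> - x))\<^sup>2 = (norm (y - x))\<^sup>2 + 2 * ((y - x) \<bullet> (A *v \<epsilon>)) + (norm (A *v \<epsilon>))\<^sup>2"
      unfolding power2_norm_eq_inner by (simp add: inner_diff_left inner_diff_right inner_add_left inner_add_right inner_commute)
    also have "\<dots> \<le> (norm (y - x))\<^sup>2 + (CARD('n))\<^sup>2"
      using \<epsilon>(2) power_mono[OF norm_admissible_mult[OF A \<epsilon>(1)] norm_ge_zero, of 2] unfolding of_nat_power by linarith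
    finally have "((norm (y + A *v \<epsilon> - x))\<^sup>2 + k * (CARD('n))\<^sup>2) / (2 * r) \<le> ((norm (y - x))\<^sup>2 + (Suc k) * (CARD('n))\<^sup>2) / (2 * r)"
      using r by (intro divide_right_mono) (auto simp: algebra_simps)
    then have "L * (r / 2 + ((norm (y + A *v \<epsilon> - x))\<^sup>2 + k * (CARD('n))\<^sup>2) / (2 * r)) \<le> L * (r / 2 + ((norm (y - x))\<^sup>2 + (Suc k) * (CARD('n))\<^sup>2) / (2 * r))"
      using L by simp
    then show "\<exists>\<epsilon>\<in>sign_vectors. game_value_steps TYPE('n) E (i + k) (y + A *v \<epsilon>) \<le>
        game_value_steps TYPE('n) E i x + L * (r / 2 + ((norm (y - x))\<^sup>2 + (Suc k) * (CARD('n))\<^sup>2) / (2 * r))"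
      using Suc[of "y + A *v \<epsilon>"] by (intro bexI[OF _ \<epsilon>(1)]) linarith
  qed
qed

lemma game_value_sqrt_growth:
  "game_value_steps TYPE('n::finite) E (i + k) x \<le> game_value_steps TYPE('n) E i x + L * CARD('n) * sqrt k"
proof (cases "k = 0")
  case False
  \<comment> \<open>Balances \<open>r / 2\<close> against the accumulated growth \<open>k\<close>
    times \<open>n^2 / (2 r)\<close>; at the balance the two add up to \<open>r\<close>.\<close>
  define r where "r = CARD('n) * sqrt k"
  have r: "r > 0" using False by (simp add: r_def)
  have "k * (CARD('n))\<^sup>2 = r\<^sup>2" by (simp add: r_def power_mult_distrib)
  then have "r / 2 + ((norm (x - x))\<^sup>2 + k * (CARD('n))\<^sup>2) / (2 * r) = r" using r by (simp add: power2_eq_square)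
  then show ?thesis using game_value_quadratic_growth[where 'n = 'n, OF r, of i k x x] by (simp add: r_def mult.assoc)
qed simp

lemma rescaled_value_lipschitz:
  assumes "\<delta> > 0"
  shows "rescaled_value TYPE('n::finite) E \<delta> (x, t) \<le> rescaled_value TYPE('n) E \<delta> (y, t) + L * norm (x - y)"
proof -
  have "norm (x /\<^sub>R \<delta> - y /\<^sub>R \<delta>) = norm (x - y) / \<delta>"
    using assms by (simp add: scaleR_right_diff_distrib[symmetric] divide_inverse)
  then have "game_value_steps TYPE('n) E k (x /\<^sub>R \<delta>) \<le> game_value_steps TYPE('n) E k (y /\<^sub>R \<delta>) + L * (norm (x - y) / \<delta>)" for k
    using game_value_lipschitz[where 'n = 'n, of k "x /\<^sub>R \<delta>" "y /\<^sub>R \<delta>"] by simp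
  from mult_left_mono[OF this, of \<delta>] show ?thesis
    using assms by (simp add: rescaled_value_def game_value_def distrib_left)
qed

text \<open>The floor extends the rescaled values to all times as step functions. The number of
  steps between \<open>s\<close> and \<open>t\<close> is at most
  \<open>(t - s) / \<delta>^2 + 1\<close>, and this rounding is the source of
  \<open>\<delta>^2\<close> under the root.\<close>

lemma rescaled_value_time_mono:
  assumes "\<delta> > 0" "s \<le> t" "t \<le> 0"
  shows "rescaled_value TYPE('n::finite) E \<delta> (x, t) \<le> rescaled_value TYPE('n) E \<delta> (x, s)"
    and "rescaled_value TYPE('n::finite) E \<delta> (x, s) \<le> rescaled_value TYPE('n) E \<delta> (x, t) + L * CARD('n) * sqrt (t - s + \<delta>\<^sup>2)"
proof -
  define i j where "i = nat (- \<lfloor>t / \<delta>\<^sup>2\<rfloor>)" and "j = nat (- \<lfloor>s / \<delta>\<^sup>2\<rfloor>) - i"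
  have d2: "\<delta>\<^sup>2 > 0" using assms by simp
  have st: "s / \<delta>\<^sup>2 \<le> t / \<delta>\<^sup>2" "t / \<delta>\<^sup>2 \<le> 0" using assms d2 by (auto simp: divide_right_mono divide_nonpos_pos)
  have fl: "\<lfloor>s / \<delta>\<^sup>2\<rfloor> \<le> \<lfloor>t / \<delta>\<^sup>2\<rfloor>" using st(1) by (rule floor_mono)
  have fl0: "\<lfloor>t / \<delta>\<^sup>2\<rfloor> \<le> 0" "\<lfloor>s / \<delta>\<^sup>2\<rfloor> \<le> 0" using floor_mono[OF st(2)] order_trans[OF fl floor_mono[OF st(2)]] by simp_all
  have j: "nat (- \<lfloor>s / \<delta>\<^sup>2\<rfloor>) = i + j" "real j = of_int (\<lfloor>t / \<delta>\<^sup>2\<rfloor> - \<lfloor>s / \<delta>\<^sup>2\<rfloor>)"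
    unfolding j_def i_def using fl fl0 by linarith+
  have "real j \<le> t / \<delta>\<^sup>2 - s / \<delta>\<^sup>2 + 1" unfolding j(2) using floor_correct[of "t / \<delta>\<^sup>2"] floor_correct[of "s / \<delta>\<^sup>2"] by linarith
  also have "\<dots> = (t - s + \<delta>\<^sup>2) / \<delta>\<^sup>2" using assms by (simp add: diff_divide_distrib add_divide_distrib)
  finally have "sqrt j \<le> sqrt (t - s + \<delta>\<^sup>2) / \<delta>"
    using assms by (metis real_sqrt_abs2 real_sqrt_divide real_sqrt_le_iff power2_eq_square abs_of_pos)
  then have "\<delta> * sqrt j \<le> sqrt (t - s + \<delta>\<^sup>2)" using assms(1) by (simp add: pos_le_divide_eq mult.commute)
  then have sq: "L * CARD('n) * (\<delta> * sqrt j) \<le> L * CARD('n) * sqrt (t - s + \<delta>\<^sup>2)" using L by (intro mult_left_mono) auto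
  have W: "rescaled_value TYPE('n) E \<delta> (x, t) = \<delta> * game_value_steps TYPE('n) E i (x /\<^sub>R \<delta>)"
    "rescaled_value TYPE('n) E \<delta> (x, s) = \<delta> * game_value_steps TYPE('n) E (i + j) (x /\<^sub>R \<delta>)"
    using j(1) by (simp_all add: rescaled_value_def game_value_def i_def)
  show "rescaled_value TYPE('n::finite) E \<delta> (x, t) \<le> rescaled_value TYPE('n) E \<delta> (x, s)"
    unfolding W using game_value_mono assms(1) by simp
  have "\<delta> * game_value_steps TYPE('n) E (i + j) (x /\<^sub>R \<delta>) \<le> \<delta> * (game_value_steps TYPE('n) E i (x /\<^sub>R \<delta>) + L * CARD('n) * sqrt j)"
    using game_value_sqrt_growth assms(1) by simp
  then show "rescaled_value TYPE('n::finite) E \<delta> (x, s) \<le> rescaled_value TYPE('n) E \<delta> (x, t) + L * CARD('n) * sqrt (t - s + \<delta>\<^sup>2)"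
    unfolding W using sq by (simp add: distrib_left mult_ac)
qed

lemma rescaled_value_equicontinuous:
  assumes "\<delta> > 0" "s \<le> 0" "t \<le> 0"
  shows "\<bar>rescaled_value TYPE('n::finite) E \<delta> (x, t) - rescaled_value TYPE('n) E \<delta> (y, s)\<bar> \<le>
     L * norm (x - y) + L * CARD('n) * sqrt (\<bar>t - s\<bar> + \<delta>\<^sup>2)"
proof -
  let ?W = "rescaled_value TYPE('n) E \<delta>" and ?h = "L * CARD('n) * sqrt (\<bar>t - s\<bar> + \<delta>\<^sup>2)"
  have h: "?h \<ge> 0" using L by simp
  have "\<bar>?W (x, t) - ?W (x, s)\<bar> \<le> ?h"
  proof (cases "s \<le> t")
    case True
    then show ?thesis using rescaled_value_time_mono[where 'n = 'n, OF assms(1) True assms(3), of x] h by (simp add: abs_le_iff)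
  next
    case False
    then have "t \<le> s" by simp
    then show ?thesis using rescaled_value_time_mono[where 'n = 'n, OF assms(1) \<open>t \<le> s\<close> assms(2), of x] h by (simp add: abs_le_iff)
  qed
  moreover have "\<bar>?W (x, s) - ?W (y, s)\<bar> \<le> L * norm (x - y)"
    using rescaled_value_lipschitz[where 'n = 'n, OF assms(1), of x s y] rescaled_value_lipschitz[where 'n = 'n, OF assms(1), of y s x]
    by (simp add: abs_le_iff norm_minus_commute)
  ultimately show ?thesis by linarith
qed

text \<open>Dynamic programming at every negative time, on the lattice or off it: the time shift
  raises the floor by exactly one, and for \<open>t < 0\<close> the floor is at most -1, so a step
  remains. The rest moves the factor \<open>\<delta>\<close> inside the supremum.\<close>

lemma rescaled_value_step:
  assumes "\<delta> > 0" "t < 0"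
  shows "rescaled_value TYPE('n::finite) E \<delta> (x, t) =
    maxmin (admissible :: (real^'n^'m) set) (\<lambda>z. rescaled_value TYPE('n) E \<delta> (x + \<delta> *\<^sub>R z, t + \<delta>\<^sup>2))"
proof -
  define k where "k = nat (- \<lfloor>(t + \<delta>\<^sup>2) / \<delta>\<^sup>2\<rfloor>)"
  have d2: "\<delta>\<^sup>2 > 0" using assms by simp
  have "(t + \<delta>\<^sup>2) / \<delta>\<^sup>2 = t / \<delta>\<^sup>2 + 1" using assms by (simp add: add_divide_distrib)
  moreover have "\<lfloor>t / \<delta>\<^sup>2\<rfloor> \<le> -1" using assms d2 floor_less_zero[of "t / \<delta>\<^sup>2"] divide_neg_pos[of t "\<delta>\<^sup>2"] by linarith
  ultimately have k: "nat (- \<lfloor>t / \<delta>\<^sup>2\<rfloor>) = Suc k" by (simp add: k_def Suc_nat_eq_nat_zadd1)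
  have "rescaled_value TYPE('n) E \<delta> (x, t) = \<delta> * maxmin (admissible :: (real^'n^'m) set) (\<lambda>z. game_value_steps TYPE('n) E k (x /\<^sub>R \<delta> + z))"
    using game_value_Suc[where 'n = 'n, of k "x /\<^sub>R \<delta>"] by (simp add: rescaled_value_def game_value_def k del: game_value_steps.simps)
  also have "\<dots> = maxmin (admissible :: (real^'n^'m) set) (\<lambda>z. \<delta> * game_value_steps TYPE('n) E k (x /\<^sub>R \<delta> + z))"
    (is "\<delta> * maxmin ?A ?G = maxmin ?A ?G'")
  proof -
    have ne: "?A \<noteq> {}" using zero_admissible by blast
    show ?thesis
    proof (rule antisym)
      have "maxmin ?A ?G \<le> maxmin ?A ?G' / \<delta>"
      proof (rule maxmin_le[OF ne])
        fix A assume A: "A \<in> ?A"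
        show "\<exists>\<epsilon>\<in>sign_vectors. ?G (A *v \<epsilon>) \<le> maxmin ?A ?G' / \<delta>"
        proof (rule ccontr)
          assume n: "\<not> ?thesis"
          define c where "c = (MIN \<epsilon>\<in>sign_vectors. ?G (A *v \<epsilon>))"
          have "c \<in> (\<lambda>\<epsilon>. ?G (A *v \<epsilon>)) ` sign_vectors"
            unfolding c_def by (intro Min_in finite_imageI finite_sign_vectors) (simp add: sign_vectors_nonempty)
          then have "c > maxmin ?A ?G' / \<delta>" using n by auto
          moreover have "\<delta> * c \<le> maxmin ?A ?G'"
          proof (rule le_maxmin[OF A _ subset_refl])
            show "\<delta> * c \<le> ?G' (A *v \<epsilon>)" if "\<epsilon> \<in> sign_vectors" for \<epsilon>
              using Min_sign_le[OF that, of "\<lambda>\<epsilon>. ?G (A *v \<epsilon>)"] assms(1) by (simp add: c_def)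
            show "?G' z \<le> \<delta> * (game_value_steps TYPE('n) E k (x /\<^sub>R \<delta>) + L * CARD('n))" if "norm z \<le> CARD('n)" for z
              using game_value_bound[where 'n = 'n, OF that] assms(1) by simp
          qed
          ultimately show False using assms(1) by (simp add: field_simps)
        qed
      qed
      then show "\<delta> * maxmin ?A ?G \<le> maxmin ?A ?G'" using assms(1) by (simp add: field_simps)
      show "maxmin ?A ?G' \<le> \<delta> * maxmin ?A ?G"
      proof (rule maxmin_le[OF ne])
        fix A assume A: "A \<in> ?A"
        define c where "c = (MIN \<epsilon>\<in>sign_vectors. ?G (A *v \<epsilon>))"
        have "c \<in> (\<lambda>\<epsilon>. ?G (A *v \<epsilon>)) ` sign_vectors"
          unfolding c_def by (intro Min_in finite_imageI finite_sign_vectors) (simp add: sign_vectors_nonempty)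
        then obtain \<epsilon> where \<epsilon>: "\<epsilon> \<in> sign_vectors" "?G (A *v \<epsilon>) = c" by auto
        have "c \<le> maxmin ?A ?G"
          by (rule le_maxmin[OF A _ subset_refl game_value_bound]) (auto simp: c_def intro: Min_sign_le)
        then show "\<exists>\<epsilon>\<in>sign_vectors. ?G' (A *v \<epsilon>) \<le> \<delta> * maxmin ?A ?G"
          using \<epsilon> assms(1) by (intro bexI[OF _ \<epsilon>(1)]) simp
      qed
    qed
  qed
  also have "(\<lambda>z. \<delta> * game_value_steps TYPE('n) E k (x /\<^sub>R \<delta> + z)) = (\<lambda>z. rescaled_value TYPE('n) E \<delta> (x + \<delta> *\<^sub>R z, t + \<delta>\<^sup>2))"
    using assms(1) by (simp add: rescaled_value_def game_value_def k_def scaleR_right_distrib)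
  finally show ?thesis .
qed

end

lemma rescaled_value_0:
  assumes "centrally_symmetric_body E" "\<delta> > 0"
  shows "rescaled_value N E \<delta> (x, 0) = body_norm E x"
  using body_norm_scale[OF assms(1), of "inverse \<delta>" x] assms(2)
  by (simp add: rescaled_value_def game_value_def)

section \<open>Consistency of the game with the equation\<close>

lemma has_real_derivative_along_line:
  fixes f :: "'a::real_inner \<Rightarrow> real"
  assumes "(f has_derivative (\<lambda>v. g \<bullet> v)) (at (a + s *\<^sub>R b))"
  shows "((\<lambda>s. f (a + s *\<^sub>R b)) has_real_derivative g \<bullet> b) (at s)"
proof -
  have "((\<lambda>s. a + s *\<^sub>R b) has_derivative (\<lambda>s. s *\<^sub>R b)) (at s)"
    by (auto intro!: derivative_eq_intros)
  from has_derivative_compose[OF this assms]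
  show ?thesis unfolding has_field_derivative_def by (simp add: mult_commute_abs)
qed

lemma divide_double_cancel: "b \<noteq> 0 \<Longrightarrow> a / (2 * b) * b = (a::real) / 2"
  by simp

text \<open>The mean value theorem along \<open>w\<close>, applied to the increment of
  \<open>f\<close> in direction \<open>v\<close>, reduces the mixed difference to gradients at two
  points; differentiability of the gradient at the single point \<open>x\<close> then suffices. Each
  of the two gradients contributes one \<open>e\<close>.\<close>

lemma second_difference_hessian:
  fixes f :: "real^'m \<Rightarrow> real"
  assumes grad: "\<And>y. (f has_derivative (\<lambda>v. g y \<bullet> v)) (at y)" and s: "s > 0" and e: "e \<ge> 0"
    and bd: "\<And>y. norm (y - x) \<le> s * (norm v + norm w) \<Longrightarrow> norm (g y - g x - h *v (y - x)) \<le> e * norm (y - x)"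
  shows "\<bar>f (x + s *\<^sub>R v + s *\<^sub>R w) - f (x + s *\<^sub>R v) - f (x + s *\<^sub>R w) + f x - s\<^sup>2 * ((h *v v) \<bullet> w)\<bar>
     \<le> 2 * e * s\<^sup>2 * (norm v + norm w)\<^sup>2"
proof -
  let ?F = "\<lambda>\<tau>. f (x + s *\<^sub>R v + \<tau> *\<^sub>R (s *\<^sub>R w)) - f (x + \<tau> *\<^sub>R (s *\<^sub>R w))"
  have D: "(?F has_real_derivative g (x + s *\<^sub>R v + \<tau> *\<^sub>R (s *\<^sub>R w)) \<bullet> (s *\<^sub>R w) - g (x + \<tau> *\<^sub>R (s *\<^sub>R w)) \<bullet> (s *\<^sub>R w)) (at \<tau>)" for \<tau>
    by (intro DERIV_diff has_real_derivative_along_line grad)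
  from MVT2[of 0 1 ?F, OF _ D] obtain \<tau> where \<tau>: "0 < \<tau>" "\<tau> < 1"
    "?F 1 - ?F 0 = g (x + s *\<^sub>R v + \<tau> *\<^sub>R (s *\<^sub>R w)) \<bullet> (s *\<^sub>R w) - g (x + \<tau> *\<^sub>R (s *\<^sub>R w)) \<bullet> (s *\<^sub>R w)" by auto
  define a where "a = s *\<^sub>R v + \<tau> *\<^sub>R (s *\<^sub>R w)"
  define b where "b = \<tau> *\<^sub>R (s *\<^sub>R w)"
  have tw: "norm (\<tau> *\<^sub>R (s *\<^sub>R w)) \<le> s * norm w" using \<tau> s by (simp add: mult_left_le_one_le)
  have na: "norm a \<le> s * (norm v + norm w)"
    unfolding a_def by (rule norm_triangle_le) (use tw s in \<open>simp add: distrib_left\<close>)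
  have nb: "norm b \<le> s * (norm v + norm w)"
    unfolding b_def by (rule order_trans[OF tw]) (use s in \<open>simp add: mult_left_mono\<close>)
  have ra: "norm (g (x + a) - g x - h *v a) \<le> e * (s * (norm v + norm w))"
    using bd[of "x + a"] na mult_left_mono[OF na e] by simp
  have rb: "norm (g (x + b) - g x - h *v b) \<le> e * (s * (norm v + norm w))"
    using bd[of "x + b"] nb mult_left_mono[OF nb e] by simp
  have ab: "h *v a - h *v b = s *\<^sub>R (h *v v)"
    by (simp add: a_def b_def matrix_vector_right_distrib matrix_vector_mult_scaleR)
  have "norm (g (x + a) - g (x + b) - s *\<^sub>R (h *v v)) \<le> 2 * e * s * (norm v + norm w)"
  proof -
    have "g (x + a) - g (x + b) - s *\<^sub>R (h *v v) = (g (x + a) - g x - h *v a) - (g (x + b) - g x - h *v b)"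
      by (simp add: ab[symmetric])
    then have "norm (g (x + a) - g (x + b) - s *\<^sub>R (h *v v)) = norm ((g (x + a) - g x - h *v a) - (g (x + b) - g x - h *v b))"
      by (rule arg_cong)
    then show ?thesis using norm_triangle_ineq4[of "g (x + a) - g x - h *v a" "g (x + b) - g x - h *v b"] ra rb by simp
  qed
  then have "norm (g (x + a) - g (x + b) - s *\<^sub>R (h *v v)) * norm (s *\<^sub>R w) \<le> (2 * e * s * (norm v + norm w)) * (s * (norm v + norm w))"
    using s e by (intro mult_mono) (auto simp: mult_left_mono)
  moreover have "f (x + s *\<^sub>R v + s *\<^sub>R w) - f (x + s *\<^sub>R v) - f (x + s *\<^sub>R w) + f x - s\<^sup>2 * ((h *v v) \<bullet> w)
     = (g (x + a) - g (x + b) - s *\<^sub>R (h *v v)) \<bullet> (s *\<^sub>R w)"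
    using \<tau>(3) by (simp add: a_def b_def inner_diff_left power2_eq_square add.assoc right_diff_distrib)
  ultimately show ?thesis
    using Cauchy_Schwarz_ineq2[of "g (x + a) - g (x + b) - s *\<^sub>R (h *v v)" "s *\<^sub>R w"]
    by (simp add: power2_eq_square mult_ac)
qed

text \<open>The mixed second difference is symmetric in \<open>v\<close> and \<open>w\<close>, hence
  so is the form of \<open>h\<close> that it approximates. Symmetry of \<open>h\<close> is not part
  of the notion of test function, whereas the envelopes see only symmetric matrices.\<close>

lemma hessian_symmetric:
  fixes f :: "real^'m \<Rightarrow> real"
  assumes grad: "\<And>y. (f has_derivative (\<lambda>v. g y \<bullet> v)) (at y)" and hess: "(g has_derivative (\<lambda>v. h *v v)) (at x)"
  shows "h \<in> symmetric_matrices"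
proof -
  have sym: "(h *v v) \<bullet> w = (h *v w) \<bullet> v" for v w
  proof -
    let ?c = "norm v + norm w"
    have "\<bar>(h *v v) \<bullet> w - (h *v w) \<bullet> v\<bar> \<le> 4 * e * ?c\<^sup>2" if e: "e > 0" for e
    proof -
      obtain d where d: "d > 0" "\<And>y. norm (y - x) < d \<Longrightarrow> norm (g y - g x - h *v (y - x)) \<le> e * norm (y - x)"
        using hess e unfolding has_derivative_at_alt by blast
      define s where "s = d / (2 * (?c + 1))"
      have c: "?c \<ge> 0" by simp
      have s: "s > 0" using d(1) c by (simp add: s_def add_nonneg_pos)
      have "s * ?c \<le> s * (?c + 1)" using s by simp
      also have "?c + 1 \<noteq> 0" using c by linarith
      then have "s * (?c + 1) = d / 2" unfolding s_def by (rule divide_double_cancel)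
      finally have sc: "s * ?c < d" using d(1) by simp
      have 1: "\<bar>f (x + s *\<^sub>R v + s *\<^sub>R w) - f (x + s *\<^sub>R v) - f (x + s *\<^sub>R w) + f x - s\<^sup>2 * ((h *v v) \<bullet> w)\<bar>
         \<le> 2 * e * s\<^sup>2 * ?c\<^sup>2"
        by (rule second_difference_hessian[OF grad s]) (use e d(2) sc in auto)
      have 2: "\<bar>f (x + s *\<^sub>R w + s *\<^sub>R v) - f (x + s *\<^sub>R w) - f (x + s *\<^sub>R v) + f x - s\<^sup>2 * ((h *v w) \<bullet> v)\<bar>
         \<le> 2 * e * s\<^sup>2 * (norm w + norm v)\<^sup>2"
        by (rule second_difference_hessian[OF grad s]) (use e d(2) sc in \<open>auto simp: add.commute\<close>)
      have "\<bar>s\<^sup>2 * ((h *v v) \<bullet> w) - s\<^sup>2 * ((h *v w) \<bullet> v)\<bar> \<le> 4 * e * s\<^sup>2 * ?c\<^sup>2"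
        using 1 2 by (simp add: add.commute[of "norm w"] add.assoc add.commute[of "s *\<^sub>R w"])
      then have "s\<^sup>2 * \<bar>(h *v v) \<bullet> w - (h *v w) \<bullet> v\<bar> \<le> s\<^sup>2 * (4 * e * ?c\<^sup>2)"
        unfolding right_diff_distrib[symmetric] abs_mult by (simp add: mult_ac)
      then show ?thesis by (rule mult_left_le_imp_le) (use s in simp)
    qed
    note * = this
    have aux: "c \<noteq> 0 \<Longrightarrow> 4 * (a / (8 * c)) * c = a / 2" for a c :: real by simp
    show ?thesis
    proof (rule ccontr)
      assume "(h *v v) \<bullet> w \<noteq> (h *v w) \<bullet> v"
      then have p: "\<bar>(h *v v) \<bullet> w - (h *v w) \<bullet> v\<bar> > 0" by simp
      \<comment> \<open>Then \<open>4 * e * ?c^2\<close> is at most half of the asymmetry that it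
        should bound.\<close>
      define e where "e = \<bar>(h *v v) \<bullet> w - (h *v w) \<bullet> v\<bar> / (8 * (?c\<^sup>2 + 1))"
      have e: "e > 0" using p by (simp add: e_def add_nonneg_pos)
      have "4 * e * ?c\<^sup>2 \<le> 4 * e * (?c\<^sup>2 + 1)" using e by simp
      also have "\<dots> = \<bar>(h *v v) \<bullet> w - (h *v w) \<bullet> v\<bar> / 2"
      proof -
        have "?c\<^sup>2 + 1 \<noteq> 0" using zero_le_power2[of ?c] by linarith
        then show ?thesis unfolding e_def by (rule aux)
      qed
      finally have "\<bar>(h *v v) \<bullet> w - (h *v w) \<bullet> v\<bar> \<le> \<bar>(h *v v) \<bullet> w - (h *v w) \<bullet> v\<bar> / 2"
        using *[OF e] by (rule order_trans[rotated])
      moreover have False if "c \<le> c / 2" "0 < c" for c :: real using that by linarith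
      ultimately show False using p by blast
    qed
  qed
  have "h $ i $ j = h $ j $ i" for i j
    using sym[of "axis j 1" "axis i 1"]
    by (simp add: matrix_vector_mult_basis inner_axis column_def)
  then show ?thesis by (simp add: symmetric_matrices_def transpose_def vec_eq_iff)
qed

lemma test_function_hessian_symmetric:
  assumes "test_function_with \<phi> d g h" "t < 0"
  shows "h (x, t) \<in> symmetric_matrices"
proof (rule hessian_symmetric)
  show "((\<lambda>y. \<phi> (y, t)) has_derivative (\<lambda>v. g (y, t) \<bullet> v)) (at y)" for y
    using assms by (simp add: test_function_with_def)
  show "((\<lambda>y. g (y, t)) has_derivative (\<lambda>v. h (x, t) *v v)) (at x)"
    using assms by (simp add: test_function_with_def)
qed

text \<open>The gradient stays at the moving point \<open>(x, t)\<close>, because it enters with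
  weight \<open>\<delta>\<close> only; time derivative and Hessian have weight
  \<open>\<delta>^2\<close> and can be frozen at \<open>(x0, t0)\<close> by continuity. Half of
  \<open>\<kappa>\<close> pays for each, uniformly in \<open>v\<close>.\<close>

lemma test_function_taylor_upper:
  fixes x0 :: "real^'m"
  assumes test: "test_function_with \<phi> d g h" and t0: "t0 < 0" and k: "\<kappa> > 0" and B: "B \<ge> 0"
  shows "\<exists>r>0. \<forall>x t \<delta> v. dist (x, t) (x0, t0) < r \<longrightarrow> 0 < \<delta> \<longrightarrow> \<delta> < r \<longrightarrow> norm v \<le> B \<longrightarrow> t < 0 \<and> t + \<delta>\<^sup>2 < 0 \<and>
    \<phi> (x + \<delta> *\<^sub>R v, t + \<delta>\<^sup>2) \<le> \<phi> (x, t) + \<delta> * (g (x, t) \<bullet> v) +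
      \<delta>\<^sup>2 * (d (x0, t0) + (h (x0, t0) *v v) \<bullet> v / 2 + \<kappa>)"
proof -
  have Dt: "((\<lambda>s. \<phi> (x, s)) has_real_derivative d (x, t)) (at t)"
    and Dx: "((\<lambda>y. \<phi> (y, t)) has_derivative (\<lambda>v. g (x, t) \<bullet> v)) (at x)"
    and Dg: "((\<lambda>y. g (y, t)) has_derivative (\<lambda>v. h (x, t) *v v)) (at x)" if "t < 0" for x t
    using test that unfolding test_function_with_def by auto
  have op: "open ((UNIV :: (real^'m) set) \<times> {..<0::real})" by (intro open_Times) auto
  have z0: "(x0, t0) \<in> UNIV \<times> {..<0::real}" using t0 by simp
  have cd: "isCont d (x0, t0)" and ch: "isCont h (x0, t0)"
    using test op z0 unfolding test_function_with_def by (auto simp: continuous_on_eq_continuous_at)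
  define e2 where "e2 = \<kappa> / (2 * (B\<^sup>2 + 1))"
  have e2: "e2 > 0" using k by (simp add: e2_def add_nonneg_pos)
  have e2B: "e2 * B\<^sup>2 \<le> \<kappa> / 2"
  proof -
    have "e2 * B\<^sup>2 \<le> e2 * (B\<^sup>2 + 1)" using e2 by simp
    also have "B\<^sup>2 + 1 \<noteq> 0" using zero_le_power2[of B] by linarith
    then have "e2 * (B\<^sup>2 + 1) = \<kappa> / 2" unfolding e2_def by (rule divide_double_cancel)
    finally show ?thesis .
  qed
  obtain r1 where r1: "r1 > 0" "\<And>z. dist z (x0, t0) < r1 \<Longrightarrow> dist (d z) (d (x0, t0)) < \<kappa> / 2"
    using cd k unfolding continuous_at_eps_delta by (metis half_gt_zero)
  obtain r2 where r2: "r2 > 0" "\<And>z. dist z (x0, t0) < r2 \<Longrightarrow> dist (h z) (h (x0, t0)) < e2"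
    using ch e2 unfolding continuous_at_eps_delta by metis
  define r3 where "r3 = min r1 (min r2 (- t0))"
  have r3: "r3 > 0" "r3 \<le> r1" "r3 \<le> r2" "r3 \<le> - t0" using r1 r2 t0 by (auto simp: r3_def)
  \<comment> \<open>A step reaches at most \<open>\<delta> * (B + 1)\<close> beyond a point at
    distance below \<open>r\<close>, so everything stays within \<open>r3\<close>.\<close>
  define r where "r = min 1 (r3 / (B + 3))"
  have r: "r > 0" "r \<le> 1" using r3 B by (auto simp: r_def)
  have rB: "r * (B + 3) \<le> r3"
  proof -
    have "r * (B + 3) \<le> r3 / (B + 3) * (B + 3)" using B by (intro mult_right_mono) (auto simp: r_def)
    then show ?thesis using B by simp
  qed
  show ?thesis
  proof (intro exI[of _ r] conjI allI impI r(1))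
    fix x :: "real^'m" and t \<delta> :: real and v :: "real^'m"
    assume z: "dist (x, t) (x0, t0) < r" and \<delta>: "0 < \<delta>" "\<delta> < r" and v: "norm v \<le> B"
    have d1: "\<delta>\<^sup>2 \<le> \<delta>" using \<delta> r by (simp add: power2_eq_square mult_left_le)
    have near: "dist (x + s *\<^sub>R (\<delta> *\<^sub>R v), t + \<tau>) (x0, t0) < r3" if "0 \<le> s" "s \<le> 1" "0 \<le> \<tau>" "\<tau> \<le> \<delta>\<^sup>2" for s \<tau>
    proof -
      have "dist (x + s *\<^sub>R (\<delta> *\<^sub>R v), t + \<tau>) (x, t) = norm (s *\<^sub>R (\<delta> *\<^sub>R v), \<tau>)" by (simp add: dist_norm)
      also have "\<dots> \<le> norm (s *\<^sub>R (\<delta> *\<^sub>R v)) + norm \<tau>" by (rule norm_Pair_le)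
      also have "norm (s *\<^sub>R (\<delta> *\<^sub>R v)) \<le> 1 * (\<delta> * B)"
        unfolding norm_scaleR using that \<delta> v by (intro mult_mono) auto
      also have "norm \<tau> \<le> \<delta>" using that d1 by simp
      finally have "dist (x + s *\<^sub>R (\<delta> *\<^sub>R v), t + \<tau>) (x, t) \<le> \<delta> * (B + 1)" by (simp add: distrib_left)
      also have "\<dots> \<le> r * (B + 1)" using \<delta> B by (intro mult_right_mono) auto
      finally have "dist (x + s *\<^sub>R (\<delta> *\<^sub>R v), t + \<tau>) (x0, t0) < r * (B + 1) + r"
        using z dist_triangle[of "(x + s *\<^sub>R (\<delta> *\<^sub>R v), t + \<tau>)" "(x0, t0)" "(x, t)"] by linarith
      also have "\<dots> \<le> r * (B + 3)" using r by (simp add: distrib_left)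
      finally show ?thesis using rB by linarith
    qed
    have neg: "t + \<tau> < 0" if "0 \<le> \<tau>" "\<tau> \<le> \<delta>\<^sup>2" for \<tau>
    proof -
      have "dist (t + \<tau>) t0 \<le> dist (x + 0 *\<^sub>R (\<delta> *\<^sub>R v), t + \<tau>) (x0, t0)" using dist_snd_le[of "(x + 0 *\<^sub>R (\<delta> *\<^sub>R v), t + \<tau>)" "(x0, t0)"] by simp
      then show ?thesis using near[of 0 \<tau>] that r3(4) by (simp add: dist_real_def)
    qed
    show "t < 0" using neg[of 0] \<delta> by simp
    show "t + \<delta>\<^sup>2 < 0" using neg[of "\<delta>\<^sup>2"] by simp
    define y where "y = x + \<delta> *\<^sub>R v"
    have "\<exists>z>t. z < t + \<delta>\<^sup>2 \<and> \<phi> (y, t + \<delta>\<^sup>2) - \<phi> (y, t) = (t + \<delta>\<^sup>2 - t) * d (y, z)"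
      by (rule MVT2) (use \<delta> neg[of "_ - t"] in \<open>auto intro!: Dt\<close>)
    then obtain \<tau> where \<tau>: "t < \<tau>" "\<tau> < t + \<delta>\<^sup>2" "\<phi> (y, t + \<delta>\<^sup>2) - \<phi> (y, t) = \<delta>\<^sup>2 * d (y, \<tau>)" by auto
    have "dist (y, \<tau>) (x0, t0) < r3" using near[of 1 "\<tau> - t"] \<tau> by (simp add: y_def)
    then have "d (y, \<tau>) \<le> d (x0, t0) + \<kappa> / 2" using r1(2)[of "(y, \<tau>)"] r3(2) unfolding dist_real_def by linarith
    then have time: "\<phi> (y, t + \<delta>\<^sup>2) - \<phi> (y, t) \<le> \<delta>\<^sup>2 * (d (x0, t0) + \<kappa> / 2)"
      unfolding \<tau>(3) by (intro mult_left_mono) auto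
    let ?hz = "h (x0, t0)"
    define \<theta> where "\<theta> s = \<phi> (x + s *\<^sub>R (\<delta> *\<^sub>R v), t) - s * (g (x, t) \<bullet> (\<delta> *\<^sub>R v)) - s\<^sup>2 * \<delta>\<^sup>2 * ((?hz *v v) \<bullet> v) / 2" for s
    have D\<theta>: "(\<theta> has_real_derivative g (x + s *\<^sub>R (\<delta> *\<^sub>R v), t) \<bullet> (\<delta> *\<^sub>R v) - g (x, t) \<bullet> (\<delta> *\<^sub>R v) - s * \<delta>\<^sup>2 * ((?hz *v v) \<bullet> v)) (at s)" for s
    proof -
      have 1: "((\<lambda>s. s * c) has_real_derivative c) (at s)" for c by (auto intro!: derivative_eq_intros)
      have 2: "((\<lambda>s. s\<^sup>2 * \<delta>\<^sup>2 * c / 2) has_real_derivative s * \<delta>\<^sup>2 * c) (at s)" for c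
        by (auto intro!: derivative_eq_intros)
      show ?thesis unfolding \<theta>_def
        by (intro DERIV_diff 1 2 has_real_derivative_along_line[where f = "\<lambda>y. \<phi> (y, t)"] Dx \<open>t < 0\<close>)
    qed
    from MVT2[of 0 1 \<theta>, OF _ D\<theta>] obtain s where s: "0 < s" "s < 1"
      "\<theta> 1 - \<theta> 0 = g (x + s *\<^sub>R (\<delta> *\<^sub>R v), t) \<bullet> (\<delta> *\<^sub>R v) - g (x, t) \<bullet> (\<delta> *\<^sub>R v) - s * \<delta>\<^sup>2 * ((?hz *v v) \<bullet> v)" by auto
    let ?G = "\<lambda>s'. g (x + s' *\<^sub>R (\<delta> *\<^sub>R v), t) \<bullet> (\<delta> *\<^sub>R v)"
    have DG: "(?G has_real_derivative (h (x + s' *\<^sub>R (\<delta> *\<^sub>R v), t) *v (\<delta> *\<^sub>R v)) \<bullet> (\<delta> *\<^sub>R v)) (at s')" for s'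
    proof -
      have "((\<lambda>s. x + s *\<^sub>R (\<delta> *\<^sub>R v)) has_derivative (\<lambda>s. s *\<^sub>R (\<delta> *\<^sub>R v))) (at s')"
        by (auto intro!: derivative_eq_intros)
      note has_derivative_inner_left[OF has_derivative_compose[OF this Dg[OF \<open>t < 0\<close>]], of "\<delta> *\<^sub>R v"]
      then show ?thesis unfolding has_field_derivative_def
        by (rule has_derivative_eq_rhs) (simp add: fun_eq_iff matrix_vector_mult_scaleR)
    qed
    have "\<exists>s'>0. s' < s \<and> ?G s - ?G 0 = (s - 0) * ((h (x + s' *\<^sub>R (\<delta> *\<^sub>R v), t) *v (\<delta> *\<^sub>R v)) \<bullet> (\<delta> *\<^sub>R v))"
      by (rule MVT2) (use s DG in auto)
    then obtain s' where s': "0 < s'" "s' < s" "?G s - ?G 0 = s * ((h (x + s' *\<^sub>R (\<delta> *\<^sub>R v), t) *v (\<delta> *\<^sub>R v)) \<bullet> (\<delta> *\<^sub>R v))" by auto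
    let ?h = "h (x + s' *\<^sub>R (\<delta> *\<^sub>R v), t)"
    have "dist (x + s' *\<^sub>R (\<delta> *\<^sub>R v), t) (x0, t0) < r3" using near[of s' 0] s s' by simp
    from r2(2)[OF order.strict_trans2[OF this r3(3)]] have nh: "norm (?h - ?hz) < e2" by (simp only: dist_norm)
    have "\<theta> 1 - \<theta> 0 = s * \<delta>\<^sup>2 * (((?h - ?hz) *v v) \<bullet> v)"
      using s(3) s'(3) by (simp add: matrix_vector_mult_scaleR matrix_vector_mult_diff_rdistrib inner_diff_left power2_eq_square algebra_simps)
    also have "\<dots> \<le> s * \<delta>\<^sup>2 * (\<kappa> / 2)"
    proof (rule mult_left_mono)
      have "((?h - ?hz) *v v) \<bullet> v \<le> norm (?h - ?hz) * (norm v)\<^sup>2" using abs_quadratic_form_le[of "?h - ?hz" v] by simp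
      also have "\<dots> \<le> e2 * B\<^sup>2" using nh v e2 by (intro mult_mono power_mono) auto
      finally show "((?h - ?hz) *v v) \<bullet> v \<le> \<kappa> / 2" using e2B by linarith
    qed (use s in auto)
    also have "\<dots> \<le> 1 * \<delta>\<^sup>2 * (\<kappa> / 2)" using s k by (intro mult_right_mono) auto
    finally have "\<phi> (y, t) - \<delta> * (g (x, t) \<bullet> v) - \<delta>\<^sup>2 * ((?hz *v v) \<bullet> v) / 2 - \<phi> (x, t) \<le> \<delta>\<^sup>2 * (\<kappa> / 2)"
      by (simp add: \<theta>_def y_def)
    then show "\<phi> (x + \<delta> *\<^sub>R v, t + \<delta>\<^sup>2) \<le> \<phi> (x, t) + \<delta> * (g (x, t) \<bullet> v) + \<delta>\<^sup>2 * (d (x0, t0) + (?hz *v v) \<bullet> v / 2 + \<kappa>)"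
      using time unfolding y_def[symmetric] by (simp add: algebra_simps)
  qed
qed


text \<open>Consistency of a family \<open>W\<close> of discrete solutions with the operator \<open>F\<close>, tested at approximate
  maxima: these exist although \<open>W \<delta>\<close> is discontinuous in time, and the error \<open>\<delta>\<^sup>3\<close> is negligible
  against the time step \<open>\<delta>\<^sup>2\<close>.\<close>

definition consistent :: "(real^'m^'m \<Rightarrow> real^'m \<Rightarrow> real) \<Rightarrow> (real \<Rightarrow> (real^'m) \<times> real \<Rightarrow> real) \<Rightarrow> bool" where
  "consistent F W \<longleftrightarrow> (\<forall>\<phi> d g h x0 t0 \<kappa> \<rho>. test_function_with \<phi> d g h \<and> t0 < 0 \<and> \<kappa> > 0 \<and> \<rho> > 0 \<longrightarrow>
     (\<exists>r>0. \<forall>\<delta> z. 0 < \<delta> \<longrightarrow> \<delta> < r \<longrightarrow> dist z (x0, t0) < r \<longrightarrow>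
        (\<forall>z'. dist z' (x0, t0) < \<rho> \<longrightarrow> W \<delta> z' - \<phi> z' \<le> W \<delta> z - \<phi> z + \<delta> ^ 3) \<longrightarrow>
        (\<exists>M' p'. M' \<in> symmetric_matrices \<and> dist (M', p') (h (x0, t0), g (x0, t0)) < \<kappa> \<and> - \<kappa> \<le> d (x0, t0) + F M' p' / 2)))"

section \<open>One step of the game against a test function\<close>

text \<open>The quadratic form is even in \<open>\<epsilon>\<close>, so the sign of a minimizer is
  free and can be spent on the linear term. Two matrices occur because the form will be evaluated on
  projected moves and the linear term on the original ones.\<close>

lemma exists_minimizing_sign:
  fixes A B :: "real^'n^'m" and p :: "real^'m" and M :: "real^'m^'m"
  shows "\<exists>\<epsilon>\<in>sign_vectors. p \<bullet> (A *v \<epsilon>) \<le> 0 \<and> (\<forall>\<epsilon>'\<in>sign_vectors. (M *v (B *v \<epsilon>)) \<bullet> (B *v \<epsilon>) \<le> (M *v (B *v \<epsilon>')) \<bullet> (B *v \<epsilon>'))"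
proof -
  define f where "f \<epsilon> = (M *v (B *v \<epsilon>)) \<bullet> (B *v \<epsilon>)" for \<epsilon> :: "real^'n"
  have um: "C *v (- \<epsilon>) = - (C *v \<epsilon>)" for C :: "real^'n^'m" and \<epsilon>
    using matrix_vector_mult_diff_distrib[of C 0 \<epsilon>] by simp
  have feven: "f (- \<epsilon>) = f \<epsilon>" for \<epsilon>
    using matrix_vector_mult_diff_distrib[of M 0 "B *v \<epsilon>"] by (simp add: f_def um)
  obtain \<epsilon>0 where e0: "\<epsilon>0 \<in> sign_vectors" "\<And>\<epsilon>'. \<epsilon>' \<in> sign_vectors \<Longrightarrow> f \<epsilon>0 \<le> f \<epsilon>'"
  proof -
    have "Min (f ` sign_vectors) \<in> f ` sign_vectors"
      by (intro Min_in finite_imageI finite_sign_vectors) (simp add: sign_vectors_nonempty)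
    then obtain \<epsilon>0 where "\<epsilon>0 \<in> sign_vectors" "f \<epsilon>0 = Min (f ` sign_vectors)" by auto
    then show ?thesis using that[of \<epsilon>0] Min_le[OF finite_imageI[OF finite_sign_vectors], of _ f] by auto
  qed
  define \<epsilon> where "\<epsilon> = (if p \<bullet> (A *v \<epsilon>0) \<le> 0 then \<epsilon>0 else - \<epsilon>0)"
  have "\<epsilon> \<in> sign_vectors" "p \<bullet> (A *v \<epsilon>) \<le> 0" "\<And>\<epsilon>'. \<epsilon>' \<in> sign_vectors \<Longrightarrow> f \<epsilon> \<le> f \<epsilon>'"
    using e0 uminus_sign_vectors[OF e0(1)] by (auto simp: \<epsilon>_def um feven)
  then show ?thesis unfolding f_def by blast
qed

text \<open>The gradient of the test function forces an optimal \<open>A\<close> to be nearly orthogonal to it, and its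
  projection is then a competitor for \<open>H\<^sub>n\<close>. If the gradient vanishes at the base point, no
  constraint is needed.\<close>

lemma consistent_H_op:
  assumes step: "\<And>\<delta> x t. \<delta> > 0 \<Longrightarrow> t < 0 \<Longrightarrow>
      W \<delta> (x, t) = maxmin (admissible :: (real^'n^'m) set) (\<lambda>z. W \<delta> (x + \<delta> *\<^sub>R z, t + \<delta>\<^sup>2))"
  shows "consistent (H_op TYPE('n::finite)) W"
  unfolding consistent_def
proof (intro allI impI, elim conjE)
  fix \<phi> d :: "(real^'m) \<times> real \<Rightarrow> real" and g :: "(real^'m) \<times> real \<Rightarrow> real^'m"
    and h :: "(real^'m) \<times> real \<Rightarrow> real^'m^'m" and x0 :: "real^'m" and t0 \<kappa> \<rho> :: real
  assume test: "test_function_with \<phi> d g h" and t0: "t0 < 0" and k: "\<kappa> > 0" and \<rho>: "\<rho> > 0"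
  define n where "n = real CARD('n)"
  have n: "n \<ge> 1" by (simp add: n_def Suc_leI)
  have n0: "n \<ge> 0" using n by simp
  let ?hz = "h (x0, t0)" and ?dz = "d (x0, t0)" and ?gz = "g (x0, t0)"
  have "\<kappa> / 8 > 0" using k by simp
  from test_function_taylor_upper[OF test t0 this n0]
  obtain r1 where r1: "r1 > 0" "\<And>x t \<delta> v. dist (x, t) (x0, t0) < r1 \<Longrightarrow> 0 < \<delta> \<Longrightarrow> \<delta> < r1 \<Longrightarrow> norm v \<le> n \<Longrightarrow>
     t < 0 \<and> t + \<delta>\<^sup>2 < 0 \<and> \<phi> (x + \<delta> *\<^sub>R v, t + \<delta>\<^sup>2) \<le> \<phi> (x, t) + \<delta> * (g (x, t) \<bullet> v) +
      \<delta>\<^sup>2 * (?dz + (?hz *v v) \<bullet> v / 2 + \<kappa> / 8)" by blast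
  have op: "open ((UNIV :: (real^'m) set) \<times> {..<0::real})" by (intro open_Times) auto
  have cg: "isCont g (x0, t0)"
    using test op t0 unfolding test_function_with_def by (auto simp: continuous_on_eq_continuous_at)
  \<comment> \<open>If the gradient at the base point is not 0, nearby gradients keep more than half
    of its norm, which controls the projection error.\<close>
  define m where "m = (if ?gz = 0 then \<kappa> else min \<kappa> (norm ?gz / 2))"
  have m: "m > 0" "m \<le> \<kappa>" using k by (auto simp: m_def)
  obtain r2 where r2: "r2 > 0" "\<And>z. dist z (x0, t0) < r2 \<Longrightarrow> dist (g z) ?gz < m"
    using cg m(1) unfolding continuous_at_eps_delta by metis
  \<comment> \<open>Bounds the bracket multiplying \<open>\<delta>\<close> in \<open>main\<close>,
    so that a nonpositive \<open>p \<bullet> (A *v \<epsilon>)\<close> is at least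
    \<open>- \<delta> * K\<close>.\<close>
  define K where "K = \<bar>?dz\<bar> + norm ?hz * n\<^sup>2 + \<kappa> + 2"
  have K: "K > 0" using k by (simp add: K_def add_nonneg_pos)
  \<comment> \<open>Projection changes the quadratic form by at most
    \<open>2 * \<delta> * c\<close>, which is below \<open>\<kappa> / 2\<close> once
    \<open>\<delta> \<le> \<kappa> / (4 * c)\<close>.\<close>
  define c where "c = (if ?gz = 0 then 1 else n * norm ?hz * K / (norm ?gz / 2) + 1)"
  have c: "c > 0" using n K by (auto simp: c_def intro!: add_nonneg_pos divide_nonneg_pos)
  define r where "r = min (min r1 r2) (min (min 1 (\<rho> / (n + 2))) (min (\<kappa> / 16) (\<kappa> / (4 * c))))"
  have r: "r > 0" "r \<le> r1" "r \<le> r2" "r \<le> 1" "r \<le> \<rho> / (n + 2)" "r \<le> \<kappa> / 16" "r \<le> \<kappa> / (4 * c)"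
    unfolding r_def using r1(1) r2(1) \<rho> n k c
    by (simp_all only: min_less_iff_conj min_le_iff_disj order_refl) simp_all
  show "\<exists>r>0. \<forall>\<delta> z. 0 < \<delta> \<longrightarrow> \<delta> < r \<longrightarrow> dist z (x0, t0) < r \<longrightarrow>
        (\<forall>z'. dist z' (x0, t0) < \<rho> \<longrightarrow> W \<delta> z' - \<phi> z' \<le> W \<delta> z - \<phi> z + \<delta> ^ 3) \<longrightarrow>
        (\<exists>M' p'. M' \<in> symmetric_matrices \<and> dist (M', p') (?hz, ?gz) < \<kappa> \<and> - \<kappa> \<le> ?dz + H_op TYPE('n) M' p' / 2)"
  proof (intro exI[of _ r] conjI allI impI r(1))
    fix \<delta> and z :: "(real^'m) \<times> real"
    assume \<delta>: "0 < \<delta>" "\<delta> < r" and dz: "dist z (x0, t0) < r"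
      and mx: "\<forall>z'. dist z' (x0, t0) < \<rho> \<longrightarrow> W \<delta> z' - \<phi> z' \<le> W \<delta> z - \<phi> z + \<delta> ^ 3"
    obtain x t where z: "z = (x, t)" by (cases z)
    define p where "p = g (x, t)"
    have near: "dist (x + \<delta> *\<^sub>R v, t + \<delta>\<^sup>2) (x0, t0) < \<rho>" if "norm v \<le> n" for v
    proof -
      have "dist (x + \<delta> *\<^sub>R v, t + \<delta>\<^sup>2) (x, t) = norm (\<delta> *\<^sub>R v, \<delta>\<^sup>2)" by (simp add: dist_norm)
      also have "\<dots> \<le> norm (\<delta> *\<^sub>R v) + norm (\<delta>\<^sup>2)" by (rule norm_Pair_le)
      also have "norm (\<delta> *\<^sub>R v) \<le> \<delta> * n" using \<delta> that by simp
      also have "norm (\<delta>\<^sup>2) \<le> \<delta>" using \<delta> r(4) by (simp add: power2_eq_square mult_left_le)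
      finally have "dist (x + \<delta> *\<^sub>R v, t + \<delta>\<^sup>2) (x0, t0) < \<delta> * n + \<delta> + r"
        using dist_triangle[of "(x + \<delta> *\<^sub>R v, t + \<delta>\<^sup>2)" "(x0, t0)" "(x, t)"] dz z by simp
      also have "\<dots> \<le> r * n + r + r" using \<delta> n by (intro add_mono mult_right_mono) auto
      also have "\<dots> = r * (n + 2)" by (simp add: algebra_simps)
      also have "\<dots> \<le> \<rho>" using r(5) n by (simp add: pos_le_divide_eq)
      finally show ?thesis .
    qed
    have taylor: "t < 0 \<and> t + \<delta>\<^sup>2 < 0 \<and> \<phi> (x + \<delta> *\<^sub>R v, t + \<delta>\<^sup>2) \<le> \<phi> (x, t) + \<delta> * (p \<bullet> v) +
      \<delta>\<^sup>2 * (?dz + (?hz *v v) \<bullet> v / 2 + \<kappa> / 8)" if "norm v \<le> n" for v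
      unfolding p_def using r1(2)[of x t \<delta> v] dz z \<delta> r(2) that by simp
    have t: "t < 0" using taylor[of 0] n by simp
    \<comment> \<open>Optimality up to \<open>\<delta>^3\<close>, the same slack as in the
      approximate maximum; divided by \<open>\<delta>^2\<close> the two leave
      \<open>2 * \<delta>\<close>.\<close>
    have "W \<delta> (x, t) - \<delta> ^ 3 < maxmin (admissible :: (real^'n^'m) set) (\<lambda>z. W \<delta> (x + \<delta> *\<^sub>R z, t + \<delta>\<^sup>2))"
      using step[OF \<delta>(1) t, of x] \<delta>(1) by simp
    from less_maxminD[OF this] zero_admissible obtain A :: "real^'n^'m" where A: "A \<in> admissible"
      "\<And>\<epsilon>. \<epsilon> \<in> sign_vectors \<Longrightarrow> W \<delta> (x, t) - \<delta> ^ 3 < W \<delta> (x + \<delta> *\<^sub>R (A *v \<epsilon>), t + \<delta>\<^sup>2)" by blast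
    have nA: "norm (A *v \<epsilon>) \<le> n" if "\<epsilon> \<in> sign_vectors" for \<epsilon>
      using norm_admissible_mult[OF A(1) that] by (simp add: n_def)
    have d3: "\<delta> ^ 3 = \<delta> * \<delta>\<^sup>2" by (simp add: power3_eq_cube power2_eq_square)
    have main: "0 \<le> (p \<bullet> (A *v \<epsilon>)) + \<delta> * (?dz + (?hz *v (A *v \<epsilon>)) \<bullet> (A *v \<epsilon>) / 2 + \<kappa> / 8 + 2 * \<delta>)"
      if e: "\<epsilon> \<in> sign_vectors" for \<epsilon>
    proof -
      let ?v = "A *v \<epsilon>"
      have "W \<delta> (x + \<delta> *\<^sub>R ?v, t + \<delta>\<^sup>2) - \<phi> (x + \<delta> *\<^sub>R ?v, t + \<delta>\<^sup>2) \<le> W \<delta> z - \<phi> z + \<delta> ^ 3"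
        using mx near[OF nA[OF e]] by blast
      then have "\<phi> (x, t) - 2 * \<delta> ^ 3 \<le> \<phi> (x + \<delta> *\<^sub>R ?v, t + \<delta>\<^sup>2)" using A(2)[OF e] by (simp add: z)
      also have "\<dots> \<le> \<phi> (x, t) + \<delta> * (p \<bullet> ?v) + \<delta>\<^sup>2 * (?dz + (?hz *v ?v) \<bullet> ?v / 2 + \<kappa> / 8)"
        using taylor[OF nA[OF e]] by simp
      finally have "0 \<le> \<delta> * ((p \<bullet> ?v) + \<delta> * (?dz + (?hz *v ?v) \<bullet> ?v / 2 + \<kappa> / 8 + 2 * \<delta>))"
        by (simp add: d3 power2_eq_square algebra_simps)
      then show ?thesis using \<delta>(1) by (simp add: zero_le_mult_iff)
    qed
    have quad: "0 \<le> ?dz + (?hz *v (A *v \<epsilon>)) \<bullet> (A *v \<epsilon>) / 2 + \<kappa> / 4"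
      if e: "\<epsilon> \<in> sign_vectors" and pe: "p \<bullet> (A *v \<epsilon>) \<le> 0" for \<epsilon>
    proof -
      have "0 \<le> \<delta> * (?dz + (?hz *v (A *v \<epsilon>)) \<bullet> (A *v \<epsilon>) / 2 + \<kappa> / 8 + 2 * \<delta>)"
        using main[OF e] pe by linarith
      then have "0 \<le> ?dz + (?hz *v (A *v \<epsilon>)) \<bullet> (A *v \<epsilon>) / 2 + \<kappa> / 8 + 2 * \<delta>"
        using \<delta>(1) by (simp add: zero_le_mult_iff)
      then show ?thesis using \<delta>(2) r(6) by linarith
    qed
    have sym: "?hz \<in> symmetric_matrices" by (rule test_function_hessian_symmetric[OF test t0])
    show "\<exists>M' p'. M' \<in> symmetric_matrices \<and> dist (M', p') (?hz, ?gz) < \<kappa> \<and> - \<kappa> \<le> ?dz + H_op TYPE('n) M' p' / 2"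
    proof (cases "?gz = 0")
      case True
      \<comment> \<open>The witness gradient is 0, where every admissible matrix competes, although
        the gradient \<open>p\<close> at \<open>(x, t)\<close> may differ from 0.\<close>
      obtain \<epsilon> where \<epsilon>: "\<epsilon> \<in> sign_vectors" "p \<bullet> (A *v \<epsilon>) \<le> 0"
        "\<And>\<epsilon>'. \<epsilon>' \<in> sign_vectors \<Longrightarrow> (?hz *v (A *v \<epsilon>)) \<bullet> (A *v \<epsilon>) \<le> (?hz *v (A *v \<epsilon>')) \<bullet> (A *v \<epsilon>')"
        using exists_minimizing_sign[of p A ?hz A] by blast
      have "(?hz *v (A *v \<epsilon>)) \<bullet> (A *v \<epsilon>) \<le> H_op TYPE('n) ?hz 0"
        using A(1) \<epsilon>(3) by (intro H_op_ge) (simp_all add: orthogonal_admissible_0)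
      then have "- \<kappa> \<le> ?dz + H_op TYPE('n) ?hz 0 / 2" using quad[OF \<epsilon>(1,2)] k by linarith
      then show ?thesis using sym True k by (intro exI[of _ ?hz] exI[of _ 0]) auto
    next
      case False
      have pg: "dist p ?gz < m" using r2(2)[of "(x, t)"] dz z r(3) by (simp add: p_def)
      then have "norm (p - ?gz) < norm ?gz / 2" using False by (simp add: m_def dist_norm)
      then have np: "norm p > norm ?gz / 2" using norm_triangle_ineq2[of ?gz p] by (simp add: norm_minus_commute)
      then have p0: "p \<noteq> 0" using norm_ge_zero[of ?gz] by auto
      let ?B = "proj_columns p A"
      have B: "?B \<in> orthogonal_admissible p" by (rule proj_columns_orthogonal_admissible[OF A(1) p0])
      have nB: "norm (?B *v \<epsilon>) \<le> n" if "\<epsilon> \<in> sign_vectors" for \<epsilon>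
        using norm_admissible_mult[OF subsetD[OF orthogonal_admissible_subset B] that] by (simp add: n_def)
      obtain \<epsilon> where \<epsilon>: "\<epsilon> \<in> sign_vectors" "p \<bullet> (A *v \<epsilon>) \<le> 0"
        "\<And>\<epsilon>'. \<epsilon>' \<in> sign_vectors \<Longrightarrow> (?hz *v (?B *v \<epsilon>)) \<bullet> (?B *v \<epsilon>) \<le> (?hz *v (?B *v \<epsilon>')) \<bullet> (?B *v \<epsilon>')"
        using exists_minimizing_sign[of p A ?hz ?B] by blast
      have HB: "(?hz *v (?B *v \<epsilon>)) \<bullet> (?B *v \<epsilon>) \<le> H_op TYPE('n) ?hz p"
        using B \<epsilon>(3) by (intro H_op_ge)
      have "?dz + (?hz *v (A *v \<epsilon>)) \<bullet> (A *v \<epsilon>) / 2 + \<kappa> / 8 + 2 * \<delta> \<le> K"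
      proof -
        have "(?hz *v (A *v \<epsilon>)) \<bullet> (A *v \<epsilon>) \<le> norm ?hz * n\<^sup>2"
          unfolding n_def by (rule quadratic_form_bound) (use nA[OF \<epsilon>(1)] in \<open>simp add: n_def\<close>)
        moreover have "norm ?hz * n\<^sup>2 \<ge> 0" by simp
        ultimately show ?thesis using \<delta>(2) r(4) k unfolding K_def by linarith
      qed
      from mult_left_mono[OF this, of \<delta>] have "- (p \<bullet> (A *v \<epsilon>)) \<le> \<delta> * K"
        using main[OF \<epsilon>(1)] \<delta>(1) by linarith
      then have "\<bar>(A *v \<epsilon>) \<bullet> p\<bar> \<le> \<delta> * K" using \<epsilon>(2) by (simp add: inner_commute)
      then have "norm (A *v \<epsilon> - ?B *v \<epsilon>) \<le> \<delta> * K / (norm ?gz / 2)"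
        unfolding norm_proj_columns_mult_diff[OF p0] using np \<delta>(1) K False by (intro frac_le) auto
      then have "2 * n * norm ?hz * norm (A *v \<epsilon> - ?B *v \<epsilon>) \<le> 2 * n * norm ?hz * (\<delta> * K / (norm ?gz / 2))"
        using n by (intro mult_left_mono) auto
      also have "\<dots> = 2 * \<delta> * (n * norm ?hz * K / (norm ?gz / 2))" by simp
      also have "\<dots> \<le> 2 * \<delta> * c" using \<delta>(1) False by (intro mult_left_mono) (simp_all add: c_def)
      also have "\<dots> \<le> \<kappa> / 2"
      proof -
        have "\<delta> \<le> \<kappa> / (4 * c)" using \<delta>(2) r(7) by linarith
        then show ?thesis using c by (simp add: field_simps)
      qed
      finally have "(?hz *v (A *v \<epsilon>)) \<bullet> (A *v \<epsilon>) - (?hz *v (?B *v \<epsilon>)) \<bullet> (?B *v \<epsilon>) \<le> \<kappa> / 2"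
        using quadratic_form_diff_le[OF nA[OF \<epsilon>(1)] nB[OF \<epsilon>(1)], of ?hz] by linarith
      then have "- \<kappa> \<le> ?dz + H_op TYPE('n) ?hz p / 2" using quad[OF \<epsilon>(1,2)] HB k by linarith
      moreover have "dist (?hz, p) (?hz, ?gz) < \<kappa>" using pg m(2) by (simp add: dist_Pair_Pair)
      ultimately show ?thesis using sym by blast
    qed
  qed
qed

text \<open>Now \<open>\<phi>\<close> touches \<open>- W\<close>, so the operator is taken at the
  negated jet. The maximizing player uses a near-optimal matrix for it, which is orthogonal to the
  gradient; the first-order term then vanishes for every reply, and vanishing gradients are no
  special case. The bound \<open>bdd\<close> feeds \<open>le_maxmin\<close>.\<close>

lemma consistent_reflect_H_op:
  assumes step: "\<And>\<delta> x t. \<delta> > 0 \<Longrightarrow> t < 0 \<Longrightarrow>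
      W \<delta> (x, t) = maxmin (admissible :: (real^'n^'m) set) (\<lambda>z. W \<delta> (x + \<delta> *\<^sub>R z, t + \<delta>\<^sup>2))"
    and bdd: "\<And>\<delta> x t. \<delta> > 0 \<Longrightarrow> t \<le> 0 \<Longrightarrow> \<exists>b. \<forall>z. norm z \<le> CARD('n) \<longrightarrow> W \<delta> (x + \<delta> *\<^sub>R z, t) \<le> b"
  shows "consistent (reflect_op (H_op TYPE('n::finite))) (\<lambda>\<delta> z. - W \<delta> z)"
  unfolding consistent_def
proof (intro allI impI, elim conjE)
  fix \<phi> d :: "(real^'m) \<times> real \<Rightarrow> real" and g :: "(real^'m) \<times> real \<Rightarrow> real^'m"
    and h :: "(real^'m) \<times> real \<Rightarrow> real^'m^'m" and x0 :: "real^'m" and t0 \<kappa> \<rho> :: real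
  assume test: "test_function_with \<phi> d g h" and t0: "t0 < 0" and k: "\<kappa> > 0" and \<rho>: "\<rho> > 0"
  define n where "n = real CARD('n)"
  have n: "n \<ge> 1" by (simp add: n_def Suc_leI)
  have n0: "n \<ge> 0" using n by simp
  let ?hz = "h (x0, t0)" and ?dz = "d (x0, t0)" and ?gz = "g (x0, t0)"
  have "\<kappa> / 8 > 0" using k by simp
  from test_function_taylor_upper[OF test t0 this n0]
  obtain r1 where r1: "r1 > 0" "\<And>x t \<delta> v. dist (x, t) (x0, t0) < r1 \<Longrightarrow> 0 < \<delta> \<Longrightarrow> \<delta> < r1 \<Longrightarrow> norm v \<le> n \<Longrightarrow>
     t < 0 \<and> t + \<delta>\<^sup>2 < 0 \<and> \<phi> (x + \<delta> *\<^sub>R v, t + \<delta>\<^sup>2) \<le> \<phi> (x, t) + \<delta> * (g (x, t) \<bullet> v) +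
      \<delta>\<^sup>2 * (?dz + (?hz *v v) \<bullet> v / 2 + \<kappa> / 8)" by blast
  have op: "open ((UNIV :: (real^'m) set) \<times> {..<0::real})" by (intro open_Times) auto
  have cg: "isCont g (x0, t0)"
    using test op t0 unfolding test_function_with_def by (auto simp: continuous_on_eq_continuous_at)
  obtain r2 where r2: "r2 > 0" "\<And>z. dist z (x0, t0) < r2 \<Longrightarrow> dist (g z) ?gz < \<kappa>"
    using cg k unfolding continuous_at_eps_delta by metis
  define r where "r = min (min r1 r2) (min (min 1 (\<rho> / (n + 2))) (\<kappa> / 16))"
  have r: "r > 0" "r \<le> r1" "r \<le> r2" "r \<le> 1" "r \<le> \<rho> / (n + 2)" "r \<le> \<kappa> / 16"
    unfolding r_def using r1(1) r2(1) \<rho> n k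
    by (simp_all only: min_less_iff_conj min_le_iff_disj order_refl) simp_all
  show "\<exists>r>0. \<forall>\<delta> z. 0 < \<delta> \<longrightarrow> \<delta> < r \<longrightarrow> dist z (x0, t0) < r \<longrightarrow>
        (\<forall>z'. dist z' (x0, t0) < \<rho> \<longrightarrow> - W \<delta> z' - \<phi> z' \<le> - W \<delta> z - \<phi> z + \<delta> ^ 3) \<longrightarrow>
        (\<exists>M' p'. M' \<in> symmetric_matrices \<and> dist (M', p') (?hz, ?gz) < \<kappa> \<and>
           - \<kappa> \<le> ?dz + reflect_op (H_op TYPE('n)) M' p' / 2)"
  proof (intro exI[of _ r] conjI allI impI r(1))
    fix \<delta> and z :: "(real^'m) \<times> real"
    assume \<delta>: "0 < \<delta>" "\<delta> < r" and dz: "dist z (x0, t0) < r"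
      and mx: "\<forall>z'. dist z' (x0, t0) < \<rho> \<longrightarrow> - W \<delta> z' - \<phi> z' \<le> - W \<delta> z - \<phi> z + \<delta> ^ 3"
    obtain x t where z: "z = (x, t)" by (cases z)
    define p where "p = g (x, t)"
    have near: "dist (x + \<delta> *\<^sub>R v, t + \<delta>\<^sup>2) (x0, t0) < \<rho>" if "norm v \<le> n" for v
    proof -
      have "dist (x + \<delta> *\<^sub>R v, t + \<delta>\<^sup>2) (x, t) = norm (\<delta> *\<^sub>R v, \<delta>\<^sup>2)" by (simp add: dist_norm)
      also have "\<dots> \<le> norm (\<delta> *\<^sub>R v) + norm (\<delta>\<^sup>2)" by (rule norm_Pair_le)
      also have "norm (\<delta> *\<^sub>R v) \<le> \<delta> * n" using \<delta> that by simp
      also have "norm (\<delta>\<^sup>2) \<le> \<delta>" using \<delta> r(4) by (simp add: power2_eq_square mult_left_le)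
      finally have "dist (x + \<delta> *\<^sub>R v, t + \<delta>\<^sup>2) (x0, t0) < \<delta> * n + \<delta> + r"
        using dist_triangle[of "(x + \<delta> *\<^sub>R v, t + \<delta>\<^sup>2)" "(x0, t0)" "(x, t)"] dz z by simp
      also have "\<dots> \<le> r * n + r + r" using \<delta> n by (intro add_mono mult_right_mono) auto
      also have "\<dots> = r * (n + 2)" by (simp add: algebra_simps)
      also have "\<dots> \<le> \<rho>" using r(5) n by (simp add: pos_le_divide_eq)
      finally show ?thesis .
    qed
    have taylor: "t < 0 \<and> t + \<delta>\<^sup>2 < 0 \<and> \<phi> (x + \<delta> *\<^sub>R v, t + \<delta>\<^sup>2) \<le> \<phi> (x, t) + \<delta> * (p \<bullet> v) +
      \<delta>\<^sup>2 * (?dz + (?hz *v v) \<bullet> v / 2 + \<kappa> / 8)" if "norm v \<le> n" for v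
      unfolding p_def using r1(2)[of x t \<delta> v] dz z \<delta> r(2) that by simp
    have t: "t < 0" "t + \<delta>\<^sup>2 < 0" using taylor[of 0] n by simp_all
    have sym: "?hz \<in> symmetric_matrices" by (rule test_function_hessian_symmetric[OF test t0])
    have "H_op TYPE('n) (- ?hz) (- p) - \<kappa> / 2 < H_op TYPE('n) (- ?hz) (- p)" using k by simp
    from less_H_opD[OF this] obtain A :: "real^'n^'m" where A: "A \<in> orthogonal_admissible (- p)"
      "\<And>\<epsilon>. \<epsilon> \<in> sign_vectors \<Longrightarrow> H_op TYPE('n) (- ?hz) (- p) - \<kappa> / 2 < (- ?hz *v (A *v \<epsilon>)) \<bullet> (A *v \<epsilon>)" by blast
    have A1: "A \<in> admissible" using A(1) orthogonal_admissible_subset by blast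
    let ?G = "\<lambda>z. W \<delta> (x + \<delta> *\<^sub>R z, t + \<delta>\<^sup>2)"
    obtain b where b: "\<And>z. norm z \<le> CARD('n) \<Longrightarrow> ?G z \<le> b" using bdd[OF \<delta>(1), of "t + \<delta>\<^sup>2" x] t(2) by auto
    have "Min ((\<lambda>\<epsilon>. ?G (A *v \<epsilon>)) ` sign_vectors) \<in> (\<lambda>\<epsilon>. ?G (A *v \<epsilon>)) ` sign_vectors"
      by (intro Min_in finite_imageI finite_sign_vectors) (simp add: sign_vectors_nonempty)
    then obtain \<epsilon> where \<epsilon>: "\<epsilon> \<in> sign_vectors" "Min ((\<lambda>\<epsilon>. ?G (A *v \<epsilon>)) ` sign_vectors) = ?G (A *v \<epsilon>)" by auto
    have "?G (A *v \<epsilon>) \<le> maxmin (admissible :: (real^'n^'m) set) ?G"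
      by (rule le_maxmin[OF A1 _ subset_refl b]) (auto simp: \<epsilon>(2)[symmetric] intro!: Min_le finite_imageI finite_sign_vectors)
    then have WG: "?G (A *v \<epsilon>) \<le> W \<delta> (x, t)" using step[OF \<delta>(1) t(1)] by simp
    let ?v = "A *v \<epsilon>"
    have nv: "norm ?v \<le> n" using norm_admissible_mult[OF A1 \<epsilon>(1)] by (simp add: n_def)
    have "- W \<delta> (x + \<delta> *\<^sub>R ?v, t + \<delta>\<^sup>2) - \<phi> (x + \<delta> *\<^sub>R ?v, t + \<delta>\<^sup>2) \<le> - W \<delta> z - \<phi> z + \<delta> ^ 3"
      using mx near[OF nv] by blast
    then have "\<phi> (x, t) - \<delta> ^ 3 \<le> \<phi> (x + \<delta> *\<^sub>R ?v, t + \<delta>\<^sup>2)" using WG by (simp add: z)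
    also have "\<dots> \<le> \<phi> (x, t) + \<delta> * (p \<bullet> ?v) + \<delta>\<^sup>2 * (?dz + (?hz *v ?v) \<bullet> ?v / 2 + \<kappa> / 8)"
      using taylor[OF nv] by simp
    also have "p \<bullet> ?v = 0" using orthogonal_admissible_inner[OF A(1), of \<epsilon>] by (simp add: inner_commute)
    finally have "0 \<le> \<delta>\<^sup>2 * (?dz + (?hz *v ?v) \<bullet> ?v / 2 + \<kappa> / 8 + \<delta>)"
      by (simp add: power3_eq_cube power2_eq_square algebra_simps)
    then have "0 \<le> ?dz + (?hz *v ?v) \<bullet> ?v / 2 + \<kappa> / 8 + \<delta>"
      using \<delta>(1) by (simp add: zero_le_mult_iff)
    moreover have "(?hz *v ?v) \<bullet> ?v < - H_op TYPE('n) (- ?hz) (- p) + \<kappa> / 2"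
      using A(2)[OF \<epsilon>(1)] by (simp add: uminus_matrix_vector_mult)
    ultimately have "- \<kappa> \<le> ?dz + reflect_op (H_op TYPE('n)) ?hz p / 2"
      using \<delta>(2) r(6) k unfolding reflect_op_def by linarith
    moreover have "dist (?hz, p) (?hz, ?gz) < \<kappa>"
      using r2(2)[of "(x, t)"] dz z r(3) by (simp add: dist_Pair_Pair p_def)
    ultimately show "\<exists>M' p'. M' \<in> symmetric_matrices \<and> dist (M', p') (?hz, ?gz) < \<kappa> \<and>
           - \<kappa> \<le> ?dz + reflect_op (H_op TYPE('n)) M' p' / 2"
      using sym by blast
  qed
qed

section \<open>Half-relaxed limits\<close>

lemma symmetric_matrix_inner:
  assumes "M \<in> symmetric_matrices"
  shows "(M *v v) \<bullet> w = (M *v w) \<bullet> (v :: real^'m)"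
proof -
  have "M *v v = v v* M" using assms transpose_matrix_vector[of M v] by (simp add: symmetric_matrices_def)
  then have "(M *v v) \<bullet> w = v \<bullet> (M *v w)" by (simp only: dot_lmul_matrix)
  then show ?thesis by (simp only: inner_commute)
qed

lemma test_function_add:
  assumes "test_function_with \<phi> d g h" "test_function_with \<phi>' d' g' h'"
  shows "test_function_with (\<lambda>z. \<phi> z + \<phi>' z) (\<lambda>z. d z + d' z) (\<lambda>z. g z + g' z) (\<lambda>z. h z + h' z)"
  unfolding test_function_with_def
proof (intro conjI allI impI)
  fix x t assume t: "t < (0::real)"
  have a: "((\<lambda>s. \<phi> (x, s)) has_real_derivative d (x, t)) (at t)"
    "((\<lambda>y. \<phi> (y, t)) has_derivative (\<lambda>v. g (x, t) \<bullet> v)) (at x)"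
    "((\<lambda>y. g (y, t)) has_derivative (\<lambda>v. h (x, t) *v v)) (at x)"
    using assms(1) t unfolding test_function_with_def by auto
  have b: "((\<lambda>s. \<phi>' (x, s)) has_real_derivative d' (x, t)) (at t)"
    "((\<lambda>y. \<phi>' (y, t)) has_derivative (\<lambda>v. g' (x, t) \<bullet> v)) (at x)"
    "((\<lambda>y. g' (y, t)) has_derivative (\<lambda>v. h' (x, t) *v v)) (at x)"
    using assms(2) t unfolding test_function_with_def by auto
  show "((\<lambda>s. \<phi> (x, s) + \<phi>' (x, s)) has_real_derivative d (x, t) + d' (x, t)) (at t)" by (rule DERIV_add[OF a(1) b(1)])
  show "((\<lambda>y. \<phi> (y, t) + \<phi>' (y, t)) has_derivative (\<lambda>v. (g (x, t) + g' (x, t)) \<bullet> v)) (at x)"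
    unfolding inner_add_left by (rule has_derivative_add[OF a(2) b(2)])
  show "((\<lambda>y. g (y, t) + g' (y, t)) has_derivative (\<lambda>v. (h (x, t) + h' (x, t)) *v v)) (at x)"
    unfolding matrix_vector_mult_add_rdistrib by (rule has_derivative_add[OF a(3) b(3)])
qed (use assms in \<open>auto simp: test_function_with_def intro: continuous_on_add\<close>)

lemma test_function_time:
  assumes "\<And>t. (f has_real_derivative f' t) (at t)" "continuous_on UNIV f'"
  shows "test_function_with (\<lambda>z :: (real^'b) \<times> real. f (snd z)) (\<lambda>z. f' (snd z)) (\<lambda>z. 0) (\<lambda>z. 0)"
proof -
  have z1: "(\<bullet>) (0 :: real^'b) = (\<lambda>_. 0)" and z2: "(*v) (0 :: real^'b^'b) = (\<lambda>_. 0)" by (auto simp: fun_eq_iff)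
  show ?thesis using assms(1) unfolding test_function_with_def z1 z2
    by (auto intro!: continuous_on_compose2[OF assms(2)] continuous_intros)
qed

text \<open>The cross term \<open>b\<close> and the time coefficient \<open>c\<close> admit every
  quadratic polynomial in space-time, in particular the paraboloids delivered by the maximum
  principle.\<close>

lemma test_function_quadratic:
  fixes M :: "real^'m^'m"
  assumes M: "M \<in> symmetric_matrices"
  shows "test_function_with
    (\<lambda>z. k + p \<bullet> (fst z - x0) + a * (snd z - t0) + (M *v (fst z - x0)) \<bullet> (fst z - x0) / 2
       + (snd z - t0) * (b \<bullet> (fst z - x0)) + c * (snd z - t0)\<^sup>2 / 2)
    (\<lambda>z. a + b \<bullet> (fst z - x0) + c * (snd z - t0))
    (\<lambda>z. p + M *v (fst z - x0) + (snd z - t0) *\<^sub>R b)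
    (\<lambda>z. M)"
  unfolding test_function_with_def fst_conv snd_conv
proof (intro conjI allI impI)
  fix x :: "real^'m" and t :: real
  show "((\<lambda>s. k + p \<bullet> (x - x0) + a * (s - t0) + (M *v (x - x0)) \<bullet> (x - x0) / 2 + (s - t0) * (b \<bullet> (x - x0)) + c * (s - t0)\<^sup>2 / 2)
     has_real_derivative a + b \<bullet> (x - x0) + c * (t - t0)) (at t)"
    by (auto intro!: derivative_eq_intros)
  have L: "((\<lambda>y. M *v (y - x0)) has_derivative (\<lambda>v. M *v v)) (at x)"
    by (rule bounded_linear.has_derivative[OF matrix_vector_mul_bounded_linear]) (auto intro!: derivative_eq_intros)
  have q: "((\<lambda>y. (M *v (y - x0)) \<bullet> (y - x0)) has_derivative (\<lambda>v. 2 * ((M *v (x - x0)) \<bullet> v))) (at x)"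
  proof (rule has_derivative_eq_rhs[OF has_derivative_inner[OF L]])
    show "((\<lambda>y. y - x0) has_derivative (\<lambda>v. v)) (at x)" by (auto intro!: derivative_eq_intros)
    show "(\<lambda>v. (M *v (x - x0)) \<bullet> v + (M *v v) \<bullet> (x - x0)) = (\<lambda>v. 2 * ((M *v (x - x0)) \<bullet> v))"
      using symmetric_matrix_inner[OF M, of _ "x - x0"] by (simp add: fun_eq_iff)
  qed
  show "((\<lambda>y. k + p \<bullet> (y - x0) + a * (t - t0) + (M *v (y - x0)) \<bullet> (y - x0) / 2 + (t - t0) * (b \<bullet> (y - x0)) + c * (t - t0)\<^sup>2 / 2)
     has_derivative (\<lambda>v. (p + M *v (x - x0) + (t - t0) *\<^sub>R b) \<bullet> v)) (at x)"
  proof -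
    have q2: "((\<lambda>y. (M *v (y - x0)) \<bullet> (y - x0) / 2) has_derivative (\<lambda>v. (M *v (x - x0)) \<bullet> v)) (at x)"
      by (rule has_derivative_eq_rhs[OF bounded_linear.has_derivative[OF bounded_linear_divide q]]) simp
    have lin: "((\<lambda>y. u \<bullet> (y - x0)) has_derivative (\<lambda>v. u \<bullet> v)) (at x)" for u :: "real^'m"
      by (auto intro!: derivative_eq_intros)
    have "((\<lambda>y. p \<bullet> (y - x0) + (M *v (y - x0)) \<bullet> (y - x0) / 2 + ((t - t0) *\<^sub>R b) \<bullet> (y - x0) + (k + a * (t - t0) + c * (t - t0)\<^sup>2 / 2))
       has_derivative (\<lambda>v. p \<bullet> v + (M *v (x - x0)) \<bullet> v + ((t - t0) *\<^sub>R b) \<bullet> v + 0)) (at x)"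
      by (intro has_derivative_add lin q2 has_derivative_const)
    then show ?thesis by (simp add: inner_add_left algebra_simps)
  qed
  show "((\<lambda>y. p + M *v (y - x0) + (t - t0) *\<^sub>R b) has_derivative (\<lambda>v. M *v v)) (at x)"
    by (rule derivative_eq_intros L refl)+ auto
next
  show "continuous_on (UNIV \<times> {..<0}) (\<lambda>z. a + b \<bullet> (fst z - x0) + c * (snd z - t0))" by (intro continuous_intros)
  show "continuous_on (UNIV \<times> {..<0}) (\<lambda>z. p + M *v (fst z - x0) + (snd z - t0) *\<^sub>R b)"
    by (intro continuous_intros linear_continuous_on_compose[OF _ matrix_vector_mul_linear])
qed simp

section \<open>Upper limits of equicontinuous families\<close>

text \<open>Taken in the extended reals and projected back; this is the true upper limit when
  \<open>g\<close> is bounded near 0.\<close>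

definition limsup_zero :: "(real \<Rightarrow> real) \<Rightarrow> real" where
  "limsup_zero g = real_of_ereal (Limsup (at_right 0) (\<lambda>\<delta>. ereal (g \<delta>)))"

lemma
  assumes bd: "\<And>\<delta>. 0 < \<delta> \<Longrightarrow> \<delta> < 1 \<Longrightarrow> \<bar>g \<delta>\<bar> \<le> b" and e: "e > 0"
  shows limsup_zero_eventually: "\<forall>\<^sub>F \<delta> in at_right 0. g \<delta> < limsup_zero g + e"
    and limsup_zero_frequently: "\<exists>\<^sub>F \<delta> in at_right 0. limsup_zero g - e < g \<delta>"
proof -
  have ev1: "\<forall>\<^sub>F \<delta> in at_right (0::real). \<delta> < 1" by (rule eventually_at_right_less[THEN eventually_rev_mp]) (auto simp: eventually_at_right_field intro: exI[of _ 1])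
  have ev0: "\<forall>\<^sub>F \<delta> in at_right (0::real). 0 < \<delta>" by (rule eventually_at_right_less)
  let ?L = "Limsup (at_right 0) (\<lambda>\<delta>. ereal (g \<delta>))"
  have "?L \<le> ereal b"
    by (rule Limsup_bounded) (use ev0 ev1 in eventually_elim, use bd in \<open>force simp: abs_le_iff\<close>)
  moreover have "ereal (- b) \<le> ?L"
    by (rule le_Limsup) (simp, use ev0 ev1 in eventually_elim, use bd in \<open>force simp: abs_le_iff\<close>)
  ultimately have L: "?L = ereal (limsup_zero g)" unfolding limsup_zero_def by (cases ?L) auto
  have "\<forall>\<^sub>F \<delta> in at_right 0. ereal (g \<delta>) < ereal (limsup_zero g + e)"
    by (rule Limsup_lessD) (simp add: L e)
  then show "\<forall>\<^sub>F \<delta> in at_right 0. g \<delta> < limsup_zero g + e" by simp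
  have "ereal (limsup_zero g) \<le> ?L" by (simp add: L)
  from this[unfolded le_Limsup_iff_frequently, rule_format, of "ereal (limsup_zero g - e)"]
  show "\<exists>\<^sub>F \<delta> in at_right 0. limsup_zero g - e < g \<delta>" using e by simp
qed

text \<open>Only \<open>\<delta>\<close> varies: for an equicontinuous family, letting the point
  vary as well, as in the usual half-relaxed limit, gives the same value.\<close>

definition relaxed_limsup :: "(real \<Rightarrow> (real^'m) \<times> real \<Rightarrow> real) \<Rightarrow> (real^'m) \<times> real \<Rightarrow> real" where
  "relaxed_limsup W z = limsup_zero (\<lambda>\<delta>. W \<delta> z)"

text \<open>The \<open>\<delta>^2\<close> under the root absorbs the jumps in time and disappears in
  the limit; the last clause keeps the upper limits finite.\<close>

definition equicontinuous_family :: "real \<Rightarrow> real \<Rightarrow> (real \<Rightarrow> (real^'m) \<times> real \<Rightarrow> real) \<Rightarrow> bool" where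
  "equicontinuous_family L c W \<longleftrightarrow> L \<ge> 0 \<and> c \<ge> 0 \<and>
     (\<forall>\<delta> x y s t. 0 < \<delta> \<longrightarrow> \<delta> < 1 \<longrightarrow> s \<le> 0 \<longrightarrow> t \<le> 0 \<longrightarrow>
        \<bar>W \<delta> (x, t) - W \<delta> (y, s)\<bar> \<le> L * norm (x - y) + c * sqrt (\<bar>t - s\<bar> + \<delta>\<^sup>2)) \<and>
     (\<forall>x. \<forall>t\<le>0. \<exists>b. \<forall>\<delta>. 0 < \<delta> \<longrightarrow> \<delta> < 1 \<longrightarrow> \<bar>W \<delta> (x, t)\<bar> \<le> b)"

lemma equicontinuous_family_uminus: "equicontinuous_family L c W \<Longrightarrow> equicontinuous_family L c (\<lambda>\<delta> z. - W \<delta> z)"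
  by (simp add: equicontinuous_family_def abs_minus_commute)

context
  fixes W :: "real \<Rightarrow> (real^'m) \<times> real \<Rightarrow> real" and L c :: real
  assumes family: "equicontinuous_family L c W"
begin

private lemma
  shows equi: "\<And>\<delta> x y s t. 0 < \<delta> \<Longrightarrow> \<delta> < 1 \<Longrightarrow> s \<le> 0 \<Longrightarrow> t \<le> 0 \<Longrightarrow>
      \<bar>W \<delta> (x, t) - W \<delta> (y, s)\<bar> \<le> L * norm (x - y) + c * sqrt (\<bar>t - s\<bar> + \<delta>\<^sup>2)"
    and Lc: "L \<ge> 0" "c \<ge> 0"
    and bdd: "\<And>x t. t \<le> 0 \<Longrightarrow> \<exists>b. \<forall>\<delta>. 0 < \<delta> \<longrightarrow> \<delta> < 1 \<longrightarrow> \<bar>W \<delta> (x, t)\<bar> \<le> b"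
  using family unfolding equicontinuous_family_def by blast+

lemma relaxed_limsup_eventually:
  assumes "snd z \<le> 0" "e > 0"
  shows "\<forall>\<^sub>F \<delta> in at_right 0. W \<delta> z < relaxed_limsup W z + e"
proof -
  obtain b where "\<And>\<delta>. 0 < \<delta> \<Longrightarrow> \<delta> < 1 \<Longrightarrow> \<bar>W \<delta> z\<bar> \<le> b" using bdd[of "snd z" "fst z"] assms(1) by auto
  from limsup_zero_eventually[OF this assms(2)] show ?thesis by (simp add: relaxed_limsup_def)
qed

lemma relaxed_limsup_frequently:
  assumes "snd z \<le> 0" "e > 0"
  shows "\<exists>\<^sub>F \<delta> in at_right 0. relaxed_limsup W z - e < W \<delta> z"
proof -
  obtain b where "\<And>\<delta>. 0 < \<delta> \<Longrightarrow> \<delta> < 1 \<Longrightarrow> \<bar>W \<delta> z\<bar> \<le> b" using bdd[of "snd z" "fst z"] assms(1) by auto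
  from limsup_zero_frequently[OF this assms(2)] show ?thesis by (simp add: relaxed_limsup_def)
qed

lemma eventually_time_modulus:
  assumes "e > 0"
  shows "\<forall>\<^sub>F \<delta> in at_right 0. c * sqrt (a + \<delta>\<^sup>2) < c * sqrt a + e"
proof -
  have "((\<lambda>\<delta>. c * sqrt (a + \<delta>\<^sup>2)) \<longlongrightarrow> c * sqrt (a + 0\<^sup>2)) (at_right 0)"
    by (intro tendsto_intros)
  then show ?thesis using assms by (intro order_tendstoD(2)) auto
qed

lemma eventually_unit: "\<forall>\<^sub>F \<delta> in at_right (0::real). 0 < \<delta> \<and> \<delta> < 1"
  by (auto simp: eventually_at_right_field intro: exI[of _ 1])

lemma relaxed_limsup_le:
  assumes "s \<le> 0" "t \<le> 0"
  shows "relaxed_limsup W (x, t) \<le> relaxed_limsup W (y, s) + L * norm (x - y) + c * sqrt \<bar>t - s\<bar>"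
proof (rule field_le_epsilon)
  fix e :: real assume "e > 0"
  then have e: "e / 3 > 0" by simp
  have "\<exists>\<^sub>F \<delta> in at_right 0. relaxed_limsup W (x, t) - e / 3 < W \<delta> (x, t)"
    using assms e by (intro relaxed_limsup_frequently) auto
  moreover have "\<forall>\<^sub>F \<delta> in at_right 0. (W \<delta> (y, s) < relaxed_limsup W (y, s) + e / 3 \<and>
      c * sqrt (\<bar>t - s\<bar> + \<delta>\<^sup>2) < c * sqrt \<bar>t - s\<bar> + e / 3) \<and> 0 < \<delta> \<and> \<delta> < 1"
    using assms e by (intro eventually_conj relaxed_limsup_eventually eventually_time_modulus eventually_unit) auto
  ultimately obtain \<delta> where "relaxed_limsup W (x, t) - e / 3 < W \<delta> (x, t)" "W \<delta> (y, s) < relaxed_limsup W (y, s) + e / 3"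
     "c * sqrt (\<bar>t - s\<bar> + \<delta>\<^sup>2) < c * sqrt \<bar>t - s\<bar> + e / 3" "0 < \<delta>" "\<delta> < 1"
    using frequently_ex[OF frequently_eventually_frequently] by blast
  then show "relaxed_limsup W (x, t) \<le> relaxed_limsup W (y, s) + L * norm (x - y) + c * sqrt \<bar>t - s\<bar> + e"
    using equi[of \<delta> s t x y] assms by (simp add: abs_le_iff)
qed

lemma relaxed_limsup_dist:
  assumes "s \<le> 0" "t \<le> 0"
  shows "\<bar>relaxed_limsup W (x, t) - relaxed_limsup W (y, s)\<bar> \<le> L * norm (x - y) + c * sqrt \<bar>t - s\<bar>"
  using relaxed_limsup_le[OF assms, of x y] relaxed_limsup_le[OF assms(2,1), of y x]
  by (simp add: abs_le_iff norm_minus_commute abs_minus_commute)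

lemma continuous_on_relaxed_limsup: "continuous_on (UNIV \<times> {..0}) (relaxed_limsup W)"
  unfolding continuous_on_def
proof
  fix z0 :: "(real^'m) \<times> real" assume z0: "z0 \<in> UNIV \<times> {..0}"
  have "((\<lambda>z. L * norm (fst z - fst z0) + c * sqrt \<bar>snd z - snd z0\<bar>) \<longlongrightarrow> L * norm (fst z0 - fst z0) + c * sqrt \<bar>snd z0 - snd z0\<bar>)
     (at z0 within UNIV \<times> {..0})"
    by (intro tendsto_intros)
  then have "((\<lambda>z. L * norm (fst z - fst z0) + c * sqrt \<bar>snd z - snd z0\<bar>) \<longlongrightarrow> 0) (at z0 within UNIV \<times> {..0})" by simp
  moreover have "\<forall>\<^sub>F z in at z0 within UNIV \<times> {..0}. norm (relaxed_limsup W z - relaxed_limsup W z0) \<le> L * norm (fst z - fst z0) + c * sqrt \<bar>snd z - snd z0\<bar>"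
    unfolding eventually_at_topological
  proof (intro exI[of _ UNIV] conjI ballI impI)
    fix z :: "(real^'m) \<times> real" assume "z \<in> UNIV \<times> {..0}"
    then show "norm (relaxed_limsup W z - relaxed_limsup W z0) \<le> L * norm (fst z - fst z0) + c * sqrt \<bar>snd z - snd z0\<bar>"
      using relaxed_limsup_dist[of "snd z0" "snd z" "fst z" "fst z0"] z0 by (auto simp: mem_Times_iff)
  qed auto
  ultimately have "((\<lambda>z. relaxed_limsup W z - relaxed_limsup W z0) \<longlongrightarrow> 0) (at z0 within UNIV \<times> {..0})"
    by (rule Lim_null_comparison[rotated])
  then show "(relaxed_limsup W \<longlongrightarrow> relaxed_limsup W z0) (at z0 within UNIV \<times> {..0})" by (rule LIM_zero_cancel)
qed

text \<open>One half of locally uniform convergence; the other half comes from the negated family.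
  Equicontinuity transfers the pointwise bound from a finite \<open>\<rho>\<close>-net.\<close>

lemma relaxed_limsup_uniform:
  assumes B: "compact B" "B \<subseteq> UNIV \<times> {..0}" and e: "e > 0"
  shows "\<forall>\<^sub>F \<delta> in at_right 0. \<forall>z\<in>B. W \<delta> z < relaxed_limsup W z + e"
proof -
  have "((\<lambda>\<rho>. L * \<rho> + c * sqrt \<rho>) \<longlongrightarrow> L * 0 + c * sqrt 0) (at_right 0)" by (intro tendsto_intros)
  \<comment> \<open>The modulus is paid twice, for \<open>W\<close> and for its limit, so twice
    \<open>e / 4\<close>; the rest of \<open>e\<close> goes to the bound at the net point and to the
    \<open>\<delta>^2\<close> under the root.\<close>
  then have "\<forall>\<^sub>F \<rho> in at_right 0. L * \<rho> + c * sqrt \<rho> < e / 4" using e by (intro order_tendstoD(2)) auto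
  then obtain \<rho> where \<rho>: "0 < \<rho>" "L * \<rho> + c * sqrt \<rho> < e / 4"
    unfolding eventually_at_right_field by (meson dense)
  obtain Z where Z: "finite Z" "Z \<subseteq> B" "B \<subseteq> (\<Union>z\<in>Z. ball z \<rho>)"
    using compactE_image[OF B(1), of B "\<lambda>z. ball z \<rho>"] \<rho>(1) by (metis (no_types, lifting) UN_iff centre_in_ball open_ball subsetI)
  have "\<forall>\<^sub>F \<delta> in at_right 0. (\<forall>z\<in>Z. W \<delta> z < relaxed_limsup W z + e / 4) \<and> c * sqrt (\<rho> + \<delta>\<^sup>2) < c * sqrt \<rho> + e / 4 \<and> 0 < \<delta> \<and> \<delta> < 1"
    using Z B(2) e
    by (intro eventually_conj eventually_ball_finite ballI relaxed_limsup_eventually eventually_time_modulus eventually_unit) auto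
  then show ?thesis
  proof eventually_elim
    case (elim \<delta>)
    show ?case
    proof
      fix z assume z: "z \<in> B"
      then obtain y where y: "y \<in> Z" "dist y z < \<rho>" using Z(3) by auto
      have neg: "snd z \<le> 0" "snd y \<le> 0" using z y(1) Z(2) B(2) by auto
      have n: "norm (fst z - fst y) \<le> \<rho>" "\<bar>snd z - snd y\<bar> \<le> \<rho>"
        using dist_fst_le[of z y] dist_snd_le[of z y] y(2) by (auto simp: dist_norm norm_minus_commute)
      have Ln: "L * norm (fst z - fst y) \<le> L * \<rho>" using n Lc by (simp add: mult_left_mono)
      have "\<bar>W \<delta> z - W \<delta> y\<bar> \<le> L * norm (fst z - fst y) + c * sqrt (\<bar>snd z - snd y\<bar> + \<delta>\<^sup>2)"
        using equi[of \<delta> "snd y" "snd z" "fst z" "fst y"] elim neg by simp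
      moreover have "c * sqrt (\<bar>snd z - snd y\<bar> + \<delta>\<^sup>2) \<le> c * sqrt (\<rho> + \<delta>\<^sup>2)" using n Lc by (intro mult_left_mono) auto
      moreover have "\<bar>relaxed_limsup W z - relaxed_limsup W y\<bar> \<le> L * norm (fst z - fst y) + c * sqrt \<bar>snd z - snd y\<bar>"
        using relaxed_limsup_dist[of "snd y" "snd z" "fst z" "fst y"] neg by simp
      moreover have "c * sqrt \<bar>snd z - snd y\<bar> \<le> c * sqrt \<rho>" using n Lc by (intro mult_left_mono) auto
      moreover have "W \<delta> y < relaxed_limsup W y + e / 4" using elim y(1) by blast
      moreover have "c * sqrt \<rho> \<ge> 0" "L * \<rho> \<ge> 0" using Lc \<rho>(1) by auto
      ultimately show "W \<delta> z < relaxed_limsup W z + e"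
        using elim \<rho>(2) Ln by linarith
    qed
  qed
qed

text \<open>Stability by perturbed maxima: a quadratic makes the maximum of the limit strict, so
  approximate maxima of \<open>W \<delta>\<close> fall near the base point, where
  \<open>consistent\<close> applies. This works for those small \<open>\<delta>\<close> at which
  \<open>W \<delta>\<close> nearly attains the upper limit at the base point.\<close>

lemma relaxed_limsup_eps_subsolution:
  assumes cons: "consistent F W"
  shows "eps_subsolution F (relaxed_limsup W)"
  unfolding eps_subsolution_def
proof (intro allI impI, elim conjE)
  fix \<phi> d :: "(real^'m) \<times> real \<Rightarrow> real" and g :: "(real^'m) \<times> real \<Rightarrow> real^'m"
    and h :: "(real^'m) \<times> real \<Rightarrow> real^'m^'m" and x0 :: "real^'m" and t0 \<kappa> :: real
  assume test: "test_function_with \<phi> d g h" and t0: "t0 < 0" and k: "\<kappa> > 0"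
    and mx: "local_max_at (\<lambda>z. relaxed_limsup W z - \<phi> z) (x0, t0)"
  let ?U = "relaxed_limsup W" and ?z = "(x0, t0)"
  let ?I = "mat 1 :: real^'m^'m"
  obtain \<rho>0 where \<rho>0: "\<rho>0 > 0" "\<And>z. dist z ?z < \<rho>0 \<Longrightarrow> ?U z - \<phi> z \<le> ?U ?z - \<phi> ?z"
    using mx unfolding local_max_at_def eventually_nhds_metric by auto
  define \<rho> where "\<rho> = min (\<rho>0 / 2) (- t0 / 2)"
  have \<rho>: "\<rho> > 0" "\<rho> < \<rho>0" "\<rho> < - t0" using \<rho>0(1) t0 by (auto simp: \<rho>_def)
  \<comment> \<open>The perturbation adds \<open>2 * q\<close> times the identity to the Hessian;
    this \<open>q\<close> keeps it within \<open>\<kappa> / 2\<close>.\<close>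
  define q where "q = \<kappa> / (4 * (norm ?I + 1))"
  have q: "q > 0" using k by (simp add: q_def add_nonneg_pos)
  have I1: "norm ?I + 1 > 0" by (simp add: add_nonneg_pos)
  have qI: "norm ((2 * q) *\<^sub>R ?I) < \<kappa> / 2 + \<kappa> / 4"
  proof -
    have "norm ((2 * q) *\<^sub>R ?I) \<le> 2 * q * (norm ?I + 1)" using q by (simp add: distrib_left)
    also have "\<dots> = \<kappa> / 2"
    proof -
      have aux: "a \<noteq> 0 \<Longrightarrow> 2 * (\<kappa> / (4 * a)) * a = \<kappa> / 2" for a :: real by simp
      show ?thesis unfolding q_def by (rule aux) (use I1 in linarith)
    qed
    finally show ?thesis using k by simp
  qed
  have sI: "(2 * q) *\<^sub>R ?I \<in> symmetric_matrices"
    by (simp add: symmetric_matrices_def transpose_scalar transpose_mat)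
  let ?Q = "\<lambda>z. 0 + 0 \<bullet> (fst z - x0) + 0 * (snd z - t0) + (((2 * q) *\<^sub>R ?I) *v (fst z - x0)) \<bullet> (fst z - x0) / 2
       + (snd z - t0) * (0 \<bullet> (fst z - x0)) + (2 * q) * (snd z - t0)\<^sup>2 / 2"
  have Q: "?Q z = q * (dist z ?z)\<^sup>2" for z
  proof -
    have "(dist z ?z)\<^sup>2 = (norm (fst z - x0))\<^sup>2 + (snd z - t0)\<^sup>2"
      by (simp add: dist_prod_def dist_norm)
    moreover have "(((2 * q) *\<^sub>R ?I) *v w) \<bullet> w = 2 * q * (norm w)\<^sup>2" for w
      by (simp add: scaleR_matrix_vector_assoc[symmetric] power2_norm_eq_inner)
    ultimately show ?thesis by (simp add: distrib_left)
  qed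
  define \<psi> where "\<psi> z = \<phi> z + ?Q z" for z
  have test\<psi>: "test_function_with \<psi> (\<lambda>z. d z + (0 + 0 \<bullet> (fst z - x0) + (2 * q) * (snd z - t0)))
     (\<lambda>z. g z + (0 + ((2 * q) *\<^sub>R ?I) *v (fst z - x0) + (snd z - t0) *\<^sub>R 0)) (\<lambda>z. h z + (2 * q) *\<^sub>R ?I)"
    unfolding \<psi>_def[abs_def] by (rule test_function_add[OF test test_function_quadratic[OF sI]])
  have k4: "\<kappa> / 4 > 0" using k by simp
  obtain r where r: "r > 0" "\<And>\<delta> z. 0 < \<delta> \<Longrightarrow> \<delta> < r \<Longrightarrow> dist z ?z < r \<Longrightarrow>
      (\<forall>z'. dist z' ?z < \<rho> \<longrightarrow> W \<delta> z' - \<psi> z' \<le> W \<delta> z - \<psi> z + \<delta> ^ 3) \<Longrightarrow>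
      \<exists>M' p'. M' \<in> symmetric_matrices \<and> dist (M', p') (h ?z + (2 * q) *\<^sub>R ?I, g ?z) < \<kappa> / 4 \<and> - (\<kappa> / 4) \<le> d ?z + F M' p' / 2"
  proof -
    have "\<exists>r>0. \<forall>\<delta> z. 0 < \<delta> \<longrightarrow> \<delta> < r \<longrightarrow> dist z ?z < r \<longrightarrow>
        (\<forall>z'. dist z' ?z < \<rho> \<longrightarrow> W \<delta> z' - \<psi> z' \<le> W \<delta> z - \<psi> z + \<delta> ^ 3) \<longrightarrow>
        (\<exists>M' p'. M' \<in> symmetric_matrices \<and> dist (M', p') (h ?z + (2 * q) *\<^sub>R ?I, g ?z) < \<kappa> / 4 \<and> - (\<kappa> / 4) \<le> d ?z + F M' p' / 2)"
      using cons[unfolded consistent_def, rule_format, OF conjI[OF test\<psi> conjI[OF t0 conjI[OF k4 \<rho>(1)]]], of x0]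
      unfolding fst_conv snd_conv by simp
    then show ?thesis using that by blast
  qed
  \<comment> \<open>Three errors below \<open>e\<close> occur: the upper bound on the ball, the
    value at the base point, and \<open>\<delta>^3\<close>. Their sum is less than
    \<open>q * r^2\<close>, which confines the approximate maximum to radius
    \<open>r\<close>.\<close>
  define e where "e = q * r\<^sup>2 / 4"
  have e: "e > 0" using q r by (simp add: e_def)
  have cB: "cball ?z \<rho> \<subseteq> UNIV \<times> {..0}"
  proof
    fix z assume "z \<in> cball ?z \<rho>"
    then have "\<bar>snd z - t0\<bar> \<le> \<rho>" using dist_snd_le[of z ?z] by (auto simp: dist_real_def dist_commute)
    then show "z \<in> UNIV \<times> {..0}" using \<rho>(3) by (auto simp: mem_Times_iff)
  qed
  have "\<exists>\<^sub>F \<delta> in at_right 0. ?U ?z - e < W \<delta> ?z" using t0 e by (intro relaxed_limsup_frequently) auto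
  moreover have "\<forall>\<^sub>F \<delta> in at_right 0. (\<forall>z\<in>cball ?z \<rho>. W \<delta> z < ?U z + e) \<and> (0 < \<delta> \<and> \<delta> < 1) \<and> \<delta> < r \<and> \<delta> < e"
    using r e eventually_at_right_real[of 0 r] eventually_at_right_real[of 0 e]
    by (intro eventually_conj relaxed_limsup_uniform[OF compact_cball cB] eventually_unit) (auto elim: eventually_mono)
  ultimately obtain \<delta> where \<delta>: "?U ?z - e < W \<delta> ?z" "\<forall>z\<in>cball ?z \<rho>. W \<delta> z < ?U z + e" "0 < \<delta>" "\<delta> < 1" "\<delta> < r" "\<delta> < e"
    using frequently_ex[OF frequently_eventually_frequently] by blast
  have d3: "\<delta> ^ 3 > 0" "\<delta> ^ 3 < e"
  proof -
    have "\<delta> ^ 3 \<le> \<delta> ^ 1" using \<delta>(3,4) by (intro power_decreasing) auto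
    then show "\<delta> ^ 3 < e" using \<delta>(6) by simp
  qed (use \<delta>(3) in simp)
  have up: "W \<delta> z - \<psi> z \<le> ?U ?z - \<phi> ?z + e - q * (dist z ?z)\<^sup>2" if "dist z ?z < \<rho>" for z
  proof -
    have "z \<in> cball ?z \<rho>" "dist z ?z < \<rho>0" using that \<rho>(2) by (simp_all add: dist_commute)
    then have "W \<delta> z < ?U z + e" "?U z - \<phi> z \<le> ?U ?z - \<phi> ?z" using \<delta>(2) \<rho>0(2) by blast+
    moreover have "\<psi> z = \<phi> z + q * (dist z ?z)\<^sup>2" unfolding \<psi>_def Q ..
    ultimately show ?thesis by linarith
  qed
  \<comment> \<open>\<open>W \<delta>\<close> may jump in time, so the supremum over the ball need
    not be attained; a point within \<open>\<delta>^3\<close> of it is taken.\<close>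
  define S where "S = (\<lambda>z. W \<delta> z - \<psi> z) ` ball ?z \<rho>"
  have "bdd_above S" unfolding S_def
  proof (rule bdd_aboveI2)
    fix z assume "z \<in> ball ?z \<rho>"
    then show "W \<delta> z - \<psi> z \<le> ?U ?z - \<phi> ?z + e" using up[of z] q zero_le_power2[of "dist z ?z"]
      by (smt (verit) dist_commute mem_ball mult_nonneg_nonneg)
  qed
  have "?z \<in> ball ?z \<rho>" using \<rho>(1) by simp
  then have "S \<noteq> {}" unfolding S_def by blast
  moreover have "Sup S - \<delta> ^ 3 < Sup S" using d3 by simp
  ultimately obtain a where "a \<in> S" "Sup S - \<delta> ^ 3 < a" using less_cSup_iff[OF _ \<open>bdd_above S\<close>] by blast
  then obtain z where z: "z \<in> ball ?z \<rho>" "Sup S - \<delta> ^ 3 < W \<delta> z - \<psi> z" unfolding S_def by blast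
  have app: "W \<delta> z' - \<psi> z' \<le> W \<delta> z - \<psi> z + \<delta> ^ 3" if "dist z' ?z < \<rho>" for z'
  proof -
    have "W \<delta> z' - \<psi> z' \<le> Sup S" using that \<open>bdd_above S\<close> unfolding S_def by (intro cSUP_upper) (auto simp: dist_commute)
    then show ?thesis using z(2) by linarith
  qed
  have "q * (dist z ?z)\<^sup>2 < q * r\<^sup>2"
  proof -
    have "W \<delta> ?z - \<psi> ?z \<le> W \<delta> z - \<psi> z + \<delta> ^ 3" using app[of ?z] \<rho>(1) by simp
    moreover have "\<psi> ?z = \<phi> ?z" by (simp add: \<psi>_def)
    moreover have "dist z ?z < \<rho>" using z(1) by (simp add: dist_commute)
    ultimately have "q * (dist z ?z)\<^sup>2 < 3 * e" using up[of z] \<delta>(1) d3 by linarith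
    then show ?thesis using e by (simp add: e_def)
  qed
  then have "dist z ?z < r" using q r(1) by (metis mult_less_cancel_left_pos power_less_imp_less_base less_imp_le)
  from r(2)[OF \<delta>(3,5) this] app obtain M' p' where M': "M' \<in> symmetric_matrices"
     "dist (M', p') (h ?z + (2 * q) *\<^sub>R ?I, g ?z) < \<kappa> / 4" "- (\<kappa> / 4) \<le> d ?z + F M' p' / 2" by blast
  have "dist (h ?z + (2 * q) *\<^sub>R ?I, g ?z) (h ?z, g ?z) = norm ((2 * q) *\<^sub>R ?I)"
    by (simp add: dist_Pair_Pair dist_norm)
  then have "dist (M', p') (h ?z, g ?z) < \<kappa>"
    using dist_triangle[of "(M', p')" "(h ?z, g ?z)" "(h ?z + (2 * q) *\<^sub>R ?I, g ?z)"] M'(2) qI by linarith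
  moreover have "- \<kappa> \<le> d ?z + F M' p' / 2" using M'(3) k by linarith
  ultimately show "\<exists>M' p'. M' \<in> symmetric_matrices \<and> dist (M', p') (h ?z, g ?z) < \<kappa> \<and> - \<kappa> \<le> d ?z + F M' p' / 2"
    using M'(1) by blast
qed

end

section \<open>Barriers\<close>

lemma attains_max_coercive:
  fixes h :: "'a::euclidean_space \<Rightarrow> real"
  assumes S: "closed S" "continuous_on S h" and a: "a \<in> S"
    and bd: "\<And>z. z \<in> S \<Longrightarrow> h a \<le> h z \<Longrightarrow> norm z \<le> R"
  shows "\<exists>z\<in>S. \<forall>y\<in>S. h y \<le> h z"
proof -
  let ?C = "S \<inter> cball 0 (max R (norm a))"
  have "compact ?C" using S(1) by (simp add: closed_Int_compact)
  moreover have aC: "a \<in> ?C" using a by simp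
  ultimately obtain z where z: "z \<in> ?C" "\<And>y. y \<in> ?C \<Longrightarrow> h y \<le> h z"
    using continuous_attains_sup[of ?C h] continuous_on_subset[OF S(2)] by blast
  have "h y \<le> h z" if "y \<in> S" for y
  proof (cases "h a \<le> h y")
    case True
    then show ?thesis using z(2)[of y] bd[OF that True] that by simp
  next
    case False
    then show ?thesis using z(2)[OF aC] by simp
  qed
  then show ?thesis using z(1) by blast
qed

lemma local_max_at_interior:
  assumes "open U" "z \<in> U" "\<And>y. y \<in> U \<Longrightarrow> f y \<le> f z"
  shows "local_max_at f z"
  unfolding local_max_at_def using assms by (auto simp: eventually_nhds)

lemma young_square:
  fixes b :: real
  assumes "b > 0"
  shows "C * a - b * a\<^sup>2 / 2 \<le> C\<^sup>2 / (2 * b)"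
proof -
  have "0 \<le> (b * a - C)\<^sup>2" by simp
  then have "(C * a - b * a\<^sup>2 / 2) * (2 * b) \<le> C\<^sup>2" by (simp add: power2_eq_square algebra_simps)
  then show ?thesis using assms by (simp add: pos_le_divide_eq)
qed

text \<open>The barrier is \<open>f x1 + L r / 2 - c t\<close>, plus a paraboloid of curvature
  \<open>L / r\<close>, plus a multiple of \<open>exp (- j (t + T))\<close>. The paraboloid
  dominates \<open>f\<close> at time 0 by Young's inequality, and \<open>c\<close> exceeds half of
  what the operator can make of its Hessian. The exponential, decreasing in time, dominates
  \<open>u\<close> at the artificial time \<open>- T\<close>, where only linear growth is known; at
  \<open>t1\<close> it vanishes as \<open>j\<close> tends to infinity.\<close>

lemma subsolution_barrier:
  fixes u :: "(real^'m) \<times> real \<Rightarrow> real"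
  assumes sub: "eps_subsolution F u" and cont: "continuous_on (UNIV \<times> {..0}) u" and growth: "linear_growth u"
    and terminal: "\<And>x. u (x, 0) = f x" and lip: "\<And>x y. f x \<le> f y + L * norm (x - y)" and L: "L > 0"
    and F: "\<And>M p. F M p \<le> K * norm M" and K: "K \<ge> 0" and t1: "t1 < 0" and r: "r > 0"
    and c: "K * (L / r * norm (mat 1 :: real^'m^'m)) / 2 < c"
  shows "u (x1, t1) \<le> f x1 + L * r / 2 - c * t1"
proof -
  let ?I = "mat 1 :: real^'m^'m"
  \<comment> \<open>With \<open>t1 + T = 1\<close> the exponential at \<open>t1\<close> is
    \<open>exp (- j)\<close>.\<close>
  define T where "T = 1 - t1"
  have T: "T > 0" using t1 by (simp add: T_def)
  obtain C0 where C0: "\<And>x t. t \<in> {-T..0} \<Longrightarrow> \<bar>u (x, t)\<bar> \<le> C0 * (1 + norm x)"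
    using growth T unfolding linear_growth_def by blast
  define C where "C = max C0 1"
  have C: "C \<ge> 1" by (simp add: C_def)
  have uC: "u (x, t) \<le> C * (1 + norm x1) + C * norm (x - x1)" if "t \<in> {-T..0}" for x t
  proof -
    have "u (x, t) \<le> C0 * (1 + norm x)" using C0[OF that, of x] by simp
    also have "\<dots> \<le> C * (1 + norm x)" by (intro mult_right_mono) (simp_all add: C_def add_nonneg_nonneg)
    also have "norm x \<le> norm x1 + norm (x - x1)" using norm_triangle_ineq[of x1 "x - x1"] by simp
    finally show ?thesis using C by (simp add: distrib_left)
  qed
  define b where "b = L / r"
  have b: "b > 0" using L r by (simp add: b_def)
  \<comment> \<open>Large enough for the barrier to exceed the growth bound of \<open>u\<close> at
    time \<open>- T\<close>, after the paraboloid has absorbed the linear term in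
    \<open>x\<close>.\<close>
  define N where "N = C * (1 + norm x1) + C\<^sup>2 / (2 * b) + \<bar>f x1\<bar> + 1"
  have N: "N > 0" using C b by (auto simp: N_def intro!: add_nonneg_pos add_nonneg_nonneg)
  have c0: "c > 0"
  proof -
    have "0 \<le> K * (L / r * norm ?I) / 2" using K L r by simp
    then show ?thesis using c by linarith
  qed
  have sI: "b *\<^sub>R ?I \<in> symmetric_matrices" by (simp add: symmetric_matrices_def transpose_scalar transpose_mat)
  define Q where "Q z = (f x1 + L * r / 2) + 0 \<bullet> (fst z - x1) + (- c) * (snd z - 0) + ((b *\<^sub>R ?I) *v (fst z - x1)) \<bullet> (fst z - x1) / 2
       + (snd z - 0) * (0 \<bullet> (fst z - x1)) + 0 * (snd z - 0)\<^sup>2 / 2" for z :: "(real^'m) \<times> real"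
  have Q: "Q z = f x1 + L * r / 2 - c * snd z + b * (norm (fst z - x1))\<^sup>2 / 2" for z
    by (simp add: Q_def scaleR_matrix_vector_assoc[symmetric] power2_norm_eq_inner)
  have young: "C * a - b * a\<^sup>2 / 2 \<le> C\<^sup>2 / (2 * b)" for a using young_square[OF b] .
  have main: "u (x1, t1) \<le> f x1 + L * r / 2 - c * t1 + N * exp (- real j)" for j :: nat
  proof -
    define E where "E t = N * exp (- real j * (t + T))" for t :: real
    define E' where "E' t = - real j * N * exp (- real j * (t + T))" for t :: real
    have DE: "(E has_real_derivative E' t) (at t)" for t
      unfolding E_def E'_def by (auto intro!: derivative_eq_intros)
    have contE: "continuous_on UNIV E" "continuous_on UNIV E'" unfolding E_def E'_def by (intro continuous_intros)+
    have test: "test_function_with (\<lambda>z. Q z + E (snd z)) (\<lambda>z. (- c + 0 \<bullet> (fst z - x1) + 0 * (snd z - 0)) + E' (snd z))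
       (\<lambda>z. (0 + (b *\<^sub>R ?I) *v (fst z - x1) + (snd z - 0) *\<^sub>R 0) + 0) (\<lambda>z. b *\<^sub>R ?I + 0)"
      unfolding Q_def[abs_def] by (rule test_function_add[OF test_function_quadratic[OF sI] test_function_time[OF DE contE(2)]])
    define h where "h z = u z - (Q z + E (snd z))" for z
    have "u z \<le> Q z + E (snd z)" if zS: "z \<in> UNIV \<times> {-T..0}" for z
    proof (rule ccontr)
      assume "\<not> ?thesis"
      then have hz: "h z > 0" by (simp add: h_def)
      have neg: "h (x, - T) < 0" for x
      proof -
        have "u (x, - T) \<le> C * (1 + norm x1) + C * norm (x - x1)" using uC[of "- T" x] T by simp
        moreover have "0 \<le> L * r / 2 + c * T" using L r c0 T by simp
        ultimately show ?thesis using young[of "norm (x - x1)"] by (simp add: h_def Q E_def N_def)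
      qed
      have neg0: "h (x, 0) < 0" for x
      proof -
        have "0 \<le> (norm (x - x1) - r)\<^sup>2" by simp
        then have "norm (x - x1) \<le> r / 2 + (norm (x - x1))\<^sup>2 / (2 * r)"
          using r by (simp add: power2_diff field_simps power2_eq_square)
        then have "L * norm (x - x1) \<le> L * (r / 2 + (norm (x - x1))\<^sup>2 / (2 * r))" using L by simp
        then have "f x \<le> f x1 + L * r / 2 + b * (norm (x - x1))\<^sup>2 / 2"
          using lip[of x x1] by (simp add: b_def distrib_left)
        moreover have "E 0 > 0" using N by (simp add: E_def)
        ultimately show ?thesis using terminal by (simp add: h_def Q)
      qed
      have contQ: "continuous_on UNIV (\<lambda>z. Q z)" unfolding Q[abs_def] by (intro continuous_intros) simp
      have conth: "continuous_on (UNIV \<times> {-T..0}) h" unfolding h_def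
        by (intro continuous_intros continuous_on_subset[OF cont] continuous_on_subset[OF contQ]
            continuous_on_compose2[OF contE(1)]) auto
      have "\<exists>y\<in>UNIV \<times> {-T..0}. \<forall>y'\<in>UNIV \<times> {-T..0}. h y' \<le> h y"
      proof (rule attains_max_coercive[OF _ conth zS])
        show "closed ((UNIV :: (real^'m) set) \<times> {-T..0})" by (intro closed_Times) auto
        fix y :: "(real^'m) \<times> real" assume y: "y \<in> UNIV \<times> {-T..0}" "h z \<le> h y"
        obtain x t where xt: "y = (x, t)" "t \<in> {-T..0}" using y(1) by (cases y) auto
        let ?a = "norm (x - x1)"
        have "0 < h y" using y(2) hz by linarith
        moreover have "E t > 0" using N by (simp add: E_def)
        moreover have "c * t \<le> 0" using c0 xt(2) by (simp add: mult_nonneg_nonpos)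
        moreover have "L * r / 2 \<ge> 0" using L r by simp
        ultimately have "b * ?a\<^sup>2 / 2 \<le> C * (1 + norm x1) + \<bar>f x1\<bar> + C * ?a"
          using uC[OF xt(2), of x] by (simp add: h_def Q xt)
        moreover have "(C + 1) * ?a - b * ?a\<^sup>2 / 2 \<le> (C + 1)\<^sup>2 / (2 * b)" using young_square[OF b] .
        ultimately have "?a \<le> C * (1 + norm x1) + \<bar>f x1\<bar> + (C + 1)\<^sup>2 / (2 * b)" by (simp add: distrib_right)
        moreover have "norm x \<le> norm x1 + ?a" using norm_triangle_ineq[of x1 "x - x1"] by simp
        moreover have "norm y \<le> norm x + norm t" unfolding xt by (rule norm_Pair_le)
        moreover have "norm t \<le> T" using xt(2) by auto
        ultimately show "norm y \<le> norm x1 + (C * (1 + norm x1) + \<bar>f x1\<bar> + (C + 1)\<^sup>2 / (2 * b)) + T" by linarith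
      qed
      then obtain y where y: "y \<in> UNIV \<times> {-T..0}" "\<And>y'. y' \<in> UNIV \<times> {-T..0} \<Longrightarrow> h y' \<le> h y" by blast
      obtain x t where xt: "y = (x, t)" by (cases y)
      have "h y > 0" using y(2)[OF zS] hz by linarith
      then have t: "- T < t" "t < 0" using y(1) neg[of x] neg0[of x] unfolding xt by (auto simp: less_le)
      have "local_max_at h (x, t)"
        by (rule local_max_at_interior[where U = "UNIV \<times> {-T<..<0}"]) (use t y(2) xt in \<open>auto intro!: open_Times\<close>)
      then have lm: "local_max_at (\<lambda>z. u z - (Q z + E (snd z))) (x, t)" by (simp add: h_def[abs_def])
      \<comment> \<open>The tolerance perturbs the inequality and the Hessian, together by
        \<open>\<kappa> + K * \<kappa> / 2\<close>, which is half of the slack in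
        \<open>c\<close>.\<close>
      define \<kappa> where "\<kappa> = (c - K * (b * norm ?I) / 2) / (2 + K)"
      have k: "\<kappa> > 0" using c K by (simp add: \<kappa>_def b_def)
      from sub[unfolded eps_subsolution_def, rule_format, OF conjI[OF test conjI[OF t(2) conjI[OF lm k]]]]
      obtain M' p' where M': "dist (M', p') (b *\<^sub>R ?I, (b *\<^sub>R ?I) *v (x - x1)) < \<kappa>" "- \<kappa> \<le> - c + E' t + F M' p' / 2"
        by auto
      have "dist M' (b *\<^sub>R ?I) < \<kappa>" using M'(1) dist_fst_le[of "(M', p')" "(b *\<^sub>R ?I, (b *\<^sub>R ?I) *v (x - x1))"] by simp
      then have "norm M' \<le> b * norm ?I + \<kappa>"
        using norm_triangle_ineq[of "M' - b *\<^sub>R ?I" "b *\<^sub>R ?I"] b by (simp add: dist_norm)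
      then have "K * norm M' \<le> K * (b * norm ?I + \<kappa>)" using K by (rule mult_left_mono)
      moreover have "E' t \<le> 0" using N by (simp add: E'_def)
      ultimately have "c - K * (b * norm ?I) / 2 \<le> \<kappa> + K * \<kappa> / 2"
        using M'(2) F[of M' p'] by (simp add: distrib_left)
      moreover have "\<kappa> * (2 + K) = c - K * (b * norm ?I) / 2" using K by (simp add: \<kappa>_def)
      moreover have "K * \<kappa> \<ge> 0" using K k by simp
      ultimately show False using k by (simp add: algebra_simps)
    qed
    from this[of "(x1, t1)"] show ?thesis using t1 by (simp add: Q E_def T_def)
  qed
  have "(\<lambda>j. f x1 + L * r / 2 - c * t1 + N * exp (- real j)) \<longlonglongrightarrow> f x1 + L * r / 2 - c * t1 + N * 0"
  proof (intro tendsto_intros)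
    have "(\<lambda>j. exp (- 1 :: real) ^ j) \<longlonglongrightarrow> 0" by (intro LIMSEQ_realpow_zero) auto
    then show "(\<lambda>j. exp (- real j)) \<longlonglongrightarrow> 0" by (simp add: exp_of_nat_mult[symmetric])
  qed
  then show ?thesis using main by (intro LIMSEQ_le_const) auto
qed

text \<open>With \<open>r = sqrt (- t)\<close> the terms \<open>L * r / 2\<close> and
  \<open>- c * t\<close> of the barrier have the same order; \<open>c\<close> exceeds its threshold
  by \<open>L / (2 * r)\<close>, which costs another \<open>L * r / 2\<close>.\<close>

lemma subsolution_sqrt_bound:
  fixes u :: "(real^'m) \<times> real \<Rightarrow> real"
  assumes sub: "eps_subsolution F u" and cont: "continuous_on (UNIV \<times> {..0}) u" and growth: "linear_growth u"
    and terminal: "\<And>x. u (x, 0) = f x" and lip: "\<And>x y. f x \<le> f y + L * norm (x - y)" and L: "L > 0"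
    and F: "\<And>M p. F M p \<le> K * norm M" and K: "K \<ge> 0" and t: "t \<le> 0"
  shows "u (x, t) \<le> f x + L * (1 + K * norm (mat 1 :: real^'m^'m)) * sqrt (- t)"
proof (cases "t = 0")
  case True
  then show ?thesis using terminal by simp
next
  case False
  then have t: "t < 0" using t by simp
  define r where "r = sqrt (- t)"
  have r: "r > 0" "r * r = - t" using t by (auto simp: r_def)
  let ?n = "norm (mat 1 :: real^'m^'m)"
  define c where "c = K * (L / r * ?n) / 2 + L / (2 * r)"
  have "u (x, t) \<le> f x + L * r / 2 - c * t"
    by (rule subsolution_barrier[OF sub cont growth terminal lip L F K t r(1)]) (use L r in \<open>simp add: c_def\<close>)
  also have "- c * t = K * L * ?n * r / 2 + L * r / 2"
  proof -
    have t2: "t = - (r * r)" using r(2) by simp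
    show ?thesis using r(1) unfolding t2 by (simp add: c_def field_simps)
  qed
  then have "- (c * t) = K * L * ?n * r / 2 + L * r / 2" by simp
  then have "f x + L * r / 2 - c * t = f x + L * r + K * L * ?n * r / 2" by simp
  also have "\<dots> \<le> f x + L * (1 + K * ?n) * r"
  proof -
    have "0 \<le> K * L * ?n * r" using K L r by simp
    then show ?thesis by (simp add: algebra_simps)
  qed
  finally show ?thesis by (simp add: r_def)
qed

text \<open>With \<open>K = 0\<close> every positive \<open>c\<close> is allowed, so
  \<open>r\<close> and \<open>c\<close> can both be sent to 0. For the reflected \<open>H_op\<close>
  this says that a supersolution stays above its terminal values.\<close>

lemma subsolution_bound_nonpositive_operator:
  fixes u :: "(real^'m) \<times> real \<Rightarrow> real"
  assumes sub: "eps_subsolution F u" and cont: "continuous_on (UNIV \<times> {..0}) u" and growth: "linear_growth u"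
    and terminal: "\<And>x. u (x, 0) = f x" and lip: "\<And>x y. f x \<le> f y + L * norm (x - y)" and L: "L > 0"
    and F: "\<And>M p. F M p \<le> 0" and t: "t \<le> 0"
  shows "u (x, t) \<le> f x"
proof (cases "t = 0")
  case True
  then show ?thesis using terminal by simp
next
  case False
  then have t: "t < 0" using t by simp
  show ?thesis
  proof (rule field_le_epsilon)
    fix e :: real assume e: "e > 0"
    have "u (x, t) \<le> f x + L * (e / L) / 2 - (e / (- 2 * t)) * t"
      by (rule subsolution_barrier[OF sub cont growth terminal lip L _ _ t, where K = 0]) (use F e L t in \<open>auto simp: divide_pos_neg\<close>)
    also have "\<dots> = f x + e" using L t by (simp add: field_simps)
    finally show "u (x, t) \<le> f x + e" .
  qed
qed

section \<open>Comparison\<close>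

text \<open>The quartic spatial penalty makes both gradient and Hessian of the test functions vanish
  together, which is what tames the discontinuity of \<open>H\<^sub>n\<close> at vanishing gradient.\<close>

definition quartic_kernel :: "real \<Rightarrow> (real^'m) \<times> real \<Rightarrow> real" where
  "quartic_kernel \<eta> z = ((norm (fst z))\<^sup>2)\<^sup>2 / (4 * \<eta>) + (snd z)\<^sup>2 / (2 * \<eta>)"

definition quartic_kernel_grad :: "real \<Rightarrow> (real^'m) \<times> real \<Rightarrow> (real^'m) \<times> real" where
  "quartic_kernel_grad \<eta> z = (((norm (fst z))\<^sup>2 / \<eta>) *\<^sub>R fst z, snd z / \<eta>)"

section \<open>Expansion of the kernel and sup-convolutions\<close>

lemma fst_norm_le: "norm (fst z) \<le> norm z" and snd_norm_le: "norm (snd z) \<le> norm z"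
  using norm_fst_le[of "fst z" "snd z"] norm_snd_le[of "snd z" "fst z"] by simp_all

text \<open>The expansion is exact with a polynomial remainder. The size of the remainder yields
  semiconvexity of sup-convolutions, its coefficients yield the jets at contact points.\<close>

lemma quartic_kernel_add:
  assumes "\<eta> > 0"
  shows "quartic_kernel \<eta> (z + v) = quartic_kernel \<eta> z + quartic_kernel_grad \<eta> z \<bullet> v
    + ((2 * (norm (fst z))\<^sup>2 * (norm (fst v))\<^sup>2 + (2 * (fst z \<bullet> fst v) + (norm (fst v))\<^sup>2)\<^sup>2) / (4 * \<eta>) + (snd v)\<^sup>2 / (2 * \<eta>))"
proof -
  have "(norm (fst z + fst v))\<^sup>2 = (norm (fst z))\<^sup>2 + (2 * (fst z \<bullet> fst v) + (norm (fst v))\<^sup>2)"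
    unfolding power2_norm_eq_inner by (simp add: inner_add_left inner_add_right inner_commute)
  then have 1: "((norm (fst z + fst v))\<^sup>2)\<^sup>2 = ((norm (fst z))\<^sup>2)\<^sup>2 + 4 * ((norm (fst z))\<^sup>2 * (fst z \<bullet> fst v))
      + (2 * (norm (fst z))\<^sup>2 * (norm (fst v))\<^sup>2 + (2 * (fst z \<bullet> fst v) + (norm (fst v))\<^sup>2)\<^sup>2)"
    by (simp add: power2_sum algebra_simps)
  have 2: "quartic_kernel_grad \<eta> z \<bullet> v = 4 * ((norm (fst z))\<^sup>2 * (fst z \<bullet> fst v)) / (4 * \<eta>) + 2 * snd z * snd v / (2 * \<eta>)"
    by (simp add: quartic_kernel_grad_def inner_prod_def)
  show ?thesis unfolding quartic_kernel_def 2 fst_add snd_add 1 by (simp add: power2_sum add_divide_distrib)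
qed

text \<open>The condition \<open>norm v \<le> 2\<close> covers differences of two points of a unit
  ball, the region on which sup-convolutions are studied.\<close>

lemma quartic_kernel_upper:
  assumes \<eta>: "\<eta> > 0" and z: "norm z \<le> R" and v: "norm v \<le> 2"
  shows "quartic_kernel \<eta> (z + v) \<le> quartic_kernel \<eta> z + quartic_kernel_grad \<eta> z \<bullet> v + ((2 * R\<^sup>2 + (2 * R + 2)\<^sup>2) / (4 * \<eta>) + 1 / (2 * \<eta>)) * (norm v)\<^sup>2"
proof -
  let ?x = "norm (fst z)" and ?w = "norm (fst v)"
  have R: "R \<ge> 0" using z norm_ge_zero order_trans by blast
  have xz: "?x \<le> R" using fst_norm_le[of z] z by linarith
  have wv: "?w \<le> norm v" by (rule fst_norm_le)
  have sv: "(snd v)\<^sup>2 \<le> (norm v)\<^sup>2" using snd_norm_le[of v] power_mono[of "\<bar>snd v\<bar>" "norm v" 2] by simp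
  have "?x\<^sup>2 * ?w\<^sup>2 \<le> R\<^sup>2 * (norm v)\<^sup>2" using xz wv by (intro mult_mono power_mono) auto
  then have 1: "2 * ?x\<^sup>2 * ?w\<^sup>2 \<le> 2 * R\<^sup>2 * (norm v)\<^sup>2" by simp
  have "\<bar>fst z \<bullet> fst v\<bar> \<le> ?x * ?w" by (rule Cauchy_Schwarz_ineq2)
  also have "\<dots> \<le> R * norm v" using xz wv R by (intro mult_mono) auto
  finally have "\<bar>fst z \<bullet> fst v\<bar> \<le> R * norm v" .
  moreover have "?w\<^sup>2 \<le> 2 * norm v"
    unfolding power2_eq_square using wv v by (intro mult_mono) auto
  moreover have "?w\<^sup>2 \<ge> 0" by simp
  ultimately have "\<bar>2 * (fst z \<bullet> fst v) + ?w\<^sup>2\<bar> \<le> (2 * R + 2) * norm v" unfolding distrib_right by linarith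
  then have "\<bar>2 * (fst z \<bullet> fst v) + ?w\<^sup>2\<bar>\<^sup>2 \<le> ((2 * R + 2) * norm v)\<^sup>2" by (rule power_mono) simp
  then have 2: "(2 * (fst z \<bullet> fst v) + ?w\<^sup>2)\<^sup>2 \<le> (2 * R + 2)\<^sup>2 * (norm v)\<^sup>2" by (simp add: power_mult_distrib)
  have "(2 * ?x\<^sup>2 * ?w\<^sup>2 + (2 * (fst z \<bullet> fst v) + ?w\<^sup>2)\<^sup>2) / (4 * \<eta>) \<le> (2 * R\<^sup>2 * (norm v)\<^sup>2 + (2 * R + 2)\<^sup>2 * (norm v)\<^sup>2) / (4 * \<eta>)"
    using 1 2 \<eta> by (intro divide_right_mono add_mono) auto
  moreover have "(snd v)\<^sup>2 / (2 * \<eta>) \<le> (norm v)\<^sup>2 / (2 * \<eta>)" using sv \<eta> by (intro divide_right_mono) auto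
  ultimately show ?thesis unfolding quartic_kernel_add[OF \<eta>] by (simp add: algebra_simps add_divide_distrib)
qed

lemma norm_kernel_grad_le:
  assumes "\<eta> > 0" "norm z \<le> R"
  shows "norm (quartic_kernel_grad \<eta> z) \<le> (R ^ 3 + R) / \<eta>"
proof -
  have x: "norm (fst z) \<le> R" "norm (snd z) \<le> R" using fst_norm_le[of z] snd_norm_le[of z] assms(2) by linarith+
  have "norm (quartic_kernel_grad \<eta> z) \<le> norm (((norm (fst z))\<^sup>2 / \<eta>) *\<^sub>R fst z) + norm (snd z / \<eta>)"
    unfolding quartic_kernel_grad_def by (rule norm_Pair_le)
  also have "\<dots> = (norm (fst z) ^ 3 + norm (snd z)) / \<eta>"
    using assms(1) by (simp add: power3_eq_cube power2_eq_square add_divide_distrib)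
  also have "\<dots> \<le> (R ^ 3 + R) / \<eta>" using x assms(1) by (intro divide_right_mono add_mono power_mono) auto
  finally show ?thesis .
qed

lemma continuous_on_kernel: "\<eta> > 0 \<Longrightarrow> continuous_on UNIV (quartic_kernel \<eta>)"
  unfolding quartic_kernel_def[abs_def] by (intro continuous_intros) auto

lemma semiconvex_with_mono: "semiconvex_with C B f \<Longrightarrow> C \<le> C' \<Longrightarrow> semiconvex_with C' B f"
  unfolding semiconvex_with_def
  by (meson diff_left_mono mult_right_mono order_trans zero_le_power2)

lemma semiconvex_with_add:
  assumes "semiconvex_with C B f" "semiconvex_with C' B f'"
  shows "semiconvex_with (C + C') B (\<lambda>x. f x + f' x)"
  unfolding semiconvex_with_def
proof
  fix x assume x: "x \<in> B"
  obtain p p' where "\<And>y. y \<in> B \<Longrightarrow> f x + p \<bullet> (y - x) - C * (norm (y - x))\<^sup>2 \<le> f y"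
    "\<And>y. y \<in> B \<Longrightarrow> f' x + p' \<bullet> (y - x) - C' * (norm (y - x))\<^sup>2 \<le> f' y"
    using assms x unfolding semiconvex_with_def by meson
  then show "\<exists>p. \<forall>y\<in>B. f x + f' x + p \<bullet> (y - x) - (C + C') * (norm (y - x))\<^sup>2 \<le> f y + f' y"
    by (intro exI[of _ "p + p'"]) (fastforce simp: inner_add_left distrib_right)
qed

text \<open>Up to a constant, each function under the supremum is a translate of minus the kernel,
  so the kernel expansion at a maximizer \<open>Y x\<close> gives a supporting paraboloid. The
  Hessian of the kernel is unbounded, hence constants local to a unit ball; compactness of
  \<open>D\<close> provides the maximizers and bounds them.\<close>

lemma sup_convolution:
  fixes u :: "(real^'m) \<times> real \<Rightarrow> real"
  assumes D: "compact D" "D \<noteq> {}" and u: "continuous_on D u" and \<eta>: "\<eta> > 0"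
  shows "\<exists>f. (\<forall>x. \<forall>y\<in>D. u y - quartic_kernel \<eta> (x - y) \<le> f x) \<and> (\<forall>x. \<exists>y\<in>D. f x = u y - quartic_kernel \<eta> (x - y)) \<and>
     (\<forall>xb. continuous_on (cball xb 1) f) \<and> (\<forall>xb. \<exists>C\<ge>0. semiconvex_with C (cball xb 1) f)"
proof -
  have "\<exists>y\<in>D. \<forall>y'\<in>D. u y' - quartic_kernel \<eta> (x - y') \<le> u y - quartic_kernel \<eta> (x - y)" for x
    by (intro continuous_attains_sup D continuous_intros u continuous_on_compose2[OF continuous_on_kernel[OF \<eta>]]) auto
  then obtain Y where Y: "\<And>x. Y x \<in> D" "\<And>x y'. y' \<in> D \<Longrightarrow> u y' - quartic_kernel \<eta> (x - y') \<le> u (Y x) - quartic_kernel \<eta> (x - Y x)" by metis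
  define f where "f x = u (Y x) - quartic_kernel \<eta> (x - Y x)" for x
  obtain \<rho> where \<rho>: "\<And>y. y \<in> D \<Longrightarrow> norm y \<le> \<rho>" using compact_imp_bounded[OF D(1)] by (auto simp: bounded_iff)
  have local: "\<exists>C\<ge>0. \<exists>K\<ge>0. \<forall>x\<in>cball xb 1. \<forall>x'\<in>cball xb 1. \<exists>p. norm p \<le> K \<and> f x + p \<bullet> (x' - x) - C * (norm (x' - x))\<^sup>2 \<le> f x' \<and> p = - quartic_kernel_grad \<eta> (x - Y x)"
    for xb
  proof -
    define R where "R = norm xb + 1 + \<rho>"
    have "\<rho> \<ge> 0" using \<rho>[OF Y(1)[of xb]] norm_ge_zero order_trans by blast
    then have R: "R \<ge> 0" by (simp add: R_def)
    define C where "C = (2 * R\<^sup>2 + (2 * R + 2)\<^sup>2) / (4 * \<eta>) + 1 / (2 * \<eta>)"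
    define K where "K = (R ^ 3 + R) / \<eta>"
    have CK: "C \<ge> 0" "K \<ge> 0" using \<eta> R by (auto simp: C_def K_def)
    have "norm (- quartic_kernel_grad \<eta> (x - Y x)) \<le> K \<and> f x + (- quartic_kernel_grad \<eta> (x - Y x)) \<bullet> (x' - x) - C * (norm (x' - x))\<^sup>2 \<le> f x'"
      if x: "x \<in> cball xb 1" "x' \<in> cball xb 1" for x x'
    proof -
      have "norm x \<le> norm xb + 1" using x(1) norm_triangle_ineq4[of xb "xb - x"] by (simp add: dist_norm)
      then have nz: "norm (x - Y x) \<le> R" using norm_triangle_ineq4[of x "Y x"] \<rho>[OF Y(1)[of x]] by (simp add: R_def)
      have nv: "norm (x' - x) \<le> 2" using x dist_triangle2[of x' x xb] by (simp add: dist_norm norm_minus_commute)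
      have "quartic_kernel \<eta> ((x - Y x) + (x' - x)) \<le> quartic_kernel \<eta> (x - Y x) + quartic_kernel_grad \<eta> (x - Y x) \<bullet> (x' - x) + C * (norm (x' - x))\<^sup>2"
        unfolding C_def by (rule quartic_kernel_upper[OF \<eta> nz nv])
      moreover have "u (Y x) - quartic_kernel \<eta> (x' - Y x) \<le> f x'" unfolding f_def by (rule Y(2)[OF Y(1)])
      ultimately show ?thesis using norm_kernel_grad_le[OF \<eta> nz] by (simp add: f_def K_def)
    qed
    then show ?thesis using CK by blast
  qed
  have "continuous_on (cball xb 1) f" for xb
  proof -
    obtain C K where CK: "C \<ge> 0" "K \<ge> 0" "\<And>x x'. x \<in> cball xb 1 \<Longrightarrow> x' \<in> cball xb 1 \<Longrightarrow> \<exists>p. norm p \<le> K \<and> f x + p \<bullet> (x' - x) - C * (norm (x' - x))\<^sup>2 \<le> f x'"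
      using local[of xb] by blast
    have one: "f x - f x' \<le> (K + 2 * C) * norm (x - x')" if x: "x \<in> cball xb 1" "x' \<in> cball xb 1" for x x'
    proof -
      obtain p where p: "norm p \<le> K" "f x + p \<bullet> (x' - x) - C * (norm (x' - x))\<^sup>2 \<le> f x'" using CK(3)[OF x] by blast
      have "- (p \<bullet> (x' - x)) \<le> norm p * norm (x' - x)" using Cauchy_Schwarz_ineq2[of p "x' - x"] by linarith
      also have "\<dots> \<le> K * norm (x' - x)" using p(1) by (rule mult_right_mono) simp
      finally have 1: "- (p \<bullet> (x' - x)) \<le> K * norm (x' - x)" .
      have nv: "norm (x' - x) \<le> 2" using x dist_triangle2[of x' x xb] by (simp add: dist_norm norm_minus_commute)
      have "C * (norm (x' - x))\<^sup>2 \<le> C * (2 * norm (x' - x))"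
        unfolding power2_eq_square using nv CK(1) by (intro mult_left_mono mult_right_mono) auto
      then show ?thesis using 1 p(2) by (simp add: norm_minus_commute algebra_simps)
    qed
    have "(K + 2 * C)-lipschitz_on (cball xb 1) f"
    proof (rule lipschitz_onI)
      fix x x' assume x: "x \<in> cball xb 1" "x' \<in> cball xb 1"
      then show "dist (f x) (f x') \<le> (K + 2 * C) * dist x x'"
        using one[OF x] one[OF x(2,1)] by (simp add: dist_real_def dist_norm abs_le_iff norm_minus_commute)
    qed (use CK in simp)
    then show ?thesis by (rule lipschitz_on_continuous_on)
  qed
  moreover have "\<exists>C\<ge>0. semiconvex_with C (cball xb 1) f" for xb
    using local[of xb] unfolding semiconvex_with_def by metis
  ultimately show ?thesis using Y unfolding f_def by (intro exI[of _ "\<lambda>x. u (Y x) - quartic_kernel \<eta> (x - Y x)"]) (auto simp: f_def)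
qed

text \<open>For \<open>\<bar>t\<bar> \<le> 1\<close> the two highest terms are at most
  \<open>m * \<bar>t\<bar> * t^2\<close>, so the linear coefficient must vanish, and then the
  quadratic one decides the sign.\<close>

lemma quartic_nonneg_near_0:
  fixes a b c d :: real
  assumes e: "e > 0" and pos: "\<And>t. \<bar>t\<bar> < e \<Longrightarrow> 0 \<le> a * t + b * t\<^sup>2 + c * t ^ 3 + d * t ^ 4"
  shows "a = 0 \<and> b \<ge> 0"
proof -
  define m where "m = \<bar>c\<bar> + \<bar>d\<bar>"
  have rest: "c * t ^ 3 + d * t ^ 4 \<le> m * \<bar>t\<bar> * t\<^sup>2" if t: "\<bar>t\<bar> \<le> 1" for t
  proof -
    have "c * t ^ 3 + d * t ^ 4 = (c * t + d * (t * t)) * t\<^sup>2" by (simp add: power_numeral_reduce power2_eq_square algebra_simps)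
    also have "\<dots> \<le> (\<bar>c\<bar> * \<bar>t\<bar> + \<bar>d\<bar> * \<bar>t\<bar>) * t\<^sup>2"
    proof (intro mult_right_mono add_mono)
      show "c * t \<le> \<bar>c\<bar> * \<bar>t\<bar>" by (metis abs_ge_self abs_mult)
      have "d * (t * t) \<le> \<bar>d\<bar> * (\<bar>t\<bar> * \<bar>t\<bar>)" by (metis abs_ge_self abs_mult)
      also have "\<dots> \<le> \<bar>d\<bar> * \<bar>t\<bar>" using t by (intro mult_left_mono mult_left_le) auto
      finally show "d * (t * t) \<le> \<bar>d\<bar> * \<bar>t\<bar>" .
    qed simp
    finally show ?thesis by (simp add: m_def distrib_right)
  qed
  have m0: "m \<ge> 0" by (simp add: m_def)
  have "- a = 0"
  proof (rule eq_0_if_inner_le_square[where r = "min (e / 2) 1" and x = "0::real" and c = "\<bar>b\<bar> + m"])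
    fix t :: real assume "t \<in> cball 0 (min (e / 2) 1)"
    then have t: "\<bar>t\<bar> < e" "\<bar>t\<bar> \<le> 1" using e by auto
    have "b * t\<^sup>2 \<le> \<bar>b\<bar> * t\<^sup>2" by (intro mult_right_mono) auto
    moreover have "m * \<bar>t\<bar> * t\<^sup>2 \<le> m * t\<^sup>2" using t m0 by (intro mult_right_mono) (auto simp: mult_left_le)
    ultimately show "(- a) \<bullet> (t - 0) \<le> (\<bar>b\<bar> + m) * (norm (t - 0))\<^sup>2"
      using pos[OF t(1)] rest[OF t(2)] by (simp add: distrib_right)
  qed (use e in auto)
  then have a: "a = 0" by simp
  have "b \<ge> 0"
  proof (rule ccontr)
    assume "\<not> b \<ge> 0"
    then have b: "b < 0" by simp
    define t where "t = min (min (e / 2) 1) (- b / (2 * (m + 1)))"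
    have t: "t > 0" "t < e" "t \<le> 1" "t \<le> - b / (2 * (m + 1))" using e divide_pos_pos[of "- b" "2 * (m + 1)"] b m0 by (auto simp: t_def)
    have "0 \<le> b * t\<^sup>2 + m * t * t\<^sup>2" using pos[of t] rest[of t] t a by simp
    then have "0 \<le> (b + m * t) * t\<^sup>2" by (simp add: distrib_right)
    then have "0 \<le> b + m * t" using t(1) by (simp add: zero_le_mult_iff)
    moreover have "m * t \<le> (m + 1) * t" using t(1) by simp
    moreover have "(m + 1) * t \<le> - b / 2"
    proof -
      have "(m + 1) * t \<le> (m + 1) * (- b / (2 * (m + 1)))" using t(4) m0 by (intro mult_left_mono) auto
      also have "m' \<noteq> 0 \<Longrightarrow> m' * (- b / (2 * m')) = - b / 2" for m' :: real by simp
      then have "(m + 1) * (- b / (2 * (m + 1))) = - b / 2" using m0 by (metis add_nonneg_pos less_irrefl zero_less_one)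
      finally show ?thesis .
    qed
    ultimately show False using b by linarith
  qed
  with a show ?thesis by simp
qed

text \<open>The paraboloid touching \<open>f\<close> at \<open>x\<close> also lies above
  \<open>k\<close> minus the kernel centred at \<open>y\<close>, with equality at \<open>x\<close>.
  Along \<open>x + t (v, 0)\<close> the difference is a quartic polynomial in \<open>t\<close>,
  whose first two coefficients give slope and curvature. The 3 comes from the kernel's spatial
  Hessian \<open>(|\<xi>|^2 I + 2 \<xi> \<xi>^T) / \<eta>\<close>, of norm
  \<open>3 |\<xi>|^2 / \<eta>\<close>.\<close>

lemma touching_kernel:
  fixes x y :: "(real^'m) \<times> real"
  assumes touch: "touches_above f x p X" and ge: "\<And>x'. k - quartic_kernel \<eta> (x' - y) \<le> f x'" and eq: "f x = k - quartic_kernel \<eta> (x - y)"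
    and \<eta>: "\<eta> > 0"
  shows "fst p = - (((norm (fst (x - y)))\<^sup>2 / \<eta>) *\<^sub>R fst (x - y))"
    and "- (3 * (norm (fst (x - y)))\<^sup>2 / \<eta>) * (norm v)\<^sup>2 \<le> X (v, 0) \<bullet> (v, 0)"
proof -
  let ?\<xi> = "fst (x - y)"
  let ?r = "(norm ?\<xi>)\<^sup>2"
  obtain r where r: "r > 0" "\<And>z. z \<in> ball x r \<Longrightarrow> f z \<le> f x + p \<bullet> (z - x) + (X (z - x) \<bullet> (z - x)) / 2" and X: "linear X"
    using touch unfolding touches_above_def by blast
  have "fst p \<bullet> v + ?r / \<eta> * (?\<xi> \<bullet> v) = 0 \<and>
     0 \<le> (X (v, 0) \<bullet> (v, 0)) / 2 + (2 * ?r * (norm v)\<^sup>2 + 4 * (?\<xi> \<bullet> v)\<^sup>2) / (4 * \<eta>)" for v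
  proof (rule quartic_nonneg_near_0[where c = "(?\<xi> \<bullet> v) * (norm v)\<^sup>2 / \<eta>" and d = "((norm v)\<^sup>2)\<^sup>2 / (4 * \<eta>)"])
    show "r / (norm v + 1) > 0" using r(1) by (simp add: add_nonneg_pos)
    fix t :: real assume t: "\<bar>t\<bar> < r / (norm v + 1)"
    have "norm (t *\<^sub>R (v, 0::real)) = \<bar>t\<bar> * norm v" by (simp add: norm_Pair)
    also have "\<dots> \<le> \<bar>t\<bar> * (norm v + 1)" by (intro mult_left_mono) auto
    also have "\<dots> < r" using t by (simp add: pos_less_divide_eq add_nonneg_pos)
    finally have inball: "x + t *\<^sub>R (v, 0) \<in> ball x r" by (simp add: dist_norm)
    have Xt: "X (t *\<^sub>R (v, 0)) \<bullet> (t *\<^sub>R (v, 0)) = t\<^sup>2 * (X (v, 0) \<bullet> (v, 0))"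
      unfolding linear_scale[OF X] inner_scaleR_left inner_scaleR_right by (simp add: power2_eq_square)
    have "k - quartic_kernel \<eta> (x + t *\<^sub>R (v, 0) - y) \<le> f x + p \<bullet> (t *\<^sub>R (v, 0)) + (X (t *\<^sub>R (v, 0)) \<bullet> (t *\<^sub>R (v, 0))) / 2"
      using ge[of "x + t *\<^sub>R (v, 0)"] r(2)[OF inball] by simp
    then have "0 \<le> quartic_kernel \<eta> ((x - y) + t *\<^sub>R (v, 0)) - quartic_kernel \<eta> (x - y) + t * (fst p \<bullet> v) + t\<^sup>2 * (X (v, 0) \<bullet> (v, 0)) / 2"
      unfolding Xt eq by (simp add: inner_prod_def algebra_simps)
    then have 1: "0 \<le> quartic_kernel_grad \<eta> (x - y) \<bullet> (t *\<^sub>R (v, 0)) + (2 * ?r * (norm (t *\<^sub>R v))\<^sup>2 + (2 * (?\<xi> \<bullet> (t *\<^sub>R v)) + (norm (t *\<^sub>R v))\<^sup>2)\<^sup>2) / (4 * \<eta>)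
       + t * (fst p \<bullet> v) + t\<^sup>2 * (X (v, 0) \<bullet> (v, 0)) / 2"
      unfolding quartic_kernel_add[OF \<eta>] by simp
    have g: "quartic_kernel_grad \<eta> (x - y) \<bullet> (t *\<^sub>R (v, 0)) = t * (?r / \<eta> * (?\<xi> \<bullet> v))"
      by (simp add: quartic_kernel_grad_def inner_prod_def)
    have nt: "(norm (t *\<^sub>R v))\<^sup>2 = t\<^sup>2 * (norm v)\<^sup>2" by (simp add: power_mult_distrib)
    have sq: "(2 * ?r * (t\<^sup>2 * n) + (2 * (t * a) + t\<^sup>2 * n)\<^sup>2) / (4 * \<eta>)
        = (2 * ?r * n + 4 * a\<^sup>2) / (4 * \<eta>) * t\<^sup>2 + a * n / \<eta> * t ^ 3 + n\<^sup>2 / (4 * \<eta>) * t ^ 4" for n a :: real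
    proof -
      have "(2 * ?r * (t\<^sup>2 * n) + (2 * (t * a) + t\<^sup>2 * n)\<^sup>2) = (2 * ?r * n + 4 * a\<^sup>2) * t\<^sup>2 + 4 * (a * n) * t ^ 3 + n\<^sup>2 * t ^ 4"
        by (simp add: power2_eq_square power_numeral_reduce algebra_simps)
      moreover have "(A * t\<^sup>2 + 4 * B * t ^ 3 + C * t ^ 4) / (4 * \<eta>) = A / (4 * \<eta>) * t\<^sup>2 + B / \<eta> * t ^ 3 + C / (4 * \<eta>) * t ^ 4"
        for A B C :: real using \<eta> by (simp add: add_divide_distrib)
      ultimately show ?thesis by simp
    qed
    show "0 \<le> (fst p \<bullet> v + ?r / \<eta> * (?\<xi> \<bullet> v)) * t + ((X (v, 0) \<bullet> (v, 0)) / 2 + (2 * ?r * (norm v)\<^sup>2 + 4 * (?\<xi> \<bullet> v)\<^sup>2) / (4 * \<eta>)) * t\<^sup>2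
       + (?\<xi> \<bullet> v) * (norm v)\<^sup>2 / \<eta> * t ^ 3 + ((norm v)\<^sup>2)\<^sup>2 / (4 * \<eta>) * t ^ 4"
    proof -
      have "0 \<le> (\<alpha> + \<beta>) * t + (\<gamma> / 2 + B) * t\<^sup>2 + C * t ^ 3 + D * t ^ 4"
        if "0 \<le> t * \<beta> + (B * t\<^sup>2 + C * t ^ 3 + D * t ^ 4) + t * \<alpha> + t\<^sup>2 * \<gamma> / 2" for \<alpha> \<beta> \<gamma> B C D :: real
        using that by (simp add: algebra_simps)
      from this[OF 1[unfolded g nt, unfolded inner_scaleR_right, unfolded sq]] show ?thesis .
    qed
  qed
  note * = this
  have "(fst p + (?r / \<eta>) *\<^sub>R ?\<xi>) \<bullet> v = 0" for v using *[of v] by (simp add: inner_add_left)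
  then have "fst p + (?r / \<eta>) *\<^sub>R ?\<xi> = 0" using inner_eq_zero_iff by blast
  then show "fst p = - ((?r / \<eta>) *\<^sub>R ?\<xi>)" by (rule eq_neg_iff_add_eq_0[THEN iffD2])
  have "(?\<xi> \<bullet> v)\<^sup>2 \<le> (norm ?\<xi> * norm v)\<^sup>2" using Cauchy_Schwarz_ineq2[of ?\<xi> v] by (rule power2_le_iff_abs_le[THEN iffD2, rotated]) simp
  then have "(2 * ?r * (norm v)\<^sup>2 + 4 * (?\<xi> \<bullet> v)\<^sup>2) / (4 * \<eta>) \<le> (6 * (?r * (norm v)\<^sup>2)) / (4 * \<eta>)"
    using \<eta> by (intro divide_right_mono) (auto simp: power_mult_distrib mult.commute)
  then show "- (3 * ?r / \<eta>) * (norm v)\<^sup>2 \<le> X (v, 0) \<bullet> (v, 0)"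
  proof -
    have "- (3 * ?r / \<eta>) * (norm v)\<^sup>2 = - 2 * ((6 * (?r * (norm v)\<^sup>2)) / (4 * \<eta>))" using \<eta> by simp
    moreover assume "(2 * ?r * (norm v)\<^sup>2 + 4 * (?\<xi> \<bullet> v)\<^sup>2) / (4 * \<eta>) \<le> (6 * (?r * (norm v)\<^sup>2)) / (4 * \<eta>)"
    ultimately show ?thesis using *[of v, THEN conjunct2] by linarith
  qed
qed

section \<open>Jets at contact points and their transfer\<close>

text \<open>The spatial block of a space-time Hessian, the part that enters the equation.\<close>

definition spatial_matrix :: "((real^'m) \<times> real \<Rightarrow> (real^'m) \<times> real) \<Rightarrow> real^'m^'m" where
  "spatial_matrix X = matrix (\<lambda>v. fst (X (v, 0)))"

lemma spatial_matrix:
  assumes X: "linear X" and sym: "\<And>v w. X v \<bullet> w = v \<bullet> X w"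
  shows "spatial_matrix X *v v = fst (X (v, 0))" and "spatial_matrix X \<in> symmetric_matrices"
proof -
  have "linear (\<lambda>v. fst (X (v, 0)))"
  proof (rule linearI)
    fix v w :: "real^'a" and c
    show "fst (X (v + w, 0)) = fst (X (v, 0)) + fst (X (w, 0))" using linear_add[OF X, of "(v, 0)" "(w, 0)"] by simp
    show "fst (X (c *\<^sub>R v, 0)) = c *\<^sub>R fst (X (v, 0))" using linear_scale[OF X, of c "(v, 0)"] by simp
  qed
  then show M: "spatial_matrix X *v v = fst (X (v, 0))" for v
    unfolding spatial_matrix_def by (simp add: matrix_works)
  have "(spatial_matrix X *v v) \<bullet> w = (spatial_matrix X *v w) \<bullet> v" for v w
    using sym[of "(v, 0)" "(w, 0)"] unfolding M by (simp add: inner_prod_def inner_commute)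
  then have "spatial_matrix X $ i $ j = spatial_matrix X $ j $ i" for i j
    using \<open>\<And>v w. (spatial_matrix X *v v) \<bullet> w = (spatial_matrix X *v w) \<bullet> v\<close>[of "axis j 1" "axis i 1"]
    by (simp add: matrix_vector_mult_basis inner_axis column_def)
  then show "spatial_matrix X \<in> symmetric_matrices" by (simp add: symmetric_matrices_def transpose_def vec_eq_iff)
qed

lemma touching_subsolution:
  assumes sub: "eps_subsolution F u" and touch: "touches_above u (y, s) p X" and s: "s < 0" and k: "\<kappa> > 0"
  shows "\<exists>M' p'. M' \<in> symmetric_matrices \<and> dist (M', p') (spatial_matrix X, fst p) < \<kappa> \<and> - \<kappa> \<le> snd p + F M' p' / 2"
proof -
  obtain r where r: "r > 0" "\<And>z. z \<in> ball (y, s) r \<Longrightarrow> u z \<le> u (y, s) + p \<bullet> (z - (y, s)) + (X (z - (y, s)) \<bullet> (z - (y, s))) / 2"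
    and X: "linear X" "\<And>v w. X v \<bullet> w = v \<bullet> X w"
    using touch unfolding touches_above_def by blast
  let ?M = "spatial_matrix X"
  define b where "b = fst (X (0, 1))"
  define c where "c = snd (X (0, 1))"
  define \<phi> where "\<phi> z = u (y, s) + fst p \<bullet> (fst z - y) + snd p * (snd z - s) + (?M *v (fst z - y)) \<bullet> (fst z - y) / 2
       + (snd z - s) * (b \<bullet> (fst z - y)) + c * (snd z - s)\<^sup>2 / 2" for z
  have quad: "X (v, t) \<bullet> (v, t) = (?M *v v) \<bullet> v + 2 * t * (b \<bullet> v) + c * t\<^sup>2" for v t
  proof -
    have "X (v, t) = X (v, 0) + t *\<^sub>R X (0, 1)"
      using linear_add[OF X(1), of "(v, 0)" "t *\<^sub>R (0, 1)"] linear_scale[OF X(1), of t "(0, 1)"] by simp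
    moreover have "snd (X (v, 0)) = b \<bullet> v"
      using X(2)[of "(v, 0)" "(0, 1)"] by (simp add: inner_prod_def b_def inner_commute)
    ultimately show ?thesis
      by (simp add: spatial_matrix(1)[OF X] inner_prod_def b_def c_def inner_add_left power2_eq_square algebra_simps)
  qed
  have \<phi>: "\<phi> z = u (y, s) + p \<bullet> (z - (y, s)) + (X (z - (y, s)) \<bullet> (z - (y, s))) / 2" for z
  proof -
    have e: "z - (y, s) = (fst z - y, snd z - s)" by (cases z) simp
    show ?thesis unfolding e quad \<phi>_def by (simp add: inner_prod_def add_divide_distrib)
  qed
  have test: "test_function_with \<phi> (\<lambda>z. snd p + b \<bullet> (fst z - y) + c * (snd z - s)) (\<lambda>z. fst p + ?M *v (fst z - y) + (snd z - s) *\<^sub>R b) (\<lambda>z. ?M)"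
    unfolding \<phi>_def[abs_def] by (rule test_function_quadratic[OF spatial_matrix(2)[OF X]])
  have lm: "local_max_at (\<lambda>z. u z - \<phi> z) (y, s)"
  proof (rule local_max_at_interior[where U = "ball (y, s) r"])
    fix z assume "z \<in> ball (y, s) r"
    from r(2)[OF this] have "u z - \<phi> z \<le> 0" by (simp add: \<phi>)
    moreover have "u (y, s) - \<phi> (y, s) = 0" by (simp add: \<phi>_def)
    ultimately show "u z - \<phi> z \<le> u (y, s) - \<phi> (y, s)" by simp
  qed (use r(1) in auto)
  from sub[unfolded eps_subsolution_def, rule_format, OF conjI[OF test conjI[OF s conjI[OF lm k]]]]
  show ?thesis by simp
qed

text \<open>Either \<open>a \<le> h\<close>, or \<open>k * L \<le> h^3 \<le> a^3\<close> lets the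
  quartic absorb the linear term. It stands in for Young's inequality with exponents 4 and 4/3 and
  keeps the loss \<open>L * h\<close> explicit.\<close>

lemma quartic_young:
  fixes L :: real
  assumes "k > 0" "L \<ge> 0" "h > 0" "a \<ge> 0" "k * L \<le> h ^ 3"
  shows "L * a \<le> a ^ 4 / k + L * h"
proof (cases "a \<le> h")
  case True
  then have "L * a \<le> L * h" using assms(2) by (rule mult_left_mono)
  moreover have "a ^ 4 / k \<ge> 0" using assms by simp
  ultimately show ?thesis by linarith
next
  case False
  then have "h ^ 3 \<le> a ^ 3" using assms by (intro power_mono) auto
  then have "k * L \<le> a ^ 3" using assms(5) by linarith
  then have "k * L * a \<le> a ^ 3 * a" using assms(4) by (rule mult_right_mono)
  then have "L * a \<le> a ^ 4 / k" using assms(1) by (simp add: pos_le_divide_eq power_numeral_reduce mult_ac)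
  moreover have "L * h \<ge> 0" using assms by simp
  ultimately show ?thesis by linarith
qed

lemma le_one_plus_power:
  fixes a K :: real
  assumes "a \<ge> 0" "a ^ n \<le> K" "n > 0"
  shows "a \<le> 1 + K"
proof (cases "a \<le> 1")
  case True
  moreover have "0 \<le> K" using assms zero_le_power[of a n] by linarith
  ultimately show ?thesis by linarith
next
  case False
  then have "a ^ 1 \<le> a ^ n" using assms by (intro power_increasing) auto
  then show ?thesis using assms by simp
qed

text \<open>The classical property of sup-convolutions: moving \<open>x\<close> and \<open>y\<close>
  by the same vector leaves the kernel unchanged, so a jet of \<open>f\<close> at \<open>x\<close>
  is one of \<open>u\<close> at the maximizer \<open>y\<close>. The supremum has to see a
  neighbourhood of \<open>y\<close>, hence \<open>\<rho>\<close>.\<close>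

lemma touching_transfer:
  assumes touch: "touches_above f x p X" and eq: "f x = u y - quartic_kernel \<eta> (x - y)" and \<rho>: "\<rho> > 0"
    and ge: "\<And>x' y'. y' \<in> ball y \<rho> \<Longrightarrow> u y' - quartic_kernel \<eta> (x' - y') \<le> f x'"
  shows "touches_above u y p X"
proof -
  obtain r where r: "r > 0" "\<And>z. z \<in> ball x r \<Longrightarrow> f z \<le> f x + p \<bullet> (z - x) + (X (z - x) \<bullet> (z - x)) / 2"
    using touch unfolding touches_above_def by blast
  have "u z \<le> u y + p \<bullet> (z - y) + (X (z - y) \<bullet> (z - y)) / 2" if z: "z \<in> ball y (min r \<rho>)" for z
  proof -
    have "z + x - y \<in> ball x r" using z by (simp add: dist_norm)
    from r(2)[OF this] have "f (z + x - y) \<le> f x + p \<bullet> (z - y) + (X (z - y) \<bullet> (z - y)) / 2" by simp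
    moreover have "u z - quartic_kernel \<eta> (x - y) \<le> f (z + x - y)" using ge[of z "z + x - y"] z by simp
    ultimately show ?thesis using eq by simp
  qed
  moreover have "min r \<rho> > 0" using r(1) \<rho> by simp
  ultimately have "\<exists>r>0. \<forall>z\<in>ball y r. u z \<le> u y + p \<bullet> (z - y) + (X (z - y) \<bullet> (z - y)) / 2" by blast
  then show ?thesis using touch unfolding touches_above_def by blast
qed

section \<open>Doubling of variables\<close>

text \<open>The spatial weight \<open>\<kappa>\<close> secures a maximum and tends to 0; the time
  weight \<open>\<sigma>\<close> is fixed, since its slope at negative times provides the strict
  gap.\<close>

definition penalty :: "real \<Rightarrow> real \<Rightarrow> (real^'m) \<times> real \<Rightarrow> real" where
  "penalty \<kappa> \<sigma> x = \<kappa> * (norm (fst x))\<^sup>2 + \<sigma> * (snd x)\<^sup>2"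

lemma penalty_add:
  "penalty \<kappa> \<sigma> (x + v) = penalty \<kappa> \<sigma> x + ((2 * \<kappa>) *\<^sub>R fst x, 2 * \<sigma> * snd x) \<bullet> v + \<kappa> * (norm (fst v))\<^sup>2 + \<sigma> * (snd v)\<^sup>2"
  unfolding penalty_def power2_norm_eq_inner
  by (simp add: inner_prod_def inner_add_left inner_add_right inner_commute power2_eq_square algebra_simps)

lemma semiconvex_uminus_penalty:
  assumes "\<kappa> \<ge> 0" "\<sigma> \<ge> 0"
  shows "semiconvex_with (\<kappa> + \<sigma>) B (\<lambda>x. - penalty \<kappa> \<sigma> x)"
  unfolding semiconvex_with_def
proof
  fix x :: "(real^'a) \<times> real" assume "x \<in> B"
  have "- penalty \<kappa> \<sigma> x + (- ((2 * \<kappa>) *\<^sub>R fst x, 2 * \<sigma> * snd x)) \<bullet> (y - x) - (\<kappa> + \<sigma>) * (norm (y - x))\<^sup>2 \<le> - penalty \<kappa> \<sigma> y" for y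
  proof -
    have "\<kappa> * (norm (fst (y - x)))\<^sup>2 \<le> \<kappa> * (norm (y - x))\<^sup>2"
      using assms(1) by (intro mult_left_mono power_mono fst_norm_le) auto
    moreover have "\<sigma> * (snd (y - x))\<^sup>2 \<le> \<sigma> * (norm (y - x))\<^sup>2"
      using assms(2) power_mono[OF snd_norm_le, of "y - x" 2] by (intro mult_left_mono) auto
    ultimately show ?thesis using penalty_add[of \<kappa> \<sigma> x "y - x"] by (simp only: inner_minus_left distrib_right) simp
  qed
  then show "\<exists>p. \<forall>y\<in>B. - penalty \<kappa> \<sigma> x + p \<bullet> (y - x) - (\<kappa> + \<sigma>) * (norm (y - x))\<^sup>2 \<le> - penalty \<kappa> \<sigma> y" by blast
qed

lemma touches_above_add_penalty:
  assumes "touches_above (\<lambda>x. f x - penalty \<kappa> \<sigma> x) x p X"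
  shows "touches_above f x (p + ((2 * \<kappa>) *\<^sub>R fst x, 2 * \<sigma> * snd x)) (\<lambda>v. X v + ((2 * \<kappa>) *\<^sub>R fst v, 2 * \<sigma> * snd v))"
proof -
  let ?g = "((2 * \<kappa>) *\<^sub>R fst x, 2 * \<sigma> * snd x)" and ?X = "\<lambda>v. X v + ((2 * \<kappa>) *\<^sub>R fst v, 2 * \<sigma> * snd v)"
  obtain r where r: "r > 0" "\<And>z. z \<in> ball x r \<Longrightarrow> f z - penalty \<kappa> \<sigma> z \<le> f x - penalty \<kappa> \<sigma> x + p \<bullet> (z - x) + (X (z - x) \<bullet> (z - x)) / 2"
    and X: "linear X" "\<And>v w. X v \<bullet> w = v \<bullet> X w"
    using assms unfolding touches_above_def by blast
  have "linear ?X"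
    by (rule linearI) (auto simp: linear_add[OF X(1)] linear_scale[OF X(1)] algebra_simps)
  moreover have "?X v \<bullet> w = v \<bullet> ?X w" for v w
    using X(2)[of v w] by (simp add: inner_add_left inner_add_right) (simp add: inner_prod_def)
  moreover have "f z \<le> f x + (p + ?g) \<bullet> (z - x) + (?X (z - x) \<bullet> (z - x)) / 2" if "z \<in> ball x r" for z
  proof -
    define v where "v = z - x"
    have z: "z = x + v" by (simp add: v_def)
    have "?X v \<bullet> v = X v \<bullet> v + 2 * (\<kappa> * (norm (fst v))\<^sup>2 + \<sigma> * (snd v)\<^sup>2)"
      by (simp add: inner_add_left) (simp add: inner_prod_def power2_norm_eq_inner[symmetric] power2_eq_square[of "snd v"])
    then have "(?X v \<bullet> v) / 2 = (X v \<bullet> v) / 2 + \<kappa> * (norm (fst v))\<^sup>2 + \<sigma> * (snd v)\<^sup>2" by simp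
    moreover have "f z \<le> f x + p \<bullet> v + (X v \<bullet> v) / 2 + ?g \<bullet> v + \<kappa> * (norm (fst v))\<^sup>2 + \<sigma> * (snd v)\<^sup>2"
    proof -
      have "f z - penalty \<kappa> \<sigma> z \<le> f x - penalty \<kappa> \<sigma> x + p \<bullet> v + (X v \<bullet> v) / 2"
        using r(2)[OF that] by (simp only: v_def)
      then show ?thesis using penalty_add[of \<kappa> \<sigma> x v] unfolding z by linarith
    qed
    ultimately show ?thesis unfolding v_def[symmetric] inner_add_left[of p] by linarith
  qed
  ultimately show ?thesis unfolding touches_above_def using r(1) by blast
qed

context
  fixes u v :: "(real^'m) \<times> real \<Rightarrow> real" and f :: "real^'m \<Rightarrow> real" and L C :: real
  assumes ub: "\<And>x s. s \<le> 0 \<Longrightarrow> u (x, s) \<le> f x + C * sqrt (- s)"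
    and vb: "\<And>x s. s \<le> 0 \<Longrightarrow> v (x, s) \<le> - f x"
    and lip: "\<And>x y. f x \<le> f y + L * norm (x - y)" and L: "L > 0" and C: "C > 0"
begin

text \<open>The barriers and the Lipschitz bound give \<open>u y + v z \<le> L * norm (fst y - fst
  z) + C * sqrt (- snd y)\<close>. Half of the quartic part of the kernels absorbs the spatial term
  at total cost \<open>\<theta> / 4\<close>, and \<open>\<theta> / 8\<close> more replaces the time
  of \<open>y\<close> by that of \<open>x\<close>. What is left of \<open>\<theta>\<close> forces
  both times below a fixed negative level, and the remaining penalties are bounded by
  \<open>B\<close>, uniformly in \<open>\<kappa>\<close>.\<close>

lemma doubling_bounds:
  assumes \<eta>: "\<eta> > 0" and h: "h > 0" "8 * \<eta> * L \<le> h ^ 3" "L * h \<le> \<theta> / 8"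
    and \<mu>: "\<mu> > 0" "4 * \<eta> * C \<le> \<mu> ^ 3" "C * \<mu> \<le> \<theta> / 8"
    and \<theta>: "\<theta> > 0" and \<sigma>: "\<sigma> > 0" and \<kappa>: "\<kappa> \<ge> 0"
    and neg: "snd y \<le> 0" "snd z \<le> 0"
    and ge: "\<theta> \<le> u y + v z - quartic_kernel \<eta> (x - y) - quartic_kernel \<eta> (x - z) - penalty \<kappa> \<sigma> x"
  defines "B \<equiv> C + C\<^sup>2 / (2 * \<sigma>)"
  shows "snd y \<le> - (\<theta> / (2 * C))\<^sup>2" "snd x \<le> - (\<theta> / (2 * C))\<^sup>2"
    "norm (fst (x - y)) ^ 4 \<le> 8 * \<eta> * B" "norm (fst (x - z)) ^ 4 \<le> 8 * \<eta> * B"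
    "(snd (x - y))\<^sup>2 \<le> 4 * \<eta> * B" "(snd (x - z))\<^sup>2 \<le> 2 * \<eta> * B"
    "\<kappa> * (norm (fst x))\<^sup>2 \<le> B" "\<sigma> * (snd x)\<^sup>2 / 2 \<le> B"
proof -
  define a where "a = norm (fst (x - y))"
  define b where "b = norm (fst (x - z))"
  define p where "p = \<bar>snd (x - y)\<bar>"
  define q where "q = \<bar>snd (x - z)\<bar>"
  define t where "t = snd x"
  have nn: "a \<ge> 0" "b \<ge> 0" "p \<ge> 0" "q \<ge> 0" by (simp_all add: a_def b_def p_def q_def)
  have ky: "quartic_kernel \<eta> (x - y) = a ^ 4 / (4 * \<eta>) + p\<^sup>2 / (2 * \<eta>)"
    by (simp add: quartic_kernel_def a_def p_def power_mult[symmetric])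
  have kz: "quartic_kernel \<eta> (x - z) = b ^ 4 / (4 * \<eta>) + q\<^sup>2 / (2 * \<eta>)"
    by (simp add: quartic_kernel_def b_def q_def power_mult[symmetric])
  have "norm (fst y - fst z) \<le> a + b"
  proof -
    have "fst y - fst z = fst (x - z) - fst (x - y)" by simp
    then have "norm (fst y - fst z) \<le> norm (fst (x - z)) + norm (fst (x - y))" by (metis norm_triangle_ineq4)
    then show ?thesis by (simp add: a_def b_def)
  qed
  then have "L * norm (fst y - fst z) \<le> L * a + L * b" using mult_left_mono[of _ "a + b" L] L by (simp add: distrib_left)
  then have uv: "u y + v z \<le> L * a + L * b + C * sqrt (- snd y)"
    using ub[OF neg(1), of "fst y"] vb[OF neg(2), of "fst z"] lip[of "fst y" "fst z"] by simp
  have ya: "L * a \<le> a ^ 4 / (8 * \<eta>) + L * h" using \<eta> L h nn by (intro quartic_young) auto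
  have yb: "L * b \<le> b ^ 4 / (8 * \<eta>) + L * h" using \<eta> L h nn by (intro quartic_young) auto
  have yp: "C * sqrt p \<le> p\<^sup>2 / (4 * \<eta>) + C * \<mu>"
  proof -
    have "sqrt p ^ 4 = (sqrt p ^ 2) ^ 2" by (simp only: power_mult[symmetric]) simp
    then have "sqrt p ^ 4 = p\<^sup>2" using nn(3) by simp
    then show ?thesis using quartic_young[of "4 * \<eta>" C \<mu> "sqrt p"] \<eta> C \<mu> nn(3) by simp
  qed
  have ha: "a ^ 4 / (4 * \<eta>) = a ^ 4 / (8 * \<eta>) + a ^ 4 / (8 * \<eta>)" and hb: "b ^ 4 / (4 * \<eta>) = b ^ 4 / (8 * \<eta>) + b ^ 4 / (8 * \<eta>)"
    and hp: "p\<^sup>2 / (2 * \<eta>) = p\<^sup>2 / (4 * \<eta>) + p\<^sup>2 / (4 * \<eta>)" using \<eta> by simp_all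
  have pos: "a ^ 4 / (8 * \<eta>) \<ge> 0" "b ^ 4 / (8 * \<eta>) \<ge> 0" "p\<^sup>2 / (4 * \<eta>) \<ge> 0" "q\<^sup>2 / (2 * \<eta>) \<ge> 0"
    "\<kappa> * (norm (fst x))\<^sup>2 \<ge> 0" "\<sigma> * t\<^sup>2 \<ge> 0" using \<eta> \<kappa> \<sigma> by auto
  have base: "\<theta> \<le> \<theta> / 4 + C * sqrt (- snd y) - (a ^ 4 / (8 * \<eta>) + b ^ 4 / (8 * \<eta>) + p\<^sup>2 / (4 * \<eta>) + p\<^sup>2 / (4 * \<eta>) + q\<^sup>2 / (2 * \<eta>)
      + \<kappa> * (norm (fst x))\<^sup>2 + \<sigma> * t\<^sup>2)"
    using ge uv ya yb h(3) unfolding ky kz ha hb hp penalty_def t_def by linarith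
  have sq: "w \<le> - (\<theta> / (2 * C))\<^sup>2" if "\<theta> / 2 \<le> C * sqrt (- w)" for w
  proof -
    have "\<theta> / (2 * C) \<le> sqrt (- w)" using that C by (simp add: field_simps)
    then have "(\<theta> / (2 * C))\<^sup>2 \<le> - w" using \<theta> C by (metis divide_nonneg_pos less_imp_le mult_pos_pos real_le_rsqrt real_sqrt_le_iff real_sqrt_unique real_sqrt_ge_zero sqrt_le_D zero_less_numeral)
    then show ?thesis by simp
  qed
  show "snd y \<le> - (\<theta> / (2 * C))\<^sup>2" using base pos \<theta> by (intro sq) linarith
  \<comment> \<open>The third point is unconstrained, so its time could be nonnegative; then
    \<open>- snd y\<close> would be at most the time displacement \<open>p\<close>, and the kernel
    would absorb its root.\<close>
  have tneg: "t < 0"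
  proof (rule ccontr)
    assume "\<not> t < 0"
    then have "- snd y \<le> p" using neg(1) by (simp add: p_def t_def)
    then have "C * sqrt (- snd y) \<le> C * sqrt p" using C by simp
    then show False using base yp pos \<mu>(3) \<theta> by linarith
  qed
  have "- snd y \<le> - t + p" by (simp add: p_def t_def)
  then have "sqrt (- snd y) \<le> sqrt (- t + p)" by simp
  also have "\<dots> \<le> sqrt (- t) + sqrt p" using tneg nn(3) by (intro sqrt_add_le_add_sqrt) auto
  finally have "C * sqrt (- snd y) \<le> C * sqrt (- t) + C * sqrt p" using C mult_left_mono[of _ _ C] by (simp add: distrib_left[symmetric])
  then have base2: "\<theta> \<le> 3 * \<theta> / 8 + C * sqrt (- t) - (a ^ 4 / (8 * \<eta>) + b ^ 4 / (8 * \<eta>) + p\<^sup>2 / (4 * \<eta>) + q\<^sup>2 / (2 * \<eta>)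
      + \<kappa> * (norm (fst x))\<^sup>2 + \<sigma> * t\<^sup>2)"
    using base yp \<mu>(3) by linarith
  show "snd x \<le> - (\<theta> / (2 * C))\<^sup>2" unfolding t_def[symmetric] using base2 pos \<theta> by (intro sq) linarith
  \<comment> \<open>A bound linear in time, which half of \<open>\<sigma> * t^2\<close> absorbs;
    this is the origin of \<open>B\<close>.\<close>
  have "sqrt (- t) \<le> 1 + (- t)"
  proof -
    have "(1 + - t)\<^sup>2 = 1 - 2 * t + t\<^sup>2" by (simp add: power2_eq_square algebra_simps)
    then have "- t \<le> (1 + - t)\<^sup>2" using tneg zero_le_power2[of t] by linarith
    then show ?thesis using tneg by (intro real_le_lsqrt) auto
  qed
  then have "C * sqrt (- t) \<le> C + C * (- t)" using C mult_left_mono[of _ _ C] by (metis distrib_left less_imp_le mult.right_neutral)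
  moreover have "C * (- t) - \<sigma> * (- t)\<^sup>2 / 2 \<le> C\<^sup>2 / (2 * \<sigma>)" by (rule young_square[OF \<sigma>])
  ultimately have Ct: "C * sqrt (- t) \<le> B + \<sigma> * t\<^sup>2 / 2" by (simp add: B_def)
  have st: "\<sigma> * t\<^sup>2 / 2 \<ge> 0" using \<sigma> by simp
  have all: "a ^ 4 / (8 * \<eta>) + b ^ 4 / (8 * \<eta>) + p\<^sup>2 / (4 * \<eta>) + q\<^sup>2 / (2 * \<eta>) + \<kappa> * (norm (fst x))\<^sup>2 + \<sigma> * t\<^sup>2 / 2 \<le> B"
    using base2 Ct \<theta> by linarith
  have "a ^ 4 / (8 * \<eta>) \<le> B" "b ^ 4 / (8 * \<eta>) \<le> B" "p\<^sup>2 / (4 * \<eta>) \<le> B" "q\<^sup>2 / (2 * \<eta>) \<le> B"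
    using all pos st by linarith+
  then show "norm (fst (x - y)) ^ 4 \<le> 8 * \<eta> * B" "norm (fst (x - z)) ^ 4 \<le> 8 * \<eta> * B"
    "(snd (x - y))\<^sup>2 \<le> 4 * \<eta> * B" "(snd (x - z))\<^sup>2 \<le> 2 * \<eta> * B"
    using \<eta> by (simp_all add: pos_divide_le_eq a_def b_def p_def q_def mult_ac)
  show "\<kappa> * (norm (fst x))\<^sup>2 \<le> B" using all pos st by linarith
  show "\<sigma> * (snd x)\<^sup>2 / 2 \<le> B" using all pos st unfolding t_def by linarith
qed

end

text \<open>What the maximum yields for one \<open>\<kappa>\<close>: displacements
  \<open>\<xi>\<close>, spatial Hessians \<open>M\<close>, time slopes \<open>a\<close>. Gradients
  and lower Hessian bounds are those of the kernel. The parameters \<open>\<eta>\<close>,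
  \<open>R\<close>, \<open>B\<close>, \<open>c\<close> are arguments because they must not depend on
  \<open>\<kappa>\<close>, whose limit is taken afterwards.\<close>

definition opposite_jets ::
    "(real^'m^'m \<Rightarrow> real^'m \<Rightarrow> real) \<Rightarrow> (real^'m^'m \<Rightarrow> real^'m \<Rightarrow> real) \<Rightarrow> real \<Rightarrow> real \<Rightarrow> real \<Rightarrow> real \<Rightarrow> real \<Rightarrow> bool" where
  "opposite_jets F1 F2 \<eta> R B c \<kappa> \<longleftrightarrow> (\<exists>\<xi>1 \<xi>2 M1 M2 a1 a2.
     norm \<xi>1 \<le> R \<and> norm \<xi>2 \<le> R \<and> M1 \<in> symmetric_matrices \<and> M2 \<in> symmetric_matrices \<and>
     (\<forall>w. - (3 * (norm \<xi>1)\<^sup>2 / \<eta>) * (norm w)\<^sup>2 \<le> (M1 *v w) \<bullet> w) \<and>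
     (\<forall>w. - (3 * (norm \<xi>2)\<^sup>2 / \<eta>) * (norm w)\<^sup>2 \<le> (M2 *v w) \<bullet> w) \<and>
     (\<forall>w. (M1 *v w) \<bullet> w + (M2 *v w) \<bullet> w \<le> 3 * \<kappa> * (norm w)\<^sup>2) \<and>
     norm (((norm \<xi>1)\<^sup>2 / \<eta>) *\<^sub>R \<xi>1 + ((norm \<xi>2)\<^sup>2 / \<eta>) *\<^sub>R \<xi>2) \<le> \<kappa> + 2 * sqrt (\<kappa> * B) \<and>
     a1 + a2 \<le> - c \<and>
     (\<exists>M p. dist (M, p) (M1, - (((norm \<xi>1)\<^sup>2 / \<eta>) *\<^sub>R \<xi>1)) < \<kappa> \<and> - \<kappa> \<le> a1 + F1 M p / 2) \<and>
     (\<exists>M p. dist (M, p) (M2, - (((norm \<xi>2)\<^sup>2 / \<eta>) *\<^sub>R \<xi>2)) < \<kappa> \<and> - \<kappa> \<le> a2 + F2 M p / 2))"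

text \<open>The suprema over \<open>y\<close> and \<open>z\<close> at fixed \<open>x\<close> are
  sup-convolutions \<open>f1\<close> and \<open>f2\<close>. The maximum principle acts on
  \<open>f1\<close> and \<open>f2\<close> minus the penalty near the maximizing \<open>x\<close>,
  and \<open>touching_transfer\<close> returns the jets to \<open>u\<close> and
  \<open>v\<close>.\<close>

lemma comparison_jets:
  fixes u v :: "(real^'m) \<times> real \<Rightarrow> real" and f :: "real^'m \<Rightarrow> real"
  assumes ub: "\<And>x s. s \<le> 0 \<Longrightarrow> u (x, s) \<le> f x + C * sqrt (- s)"
    and vb: "\<And>x s. s \<le> 0 \<Longrightarrow> v (x, s) \<le> - f x"
    and lip: "\<And>x y. f x \<le> f y + L * norm (x - y)" and L: "L > 0" and C: "C > 0"
    and contu: "continuous_on (UNIV \<times> {..0}) u" and contv: "continuous_on (UNIV \<times> {..0}) v"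
    and subu: "eps_subsolution F1 u" and subv: "eps_subsolution F2 v"
    and t1: "t1 < 0" and pos: "u (x1, t1) + v (x1, t1) > 0"
  shows "\<exists>\<eta>>0. \<exists>R B c \<kappa>0. c > 0 \<and> \<kappa>0 > 0 \<and> (\<forall>\<kappa>. 0 < \<kappa> \<longrightarrow> \<kappa> < \<kappa>0 \<longrightarrow> opposite_jets F1 F2 \<eta> R B c \<kappa>)"
proof -
  let ?S = "(UNIV :: (real^'m) set) \<times> {..0::real}"
  have closedS: "closed ?S" by (intro closed_Times) auto
  \<comment> \<open>A quarter of the violation: at \<open>(x1, t1)\<close> the spatial and the time
    penalty cost at most \<open>\<theta>\<close> each, which leaves \<open>2 * \<theta>\<close> for
    the maximum and still \<open>\<theta>\<close> for points near it.\<close>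
  define \<theta> where "\<theta> = (u (x1, t1) + v (x1, t1)) / 4"
  have \<theta>: "\<theta> > 0" using pos by (simp add: \<theta>_def)
  define \<sigma> where "\<sigma> = \<theta> / t1\<^sup>2"
  have \<sigma>: "\<sigma> > 0" using \<theta> t1 by (simp add: \<sigma>_def)
  define B where "B = C + C\<^sup>2 / (2 * \<sigma>)"
  have B: "B > 0" using C \<sigma> by (simp add: B_def add_pos_nonneg)
  define s0 where "s0 = (\<theta> / (2 * C))\<^sup>2"
  have s0: "s0 > 0" using \<theta> C by (simp add: s0_def)
  define h where "h = \<theta> / (8 * L)"
  define \<mu> where "\<mu> = \<theta> / (8 * C)"
  have h: "h > 0" "L * h \<le> \<theta> / 8" using \<theta> L by (simp_all add: h_def)
  have \<mu>: "\<mu> > 0" "C * \<mu> \<le> \<theta> / 8" using \<theta> C by (simp_all add: \<mu>_def)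
  \<comment> \<open>The first two bounds are those of \<open>doubling_bounds\<close>. The third
    keeps the time of \<open>z\<close> within \<open>s0 / 2\<close> of that of \<open>x\<close>, as
    \<open>doubling_bounds\<close> places only the times of \<open>y\<close> and \<open>x\<close>
    below \<open>- s0\<close>.\<close>
  define \<eta> where "\<eta> = min (h ^ 3 / (8 * L)) (min (\<mu> ^ 3 / (4 * C)) (s0\<^sup>2 / (8 * B)))"
  have \<eta>: "\<eta> > 0" using h(1) \<mu>(1) L C B s0 by (simp add: \<eta>_def)
  have \<eta>1: "8 * \<eta> * L \<le> h ^ 3"
  proof -
    have "\<eta> \<le> h ^ 3 / (8 * L)" unfolding \<eta>_def by (rule min.cobounded1)
    then show ?thesis using L by (simp add: pos_le_divide_eq mult_ac)
  qed
  have \<eta>2: "4 * \<eta> * C \<le> \<mu> ^ 3"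
  proof -
    have "\<eta> \<le> \<mu> ^ 3 / (4 * C)" unfolding \<eta>_def by (rule order_trans[OF min.cobounded2 min.cobounded1])
    then show ?thesis using C by (simp add: pos_le_divide_eq mult_ac)
  qed
  have \<eta>3: "2 * \<eta> * B \<le> (s0 / 2)\<^sup>2"
  proof -
    have "\<eta> \<le> s0\<^sup>2 / (8 * B)" unfolding \<eta>_def by (rule order_trans[OF min.cobounded2 min.cobounded2])
    then show ?thesis using B by (simp add: pos_le_divide_eq power_divide mult_ac)
  qed
  define Ra where "Ra = 1 + 8 * \<eta> * B"
  define R0 where "R0 = Ra + (1 + 4 * \<eta> * B)"
  have R0: "R0 > 0" using \<eta> B by (simp add: R0_def Ra_def add_pos_pos)
  define \<Theta> where "\<Theta> \<kappa> w = u (fst w) + v (fst (snd w)) - quartic_kernel \<eta> (snd (snd w) - fst w) - quartic_kernel \<eta> (snd (snd w) - fst (snd w)) - penalty \<kappa> \<sigma> (snd (snd w))" for \<kappa> w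
  have bounds: "snd y \<le> - s0" "snd x \<le> - s0" "snd z \<le> - s0 / 2" "dist y x \<le> R0" "dist z x \<le> R0" "norm (fst (x - y)) \<le> Ra" "norm (fst (x - z)) \<le> Ra"
      "\<kappa> * (norm (fst x))\<^sup>2 \<le> B" "\<sigma> * (snd x)\<^sup>2 / 2 \<le> B"
    if ge: "\<theta> \<le> u y + v z - quartic_kernel \<eta> (x - y) - quartic_kernel \<eta> (x - z) - penalty \<kappa> \<sigma> x" and k: "\<kappa> \<ge> 0" and S: "y \<in> ?S" "z \<in> ?S"
    for \<kappa> y z x
  proof -
    have neg: "snd y \<le> 0" "snd z \<le> 0" using S by auto
    note d = doubling_bounds[OF ub vb lip L C \<eta> h(1) \<eta>1 h(2) \<mu>(1) \<eta>2 \<mu>(2) \<theta> \<sigma> k neg ge, folded B_def s0_def]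
    show "snd y \<le> - s0" "snd x \<le> - s0" "\<kappa> * (norm (fst x))\<^sup>2 \<le> B" "\<sigma> * (snd x)\<^sup>2 / 2 \<le> B"
      by (rule d(1) d(2) d(7) d(8); assumption)+
    show a: "norm (fst (x - y)) \<le> Ra" "norm (fst (x - z)) \<le> Ra"
      unfolding Ra_def by (rule le_one_plus_power[where n = 4]; use d(3,4) in simp)+
    have p: "\<bar>snd (x - y)\<bar> \<le> 1 + 4 * \<eta> * B"
      by (rule le_one_plus_power[where n = 2]) (use d(5) in auto)
    have "\<bar>snd (x - z)\<bar> \<le> 1 + 2 * \<eta> * B"
      by (rule le_one_plus_power[where n = 2]) (use d(6) in auto)
    moreover have "2 * \<eta> * B \<le> 4 * \<eta> * B" using \<eta> B by simp
    ultimately have q: "\<bar>snd (x - z)\<bar> \<le> 1 + 4 * \<eta> * B" by linarith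
    have nrm: "norm w \<le> norm (fst w) + \<bar>snd w\<bar>" for w :: "(real^'m) \<times> real"
      using norm_Pair_le[of "fst w" "snd w"] by simp
    show "dist y x \<le> R0" using nrm[of "x - y"] a p by (simp add: dist_norm norm_minus_commute R0_def)
    show "dist z x \<le> R0" using nrm[of "x - z"] a q by (simp add: dist_norm norm_minus_commute R0_def)
    have "(snd (x - z))\<^sup>2 \<le> (s0 / 2)\<^sup>2" using d(6) \<eta>3 by linarith
    then have "\<bar>snd (x - z)\<bar> \<le> s0 / 2" using abs_le_square_iff[of "snd (x - z)" "s0 / 2"] s0 by simp
    then show "snd z \<le> - s0 / 2" using d(2) unfolding snd_diff by linarith
  qed
  define c where "c = \<sigma> * s0"
  have c: "c > 0" using \<sigma> s0 by (simp add: c_def)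
  \<comment> \<open>The first bound limits the spatial penalty at \<open>x1\<close> to
    \<open>\<theta>\<close>; the second lets the time gap survive an error
    \<open>\<kappa>\<close>.\<close>
  define \<kappa>0 where "\<kappa>0 = min (\<theta> / ((norm x1)\<^sup>2 + 1)) c"
  have \<kappa>0: "\<kappa>0 > 0" using \<theta> c by (simp add: \<kappa>0_def add_nonneg_pos)
  have jets: "opposite_jets F1 F2 \<eta> Ra B c \<kappa>"
    if \<kappa>: "0 < \<kappa>" "\<kappa> < \<kappa>0" for \<kappa>
  proof -
    have k0: "\<kappa> \<ge> 0" using \<kappa> by simp
    let ?SS = "?S \<times> ?S \<times> (UNIV :: ((real^'m) \<times> real) set)"
    let ?X1 = "(x1, t1)"
    have XS: "?X1 \<in> ?S" using t1 by simp
    have "\<kappa> * (norm x1)\<^sup>2 \<le> \<theta>"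
    proof -
      have "\<kappa> \<le> \<theta> / ((norm x1)\<^sup>2 + 1)" using \<kappa>(2) by (simp add: \<kappa>0_def)
      then have "\<kappa> * ((norm x1)\<^sup>2 + 1) \<le> \<theta>" by (simp add: pos_le_divide_eq add_nonneg_pos)
      then show ?thesis using \<kappa>(1) by (simp add: distrib_left)
    qed
    moreover have "\<sigma> * t1\<^sup>2 = \<theta>" using t1 by (simp add: \<sigma>_def)
    moreover have "quartic_kernel \<eta> (0 :: (real^'m) \<times> real) = 0" by (simp add: quartic_kernel_def)
    ultimately have \<Theta>1: "\<Theta> \<kappa> (?X1, ?X1, ?X1) \<ge> 2 * \<theta>"
      by (simp add: \<Theta>_def penalty_def \<theta>_def)
    have contP: "continuous_on UNIV (penalty \<kappa> \<sigma>)" unfolding penalty_def[abs_def] by (intro continuous_intros)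
    have cont\<Theta>: "continuous_on ?SS (\<Theta> \<kappa>)"
      unfolding \<Theta>_def
      by (intro continuous_intros continuous_on_compose2[OF contu] continuous_on_compose2[OF contv]
          continuous_on_compose2[OF continuous_on_kernel[OF \<eta>]] continuous_on_compose2[OF contP]) auto
    have "\<exists>w\<in>?SS. \<forall>w'\<in>?SS. \<Theta> \<kappa> w' \<le> \<Theta> \<kappa> w"
    proof (rule attains_max_coercive[OF _ cont\<Theta>, where R = "3 * ((1 + B / \<kappa>) + (1 + 2 * B / \<sigma>)) + 2 * R0"])
      show "closed ?SS" by (intro closed_Times closedS) auto
      show "(?X1, ?X1, ?X1) \<in> ?SS" using XS by simp
      fix w assume w: "w \<in> ?SS" "\<Theta> \<kappa> (?X1, ?X1, ?X1) \<le> \<Theta> \<kappa> w"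
      obtain y z x where yzx: "w = (y, z, x)" by (cases w) auto
      have S: "y \<in> ?S" "z \<in> ?S" using w(1) yzx by auto
      have "\<theta> \<le> u y + v z - quartic_kernel \<eta> (x - y) - quartic_kernel \<eta> (x - z) - penalty \<kappa> \<sigma> x"
        using w(2) \<Theta>1 \<theta> by (simp add: \<Theta>_def yzx)
      note b = bounds[OF this k0 S]
      have "norm (fst x) \<le> 1 + B / \<kappa>"
        by (rule le_one_plus_power[where n = 2]) (use b(8) \<kappa>(1) in \<open>auto simp: pos_le_divide_eq mult.commute\<close>)
      moreover have "\<bar>snd x\<bar> \<le> 1 + 2 * B / \<sigma>"
        by (rule le_one_plus_power[where n = 2]) (use b(9) \<sigma> in \<open>auto simp: pos_le_divide_eq mult.commute\<close>)
      moreover have "norm x \<le> norm (fst x) + \<bar>snd x\<bar>" using norm_Pair_le[of "fst x" "snd x"] by simp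
      ultimately have nx: "norm x \<le> (1 + B / \<kappa>) + (1 + 2 * B / \<sigma>)" by linarith
      have ny: "norm y \<le> norm x + R0" using b(4) norm_triangle_ineq2[of y x] by (simp add: dist_norm)
      have nz: "norm z \<le> norm x + R0" using b(5) norm_triangle_ineq2[of z x] by (simp add: dist_norm)
      have "norm w \<le> norm y + norm (z, x)" unfolding yzx by (rule norm_Pair_le)
      moreover have "norm (z, x) \<le> norm z + norm x" by (rule norm_Pair_le)
      ultimately show "norm w \<le> 3 * ((1 + B / \<kappa>) + (1 + 2 * B / \<sigma>)) + 2 * R0" using nx ny nz by argo
    qed
    then obtain w0 where w0: "w0 \<in> ?SS" "\<And>w'. w' \<in> ?SS \<Longrightarrow> \<Theta> \<kappa> w' \<le> \<Theta> \<kappa> w0" by blast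
    obtain yb zb xb where "w0 = (yb, zb, xb)" by (cases w0) auto
    note mx0 = w0[unfolded this]
    define mxv where "mxv = \<Theta> \<kappa> (yb, zb, xb)"
    have mxv: "mxv \<ge> 2 * \<theta>" using mx0(2)[of "(?X1, ?X1, ?X1)"] XS \<Theta>1 by (simp add: mxv_def)
    have Sb: "yb \<in> ?S" "zb \<in> ?S" using mx0(1) by auto
    have "\<theta> \<le> u yb + v zb - quartic_kernel \<eta> (xb - yb) - quartic_kernel \<eta> (xb - zb) - penalty \<kappa> \<sigma> xb"
      using mxv \<theta> by (simp add: \<Theta>_def mxv_def)
    note bb = bounds[OF this k0 Sb]
    \<comment> \<open>Relevant maximizers lie within \<open>R0\<close> of their \<open>x\<close>,
      which is within 1 of \<open>xb\<close>; one more unit leaves room for the neighbourhood in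
      \<open>touching_transfer\<close>.\<close>
    define D where "D = ?S \<inter> cball xb (R0 + 2)"
    have D: "compact D" unfolding D_def by (intro closed_Int_compact closedS compact_cball)
    have ybD: "yb \<in> D" "zb \<in> D" using Sb bb(4,5) by (auto simp: D_def dist_commute)
    then have Dne: "D \<noteq> {}" by blast
    have DS: "D \<subseteq> ?S" by (auto simp: D_def)
    obtain f1 where f1: "\<And>x y. y \<in> D \<Longrightarrow> u y - quartic_kernel \<eta> (x - y) \<le> f1 x" "\<And>x. \<exists>y\<in>D. f1 x = u y - quartic_kernel \<eta> (x - y)"
      "\<And>xb. continuous_on (cball xb 1) f1" "\<And>xb. \<exists>C\<ge>0. semiconvex_with C (cball xb 1) f1"
      using sup_convolution[OF D Dne continuous_on_subset[OF contu DS] \<eta>] by blast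
    obtain f2 where f2: "\<And>x y. y \<in> D \<Longrightarrow> v y - quartic_kernel \<eta> (x - y) \<le> f2 x" "\<And>x. \<exists>y\<in>D. f2 x = v y - quartic_kernel \<eta> (x - y)"
      "\<And>xb. continuous_on (cball xb 1) f2" "\<And>xb. \<exists>C\<ge>0. semiconvex_with C (cball xb 1) f2"
      using sup_convolution[OF D Dne continuous_on_subset[OF contv DS] \<eta>] by blast
    define g2 where "g2 x = f2 x - penalty \<kappa> \<sigma> x" for x
    have Fmax: "f1 x + g2 x \<le> mxv" for x
    proof -
      obtain y z where yz: "y \<in> D" "f1 x = u y - quartic_kernel \<eta> (x - y)" "z \<in> D" "f2 x = v z - quartic_kernel \<eta> (x - z)" using f1(2) f2(2) by metis
      have "\<Theta> \<kappa> (y, z, x) \<le> mxv" unfolding mxv_def using yz(1,3) DS by (intro mx0(2)) auto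
      then show ?thesis using yz by (simp add: g2_def \<Theta>_def)
    qed
    have "mxv \<le> f1 xb + g2 xb"
      using f1(1)[OF ybD(1), of xb] f2(1)[OF ybD(2), of xb] by (simp add: mxv_def \<Theta>_def g2_def)
    then have Fb: "f1 xb + g2 xb = mxv" using Fmax[of xb] by linarith
    have contg2: "continuous_on (cball xb 1) g2" unfolding g2_def
      by (intro continuous_intros f2(3) continuous_on_subset[OF contP]) auto
    obtain C1 where C1: "C1 \<ge> 0" "semiconvex_with C1 (cball xb 1) f1" using f1(4) by blast
    obtain C2 where C2: "C2 \<ge> 0" "semiconvex_with C2 (cball xb 1) f2" using f2(4) by blast
    have sg2: "semiconvex_with (C2 + (\<kappa> + \<sigma>)) (cball xb 1) g2"
      using semiconvex_with_add[OF C2(2) semiconvex_uminus_penalty[of \<kappa> \<sigma>]] \<kappa>(1) \<sigma> by (simp add: g2_def[abs_def])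
    define CC where "CC = max C1 (C2 + (\<kappa> + \<sigma>))"
    have CC: "CC \<ge> 0" "semiconvex_with CC (cball xb 1) f1" "semiconvex_with CC (cball xb 1) g2"
      using C1 semiconvex_with_mono[OF sg2, of CC] semiconvex_with_mono[OF C1(2), of CC] by (auto simp: CC_def)
    have "continuous_on (cball xb 1) (\<lambda>x. f1 x + g2 x)" by (intro continuous_intros f1(3) contg2)
    \<comment> \<open>The maximum principle delivers points \<open>a\<close> and \<open>b\<close>
      only near \<open>xb\<close>; by continuity the sum is still at least \<open>\<theta>\<close>
      there, so \<open>bounds\<close> applies to their maximizers.\<close>
    then obtain d where d: "d > 0" "\<And>x. x \<in> cball xb 1 \<Longrightarrow> dist x xb < d \<Longrightarrow> dist (f1 x + g2 x) (f1 xb + g2 xb) < \<theta>"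
      using \<theta> unfolding continuous_on_iff by (metis centre_in_cball zero_le_one)
    define kJ where "kJ = min \<kappa> (min d 1)"
    have kJ: "kJ > 0" "kJ \<le> \<kappa>" "kJ \<le> d" "kJ \<le> 1" using \<kappa>(1) d(1) by (auto simp: kJ_def)
    obtain a b p q X Y where J: "dist a xb < kJ" "dist b xb < kJ" "norm (p + q) < kJ"
      "touches_above f1 a p X" "touches_above g2 b q Y" "\<And>w. X w \<bullet> w + Y w \<bullet> w \<le> kJ * (norm w)\<^sup>2"
      using jensen_ishii[OF zero_less_one f1(3) contg2 CC(2,3,1) _ kJ(1)] Fmax Fb by metis
    have near: "f1 x + g2 x \<ge> \<theta>" if "dist x xb < kJ" for x
    proof -
      have "x \<in> cball xb 1" "dist x xb < d" using that kJ by (auto simp: dist_commute)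
      from d(2)[OF this] show ?thesis using Fb mxv by (simp add: dist_real_def)
    qed
    have ge\<theta>: "\<exists>y\<in>D. \<exists>z\<in>D. f1 x = u y - quartic_kernel \<eta> (x - y) \<and> f2 x = v z - quartic_kernel \<eta> (x - z) \<and>
       \<theta> \<le> u y + v z - quartic_kernel \<eta> (x - y) - quartic_kernel \<eta> (x - z) - penalty \<kappa> \<sigma> x" if x: "dist x xb < kJ" for x
    proof -
      obtain y z where yz: "y \<in> D" "f1 x = u y - quartic_kernel \<eta> (x - y)" "z \<in> D" "f2 x = v z - quartic_kernel \<eta> (x - z)" using f1(2) f2(2) by metis
      then show ?thesis using near[OF x] by (intro bexI[of _ y] bexI[of _ z]) (auto simp: g2_def)
    qed
    have inD: "y' \<in> D" if "dist y x \<le> R0" "snd y \<le> - s0 / 2" "dist x xb < kJ" "y' \<in> ball y (min 1 (s0 / 2))" for x y y'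
    proof -
      have "dist y' y < 1" "dist y' y < s0 / 2" using that(4) by (auto simp: dist_commute)
      then have "dist xb y' \<le> R0 + 2"
        using that(1,3) kJ(4) dist_triangle[of xb y' x] dist_triangle[of x y' y] by (simp add: dist_commute)
      moreover have "\<bar>snd y' - snd y\<bar> < s0 / 2" using \<open>dist y' y < s0 / 2\<close> dist_snd_le[of y' y] by (simp add: dist_real_def)
      then have "snd y' \<le> 0" using that(2) by linarith
      ultimately show ?thesis by (auto simp: D_def mem_Times_iff)
    qed
    have rho: "min 1 (s0 / 2) > 0" using s0 by simp
    obtain ya za where ya: "ya \<in> D" "za \<in> D" "f1 a = u ya - quartic_kernel \<eta> (a - ya)"
       "\<theta> \<le> u ya + v za - quartic_kernel \<eta> (a - ya) - quartic_kernel \<eta> (a - za) - penalty \<kappa> \<sigma> a" using ge\<theta>[OF J(1)] by blast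
    have yaS: "ya \<in> ?S" "za \<in> ?S" using ya(1,2) DS by auto
    note ba = bounds[OF ya(4) k0 yaS]
    have sa: "snd ya \<le> - s0 / 2" using ba(1) s0 by simp
    have ta: "touches_above u ya p X"
      by (rule touching_transfer[where f = f1 and u = u and y = ya and x = a, OF J(4) ya(3) rho]) (rule f1(1), rule inD[OF ba(4) sa J(1)])
    obtain yb' zb' where yb: "yb' \<in> D" "zb' \<in> D" "f2 b = v zb' - quartic_kernel \<eta> (b - zb')"
       "\<theta> \<le> u yb' + v zb' - quartic_kernel \<eta> (b - yb') - quartic_kernel \<eta> (b - zb') - penalty \<kappa> \<sigma> b" using ge\<theta>[OF J(2)] by blast
    have ybS: "yb' \<in> ?S" "zb' \<in> ?S" using yb(1,2) DS by auto
    note bbb = bounds[OF yb(4) k0 ybS]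
    define q2 where "q2 = q + ((2 * \<kappa>) *\<^sub>R fst b, 2 * \<sigma> * snd b)"
    define Y2 where "Y2 w = Y w + ((2 * \<kappa>) *\<^sub>R fst w, 2 * \<sigma> * snd w)" for w
    have t2: "touches_above f2 b q2 Y2"
      unfolding q2_def Y2_def[abs_def] by (rule touches_above_add_penalty) (use J(5) in \<open>simp add: g2_def[abs_def]\<close>)
    have tb: "touches_above v zb' q2 Y2"
      by (rule touching_transfer[where f = f2 and u = v and y = zb' and x = b, OF t2 yb(3) rho]) (rule f2(1), rule inD[OF bbb(5) bbb(3) J(2)])
    define \<xi>1 where "\<xi>1 = fst (a - ya)"
    define \<xi>2 where "\<xi>2 = fst (b - zb')"
    note k1 = touching_kernel[OF J(4) f1(1)[OF ya(1)] ya(3) \<eta>, folded \<xi>1_def]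
    note k2 = touching_kernel[OF t2 f2(1)[OF yb(2)] yb(3) \<eta>, folded \<xi>2_def]
    have linX: "linear X" "\<And>v w. X v \<bullet> w = v \<bullet> X w" and linY: "linear Y2" "\<And>v w. Y2 v \<bullet> w = v \<bullet> Y2 w"
      using J(4) t2 unfolding touches_above_def by auto
    define M1 where "M1 = spatial_matrix X"
    define M2 where "M2 = spatial_matrix Y2"
    have M1: "(M1 *v w) \<bullet> w = X (w, 0) \<bullet> (w, 0)" for w by (simp add: M1_def spatial_matrix(1)[OF linX] inner_prod_def)
    have M2: "(M2 *v w) \<bullet> w = Y2 (w, 0) \<bullet> (w, 0)" for w by (simp add: M2_def spatial_matrix(1)[OF linY] inner_prod_def)
    have sum: "(M1 *v w) \<bullet> w + (M2 *v w) \<bullet> w \<le> 3 * \<kappa> * (norm w)\<^sup>2" for w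
    proof -
      have "Y2 (w, 0) \<bullet> (w, 0) = Y (w, 0) \<bullet> (w, 0) + 2 * \<kappa> * (norm w)\<^sup>2"
        by (simp add: Y2_def inner_add_left) (simp add: inner_prod_def power2_norm_eq_inner)
      moreover have "X (w, 0) \<bullet> (w, 0) + Y (w, 0) \<bullet> (w, 0) \<le> kJ * (norm w)\<^sup>2" using J(6)[of "(w, 0)"] by (simp add: norm_Pair)
      moreover have "kJ * (norm w)\<^sup>2 \<le> \<kappa> * (norm w)\<^sup>2" using kJ(2) by (intro mult_right_mono) auto
      ultimately show ?thesis unfolding M1 M2 by simp
    qed
    have np: "norm (((norm \<xi>1)\<^sup>2 / \<eta>) *\<^sub>R \<xi>1 + ((norm \<xi>2)\<^sup>2 / \<eta>) *\<^sub>R \<xi>2) \<le> \<kappa> + 2 * sqrt (\<kappa> * B)"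
    proof -
      have "((norm \<xi>1)\<^sup>2 / \<eta>) *\<^sub>R \<xi>1 + ((norm \<xi>2)\<^sup>2 / \<eta>) *\<^sub>R \<xi>2 = - (fst p + fst q2)"
        unfolding k1(1) k2(1) by simp
      also have "fst p + fst q2 = fst (p + q) + (2 * \<kappa>) *\<^sub>R fst b" by (simp add: q2_def)
      finally have "norm (((norm \<xi>1)\<^sup>2 / \<eta>) *\<^sub>R \<xi>1 + ((norm \<xi>2)\<^sup>2 / \<eta>) *\<^sub>R \<xi>2) = norm (fst (p + q) + (2 * \<kappa>) *\<^sub>R fst b)"
        by (simp only: norm_minus_cancel)
      also have "\<dots> \<le> norm (fst (p + q)) + norm ((2 * \<kappa>) *\<^sub>R fst b)" by (rule norm_triangle_ineq)
      also have "norm (fst (p + q)) \<le> \<kappa>" using fst_norm_le[of "p + q"] J(3) kJ(2) by linarith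
      also have "norm ((2 * \<kappa>) *\<^sub>R fst b) = 2 * (\<kappa> * norm (fst b))" using \<kappa>(1) by simp
      \<comment> \<open>Only \<open>\<kappa>\<close> times the squared norm is bounded, by
        \<open>B\<close>; this still makes the gradient of the penalty of order
        \<open>sqrt \<kappa>\<close>, which tends to 0.\<close>
      also have "\<kappa> * norm (fst b) \<le> sqrt (\<kappa> * B)"
      proof (rule real_le_rsqrt)
        have "(\<kappa> * norm (fst b))\<^sup>2 = \<kappa> * (\<kappa> * (norm (fst b))\<^sup>2)" by (simp add: power2_eq_square)
        also have "\<dots> \<le> \<kappa> * B" using bbb(8) k0 by (rule mult_left_mono)
        finally show "(\<kappa> * norm (fst b))\<^sup>2 \<le> \<kappa> * B" .
      qed
      finally show ?thesis by simp
    qed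
    \<comment> \<open>The time slope of the penalty at \<open>b\<close> is at most
      \<open>- 2 * c\<close>, because \<open>snd b \<le> - s0\<close>; the tolerance
      \<open>\<kappa> \<le> c\<close> costs at most half of it.\<close>
    have as: "snd p + snd q2 \<le> - c"
    proof -
      have "snd p + snd q2 = snd (p + q) + 2 * \<sigma> * snd b" by (simp add: q2_def)
      moreover have "snd (p + q) \<le> \<kappa>" using snd_norm_le[of "p + q"] J(3) kJ(2) by simp
      moreover have "\<sigma> * snd b \<le> \<sigma> * (- s0)" using bbb(2) \<sigma> by (intro mult_left_mono) auto
      moreover have "\<kappa> \<le> c" using \<kappa>(2) by (simp add: \<kappa>0_def)
      ultimately show ?thesis by (simp add: c_def)
    qed
    have "snd ya < 0" using ba(1) s0 by linarith
    then obtain Ma pa where ea: "dist (Ma, pa) (M1, fst p) < \<kappa>" "- \<kappa> \<le> snd p + F1 Ma pa / 2"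
      using touching_subsolution[OF subu _ _ \<kappa>(1), of "fst ya" "snd ya" p X] ta unfolding M1_def by auto
    have "snd zb' < 0" using bbb(3) s0 by linarith
    then obtain Mb pb where eb: "dist (Mb, pb) (M2, fst q2) < \<kappa>" "- \<kappa> \<le> snd q2 + F2 Mb pb / 2"
      using touching_subsolution[OF subv _ _ \<kappa>(1), of "fst zb'" "snd zb'" q2 Y2] tb unfolding M2_def by auto
    show ?thesis
      unfolding opposite_jets_def
    proof (rule exI[of _ \<xi>1], rule exI[of _ \<xi>2], rule exI[of _ M1], rule exI[of _ M2], rule exI[of _ "snd p"], rule exI[of _ "snd q2"],
        intro conjI allI)
      show "norm \<xi>1 \<le> Ra" "norm \<xi>2 \<le> Ra" unfolding \<xi>1_def \<xi>2_def by (rule ba(6), rule bbb(7))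
      show "M1 \<in> symmetric_matrices" "M2 \<in> symmetric_matrices"
        unfolding M1_def M2_def by (rule spatial_matrix(2)[OF linX], rule spatial_matrix(2)[OF linY])
      show "- (3 * (norm \<xi>1)\<^sup>2 / \<eta>) * (norm w)\<^sup>2 \<le> (M1 *v w) \<bullet> w" for w unfolding M1 by (rule k1(2))
      show "- (3 * (norm \<xi>2)\<^sup>2 / \<eta>) * (norm w)\<^sup>2 \<le> (M2 *v w) \<bullet> w" for w unfolding M2 by (rule k2(2))
      show "\<exists>M p'. dist (M, p') (M1, - (((norm \<xi>1)\<^sup>2 / \<eta>) *\<^sub>R \<xi>1)) < \<kappa> \<and> - \<kappa> \<le> snd p + F1 M p' / 2"
        using ea unfolding k1(1) by blast
      show "\<exists>M p'. dist (M, p') (M2, - (((norm \<xi>2)\<^sup>2 / \<eta>) *\<^sub>R \<xi>2)) < \<kappa> \<and> - \<kappa> \<le> snd q2 + F2 M p' / 2"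
        using eb unfolding k2(1) by blast
    qed (use sum np as in auto)
  qed
  show ?thesis
    by (intro exI[of _ \<eta>] exI[of _ Ra] exI[of _ B] exI[of _ c] exI[of _ \<kappa>0] conjI allI impI jets \<eta> c \<kappa>0)
qed

section \<open>The limit of the jets and the comparison principle\<close>

text \<open>Polarization: \<open>2 * M $ i $ j\<close> is the form at the sum of two basis vectors
  minus the forms at each, hence at most \<open>4 K + K + K\<close> in absolute value.\<close>

lemma symmetric_matrix_norm_le:
  fixes M :: "real^'m^'m"
  assumes M: "M \<in> symmetric_matrices" and K: "\<And>w. \<bar>(M *v w) \<bullet> w\<bar> \<le> K * (norm w)\<^sup>2"
  shows "norm M \<le> 3 * K * (real CARD('m))\<^sup>2"
proof -
  have entry: "\<bar>M $ i $ j\<bar> \<le> 3 * K" for i j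
  proof -
    let ?e = "\<lambda>i. axis i 1 :: real^'m"
    have ent: "(M *v ?e a) \<bullet> ?e b = M $ b $ a" for a b
      by (simp add: matrix_vector_mul_component inner_axis)
    have sym: "M $ j $ i = M $ i $ j" using M by (simp add: symmetric_matrices_def vec_eq_iff transpose_def)
    have "(M *v (?e i + ?e j)) \<bullet> (?e i + ?e j) = (M *v ?e i) \<bullet> ?e i + (M *v ?e j) \<bullet> ?e j + 2 * M $ i $ j"
      by (simp add: matrix_vector_right_distrib inner_add_left inner_add_right ent sym)
    moreover have "(norm (?e i + ?e j))\<^sup>2 \<le> 4"
      using power_mono[OF norm_triangle_ineq[of "?e i" "?e j"] norm_ge_zero, of 2] by simp
    moreover have K0: "K \<ge> 0" using order_trans[OF abs_ge_zero K[of "?e i"]] by simp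
    ultimately have "\<bar>(M *v ?e i) \<bullet> ?e i + (M *v ?e j) \<bullet> ?e j + 2 * M $ i $ j\<bar> \<le> K * 4"
      using K[of "?e i + ?e j"] mult_left_mono[of "(norm (?e i + ?e j))\<^sup>2" 4 K] by linarith
    moreover have "\<bar>(M *v ?e i) \<bullet> ?e i\<bar> \<le> K" "\<bar>(M *v ?e j) \<bullet> ?e j\<bar> \<le> K" using K[of "?e i"] K[of "?e j"] by simp_all
    ultimately show ?thesis by linarith
  qed
  have "norm M \<le> (\<Sum>i\<in>UNIV. norm (M $ i))" unfolding norm_vec_def by (rule L2_set_le_sum) simp
  also have "\<dots> \<le> (\<Sum>i\<in>(UNIV::'m set). \<Sum>j\<in>(UNIV::'m set). 3 * K)"
    by (intro sum_mono order_trans[OF norm_le_l1_cart] entry)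
  also have "\<dots> = 3 * K * (real CARD('m))\<^sup>2" by (simp add: power2_eq_square)
  finally show ?thesis .
qed

text \<open>The limit \<open>P\<close> of the gradients decides. For nonzero \<open>P\<close> the
  gap \<open>c\<close> contradicts monotonicity at the limit jets. For \<open>P = 0\<close> both
  limit forms are nonnegative with nonpositive sum, so \<open>X1 = 0\<close> and the first operator
  value tends to 0, while the second enters with a favourable sign by
  \<open>H_op_nonneg\<close>.\<close>

lemma H_op_jets_contradiction:
  fixes \<xi>1 \<xi>2 p1 p2 :: "nat \<Rightarrow> real^'m" and M1 M2 N1 N2 :: "nat \<Rightarrow> real^'m^'m"
  assumes \<xi>: "\<xi>1 \<longlonglongrightarrow> y1" "\<xi>2 \<longlonglongrightarrow> y2" and M: "M1 \<longlonglongrightarrow> X1" "M2 \<longlonglongrightarrow> X2" and \<eta>: "\<eta> > 0" and c: "c > 0"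
    and sym: "\<And>k. M1 k \<in> symmetric_matrices" "\<And>k. M2 k \<in> symmetric_matrices"
    and lower: "\<And>k w. - (3 * (norm (\<xi>1 k))\<^sup>2 / \<eta>) * (norm w)\<^sup>2 \<le> (M1 k *v w) \<bullet> w"
       "\<And>k w. - (3 * (norm (\<xi>2 k))\<^sup>2 / \<eta>) * (norm w)\<^sup>2 \<le> (M2 k *v w) \<bullet> w"
    and upper: "\<And>k w. (M1 k *v w) \<bullet> w + (M2 k *v w) \<bullet> w \<le> 3 * \<kappa> k * (norm w)\<^sup>2" and \<kappa>: "\<kappa> \<longlonglongrightarrow> 0"
    and opp: "\<And>k. norm (((norm (\<xi>1 k))\<^sup>2 / \<eta>) *\<^sub>R \<xi>1 k + ((norm (\<xi>2 k))\<^sup>2 / \<eta>) *\<^sub>R \<xi>2 k) \<le> \<kappa> k + 2 * sqrt (\<kappa> k * B)"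
    and near: "\<And>k. dist (N1 k, p1 k) (M1 k, - (((norm (\<xi>1 k))\<^sup>2 / \<eta>) *\<^sub>R \<xi>1 k)) < \<kappa> k"
      "\<And>k. dist (N2 k, p2 k) (M2 k, - (((norm (\<xi>2 k))\<^sup>2 / \<eta>) *\<^sub>R \<xi>2 k)) < \<kappa> k"
    and gap: "\<And>k. c - 2 * \<kappa> k \<le> (H_op TYPE('n::finite) (N1 k) (p1 k) - H_op TYPE('n) (- N2 k) (- p2 k)) / 2"
  shows False
proof -
  let ?q = "\<lambda>y :: real^'m. ((norm y)\<^sup>2 / \<eta>) *\<^sub>R y"
  define P where "P = - ?q y1"
  have lim_pair: "(\<lambda>k. (N k, p k)) \<longlonglongrightarrow> (X, Q)"
    if "M \<longlonglongrightarrow> X" "(\<lambda>k. r k) \<longlonglongrightarrow> Q" "\<And>k. dist (N k, p k) (M k, r k) < \<kappa> k"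
    for N M :: "nat \<Rightarrow> real^'m^'m" and p r :: "nat \<Rightarrow> real^'m" and X Q
  proof -
    have "(\<lambda>k. dist (N k, p k) (M k, r k)) \<longlonglongrightarrow> 0"
      by (rule tendsto_sandwich[OF _ _ tendsto_const \<kappa>]) (use that(3) in \<open>auto intro!: always_eventually less_imp_le\<close>)
    then have d: "(\<lambda>k. (N k, p k) - (M k, r k)) \<longlonglongrightarrow> 0"
      unfolding dist_norm by (rule tendsto_norm_zero_cancel)
    from tendsto_add[OF this tendsto_Pair[OF that(1,2)]] show ?thesis by (simp add: zero_prod_def)
  qed
  have q: "(\<lambda>k. - ?q (\<xi>1 k)) \<longlonglongrightarrow> P" "(\<lambda>k. - ?q (\<xi>2 k)) \<longlonglongrightarrow> - ?q y2"
    unfolding P_def using \<eta> by (intro tendsto_intros \<xi>; simp)+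
  have "(\<lambda>k. ?q (\<xi>1 k) + ?q (\<xi>2 k)) \<longlonglongrightarrow> ?q y1 + ?q y2" using \<eta> by (intro tendsto_intros \<xi>) auto
  moreover have "(\<lambda>k. ?q (\<xi>1 k) + ?q (\<xi>2 k)) \<longlonglongrightarrow> 0"
  proof (rule tendsto_norm_zero_cancel, rule tendsto_sandwich[OF _ _ tendsto_const])
    have "(\<lambda>k. \<kappa> k + 2 * sqrt (\<kappa> k * B)) \<longlonglongrightarrow> 0 + 2 * sqrt (0 * B)" by (intro tendsto_intros \<kappa>)
    then show "(\<lambda>k. \<kappa> k + 2 * sqrt (\<kappa> k * B)) \<longlonglongrightarrow> 0" by simp
  qed (use opp in auto)
  ultimately have "?q y1 + ?q y2 = 0" by (rule LIMSEQ_unique)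
  \<comment> \<open>In the limit the two kernel gradients cancel, so \<open>- p2\<close> tends to
    the same gradient \<open>P\<close> as \<open>p1\<close>.\<close>
  then have P: "?q y2 = P" unfolding P_def by (simp add: add_eq_0_iff)
  have N1: "N1 \<longlonglongrightarrow> X1" "p1 \<longlonglongrightarrow> P"
    using tendsto_fst[OF lim_pair[OF M(1) q(1) near(1)]] tendsto_snd[OF lim_pair[OF M(1) q(1) near(1)]] by simp_all
  have N2: "N2 \<longlonglongrightarrow> X2" "p2 \<longlonglongrightarrow> - P"
    using tendsto_fst[OF lim_pair[OF M(2) q(2) near(2)]] tendsto_snd[OF lim_pair[OF M(2) q(2) near(2)]] P by simp_all
  have form: "(\<lambda>k. (M k *v w) \<bullet> w) \<longlonglongrightarrow> (X *v w) \<bullet> w" if "M \<longlonglongrightarrow> X" for M :: "nat \<Rightarrow> real^'m^'m" and X w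
    unfolding inner_vec_def[of "_ *v _"] matrix_vector_mul_component by (intro tendsto_sum tendsto_inner tendsto_const tendsto_vec_nth that)
  have le0: "(X1 *v w) \<bullet> w + (X2 *v w) \<bullet> w \<le> 0" for w
  proof (rule LIMSEQ_le)
    show "(\<lambda>k. (M1 k *v w) \<bullet> w + (M2 k *v w) \<bullet> w) \<longlonglongrightarrow> (X1 *v w) \<bullet> w + (X2 *v w) \<bullet> w" by (intro tendsto_add form M)
    have "(\<lambda>k. 3 * \<kappa> k * (norm w)\<^sup>2) \<longlonglongrightarrow> 3 * 0 * (norm w)\<^sup>2" by (intro tendsto_intros \<kappa>)
    then show "(\<lambda>k. 3 * \<kappa> k * (norm w)\<^sup>2) \<longlonglongrightarrow> 0" by simp
  qed (use upper in auto)
  have gap0: "(\<lambda>k. c - 2 * \<kappa> k) \<longlonglongrightarrow> c" using tendsto_diff[OF tendsto_const[of c] tendsto_mult_right_zero[OF \<kappa>, of 2]] by simp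
  show False
  proof (cases "P = 0")
    case False
    have "(\<lambda>k. (H_op TYPE('n) (N1 k) (p1 k) - H_op TYPE('n) (- N2 k) (- p2 k)) / 2) \<longlonglongrightarrow> (H_op TYPE('n) X1 P - H_op TYPE('n) (- X2) P) / 2"
      using tendsto_minus[OF N2(2)] False by (intro tendsto_divide tendsto_diff tendsto_H_op tendsto_minus N1 N2(1) tendsto_const) auto
    from LIMSEQ_le[OF gap0 this] have "c \<le> (H_op TYPE('n) X1 P - H_op TYPE('n) (- X2) P) / 2" using gap by blast
    moreover have "H_op TYPE('n) X1 P \<le> H_op TYPE('n) (- X2) P"
    proof (rule H_op_mono)
      fix w show "(X1 *v w) \<bullet> w \<le> (- X2 *v w) \<bullet> w" using le0[of w] by (simp add: uminus_matrix_vector_mult)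
    qed
    ultimately show False using c by simp
  next
    case True
    then have y: "y1 = 0" "y2 = 0" using P \<eta> unfolding P_def by auto
    have nn: "0 \<le> (X *v w) \<bullet> w" if "M \<longlonglongrightarrow> X" "\<xi> \<longlonglongrightarrow> 0" "\<And>k w. - (3 * (norm (\<xi> k))\<^sup>2 / \<eta>) * (norm w)\<^sup>2 \<le> (M k *v w) \<bullet> w"
      for M :: "nat \<Rightarrow> real^'m^'m" and X w and \<xi> :: "nat \<Rightarrow> real^'m"
    proof (rule LIMSEQ_le[OF _ form[OF that(1)]])
      have "(\<lambda>k. - (3 * (norm (\<xi> k))\<^sup>2 / \<eta>) * (norm w)\<^sup>2) \<longlonglongrightarrow> - (3 * (norm (0 :: real^'m))\<^sup>2 / \<eta>) * (norm w)\<^sup>2"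
        using \<eta> by (intro tendsto_intros that(2)) auto
      then show "(\<lambda>k. - (3 * (norm (\<xi> k))\<^sup>2 / \<eta>) * (norm w)\<^sup>2) \<longlonglongrightarrow> 0" by simp
    qed (use that(3) in auto)
    have X1: "(X1 *v w) \<bullet> w = 0" for w
      using nn[OF M(1) \<xi>(1)[unfolded y] lower(1), of w] nn[OF M(2) \<xi>(2)[unfolded y] lower(2), of w] le0[of w] by linarith
    have "X1 \<in> symmetric_matrices"
    proof -
      have "(\<lambda>k. transpose (M1 k)) \<longlonglongrightarrow> transpose X1"
        unfolding transpose_def by (intro vec_tendstoI) (simp add: tendsto_vec_nth M(1))
      then have "M1 \<longlonglongrightarrow> transpose X1" using sym(1) by (simp add: symmetric_matrices_def)
      from LIMSEQ_unique[OF this M(1)] show ?thesis by (simp add: symmetric_matrices_def)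
    qed
    from symmetric_matrix_norm_le[OF this, of 0] have "X1 = 0" using X1 by simp
    then have "(\<lambda>k. norm (N1 k) * (real CARD('n))\<^sup>2 / 2) \<longlonglongrightarrow> norm (0 :: real^'m^'m) * (real CARD('n))\<^sup>2 / 2"
      using N1(1) by (intro tendsto_intros) auto
    from LIMSEQ_le[OF gap0 this] have "c \<le> 0"
    proof -
      assume *: "\<exists>N. \<forall>n\<ge>N. c - 2 * \<kappa> n \<le> norm (N1 n) * (real CARD('n))\<^sup>2 / 2 \<Longrightarrow> c \<le> norm (0 :: real^'m^'m) * (real CARD('n))\<^sup>2 / 2"
      have "c - 2 * \<kappa> k \<le> norm (N1 k) * (real CARD('n))\<^sup>2 / 2" for k
        using gap[of k] H_op_le_norm[where 'n = 'n, of "N1 k" "p1 k"] H_op_nonneg[where 'n = 'n, of "- N2 k" "- p2 k"] by argo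
      with * show ?thesis by simp
    qed
    then show False using c by simp
  qed
qed

text \<open>Linear growth enters only through the two barriers \<open>ub\<close> and
  \<open>vb\<close>; from there on the bounds by \<open>f\<close> do all the work.\<close>

lemma comparison_principle:
  fixes u w :: "(real^'m) \<times> real \<Rightarrow> real"
  assumes subu: "eps_subsolution (H_op TYPE('n::finite)) u" and subw: "eps_subsolution (reflect_op (H_op TYPE('n))) (\<lambda>z. - w z)"
    and contu: "continuous_on (UNIV \<times> {..0}) u" and contw: "continuous_on (UNIV \<times> {..0}) w"
    and growth: "linear_growth u" "linear_growth w"
    and terminal: "\<And>x. u (x, 0) = f x" "\<And>x. w (x, 0) = f x" and lip: "\<And>x y. f x \<le> f y + L * norm (x - y)" and L: "L > 0"
    and t: "t \<le> 0"
  shows "u (x, t) \<le> w (x, t)"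
proof (rule ccontr)
  assume "\<not> ?thesis"
  then have neg: "u (x, t) + - w (x, t) > 0" by simp
  then have t0: "t < 0" using t terminal[of x] by (cases "t = 0") auto
  define C where "C = L * (1 + (real CARD('n))\<^sup>2 * norm (mat 1 :: real^'m^'m))"
  have C: "C > 0" using L by (simp add: C_def add_pos_nonneg)
  have contw': "continuous_on (UNIV \<times> {..0}) (\<lambda>z. - w z)" using contw by (intro continuous_intros)
  have growth': "linear_growth (\<lambda>z. - w z)" using growth(2) by (simp add: linear_growth_def)
  have ub: "u (x, s) \<le> f x + C * sqrt (- s)" if "s \<le> 0" for x s
    unfolding C_def by (rule subsolution_sqrt_bound[OF subu contu growth(1) terminal(1) lip L _ _ that])
      (use H_op_le_norm[where 'n = 'n] in \<open>auto simp: mult.commute\<close>)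
  have lip': "- f x \<le> - f y + L * norm (x - y)" for x y using lip[of y x] by (simp add: norm_minus_commute)
  have vb: "- w (x, s) \<le> - f x" if "s \<le> 0" for x s
    by (rule subsolution_bound_nonpositive_operator[OF subw contw' growth' _ lip' L _ that])
      (auto simp: terminal(2) reflect_op_def H_op_nonneg)
  let ?H = "H_op TYPE('n) :: real^'m^'m \<Rightarrow> real^'m \<Rightarrow> real"
  have "\<exists>\<eta>>0. \<exists>R B c \<kappa>0. c > 0 \<and> \<kappa>0 > 0 \<and>
      (\<forall>\<kappa>. 0 < \<kappa> \<longrightarrow> \<kappa> < \<kappa>0 \<longrightarrow> opposite_jets ?H (reflect_op ?H) \<eta> R B c \<kappa>)"
    by (rule comparison_jets[where f = f, OF _ _ lip L C contu contw' subu subw t0 neg]) (erule ub vb)+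
  then obtain \<eta> R B c \<kappa>0 where \<eta>: "\<eta> > 0" and c: "c > 0" and \<kappa>0: "\<kappa>0 > 0"
    and jets: "\<And>\<kappa>. 0 < \<kappa> \<Longrightarrow> \<kappa> < \<kappa>0 \<Longrightarrow> opposite_jets ?H (reflect_op ?H) \<eta> R B c \<kappa>"
    by blast
  \<comment> \<open>The double successor makes \<open>\<kappa> k < \<kappa>0\<close> strict already
    at \<open>k = 0\<close>.\<close>
  define \<kappa> where "\<kappa> k = \<kappa>0 * inverse (real (Suc (Suc k)))" for k
  have \<kappa>pos: "0 < \<kappa> k" "\<kappa> k < \<kappa>0" for k using \<kappa>0 by (simp_all add: \<kappa>_def field_simps add_pos_nonneg)
  have \<kappa>lim: "\<kappa> \<longlonglongrightarrow> 0"
    using tendsto_mult_right_zero[OF LIMSEQ_Suc[OF LIMSEQ_inverse_real_of_nat], of \<kappa>0] by (simp add: \<kappa>_def[abs_def])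
  \<comment> \<open>The bounded data are packed into one vector, so that a single extraction gives
    all four limits. The approximating jets stay existential: they converge along with the data they
    approximate.\<close>
  define Q :: "nat \<Rightarrow> (real^'m) \<times> (real^'m) \<times> (real^'m^'m) \<times> (real^'m^'m) \<Rightarrow> bool" where "Q k = (\<lambda>(\<xi>1, \<xi>2, M1, M2). norm \<xi>1 \<le> R \<and> norm \<xi>2 \<le> R \<and> M1 \<in> symmetric_matrices \<and> M2 \<in> symmetric_matrices \<and>
     (\<forall>w. - (3 * (norm \<xi>1)\<^sup>2 / \<eta>) * (norm w)\<^sup>2 \<le> (M1 *v w) \<bullet> w) \<and>
     (\<forall>w. - (3 * (norm \<xi>2)\<^sup>2 / \<eta>) * (norm w)\<^sup>2 \<le> (M2 *v w) \<bullet> w) \<and>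
     (\<forall>w. (M1 *v w) \<bullet> w + (M2 *v w) \<bullet> w \<le> 3 * \<kappa> k * (norm w)\<^sup>2) \<and>
     norm (((norm \<xi>1)\<^sup>2 / \<eta>) *\<^sub>R \<xi>1 + ((norm \<xi>2)\<^sup>2 / \<eta>) *\<^sub>R \<xi>2) \<le> \<kappa> k + 2 * sqrt (\<kappa> k * B) \<and>
     (\<exists>N1 p1 N2 p2. dist (N1, p1) (M1, - (((norm \<xi>1)\<^sup>2 / \<eta>) *\<^sub>R \<xi>1)) < \<kappa> k \<and>
        dist (N2, p2) (M2, - (((norm \<xi>2)\<^sup>2 / \<eta>) *\<^sub>R \<xi>2)) < \<kappa> k \<and>
        c - 2 * \<kappa> k \<le> (H_op TYPE('n) N1 p1 - H_op TYPE('n) (- N2) (- p2)) / 2))" for k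
  have "\<exists>z. Q k z" for k
  proof -
    obtain \<xi>1 \<xi>2 :: "real^'m" and M1 M2 a1 a2 where j: "norm \<xi>1 \<le> R \<and> norm \<xi>2 \<le> R \<and> M1 \<in> symmetric_matrices \<and> M2 \<in> symmetric_matrices \<and>
     (\<forall>w. - (3 * (norm \<xi>1)\<^sup>2 / \<eta>) * (norm w)\<^sup>2 \<le> (M1 *v w) \<bullet> w) \<and>
     (\<forall>w. - (3 * (norm \<xi>2)\<^sup>2 / \<eta>) * (norm w)\<^sup>2 \<le> (M2 *v w) \<bullet> w) \<and>
     (\<forall>w. (M1 *v w) \<bullet> w + (M2 *v w) \<bullet> w \<le> 3 * \<kappa> k * (norm w)\<^sup>2) \<and>
     norm (((norm \<xi>1)\<^sup>2 / \<eta>) *\<^sub>R \<xi>1 + ((norm \<xi>2)\<^sup>2 / \<eta>) *\<^sub>R \<xi>2) \<le> \<kappa> k + 2 * sqrt (\<kappa> k * B)"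
     and a: "a1 + a2 \<le> - c"
     and "\<exists>M p. dist (M, p) (M1, - (((norm \<xi>1)\<^sup>2 / \<eta>) *\<^sub>R \<xi>1)) < \<kappa> k \<and> - \<kappa> k \<le> a1 + H_op TYPE('n) M p / 2"
     and "\<exists>M p. dist (M, p) (M2, - (((norm \<xi>2)\<^sup>2 / \<eta>) *\<^sub>R \<xi>2)) < \<kappa> k \<and> - \<kappa> k \<le> a2 + reflect_op (H_op TYPE('n)) M p / 2"
      using jets[OF \<kappa>pos, of k] unfolding opposite_jets_def by blast
    then obtain N1 p1 N2 p2 where n: "dist (N1, p1) (M1, - (((norm \<xi>1)\<^sup>2 / \<eta>) *\<^sub>R \<xi>1)) < \<kappa> k" "- \<kappa> k \<le> a1 + H_op TYPE('n) N1 p1 / 2"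
      "dist (N2, p2) (M2, - (((norm \<xi>2)\<^sup>2 / \<eta>) *\<^sub>R \<xi>2)) < \<kappa> k" "- \<kappa> k \<le> a2 + reflect_op (H_op TYPE('n)) N2 p2 / 2"
      by blast
    have "c - 2 * \<kappa> k \<le> (H_op TYPE('n) N1 p1 - H_op TYPE('n) (- N2) (- p2)) / 2"
      using n(2,4) a by (simp add: reflect_op_def field_simps)
    then have "Q k (\<xi>1, \<xi>2, M1, M2)" unfolding Q_def using j n(1,3) by blast
    then show ?thesis by blast
  qed
  then obtain Z where Z: "\<And>k. Q k (Z k)" by metis
  \<comment> \<open>Each form is bounded below by the kernel, and above by
    \<open>3 * \<kappa>0\<close> plus the absolute value of the lower bound of the other.\<close>
  define K where "K = 3 * R\<^sup>2 / \<eta> + 3 * \<kappa>0"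
  have bd: "norm M \<le> 3 * K * (real CARD('m))\<^sup>2"
    if "M \<in> symmetric_matrices" "\<forall>w. - (3 * (norm \<xi>)\<^sup>2 / \<eta>) * (norm w)\<^sup>2 \<le> (M *v w) \<bullet> w" "norm \<xi> \<le> R"
      "\<forall>w. - (3 * (norm \<xi>')\<^sup>2 / \<eta>) * (norm w)\<^sup>2 \<le> (M' *v w) \<bullet> w" "norm \<xi>' \<le> R"
      "\<forall>w. (M *v w) \<bullet> w + (M' *v w) \<bullet> w \<le> 3 * \<kappa> k * (norm w)\<^sup>2"
    for M M' :: "real^'m^'m" and \<xi> \<xi>' :: "real^'m" and k
  proof (rule symmetric_matrix_norm_le[OF that(1)])
    fix w :: "real^'m"
    have "3 * (norm y)\<^sup>2 / \<eta> * (norm w)\<^sup>2 \<le> 3 * R\<^sup>2 / \<eta> * (norm w)\<^sup>2" if "norm y \<le> R" for y :: "real^'m"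
      using \<eta> that by (intro mult_right_mono divide_right_mono mult_left_mono power_mono) auto
    from this[OF that(3)] this[OF that(5)]
    have 1: "- (3 * R\<^sup>2 / \<eta> * (norm w)\<^sup>2) \<le> (M *v w) \<bullet> w" "- (3 * R\<^sup>2 / \<eta> * (norm w)\<^sup>2) \<le> (M' *v w) \<bullet> w"
      using spec[OF that(2), of w] spec[OF that(4), of w] by linarith+
    have "3 * \<kappa> k * (norm w)\<^sup>2 \<le> 3 * \<kappa>0 * (norm w)\<^sup>2" using \<kappa>pos(2)[of k] by (intro mult_right_mono) auto
    moreover have "0 \<le> 3 * \<kappa>0 * (norm w)\<^sup>2" using \<kappa>0 by simp
    moreover have "K * (norm w)\<^sup>2 = 3 * R\<^sup>2 / \<eta> * (norm w)\<^sup>2 + 3 * \<kappa>0 * (norm w)\<^sup>2" by (simp add: K_def distrib_right)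
    ultimately show "\<bar>(M *v w) \<bullet> w\<bar> \<le> K * (norm w)\<^sup>2" using 1 spec[OF that(6), of w] by linarith
  qed
  have "norm (Z k) \<le> 2 * R + 2 * (3 * K * (real CARD('m))\<^sup>2)" for k
  proof -
    obtain \<xi>1 \<xi>2 M1 M2 where z: "Z k = (\<xi>1, \<xi>2, M1, M2)" by (cases "Z k") auto
    have q: "norm \<xi>1 \<le> R" "norm \<xi>2 \<le> R" "M1 \<in> symmetric_matrices" "M2 \<in> symmetric_matrices"
     "\<forall>w. - (3 * (norm \<xi>1)\<^sup>2 / \<eta>) * (norm w)\<^sup>2 \<le> (M1 *v w) \<bullet> w"
     "\<forall>w. - (3 * (norm \<xi>2)\<^sup>2 / \<eta>) * (norm w)\<^sup>2 \<le> (M2 *v w) \<bullet> w"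
     "\<forall>w. (M1 *v w) \<bullet> w + (M2 *v w) \<bullet> w \<le> 3 * \<kappa> k * (norm w)\<^sup>2"
      using Z[of k] unfolding Q_def z by auto
    have "\<forall>w. (M2 *v w) \<bullet> w + (M1 *v w) \<bullet> w \<le> 3 * \<kappa> k * (norm w)\<^sup>2" using q(7) by (simp add: add.commute)
    note b = bd[OF q(3,5,1,6,2,7)] bd[OF q(4,6,2,5,1) this]
    have "norm (Z k) \<le> norm \<xi>1 + norm (\<xi>2, M1, M2)" unfolding z by (rule norm_Pair_le)
    moreover have "norm (\<xi>2, M1, M2) \<le> norm \<xi>2 + norm (M1, M2)" by (rule norm_Pair_le)
    moreover have "norm (M1, M2) \<le> norm M1 + norm M2" by (rule norm_Pair_le)
    ultimately show ?thesis using b q(1,2) by linarith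
  qed
  then have "bounded (range Z)" by (intro boundedI) auto
  from bounded_imp_convergent_subsequence[OF this] obtain l r where r: "strict_mono (r :: nat \<Rightarrow> nat)" and l: "(Z \<circ> r) \<longlonglongrightarrow> l" by blast
  define \<xi>1 where "\<xi>1 k = fst (Z (r k))" for k
  define \<xi>2 where "\<xi>2 k = fst (snd (Z (r k)))" for k
  define M1 where "M1 k = fst (snd (snd (Z (r k))))" for k
  define M2 where "M2 k = snd (snd (snd (Z (r k))))" for k
  have l': "(\<lambda>k. Z (r k)) \<longlonglongrightarrow> l" using l by (simp add: o_def)
  have lims: "\<xi>1 \<longlonglongrightarrow> fst l" "\<xi>2 \<longlonglongrightarrow> fst (snd l)" "M1 \<longlonglongrightarrow> fst (snd (snd l))" "M2 \<longlonglongrightarrow> snd (snd (snd l))"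
    unfolding \<xi>1_def \<xi>2_def M1_def M2_def by (intro tendsto_intros l')+
  have q: "M1 k \<in> symmetric_matrices" "M2 k \<in> symmetric_matrices"
     "- (3 * (norm (\<xi>1 k))\<^sup>2 / \<eta>) * (norm w)\<^sup>2 \<le> (M1 k *v w) \<bullet> w"
     "- (3 * (norm (\<xi>2 k))\<^sup>2 / \<eta>) * (norm w)\<^sup>2 \<le> (M2 k *v w) \<bullet> w"
     "(M1 k *v w) \<bullet> w + (M2 k *v w) \<bullet> w \<le> 3 * \<kappa> (r k) * (norm w)\<^sup>2"
     "norm (((norm (\<xi>1 k))\<^sup>2 / \<eta>) *\<^sub>R \<xi>1 k + ((norm (\<xi>2 k))\<^sup>2 / \<eta>) *\<^sub>R \<xi>2 k) \<le> \<kappa> (r k) + 2 * sqrt (\<kappa> (r k) * B)" for k w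
    using Z[of "r k"] unfolding Q_def \<xi>1_def \<xi>2_def M1_def M2_def by (simp_all add: case_prod_beta)
  have "\<forall>k. \<exists>N1 p1 N2 p2. dist (N1, p1) (M1 k, - (((norm (\<xi>1 k))\<^sup>2 / \<eta>) *\<^sub>R \<xi>1 k)) < \<kappa> (r k) \<and>
        dist (N2, p2) (M2 k, - (((norm (\<xi>2 k))\<^sup>2 / \<eta>) *\<^sub>R \<xi>2 k)) < \<kappa> (r k) \<and>
        c - 2 * \<kappa> (r k) \<le> (H_op TYPE('n) N1 p1 - H_op TYPE('n) (- N2) (- p2)) / 2"
    using Z unfolding Q_def \<xi>1_def \<xi>2_def M1_def M2_def by (simp add: case_prod_beta)
  then obtain N1 p1 N2 p2 where n: "\<And>k. dist (N1 k, p1 k) (M1 k, - (((norm (\<xi>1 k))\<^sup>2 / \<eta>) *\<^sub>R \<xi>1 k)) < \<kappa> (r k)"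
        "\<And>k. dist (N2 k, p2 k) (M2 k, - (((norm (\<xi>2 k))\<^sup>2 / \<eta>) *\<^sub>R \<xi>2 k)) < \<kappa> (r k)"
        "\<And>k. c - 2 * \<kappa> (r k) \<le> (H_op TYPE('n) (N1 k) (p1 k) - H_op TYPE('n) (- N2 k) (- p2 k)) / 2"
    by metis
  have "(\<lambda>k. \<kappa> (r k)) \<longlonglongrightarrow> 0" using LIMSEQ_subseq_LIMSEQ[OF \<kappa>lim r] by (simp add: o_def)
  from H_op_jets_contradiction[OF lims \<eta> c q(1-5) this q(6) n] show False .
qed

section \<open>Convergence\<close>

lemma semicontinuous_iff_continuous_on: "usc_on S u \<and> lsc_on S u \<longleftrightarrow> continuous_on S u"
proof
  assume s: "usc_on S u \<and> lsc_on S u"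
  show "continuous_on S u"
  proof (rule continuous_on_generate_topology[OF open_generated_order])
    fix B :: "real set" assume B: "B \<in> range lessThan \<union> range greaterThan"
    have "openin (top_of_set S) {z \<in> S. u z \<in> B}"
      using B s unfolding usc_on_def lsc_on_def by auto
    then show "\<exists>C. open C \<and> C \<inter> S = u -` B \<inter> S" unfolding openin_open by blast
  qed
next
  assume c: "continuous_on S u"
  have "openin (top_of_set S) (S \<inter> u -` B)" if "open B" for B using continuous_openin_preimage_gen[OF c that] .
  moreover have "{z \<in> S. u z < a} = S \<inter> u -` {..<a}" "{z \<in> S. a < u z} = S \<inter> u -` {a<..}" for a by auto
  ultimately show "usc_on S u \<and> lsc_on S u" unfolding usc_on_def lsc_on_def by simp
qed

lemma lower_env_nonpos_iff:
  "ereal a + ereal (1/2) * lower_env F M p \<le> 0 \<longleftrightarrow>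
     (\<forall>\<kappa>>0. \<exists>M' p'. M' \<in> symmetric_matrices \<and> dist (M', p') (- M, - p) < \<kappa> \<and> - \<kappa> \<le> - a + reflect_op F M' p' / 2)"
proof -
  have "ereal a + ereal (1/2) * - U \<le> 0 \<longleftrightarrow> 0 \<le> ereal (- a) + ereal (1/2) * U" for U
    by (cases U) simp_all
  then show ?thesis
    using upper_env_test_iff[of "- a" "reflect_op F" "- M" "- p"] by (simp only: lower_env_reflect)
qed

lemma local_min_at_iff_max: "local_min_at (\<lambda>z. w z - \<phi> z) z \<longleftrightarrow> local_max_at (\<lambda>z. - w z - - \<phi> z) z"
  for w \<phi> :: "'a::topological_space \<Rightarrow> real"
proof -
  have "w z - \<phi> z \<le> w y - \<phi> y \<longleftrightarrow> - w y - - \<phi> y \<le> - w z - - \<phi> z" for y by linarith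
  then show ?thesis unfolding local_min_at_def local_max_at_def by simp
qed

lemma viscosity_supersolution_iff:
  "viscosity_supersolution F w \<longleftrightarrow> lsc_on (UNIV \<times> {..0}) w \<and> eps_subsolution (reflect_op F) (\<lambda>z. - w z)"
proof
  assume super: "viscosity_supersolution F w"
  have "eps_subsolution (reflect_op F) (\<lambda>z. - w z)"
    unfolding eps_subsolution_def
  proof (intro allI impI, elim conjE)
    fix \<phi> d g h x t and \<kappa> :: real
    assume test: "test_function_with \<phi> d g h" and t: "t < 0" and mx: "local_max_at (\<lambda>z. - w z - \<phi> z) (x, t)" and \<kappa>: "\<kappa> > 0"
    have "local_min_at (\<lambda>z. w z - - \<phi> z) (x, t)" using mx unfolding local_min_at_iff_max by simp
    then have "ereal (- d (x, t)) + ereal (1/2) * lower_env F (- h (x, t)) (- g (x, t)) \<le> 0"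
      using super test_function_uminus[OF test] t unfolding viscosity_supersolution_def by blast
    then show "\<exists>M' p'. M' \<in> symmetric_matrices \<and> dist (M', p') (h (x, t), g (x, t)) < \<kappa> \<and> - \<kappa> \<le> d (x, t) + reflect_op F M' p' / 2"
      using \<kappa> unfolding lower_env_nonpos_iff by simp
  qed
  with super show "lsc_on (UNIV \<times> {..0}) w \<and> eps_subsolution (reflect_op F) (\<lambda>z. - w z)"
    unfolding viscosity_supersolution_def by blast
next
  assume "lsc_on (UNIV \<times> {..0}) w \<and> eps_subsolution (reflect_op F) (\<lambda>z. - w z)"
  then have lsc: "lsc_on (UNIV \<times> {..0}) w" and sub: "eps_subsolution (reflect_op F) (\<lambda>z. - w z)" by auto
  show "viscosity_supersolution F w"
    unfolding viscosity_supersolution_def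
  proof (rule conjI[OF lsc], intro allI impI, elim conjE)
    fix \<phi> d g h x t
    assume test: "test_function_with \<phi> d g h" and t: "t < 0" and mn: "local_min_at (\<lambda>z. w z - \<phi> z) (x, t)"
    show "ereal (d (x, t)) + ereal (1/2) * lower_env F (h (x, t)) (g (x, t)) \<le> 0"
      unfolding lower_env_nonpos_iff
    proof (intro allI impI)
      fix \<kappa> :: real assume "\<kappa> > 0"
      then show "\<exists>M' p'. M' \<in> symmetric_matrices \<and> dist (M', p') (- h (x, t), - g (x, t)) < \<kappa> \<and> - \<kappa> \<le> - d (x, t) + reflect_op F M' p' / 2"
        using sub[unfolded eps_subsolution_def, rule_format, of "\<lambda>z. - \<phi> z" "\<lambda>z. - d z" "\<lambda>z. - g z" "\<lambda>z. - h z" t x \<kappa>]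
          test_function_uminus[OF test] t mn[unfolded local_min_at_iff_max] by blast
    qed
  qed
qed

text \<open>A solution is upper and lower semicontinuous, hence continuous, so uniqueness reduces to
  the comparison of continuous functions.\<close>

lemma viscosity_solution_iff:
  "viscosity_solution F u \<longleftrightarrow>
     continuous_on (UNIV \<times> {..0}) u \<and> eps_subsolution F u \<and> eps_subsolution (reflect_op F) (\<lambda>z. - u z)"
  unfolding viscosity_solution_def viscosity_subsolution_iff viscosity_supersolution_iff
  using semicontinuous_iff_continuous_on by blast

text \<open>The functions are total, but the two relaxed limits are shown to agree for
  \<open>t \<le> 0\<close> only; a local maximum at \<open>t < 0\<close> sees nothing but negative
  times.\<close>

lemma eps_subsolution_cong:
  assumes sub: "eps_subsolution F u" and eq: "\<And>x t. t < 0 \<Longrightarrow> v (x, t) = u (x, t)"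
  shows "eps_subsolution F v"
proof -
  have mx: "local_max_at (\<lambda>z. u z - \<phi> z) (x, t)" if "local_max_at (\<lambda>z. v z - \<phi> z) (x, t)" "t < 0" for \<phi> x t
  proof -
    have "\<forall>\<^sub>F z in nhds (x, t). snd z < 0"
      using eventually_nhds_in_open[of "UNIV \<times> {..<0}" "(x, t)"] that(2) by (auto simp: open_Times elim: eventually_mono)
    with that(1)[unfolded local_max_at_def] show ?thesis
      unfolding local_max_at_def
    proof eventually_elim
      case (elim z)
      then show ?case using eq[OF that(2), of x] eq[of "snd z" "fst z"] by simp
    qed
  qed
  show ?thesis
    unfolding eps_subsolution_def using sub[unfolded eps_subsolution_def] mx by blast
qed

lemma linear_growth_modulus:
  fixes u :: "(real^'m) \<times> real \<Rightarrow> real"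
  assumes u: "\<And>x t. t \<le> 0 \<Longrightarrow> \<bar>u (x, t) - f x\<bar> \<le> c * sqrt \<bar>t\<bar>" and lip: "\<And>x y. f x \<le> f y + L * norm (x - y)"
    and nonneg: "L \<ge> 0" "c \<ge> 0"
  shows "linear_growth u"
  unfolding linear_growth_def
proof (intro allI impI)
  fix T :: real assume T: "T > 0"
  show "\<exists>C. \<forall>x. \<forall>t\<in>{- T..0}. \<bar>u (x, t)\<bar> \<le> C * (1 + norm x)"
  proof (intro exI[of _ "\<bar>f 0\<bar> + L + c * sqrt T"] allI ballI)
    fix x :: "real^'m" and t assume t: "t \<in> {- T..0}"
    have "c * sqrt \<bar>t\<bar> \<le> c * sqrt T" using t nonneg by (intro mult_left_mono) auto
    moreover have "\<bar>f x\<bar> \<le> \<bar>f 0\<bar> + L * norm x" using lip[of x 0] lip[of 0 x] by simp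
    moreover have "\<bar>u (x, t) - f x\<bar> \<le> c * sqrt \<bar>t\<bar>" using u t by simp
    moreover have "(\<bar>f 0\<bar> + L + c * sqrt T) * (1 + norm x) =
        (\<bar>f 0\<bar> + L * norm x + c * sqrt T) + (\<bar>f 0\<bar> * norm x + L + (c * sqrt T) * norm x)"
      by (simp add: algebra_simps)
    moreover have "0 \<le> \<bar>f 0\<bar> * norm x + L + (c * sqrt T) * norm x" using nonneg T by simp
    ultimately show "\<bar>u (x, t)\<bar> \<le> (\<bar>f 0\<bar> + L + c * sqrt T) * (1 + norm x)" by linarith
  qed
qed

lemma relaxed_limsup_stationary:
  assumes "\<And>\<delta>. \<delta> > 0 \<Longrightarrow> W \<delta> z = a"
  shows "relaxed_limsup W z = a"
proof -
  have "Limsup (at_right 0) (\<lambda>\<delta>. ereal (W \<delta> z)) = Limsup (at_right (0::real)) (\<lambda>\<delta>. ereal a)"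
    by (rule Limsup_eq) (auto simp: eventually_at_right_field assms intro: exI[of _ 1])
  then show ?thesis by (simp add: relaxed_limsup_def limsup_zero_def Limsup_const)
qed

theorem theorem6p1:
  fixes E :: "(real^'m) set"
  assumes "CARD('m) \<ge> 2"
    and "centrally_symmetric_body E"
    and "C2_boundary E"
  shows "\<exists>w :: (real^'m) \<times> real \<Rightarrow> real.
      terminal_value_solution (H_op TYPE('n::finite)) (body_norm E) w \<and>
      linear_growth w \<and>
      (\<forall>u. terminal_value_solution (H_op TYPE('n)) (body_norm E) u \<and> linear_growth u \<longrightarrow>
         (\<forall>x. \<forall>t\<le>0. u (x, t) = w (x, t))) \<and>
      (\<forall>R>0. ((\<lambda>\<delta>. SUP (x, t)\<in>{(x, t). norm x \<le> R \<and> \<bar>t\<bar> \<le> R \<and> t \<in> time_lattice \<delta>}.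
                 ereal \<bar>rescaled_value TYPE('n) E \<delta> (x, t) - w (x, t)\<bar>) \<longlongrightarrow> 0) (at_right 0))"
proof -
  note E = assms(2)
  let ?f = "body_norm E"
  let ?H = "H_op TYPE('n) :: real^'m^'m \<Rightarrow> real^'m \<Rightarrow> real"
  obtain L where L: "L > 0" and lip: "\<And>x y. ?f x \<le> ?f y + L * norm (x - y)" using body_norm_lipschitz[OF E] by blast
  define W where "W = rescaled_value TYPE('n) E"
  \<comment> \<open>The lower relaxed limit of \<open>W\<close> is handled as minus the upper
    relaxed limit of \<open>W'\<close>, so the results on \<open>relaxed_limsup\<close> cover
    both.\<close>
  define W' where "W' \<delta> z = - W \<delta> z" for \<delta> z
  define c where "c = L * real CARD('n)"
  have Lc: "L \<ge> 0" "c \<ge> 0" using L by (simp_all add: c_def)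
  have equi: "\<bar>W \<delta> (x, t) - W \<delta> (y, s)\<bar> \<le> L * norm (x - y) + c * sqrt (\<bar>t - s\<bar> + \<delta>\<^sup>2)"
    if "0 < \<delta>" "s \<le> 0" "t \<le> 0" for \<delta> x y s t
    unfolding W_def c_def by (rule rescaled_value_equicontinuous[OF L lip that])
  have W0: "W \<delta> (x, 0) = ?f x" if "\<delta> > 0" for \<delta> x unfolding W_def by (rule rescaled_value_0[OF E that])
  have bdd: "\<exists>b. \<forall>\<delta>. 0 < \<delta> \<longrightarrow> \<delta> < 1 \<longrightarrow> \<bar>W \<delta> (x, t)\<bar> \<le> b" if t: "t \<le> 0" for x t
  proof (intro exI[of _ "\<bar>?f x\<bar> + c * sqrt (\<bar>t\<bar> + 1)"] allI impI)
    fix \<delta> :: real assume \<delta>: "0 < \<delta>" "\<delta> < 1"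
    have "c * sqrt (\<bar>t\<bar> + \<delta>\<^sup>2) \<le> c * sqrt (\<bar>t\<bar> + 1)"
      using \<delta> Lc by (intro mult_left_mono) (auto simp: power_le_one)
    then show "\<bar>W \<delta> (x, t)\<bar> \<le> \<bar>?f x\<bar> + c * sqrt (\<bar>t\<bar> + 1)"
      using equi[OF \<delta>(1) order_refl t, of x x] W0[OF \<delta>(1), of x] by simp
  qed
  have fam: "equicontinuous_family L c W"
    unfolding equicontinuous_family_def using Lc equi bdd by blast
  have fam': "equicontinuous_family L c W'"
    unfolding W'_def[abs_def] by (rule equicontinuous_family_uminus[OF fam])
  have step: "W \<delta> (x, t) = maxmin (admissible :: (real^'n^'m) set) (\<lambda>z. W \<delta> (x + \<delta> *\<^sub>R z, t + \<delta>\<^sup>2))"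
    if "\<delta> > 0" "t < 0" for \<delta> x t unfolding W_def by (rule rescaled_value_step[OF L lip that])
  have cons: "consistent ?H W" using consistent_H_op[of W] step by blast
  have upper: "\<exists>b. \<forall>z. norm z \<le> CARD('n) \<longrightarrow> W \<delta> (x + \<delta> *\<^sub>R z, t) \<le> b" if "\<delta> > 0" "t \<le> 0" for \<delta> x t
  proof (intro exI[of _ "W \<delta> (x, t) + L * (\<delta> * CARD('n))"] allI impI)
    fix z :: "real^'m" assume "norm z \<le> CARD('n)"
    then have "L * (\<delta> * norm z) \<le> L * (\<delta> * CARD('n))" using L that by (intro mult_left_mono) auto
    then show "W \<delta> (x + \<delta> *\<^sub>R z, t) \<le> W \<delta> (x, t) + L * (\<delta> * CARD('n))"
      using rescaled_value_lipschitz[where 'n = 'n, OF L lip that(1), of "x + \<delta> *\<^sub>R z" t x] that(1) by (simp add: W_def)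
  qed
  have cons': "consistent (reflect_op ?H) W'"
    unfolding W'_def[abs_def] by (rule consistent_reflect_H_op[OF step upper])
  define U where "U = relaxed_limsup W"
  define V where "V z = - relaxed_limsup W' z" for z
  note mod = relaxed_limsup_dist[where W = W, OF fam, folded U_def]
  note mod' = relaxed_limsup_dist[where W = W', OF fam']
  have U0: "U (x, 0) = ?f x" for x unfolding U_def by (rule relaxed_limsup_stationary) (rule W0)
  have V0: "V (x, 0) = ?f x" for x
    unfolding V_def using relaxed_limsup_stationary[of W' "(x, 0)" "- ?f x"] by (simp add: W'_def W0)
  have growthU: "linear_growth U"
  proof (rule linear_growth_modulus[OF _ lip Lc])
    show "\<bar>U (x, t) - ?f x\<bar> \<le> c * sqrt \<bar>t\<bar>" if "t \<le> 0" for x t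
      using mod[OF order_refl that, of x x] by (simp add: U0)
  qed
  have growthV: "linear_growth V"
  proof (rule linear_growth_modulus[OF _ lip Lc])
    show "\<bar>V (x, t) - ?f x\<bar> \<le> c * sqrt \<bar>t\<bar>" if "t \<le> 0" for x t
      using mod'[OF order_refl that, of x x] V0[of x] by (simp add: V_def abs_minus_commute)
  qed
  have contU: "continuous_on (UNIV \<times> {..0}) U"
    unfolding U_def by (rule continuous_on_relaxed_limsup[OF fam])
  have contV: "continuous_on (UNIV \<times> {..0}) V"
    unfolding V_def[abs_def] by (intro continuous_on_minus continuous_on_relaxed_limsup[OF fam'])
  have subU: "eps_subsolution ?H U"
    unfolding U_def by (rule relaxed_limsup_eps_subsolution[OF fam cons])
  have superV: "eps_subsolution (reflect_op ?H) (\<lambda>z. - V z)"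
    unfolding V_def minus_minus by (rule relaxed_limsup_eps_subsolution[OF fam' cons'])
  have UV: "U (x, t) = V (x, t)" if t: "t \<le> 0" for x t
  proof (rule antisym)
    show "U (x, t) \<le> V (x, t)"
      by (rule comparison_principle[OF subU superV contU contV growthU growthV U0 V0 lip L t])
    \<comment> \<open>A lower limit never exceeds the upper one: a single small
      \<open>\<delta>\<close> witnesses both bounds.\<close>
    show "V (x, t) \<le> U (x, t)"
    proof (rule field_le_epsilon)
      fix e :: real assume e: "e > 0"
      then have e2: "e / 2 > 0" by simp
      have "\<forall>\<^sub>F \<delta> in at_right 0. W \<delta> (x, t) < U (x, t) + e / 2 \<and> W' \<delta> (x, t) < relaxed_limsup W' (x, t) + e / 2"
        using relaxed_limsup_eventually[OF fam, of "(x, t)", OF _ e2]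
          relaxed_limsup_eventually[OF fam', of "(x, t)", OF _ e2] t
        by (auto simp: U_def intro: eventually_conj)
      then obtain \<delta> where "W \<delta> (x, t) < U (x, t) + e / 2" "W' \<delta> (x, t) < relaxed_limsup W' (x, t) + e / 2"
        using eventually_happens by force
      then show "V (x, t) \<le> U (x, t) + e" by (simp add: V_def W'_def)
    qed
  qed
  \<comment> \<open>Only with \<open>U = V\<close> does one function satisfy both inequalities;
    \<open>U\<close> inherits the second from \<open>V\<close>.\<close>
  have superU: "eps_subsolution (reflect_op ?H) (\<lambda>z. - U z)"
    by (rule eps_subsolution_cong[OF superV]) (simp add: UV)
  have sol: "terminal_value_solution ?H ?f U"
    unfolding terminal_value_solution_def viscosity_solution_iff using contU subU superU U0 by blast
  have uniq: "u (x, t) = U (x, t)" if "terminal_value_solution ?H ?f u" "linear_growth u" "t \<le> 0" for u x t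
  proof (rule antisym)
    have u: "continuous_on (UNIV \<times> {..0}) u" "eps_subsolution ?H u" "eps_subsolution (reflect_op ?H) (\<lambda>z. - u z)" "\<And>x. u (x, 0) = ?f x"
      using that(1) unfolding terminal_value_solution_def viscosity_solution_iff by auto
    show "u (x, t) \<le> U (x, t)"
      by (rule comparison_principle[OF u(2) superU u(1) contU that(2) growthU u(4) U0 lip L that(3)])
    show "U (x, t) \<le> u (x, t)"
      by (rule comparison_principle[OF subU u(3) contU u(1) growthU that(2) U0 u(4) lip L that(3)])
  qed
  have conv: "((\<lambda>\<delta>. SUP (x, t)\<in>{(x, t). norm x \<le> R \<and> \<bar>t\<bar> \<le> R \<and> t \<in> time_lattice \<delta>}. ereal \<bar>W \<delta> (x, t) - U (x, t)\<bar>) \<longlongrightarrow> 0) (at_right 0)"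
    if R: "R > 0" for R
  proof (rule order_tendstoI)
    fix a :: ereal assume a: "a < 0"
    \<comment> \<open>The supremum is nonnegative because \<open>(0, 0)\<close> always belongs to
      the index set.\<close>
    have "a < (SUP (x, t)\<in>{(x, t). norm x \<le> R \<and> \<bar>t\<bar> \<le> R \<and> t \<in> time_lattice \<delta>}. ereal \<bar>W \<delta> (x, t) - U (x, t)\<bar>)" for \<delta>
    proof (rule less_le_trans[OF a], rule SUP_upper2[of "(0, 0)"])
      show "(0, 0) \<in> {(x :: real^'m, t). norm x \<le> R \<and> \<bar>t\<bar> \<le> R \<and> t \<in> time_lattice \<delta>}"
        using R by (auto simp: time_lattice_def intro: exI[of _ 0])
    qed auto
    then show "\<forall>\<^sub>F \<delta> in at_right 0. a < (SUP (x, t)\<in>{(x, t). norm x \<le> R \<and> \<bar>t\<bar> \<le> R \<and> t \<in> time_lattice \<delta>}. ereal \<bar>W \<delta> (x, t) - U (x, t)\<bar>)"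
      by (rule always_eventually[OF allI])
  next
    fix a :: ereal assume a: "0 < a"
    then obtain e where e: "e > 0" "ereal e < a" using ereal_dense2[of 0 a] by auto
    define B where "B = cball (0 :: real^'m) R \<times> {- R..0}"
    have B: "compact B" "B \<subseteq> UNIV \<times> {..0}" unfolding B_def by (auto intro: compact_Times)
    have "\<forall>\<^sub>F \<delta> in at_right 0. (\<forall>z\<in>B. W \<delta> z < U z + e) \<and> (\<forall>z\<in>B. W' \<delta> z < relaxed_limsup W' z + e)"
      unfolding U_def
      by (intro eventually_conj relaxed_limsup_uniform[OF fam B e(1)] relaxed_limsup_uniform[OF fam' B e(1)])
    then show "\<forall>\<^sub>F \<delta> in at_right 0. (SUP (x, t)\<in>{(x, t). norm x \<le> R \<and> \<bar>t\<bar> \<le> R \<and> t \<in> time_lattice \<delta>}. ereal \<bar>W \<delta> (x, t) - U (x, t)\<bar>) < a"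
    proof eventually_elim
      case (elim \<delta>)
      have "(SUP (x, t)\<in>{(x, t). norm x \<le> R \<and> \<bar>t\<bar> \<le> R \<and> t \<in> time_lattice \<delta>}. ereal \<bar>W \<delta> (x, t) - U (x, t)\<bar>) \<le> ereal e"
      proof (rule SUP_least, safe)
        fix x :: "real^'m" and t assume xt: "norm x \<le> R" "\<bar>t\<bar> \<le> R" "t \<in> time_lattice \<delta>"
        then have t: "t \<le> 0" by (auto simp: time_lattice_def mult_nonneg_nonpos)
        then have "(x, t) \<in> B" using xt by (auto simp: B_def)
        then have "W \<delta> (x, t) < U (x, t) + e" "W' \<delta> (x, t) < relaxed_limsup W' (x, t) + e" using elim by auto
        \<comment> \<open>The two one-sided uniform bounds, \<open>W\<close> against
          \<open>U\<close> and \<open>- W\<close> against \<open>- V\<close>, become two-sided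
          because \<open>U = V\<close>.\<close>
        then show "ereal \<bar>W \<delta> (x, t) - U (x, t)\<bar> \<le> ereal e"
          using UV[OF t, of x] by (simp add: V_def W'_def)
      qed
      then show ?case using e(2) by (rule le_less_trans)
    qed
  qed
  show ?thesis
    using sol growthU uniq conv unfolding W_def by (intro exI[of _ U]) blast
qed

end
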